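(* Let $X$ be a compact complex space. Then $X$ is Kobayashi hyperbolic if and only if (the sheaf represented by) $X$ is hyperbolic as a simplicial sheaf, i.e. is $\mathbb C$-local.
   Context: Kobayashi hyperbolicity: let $D\subset\mathbb C$ be the unit disc with the Poincaré distance $\rho$. For a complex space $X$ and $p,q\in X$, a chain of holomorphic discs between $p$ and $q$ is a set $\alpha=\{f_1,\dots,f_k\}$ of holomorphic maps $D\to X$ such that there are points $p=p_0,p_1,\dots,p_k=q$ in $X$ and $a_1,b_1,\dots,a_k,b_k$ in $D$ with $f_i(a_i)=p_{i-1}$, $f_i(b_i)=p_i$ for all $i$; its length is $l(\alpha)=\sum_i\rho(a_i,b_i)$. The Kobayashi pseudodistance is $d^X_{Kob}(p,q)=\inf_\alpha l(\alpha)$ over all such chains. $X$ is Kobayashi hyperbolic if $d^X_{Kob}$ is a distance. Hyperbolicity of simplicial sheaves: let $\mathcal S_T$ be the site of complex spaces and holomorphic maps with the strong topology (coverings are open coverings in the classical topology). $\mathcal F_T(\mathcal S)$ is the category of sheaves of sets on it and $\Delta^{op}\mathcal F_T(\mathcal S)$ the category of simplicial sheaves. A complex space is identified with the sheaf it represents, and a sheaf with a constant simplicial sheaf. A morphism of simplicial sheaves is a simplicial weak equivalence if it induces weak equivalences of simplicial sets on all stalks; $\mathcal H_s$ is the localization of $\Delta^{op}\mathcal F_T(\mathcal S)$ at the simplicial weak equivalences. A simplicial sheaf $\mathcal X$ is hyperbolic (equivalently, $\mathbb C$-local) if for every simplicial sheaf $\mathcal Y$ the projection $\mathcal Y\times\mathbb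 C\to\mathcal Y$ induces a bijection $\mathrm{Hom}_{\mathcal H_s}(\mathcal Y,\mathcal X)\to\mathrm{Hom}_{\mathcal H_s}(\mathcal Y\times\mathbb C,\mathcal X)$. *)

theory Defs
  imports "HOL-Complex_Analysis.Complex_Analysis" "HOL-Homology.Simplices"
begin

section \<open>Quotients\<close>

definition equiv_gen :: "'a rel \<Rightarrow> 'a rel" where
  "equiv_gen r = (r \<union> r\<inverse>)\<^sup>*"

text \<open>If \<open>f\<close> sends \<open>S\<close>-related elements to \<open>R\<close>-related ones, \<open>quot_map R f\<close> is the map
  that \<open>f\<close> induces from \<open>S\<close>-classes to \<open>R\<close>-classes.\<close>

definition quot_map :: "'b rel \<Rightarrow> ('a \<Rightarrow> 'b) \<Rightarrow> 'a set \<Rightarrow> 'b set" where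
  "quot_map R f c = R `` (f ` c)"

section \<open>Complex spaces and holomorphic maps\<close>

text \<open>Points of \<open>\<complex>\<^sup>n\<close> are sequences vanishing from index \<open>n\<close> on. Functions of several variables
  are holomorphic if they are continuous and holomorphic in each variable.\<close>

definition Cn :: "nat \<Rightarrow> (nat \<Rightarrow> complex) set" where
  "Cn n = {z. \<forall>i\<ge>n. z i = 0}"

definition holomorphic_Cn :: "nat \<Rightarrow> (nat \<Rightarrow> complex) set \<Rightarrow> ((nat \<Rightarrow> complex) \<Rightarrow> complex) \<Rightarrow> bool" where
  "holomorphic_Cn n W f \<longleftrightarrow>
     continuous_on W f \<and>
     (\<forall>z\<in>W. \<forall>i<n. (\<lambda>w. f (z(i := w))) holomorphic_on {w. z(i := w) \<in> W})"

text \<open>\<open>analytic_model n A\<close>: \<open>A\<close> is the common zero set of finitely many holomorphic functions on an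
  open subset of \<open>\<complex>\<^sup>n\<close>. The structure sheaf of such a model consists of the functions that locally
  extend to holomorphic functions on open subsets of \<open>\<complex>\<^sup>n\<close>.\<close>

definition analytic_model :: "nat \<Rightarrow> (nat \<Rightarrow> complex) set \<Rightarrow> bool" where
  "analytic_model n A \<longleftrightarrow>
     (\<exists>W F. openin (top_of_set (Cn n)) W \<and> finite F \<and> (\<forall>f\<in>F. holomorphic_Cn n W f) \<and>
        A = {z\<in>W. \<forall>f\<in>F. f z = 0})"

definition model_holomorphic :: "nat \<Rightarrow> (nat \<Rightarrow> complex) set \<Rightarrow> ((nat \<Rightarrow> complex) \<Rightarrow> complex) \<Rightarrow> bool" where
  "model_holomorphic n B h \<longleftrightarrow>
     (\<forall>z\<in>B. \<exists>W k. openin (top_of_set (Cn n)) W \<and> z \<in> W \<and> holomorphic_Cn n W k \<and>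
        (\<forall>y \<in> W \<inter> B. h y = k y))"

text \<open>A complex space is a reduced one, so that its structure sheaf is a sheaf of complex-valued
  functions; it is Hausdorff. (With nilpotents allowed in the site, no positive-dimensional
  complex manifold would be \<open>\<complex>\<close>-local: let \<open>Y\<close> be a double point.) Sections over \<open>U\<close> are extensional
  functions on \<open>U\<close>; the value of \<open>hol_sections\<close> on non-open sets is irrelevant.\<close>

record 'p cspace =
  ctop :: "'p topology"
  hol_sections :: "'p set \<Rightarrow> ('p \<Rightarrow> complex) set"

abbreviation cpoints :: "'p cspace \<Rightarrow> 'p set" where
  "cpoints X \<equiv> topspace (ctop X)"

definition function_sheaf :: "'p cspace \<Rightarrow> bool" where
  "function_sheaf X \<longleftrightarrow>
     (\<forall>U. openin (ctop X) U \<longrightarrow> hol_sections X U \<subseteq> extensional U) \<and>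
     (\<forall>U V g. openin (ctop X) U \<and> openin (ctop X) V \<and> V \<subseteq> U \<and> g \<in> hol_sections X U
        \<longrightarrow> restrict g V \<in> hol_sections X V) \<and>
     (\<forall>U g. openin (ctop X) U \<and> g \<in> extensional U \<and>
        (\<forall>x\<in>U. \<exists>V. openin (ctop X) V \<and> x \<in> V \<and> V \<subseteq> U \<and> restrict g V \<in> hol_sections X V)
        \<longrightarrow> g \<in> hol_sections X U)"

definition complex_space :: "'p cspace \<Rightarrow> bool" where
  "complex_space X \<longleftrightarrow>
     Hausdorff_space (ctop X) \<and> function_sheaf X \<and>
     (\<forall>x \<in> cpoints X. \<exists>U n A \<phi> \<psi>.
        openin (ctop X) U \<and> x \<in> U \<and> analytic_model n A \<and>
        homeomorphic_maps (subtopology (ctop X) U) (top_of_set A) \<phi> \<psi> \<and>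
        (\<forall>V g. openin (ctop X) V \<and> V \<subseteq> U \<and> g \<in> extensional V \<longrightarrow>
           (g \<in> hol_sections X V \<longleftrightarrow> model_holomorphic n (\<phi> ` V) (g \<circ> \<psi>))))"

definition hol_maps :: "'p cspace \<Rightarrow> 'q cspace \<Rightarrow> ('p \<Rightarrow> 'q) set" where
  "hol_maps X Y =
     {f \<in> extensional (cpoints X). continuous_map (ctop X) (ctop Y) f \<and>
        (\<forall>V g. openin (ctop Y) V \<and> g \<in> hol_sections Y V \<longrightarrow>
           (\<lambda>x \<in> {x \<in> cpoints X. f x \<in> V}. g (f x)) \<in> hol_sections X {x \<in> cpoints X. f x \<in> V})}"

definition open_subspace :: "'p cspace \<Rightarrow> 'p set \<Rightarrow> 'p cspace" where
  "open_subspace X V = \<lparr>ctop = subtopology (ctop X) V, hol_sections = hol_sections X\<rparr>"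

text \<open>An open subset of \<open>\<complex>\<close>, as a complex space.\<close>

definition planar_space :: "complex set \<Rightarrow> complex cspace" where
  "planar_space W = \<lparr>ctop = top_of_set W, hol_sections = \<lambda>V. {g \<in> extensional V. g holomorphic_on V}\<rparr>"

text \<open>The isomorphic copy of \<open>X\<close> under an injective relabelling \<open>j\<close> of points.\<close>

definition relabel :: "('p \<Rightarrow> 'q) \<Rightarrow> 'p cspace \<Rightarrow> 'q cspace" where
  "relabel j X =
     \<lparr>ctop = pullback_topology (j ` cpoints X) (inv_into UNIV j) (ctop X),
      hol_sections = \<lambda>V. {g \<in> extensional V. restrict (g \<circ> j) (j -` V) \<in> hol_sections X (j -` V)}\<rparr>"

section \<open>Kobayashi hyperbolicity\<close>

abbreviation unit_disc :: "complex cspace" where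
  "unit_disc \<equiv> planar_space (ball 0 1)"

text \<open>Normalized to curvature \<open>-1\<close>.\<close>

definition poincare_dist :: "complex \<Rightarrow> complex \<Rightarrow> real" where
  "poincare_dist a b = 2 * artanh (cmod ((a - b) / (1 - cnj a * b)))"

text \<open>A chain of holomorphic discs together with the chosen points \<open>a\<^sub>i, b\<^sub>i\<close>.\<close>

definition disc_chain :: "'p cspace \<Rightarrow> 'p \<Rightarrow> 'p \<Rightarrow> ((complex \<Rightarrow> 'p) \<times> complex \<times> complex) list \<Rightarrow> bool" where
  "disc_chain X p q \<alpha> \<longleftrightarrow> \<alpha> \<noteq> [] \<and>
     (\<forall>(f, a, b) \<in> set \<alpha>. f \<in> hol_maps unit_disc X \<and> a \<in> ball 0 1 \<and> b \<in> ball 0 1) \<and>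
     (\<exists>r. r 0 = p \<and> r (length \<alpha>) = q \<and>
        (\<forall>i < length \<alpha>. case \<alpha> ! i of (f, a, b) \<Rightarrow> f a = r i \<and> f b = r (Suc i)))"

definition chain_length :: "((complex \<Rightarrow> 'p) \<times> complex \<times> complex) list \<Rightarrow> real" where
  "chain_length \<alpha> = (\<Sum>(f, a, b) \<leftarrow> \<alpha>. poincare_dist a b)"

text \<open>The value is \<open>\<infinity>\<close> if no chain joins the points, i.e. if they lie in different connected
  components; accordingly a distance may take the value \<open>\<infinity>\<close>.\<close>

definition kobayashi_dist :: "'p cspace \<Rightarrow> 'p \<Rightarrow> 'p \<Rightarrow> ennreal" where
  "kobayashi_dist X p q = (INF \<alpha> \<in> Collect (disc_chain X p q). ennreal (chain_length \<alpha>))"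

definition is_distance :: "'p set \<Rightarrow> ('p \<Rightarrow> 'p \<Rightarrow> ennreal) \<Rightarrow> bool" where
  "is_distance S d \<longleftrightarrow>
     (\<forall>p\<in>S. \<forall>q\<in>S. d p q = 0 \<longleftrightarrow> p = q) \<and>
     (\<forall>p\<in>S. \<forall>q\<in>S. d p q = d q p) \<and>
     (\<forall>p\<in>S. \<forall>q\<in>S. \<forall>r\<in>S. d p r \<le> d p q + d q r)"

definition kobayashi_hyperbolic :: "'p cspace \<Rightarrow> bool" where
  "kobayashi_hyperbolic X \<longleftrightarrow> is_distance (cpoints X) (kobayashi_dist X)"

section \<open>Weak homotopy equivalences of topological spaces\<close>

definition cube :: "nat \<Rightarrow> (nat \<Rightarrow> real) topology" where
  "cube n = top_of_set {t. (\<forall>i<n. 0 \<le> t i \<and> t i \<le> 1) \<and> (\<forall>i\<ge>n. t i = 0)}"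

definition cube_boundary :: "nat \<Rightarrow> (nat \<Rightarrow> real) set" where
  "cube_boundary n = {t \<in> topspace (cube n). \<exists>i<n. t i = 0 \<or> t i = 1}"

definition cube_loops :: "nat \<Rightarrow> 'a topology \<Rightarrow> 'a \<Rightarrow> ((nat \<Rightarrow> real) \<Rightarrow> 'a) set" where
  "cube_loops n X x = {g. continuous_map (cube n) X g \<and> (\<forall>t \<in> cube_boundary n. g t = x)}"

definition loop_homotopy :: "nat \<Rightarrow> 'a topology \<Rightarrow> 'a \<Rightarrow> ((nat \<Rightarrow> real) \<Rightarrow> 'a) rel" where
  "loop_homotopy n X x =
     {(g, h). g \<in> cube_loops n X x \<and> h \<in> cube_loops n X x \<and>
        homotopic_with (\<lambda>k. \<forall>t \<in> cube_boundary n. k t = x) (cube n) X g h}"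

text \<open>The underlying set of the \<open>n\<close>-th homotopy group; a map inducing a bijection on it induces
  an isomorphism of groups.\<close>

definition homotopy_group :: "nat \<Rightarrow> 'a topology \<Rightarrow> 'a \<Rightarrow> ((nat \<Rightarrow> real) \<Rightarrow> 'a) set set" where
  "homotopy_group n X x = cube_loops n X x // loop_homotopy n X x"

definition weak_homotopy_equivalence :: "'a topology \<Rightarrow> 'b topology \<Rightarrow> ('a \<Rightarrow> 'b) \<Rightarrow> bool" where
  "weak_homotopy_equivalence X Y f \<longleftrightarrow>
     continuous_map X Y f \<and>
     bij_betw (quot_map {(y, y'). path_component_of Y y y'} f)
       (path_components_of X) (path_components_of Y) \<and>
     (\<forall>x \<in> topspace X. \<forall>n\<ge>1.
        bij_betw (quot_map (loop_homotopy n Y (f x)) (\<lambda>g. f \<circ> g))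
          (homotopy_group n X x) (homotopy_group n Y (f x)))"

section \<open>Simplicial sets\<close>

text \<open>\<open>sface K n i\<close> is the face map \<open>d\<^sub>i\<close> from \<open>(n+1)\<close>-simplices to \<open>n\<close>-simplices, and
  \<open>sdegen K n i\<close> the degeneracy map \<open>s\<^sub>i\<close> from \<open>n\<close>-simplices to \<open>(n+1)\<close>-simplices.\<close>

record 'a sset =
  simplices :: "nat \<Rightarrow> 'a set"
  sface :: "nat \<Rightarrow> nat \<Rightarrow> 'a \<Rightarrow> 'a"
  sdegen :: "nat \<Rightarrow> nat \<Rightarrow> 'a \<Rightarrow> 'a"

definition simplicial_set :: "'a sset \<Rightarrow> bool" where
  "simplicial_set K \<longleftrightarrow>
     (\<forall>n. \<forall>i \<le> Suc n. sface K n i \<in> simplices K (Suc n) \<rightarrow> simplices K n) \<and>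
     (\<forall>n. \<forall>i \<le> n. sdegen K n i \<in> simplices K n \<rightarrow> simplices K (Suc n)) \<and>
     (\<forall>n i j. \<forall>s \<in> simplices K (Suc (Suc n)). i < j \<and> j \<le> Suc (Suc n) \<longrightarrow>
        sface K n i (sface K (Suc n) j s) = sface K n (j - 1) (sface K (Suc n) i s)) \<and>
     (\<forall>n i j. \<forall>s \<in> simplices K n. i \<le> j \<and> j \<le> n \<longrightarrow>
        sdegen K (Suc n) i (sdegen K n j s) = sdegen K (Suc n) (Suc j) (sdegen K n i s)) \<and>
     (\<forall>n i j. \<forall>s \<in> simplices K (Suc n). i < j \<and> j \<le> Suc n \<longrightarrow>
        sface K (Suc n) i (sdegen K (Suc n) j s) = sdegen K n (j - 1) (sface K n i s)) \<and>
     (\<forall>n i j. \<forall>s \<in> simplices K n. j \<le> n \<and> (i = j \<or> i = Suc j) \<longrightarrow>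
        sface K n i (sdegen K n j s) = s) \<and>
     (\<forall>n i j. \<forall>s \<in> simplices K (Suc n). Suc j < i \<and> i \<le> Suc (Suc n) \<longrightarrow>
        sface K (Suc n) i (sdegen K (Suc n) j s) = sdegen K n j (sface K n (i - 1) s))"

text \<open>The map of standard simplices collapsing the vertices \<open>k\<close> and \<open>k+1\<close>; its counterpart for
  faces is \<^const>\<open>simplical_face\<close> of the library.\<close>

definition simplicial_collapse :: "nat \<Rightarrow> (nat \<Rightarrow> real) \<Rightarrow> nat \<Rightarrow> real" where
  "simplicial_collapse k t =
     (\<lambda>i. if i < k then t i else if i = k then t k + t (Suc k) else t (Suc i))"

definition realization_cells :: "'a sset \<Rightarrow> (nat \<times> 'a \<times> (nat \<Rightarrow> real)) set" where
  "realization_cells K = {(n, s, t). s \<in> simplices K n \<and> t \<in> standard_simplex n}"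

definition realization_rel :: "'a sset \<Rightarrow> (nat \<times> 'a \<times> (nat \<Rightarrow> real)) rel" where
  "realization_rel K = equiv_gen
     ({((n, sface K n i s, t), (Suc n, s, simplical_face i t)) | n i s t.
         i \<le> Suc n \<and> s \<in> simplices K (Suc n) \<and> t \<in> standard_simplex n} \<union>
      {((Suc n, sdegen K n i s, t), (n, s, simplicial_collapse i t)) | n i s t.
         i \<le> n \<and> s \<in> simplices K n \<and> t \<in> standard_simplex (Suc n)})"

definition realization :: "'a sset \<Rightarrow> (nat \<times> 'a \<times> (nat \<Rightarrow> real)) set topology" where
  "realization K = topology (\<lambda>\<U>.
     \<U> \<subseteq> realization_cells K // realization_rel K \<and>
     (\<forall>n. \<forall>s \<in> simplices K n. openin (top_of_set (standard_simplex n))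
        {t \<in> standard_simplex n. realization_rel K `` {(n, s, t)} \<in> \<U>}))"

definition sset_weak_equivalence :: "'a sset \<Rightarrow> 'b sset \<Rightarrow> (nat \<Rightarrow> 'a \<Rightarrow> 'b) \<Rightarrow> bool" where
  "sset_weak_equivalence K L f \<longleftrightarrow>
     weak_homotopy_equivalence (realization K) (realization L)
       (quot_map (realization_rel L) (\<lambda>(n, s, t). (n, f n s, t)))"

section \<open>Sheaves on the site of complex spaces\<close>

text \<open>The site consists of all complex spaces whose points belong to the type \<open>'p\<close>, and sheaves
  take values in sets of elements of the type \<open>'v\<close>. For \<open>f \<in> hol_maps V U\<close>, \<open>res F V U f\<close> is the
  map \<open>F(U) \<rightarrow> F(V)\<close>.\<close>

record ('p, 'v) sheaf =
  sec :: "'p cspace \<Rightarrow> 'v set"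
  res :: "'p cspace \<Rightarrow> 'p cspace \<Rightarrow> ('p \<Rightarrow> 'p) \<Rightarrow> 'v \<Rightarrow> 'v"

definition is_presheaf :: "('p, 'v) sheaf \<Rightarrow> bool" where
  "is_presheaf F \<longleftrightarrow>
     (\<forall>U V f. complex_space U \<and> complex_space V \<and> f \<in> hol_maps V U \<longrightarrow>
        res F V U f \<in> sec F U \<rightarrow> sec F V) \<and>
     (\<forall>U. complex_space U \<longrightarrow> (\<forall>s \<in> sec F U. res F U U (\<lambda>x \<in> cpoints U. x) s = s)) \<and>
     (\<forall>U V W f g. complex_space U \<and> complex_space V \<and> complex_space W \<and>
        f \<in> hol_maps V U \<and> g \<in> hol_maps W V \<longrightarrow>
        (\<forall>s \<in> sec F U. res F W U (compose (cpoints W) f g) s = res F W V g (res F V U f s)))"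

text \<open>Restriction from the open subspace of \<open>U\<close> on \<open>V\<close> to the one on \<open>W \<subseteq> V\<close>.\<close>

definition open_res :: "('p, 'v) sheaf \<Rightarrow> 'p cspace \<Rightarrow> 'p set \<Rightarrow> 'p set \<Rightarrow> 'v \<Rightarrow> 'v" where
  "open_res F U V W = res F (open_subspace U W) (open_subspace U V) (\<lambda>x\<in>W. x)"

definition is_sheaf :: "('p, 'v) sheaf \<Rightarrow> bool" where
  "is_sheaf F \<longleftrightarrow> is_presheaf F \<and>
     (\<forall>U \<V> s. complex_space U \<and> (\<forall>V\<in>\<V>. openin (ctop U) V) \<and> \<Union>\<V> = cpoints U \<and>
        (\<forall>V\<in>\<V>. s V \<in> sec F (open_subspace U V)) \<and>
        (\<forall>V\<in>\<V>. \<forall>V'\<in>\<V>. open_res F U V (V \<inter> V') (s V) = open_res F U V' (V \<inter> V') (s V'))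
        \<longrightarrow> (\<exists>!t. t \<in> sec F U \<and>
               (\<forall>V\<in>\<V>. res F (open_subspace U V) U (\<lambda>x\<in>V. x) t = s V)))"

section \<open>Simplicial sheaves\<close>

record ('p, 'v) ssheaf =
  level :: "nat \<Rightarrow> ('p, 'v) sheaf"
  fc :: "nat \<Rightarrow> nat \<Rightarrow> 'p cspace \<Rightarrow> 'v \<Rightarrow> 'v"
  dg :: "nat \<Rightarrow> nat \<Rightarrow> 'p cspace \<Rightarrow> 'v \<Rightarrow> 'v"

definition sections_sset :: "('p, 'v) ssheaf \<Rightarrow> 'p cspace \<Rightarrow> 'v sset" where
  "sections_sset X U =
     \<lparr>simplices = \<lambda>n. sec (level X n) U, sface = \<lambda>n i. fc X n i U, sdegen = \<lambda>n i. dg X n i U\<rparr>"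

definition simplicial_sheaf :: "('p, 'v) ssheaf \<Rightarrow> bool" where
  "simplicial_sheaf X \<longleftrightarrow>
     (\<forall>n. is_sheaf (level X n)) \<and>
     (\<forall>U. complex_space U \<longrightarrow> simplicial_set (sections_sset X U)) \<and>
     (\<forall>U V f. complex_space U \<and> complex_space V \<and> f \<in> hol_maps V U \<longrightarrow>
        (\<forall>n. \<forall>i \<le> Suc n. \<forall>s \<in> sec (level X (Suc n)) U.
           fc X n i V (res (level X (Suc n)) V U f s) = res (level X n) V U f (fc X n i U s)) \<and>
        (\<forall>n. \<forall>i \<le> n. \<forall>s \<in> sec (level X n) U.
           dg X n i V (res (level X n) V U f s) = res (level X (Suc n)) V U f (dg X n i U s)))"

type_synonym ('p, 'v) smap = "nat \<Rightarrow> 'p cspace \<Rightarrow> 'v \<Rightarrow> 'v"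

definition ssheaf_hom :: "('p, 'v) ssheaf \<Rightarrow> ('p, 'v) ssheaf \<Rightarrow> ('p, 'v) smap set" where
  "ssheaf_hom X Y =
     {\<phi>. (\<forall>n. \<phi> n \<in> (\<Pi>\<^sub>E U \<in> Collect complex_space. sec (level X n) U \<rightarrow>\<^sub>E sec (level Y n) U)) \<and>
        (\<forall>U V f. complex_space U \<and> complex_space V \<and> f \<in> hol_maps V U \<longrightarrow>
           (\<forall>n. \<forall>s \<in> sec (level X n) U.
              \<phi> n V (res (level X n) V U f s) = res (level Y n) V U f (\<phi> n U s))) \<and>
        (\<forall>U. complex_space U \<longrightarrow>
           (\<forall>n. \<forall>i \<le> Suc n. \<forall>s \<in> sec (level X (Suc n)) U.
              \<phi> n U (fc X n i U s) = fc Y n i U (\<phi> (Suc n) U s)) \<and>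
           (\<forall>n. \<forall>i \<le> n. \<forall>s \<in> sec (level X n) U.
              \<phi> (Suc n) U (dg X n i U s) = dg Y n i U (\<phi> n U s)))}"

definition const_ssheaf :: "('p, 'v) sheaf \<Rightarrow> ('p, 'v) ssheaf" where
  "const_ssheaf F = \<lparr>level = \<lambda>_. F, fc = \<lambda>_ _ _ s. s, dg = \<lambda>_ _ _ s. s\<rparr>"

text \<open>Germs at the point \<open>x\<close> of the complex space \<open>U\<close>.\<close>

definition local_sections :: "('p, 'v) sheaf \<Rightarrow> 'p cspace \<Rightarrow> 'p \<Rightarrow> ('p set \<times> 'v) set" where
  "local_sections F U x =
     {(V, s). openin (ctop U) V \<and> x \<in> V \<and> s \<in> sec F (open_subspace U V)}"

definition germ_rel :: "('p, 'v) sheaf \<Rightarrow> 'p cspace \<Rightarrow> 'p \<Rightarrow> ('p set \<times> 'v) rel" where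
  "germ_rel F U x =
     {((V, s), (V', s')). (V, s) \<in> local_sections F U x \<and> (V', s') \<in> local_sections F U x \<and>
        (\<exists>W. openin (ctop U) W \<and> x \<in> W \<and> W \<subseteq> V \<inter> V' \<and>
           open_res F U V W s = open_res F U V' W s')}"

definition stalk :: "('p, 'v) ssheaf \<Rightarrow> 'p cspace \<Rightarrow> 'p \<Rightarrow> ('p set \<times> 'v) set sset" where
  "stalk X U x =
     \<lparr>simplices = \<lambda>n. local_sections (level X n) U x // germ_rel (level X n) U x,
      sface = \<lambda>n i. quot_map (germ_rel (level X n) U x)
                (\<lambda>(V, s). (V, fc X n i (open_subspace U V) s)),
      sdegen = \<lambda>n i. quot_map (germ_rel (level X (Suc n)) U x)
                (\<lambda>(V, s). (V, dg X n i (open_subspace U V) s))\<rparr>"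

definition stalk_map :: "('p, 'v) ssheaf \<Rightarrow> ('p, 'v) smap \<Rightarrow> 'p cspace \<Rightarrow> 'p \<Rightarrow>
    nat \<Rightarrow> ('p set \<times> 'v) set \<Rightarrow> ('p set \<times> 'v) set" where
  "stalk_map Y \<phi> U x n =
     quot_map (germ_rel (level Y n) U x) (\<lambda>(V, s). (V, \<phi> n (open_subspace U V) s))"

definition simplicial_weak_equivalences :: "('p, 'v) ssheaf \<Rightarrow> ('p, 'v) ssheaf \<Rightarrow> ('p, 'v) smap set" where
  "simplicial_weak_equivalences X Y =
     {\<phi> \<in> ssheaf_hom X Y. \<forall>U x. complex_space U \<and> x \<in> cpoints U \<longrightarrow>
        sset_weak_equivalence (stalk X U x) (stalk Y U x) (stalk_map Y \<phi> U x)}"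

section \<open>Localization of categories\<close>

text \<open>\<open>Cmp C A g f\<close> is the composite of \<open>f\<close>, whose source is \<open>A\<close>, followed by \<open>g\<close>.\<close>

record ('o, 'm) category =
  Ob :: "'o set"
  Hom :: "'o \<Rightarrow> 'o \<Rightarrow> 'm set"
  Idt :: "'o \<Rightarrow> 'm"
  Cmp :: "'o \<Rightarrow> 'm \<Rightarrow> 'm \<Rightarrow> 'm"

text \<open>Morphisms of the localization are classes of zigzags. In \<open>Fwd S T f\<close> and \<open>Bwd S T w\<close>, the
  objects \<open>S\<close> and \<open>T\<close> are source and target of \<open>f\<close> resp. \<open>w\<close>; \<open>Bwd S T w\<close> is a formal inverse of
  \<open>w\<close>. Zigzags are listed in diagrammatic order.\<close>

datatype ('o, 'm) zstep = Fwd 'o 'o 'm | Bwd 'o 'o 'm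

fun zigzag :: "('o, 'm) category \<Rightarrow> ('o \<Rightarrow> 'o \<Rightarrow> 'm set) \<Rightarrow> 'o \<Rightarrow> ('o, 'm) zstep list \<Rightarrow> 'o \<Rightarrow> bool" where
  "zigzag C W A [] B \<longleftrightarrow> A \<in> Ob C \<and> A = B"
| "zigzag C W A (Fwd S T f # zs) B \<longleftrightarrow> A \<in> Ob C \<and> A = S \<and> f \<in> Hom C S T \<and> zigzag C W T zs B"
| "zigzag C W A (Bwd S T w # zs) B \<longleftrightarrow> A \<in> Ob C \<and> A = T \<and> w \<in> W S T \<and> zigzag C W S zs B"

inductive zreduce :: "('o, 'm) category \<Rightarrow> ('o, 'm) zstep list \<Rightarrow> ('o, 'm) zstep list \<Rightarrow> bool"
  for C :: "('o, 'm) category" where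
  "zreduce C [Fwd A A (Idt C A)] []"
| "zreduce C [Fwd A B f, Fwd B D g] [Fwd A D (Cmp C A g f)]"
| "zreduce C [Fwd A B w, Bwd A B w] []"
| "zreduce C [Bwd A B w, Fwd A B w] []"

definition zigzag_equiv :: "('o, 'm) category \<Rightarrow> ('o \<Rightarrow> 'o \<Rightarrow> 'm set) \<Rightarrow> 'o \<Rightarrow> 'o \<Rightarrow> ('o, 'm) zstep list rel" where
  "zigzag_equiv C W A B = equiv_gen
     {(p @ u @ q, p @ v @ q) | p q u v. zreduce C u v \<and>
        zigzag C W A (p @ u @ q) B \<and> zigzag C W A (p @ v @ q) B}"

definition loc_hom :: "('o, 'm) category \<Rightarrow> ('o \<Rightarrow> 'o \<Rightarrow> 'm set) \<Rightarrow> 'o \<Rightarrow> 'o \<Rightarrow> ('o, 'm) zstep list set set" where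
  "loc_hom C W A B = {u. zigzag C W A u B} // zigzag_equiv C W A B"

text \<open>Composition in the localization with the class of \<open>p : P \<rightarrow> A\<close>, as a map from
  \<open>loc_hom C W A B\<close> to \<open>loc_hom C W P B\<close>.\<close>

definition loc_precomp :: "('o, 'm) category \<Rightarrow> ('o \<Rightarrow> 'o \<Rightarrow> 'm set) \<Rightarrow> 'o \<Rightarrow> 'o \<Rightarrow> 'o \<Rightarrow> 'm \<Rightarrow>
    ('o, 'm) zstep list set \<Rightarrow> ('o, 'm) zstep list set" where
  "loc_precomp C W P A B p = quot_map (zigzag_equiv C W P B) (\<lambda>u. Fwd P A p # u)"

section \<open>Hyperbolic simplicial sheaves\<close>

definition ssheaf_cat :: "(('p, 'v) ssheaf, ('p, 'v) smap) category" where
  "ssheaf_cat =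
     \<lparr>Ob = Collect simplicial_sheaf, Hom = ssheaf_hom,
      Idt = \<lambda>X n. \<lambda>U \<in> Collect complex_space. \<lambda>s \<in> sec (level X n) U. s,
      Cmp = \<lambda>X \<psi> \<phi> n. \<lambda>U \<in> Collect complex_space. compose (sec (level X n) U) (\<psi> n U) (\<phi> n U)\<rparr>"

definition Hs_hom :: "('p, 'v) ssheaf \<Rightarrow> ('p, 'v) ssheaf \<Rightarrow>
    (('p, 'v) ssheaf, ('p, 'v) smap) zstep list set set" where
  "Hs_hom = loc_hom ssheaf_cat simplicial_weak_equivalences"

text \<open>The elements available to sheaves: morphisms of the site, so that complex spaces represent
  sheaves; pairs, so that products of sheaves exist; and arbitrarily many others, as \<open>'w\<close> is
  arbitrary.\<close>

datatype ('p, 'w) elem = Mor "'p \<Rightarrow> 'p" | Pr "('p, 'w) elem" "('p, 'w) elem" | Atom 'w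

fun precomp_elem :: "'p set \<Rightarrow> ('p \<Rightarrow> 'p) \<Rightarrow> ('p, 'w) elem \<Rightarrow> ('p, 'w) elem" where
  "precomp_elem S f (Mor g) = Mor (compose S g f)"
| "precomp_elem S f e = e"

definition represented :: "'p cspace \<Rightarrow> ('p, ('p, 'w) elem) sheaf" where
  "represented X = \<lparr>sec = \<lambda>U. Mor ` hol_maps U X, res = \<lambda>V U f. precomp_elem (cpoints V) f\<rparr>"

fun map_pr :: "(('p, 'w) elem \<Rightarrow> ('p, 'w) elem) \<Rightarrow> (('p, 'w) elem \<Rightarrow> ('p, 'w) elem) \<Rightarrow>
    ('p, 'w) elem \<Rightarrow> ('p, 'w) elem" where
  "map_pr f g (Pr a b) = Pr (f a) (g b)"
| "map_pr f g e = e"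

fun fst_pr :: "('p, 'w) elem \<Rightarrow> ('p, 'w) elem" where
  "fst_pr (Pr a b) = a"
| "fst_pr e = e"

definition prod_ssheaf :: "('p, ('p, 'w) elem) ssheaf \<Rightarrow> ('p, ('p, 'w) elem) ssheaf \<Rightarrow>
    ('p, ('p, 'w) elem) ssheaf" where
  "prod_ssheaf X Y =
     \<lparr>level = \<lambda>n. \<lparr>sec = \<lambda>U. {Pr a b | a b. a \<in> sec (level X n) U \<and> b \<in> sec (level Y n) U},
                  res = \<lambda>V U f. map_pr (res (level X n) V U f) (res (level Y n) V U f)\<rparr>,
      fc = \<lambda>n i U. map_pr (fc X n i U) (fc Y n i U),
      dg = \<lambda>n i U. map_pr (dg X n i U) (dg Y n i U)\<rparr>"

definition proj_ssheaf :: "('p, ('p, 'w) elem) ssheaf \<Rightarrow> ('p, ('p, 'w) elem) ssheaf \<Rightarrow>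
    ('p, ('p, 'w) elem) smap" where
  "proj_ssheaf X Y n = (\<lambda>U \<in> Collect complex_space. \<lambda>s \<in> sec (level (prod_ssheaf X Y) n) U. fst_pr s)"

text \<open>Points of the site have type \<open>complex + 'a\<close>, so that \<open>\<complex>\<close> is (isomorphic to) an object of it,
  and so is every complex space with points in \<open>'a\<close>.\<close>

definition line_ssheaf :: "(complex + 'a, (complex + 'a, 'w) elem) ssheaf" where
  "line_ssheaf = const_ssheaf (represented (relabel Inl (planar_space UNIV)))"

definition hyperbolic :: "(complex + 'a, (complex + 'a, 'w) elem) ssheaf \<Rightarrow> bool" where
  "hyperbolic X \<longleftrightarrow>
     (\<forall>Y. simplicial_sheaf Y \<longrightarrow>
        bij_betw
          (loc_precomp ssheaf_cat simplicial_weak_equivalences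
             (prod_ssheaf Y line_ssheaf) Y X (proj_ssheaf Y line_ssheaf))
          (Hs_hom Y X) (Hs_hom (prod_ssheaf Y line_ssheaf) X))"

text \<open>The simplicial sheaf of a complex space with points in an arbitrary type.\<close>

definition ssheaf_of :: "'a cspace \<Rightarrow> (complex + 'a, (complex + 'a, 'w) elem) ssheaf" where
  "ssheaf_of X = const_ssheaf (represented (relabel Inr X))"

end

theory Submission
  imports Defs
begin

text \<open>By Brody's theorem a compact complex space is Kobayashi hyperbolic iff it has no nonconstant
  entire curve. The proof works on singular spaces: a length function on holomorphic curves is the sum
  over a finite atlas, weighted by cutoff functions, of the moduli of the derivatives of the chart
  coordinates. If it is bounded on all discs at the origin, discs are Lipschitz and the Kobayashi
  pseudodistance separates points; otherwise rescaling yields discs of growing radius with bounded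
  speed, and their limit along an ultrafilter is a nonconstant entire curve.

  On the other side, a morphism from a simplicial sheaf to a represented sheaf only depends on path
  components. A simplicial weak equivalence is bijective on the path components of all stalks, hence
  composition with it is bijective on morphisms to a represented sheaf, and therefore morphisms to
  such a sheaf in \<open>\<H>\<^sub>s\<close> are plain morphisms of simplicial sheaves. So \<open>X\<close> is \<open>\<complex>\<close>-local iff every
  morphism \<open>Y \<times> \<complex> \<rightarrow> X\<close> factors through \<open>Y\<close>, and this amounts to the constancy of entire curves.\<close>

section \<open>Complex spaces and their holomorphic maps\<close>

text \<open>Two obstacles shape the proof. A singular space has no tangent bundle to carry a length
  metric; what makes sense is the derivative of a coordinate along a given curve. Limits are taken
  along an ultrafilter because compactness then yields a limit at every point of the plane at once,
  with no metrizability and no diagonal sequences; the speed bound turns this pointwise limit into a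
  locally uniform one. On the other side, weak equivalences are defined by realizations of stalks,
  whereas a section of a represented sheaf is a map, determined by its values at points; the value
  at \<open>x\<close> is a function on the stalk at \<open>x\<close> that is invariant under faces
  and degeneracies. So a morphism is extended along a weak equivalence point by point, with
  arbitrary choices, and naturality and holomorphy of the result both follow from one uniqueness
  principle: two such functions on the target stalk that agree on the image of the source stalk are
  equal. For holomorphy these functions are truth values. That locality forces entire curves to be
  constant is already visible when \<open>Y\<close> is a point.\<close>

lemma function_sheafD_ext:
  assumes "function_sheaf X" "openin (ctop X) U" "g \<in> hol_sections X U"
  shows "g \<in> extensional U"
  using assms unfolding function_sheaf_def by blast

lemma function_sheafD_restrict:
  assumes "function_sheaf X" "openin (ctop X) U" "openin (ctop X) V" "V \<subseteq> U" "g \<in> hol_sections X U"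
  shows "restrict g V \<in> hol_sections X V"
  using assms unfolding function_sheaf_def by blast

lemma function_sheafD_glue:
  assumes "function_sheaf X" "openin (ctop X) U" "g \<in> extensional U"
    and "\<And>x. x \<in> U \<Longrightarrow> \<exists>V. openin (ctop X) V \<and> x \<in> V \<and> V \<subseteq> U \<and> restrict g V \<in> hol_sections X V"
  shows "g \<in> hol_sections X U"
proof -
  have "openin (ctop X) U \<and> g \<in> extensional U \<and>
      (\<forall>x\<in>U. \<exists>V. openin (ctop X) V \<and> x \<in> V \<and> V \<subseteq> U \<and> restrict g V \<in> hol_sections X V)
      \<longrightarrow> g \<in> hol_sections X U"
    using assms(1) unfolding function_sheaf_def by (elim conjE) (erule allE, erule allE)
  then show ?thesis using assms(2-4) by simp
qed

lemma hol_mapsI: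
  assumes "f \<in> extensional (cpoints X)" "continuous_map (ctop X) (ctop Y) f"
    and "\<And>V g. openin (ctop Y) V \<Longrightarrow> g \<in> hol_sections Y V \<Longrightarrow>
      (\<lambda>x \<in> {x \<in> cpoints X. f x \<in> V}. g (f x)) \<in> hol_sections X {x \<in> cpoints X. f x \<in> V}"
  shows "f \<in> hol_maps X Y"
  using assms unfolding hol_maps_def by blast

lemma hol_mapsD:
  assumes "f \<in> hol_maps X Y"
  shows "f \<in> extensional (cpoints X)" "continuous_map (ctop X) (ctop Y) f"
    and "openin (ctop Y) V \<Longrightarrow> g \<in> hol_sections Y V \<Longrightarrow>
      (\<lambda>x \<in> {x \<in> cpoints X. f x \<in> V}. g (f x)) \<in> hol_sections X {x \<in> cpoints X. f x \<in> V}"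
    and "x \<in> cpoints X \<Longrightarrow> f x \<in> cpoints Y"
    and "openin (ctop Y) V \<Longrightarrow> openin (ctop X) {x \<in> cpoints X. f x \<in> V}"
proof -
  show c: "continuous_map (ctop X) (ctop Y) f"
    using assms unfolding hol_maps_def by blast
  show "f \<in> extensional (cpoints X)"
    and "openin (ctop Y) V \<Longrightarrow> g \<in> hol_sections Y V \<Longrightarrow>
      (\<lambda>x \<in> {x \<in> cpoints X. f x \<in> V}. g (f x)) \<in> hol_sections X {x \<in> cpoints X. f x \<in> V}"
    using assms unfolding hol_maps_def by blast+
  show "x \<in> cpoints X \<Longrightarrow> f x \<in> cpoints Y"
    using c by (auto simp: continuous_map_def Pi_iff)
  show "openin (ctop Y) V \<Longrightarrow> openin (ctop X) {x \<in> cpoints X. f x \<in> V}"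
    using c by (auto simp: continuous_map_def)
qed

lemma hol_maps_ident:
  assumes "function_sheaf X"
  shows "(\<lambda>x \<in> cpoints X. x) \<in> hol_maps X X"
proof (rule hol_mapsI)
  show "continuous_map (ctop X) (ctop X) (\<lambda>x \<in> cpoints X. x)"
    by (rule continuous_map_eq[OF continuous_map_id]) auto
  fix V g assume V: "openin (ctop X) V" and g: "g \<in> hol_sections X V"
  have "{x \<in> cpoints X. (\<lambda>x \<in> cpoints X. x) x \<in> V} = V"
    using openin_subset[OF V] by auto
  moreover have "(\<lambda>x \<in> V. g ((\<lambda>x \<in> cpoints X. x) x)) = g"
    using function_sheafD_ext[OF assms V g] openin_subset[OF V]
    by (auto simp: fun_eq_iff extensional_def)
  ultimately show "(\<lambda>x \<in> {x \<in> cpoints X. (\<lambda>x \<in> cpoints X. x) x \<in> V}. g ((\<lambda>x \<in> cpoints X. x) x))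
      \<in> hol_sections X {x \<in> cpoints X. (\<lambda>x \<in> cpoints X. x) x \<in> V}"
    using g by simp
qed simp

lemma hol_maps_compose:
  assumes f: "f \<in> hol_maps X Y" and g: "g \<in> hol_maps Y Z"
  shows "compose (cpoints X) g f \<in> hol_maps X Z"
proof (rule hol_mapsI)
  show "continuous_map (ctop X) (ctop Z) (compose (cpoints X) g f)"
    by (rule continuous_map_eq[OF continuous_map_compose[OF hol_mapsD(2)[OF f] hol_mapsD(2)[OF g]]])
       (auto simp: compose_def)
  fix V h assume V: "openin (ctop Z) V" and h: "h \<in> hol_sections Z V"
  let ?W = "{y \<in> cpoints Y. g y \<in> V}"
  have 1: "openin (ctop Y) ?W" "(\<lambda>y\<in>?W. h (g y)) \<in> hol_sections Y ?W"
    using hol_mapsD(3,5)[OF g] V h by auto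
  have eq: "{x \<in> cpoints X. compose (cpoints X) g f x \<in> V} = {x \<in> cpoints X. f x \<in> ?W}"
    using hol_mapsD(4)[OF f] by (auto simp: compose_def)
  have "(\<lambda>x \<in> {x \<in> cpoints X. f x \<in> ?W}. (\<lambda>y\<in>?W. h (g y)) (f x)) \<in> hol_sections X {x \<in> cpoints X. f x \<in> ?W}"
    using hol_mapsD(3)[OF f 1] .
  moreover have "(\<lambda>x \<in> {x \<in> cpoints X. f x \<in> ?W}. (\<lambda>y\<in>?W. h (g y)) (f x)) =
      (\<lambda>x \<in> {x \<in> cpoints X. f x \<in> ?W}. h (compose (cpoints X) g f x))"
    by (auto simp: fun_eq_iff compose_def)
  ultimately show "(\<lambda>x \<in> {x \<in> cpoints X. compose (cpoints X) g f x \<in> V}. h (compose (cpoints X) g f x))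
      \<in> hol_sections X {x \<in> cpoints X. compose (cpoints X) g f x \<in> V}"
    unfolding eq by simp
qed (simp add: compose_extensional)

section \<open>Open subspaces, and gluing of holomorphic maps\<close>

lemma ctop_open_subspace [simp]: "ctop (open_subspace X V) = subtopology (ctop X) V"
  and hol_sections_open_subspace [simp]: "hol_sections (open_subspace X V) = hol_sections X"
  by (simp_all add: open_subspace_def)

lemma open_subspace_open_subspace:
  "W \<subseteq> V \<Longrightarrow> open_subspace (open_subspace X V) W = open_subspace X W"
  by (simp add: open_subspace_def subtopology_subtopology inf_absorb2)

lemma open_subspace_cpoints [simp]: "open_subspace X (cpoints X) = X"
  by (simp add: open_subspace_def)

lemma cpoints_open_subspace:
  "openin (ctop X) V \<Longrightarrow> cpoints (open_subspace X V) = V"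
  using openin_subset by (fastforce simp: topspace_subtopology)

lemma openin_open_subspace:
  "openin (ctop X) V \<Longrightarrow> openin (ctop (open_subspace X V)) W \<longleftrightarrow> openin (ctop X) W \<and> W \<subseteq> V"
  by (simp add: openin_open_subtopology)

text \<open>Source and target shrink together, so that inclusions, restricted curves and preimages
  of open subspaces are all instances.\<close>

lemma hol_maps_restrict_open:
  assumes X: "function_sheaf X" and f: "f \<in> hol_maps X Y"
    and V: "openin (ctop X) V" and Z: "openin (ctop Y) Z" and VZ: "f ` V \<subseteq> Z"
  shows "restrict f V \<in> hol_maps (open_subspace X V) (open_subspace Y Z)"
proof (rule hol_mapsI)
  have VX: "V \<subseteq> cpoints X"
    using openin_subset[OF V] .
  show "restrict f V \<in> extensional (cpoints (open_subspace X V))"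
    by (simp add: cpoints_open_subspace[OF V] del: ctop_open_subspace)
  have "continuous_map (subtopology (ctop X) V) (ctop Y) (restrict f V)"
    by (rule continuous_map_eq[OF continuous_map_from_subtopology[OF hol_mapsD(2)[OF f]]]) auto
  then show "continuous_map (ctop (open_subspace X V)) (ctop (open_subspace Y Z)) (restrict f V)"
    using VZ VX by (auto simp: continuous_map_in_subtopology)
  fix W g assume W: "openin (ctop (open_subspace Y Z)) W" and g: "g \<in> hol_sections (open_subspace Y Z) W"
  have W': "openin (ctop Y) W" "W \<subseteq> Z"
    using W openin_open_subspace[OF Z] by blast+
  have eq: "{x \<in> cpoints (open_subspace X V). restrict f V x \<in> W} = {x \<in> cpoints X. f x \<in> W} \<inter> V"
    using VX by (auto simp: cpoints_open_subspace[OF V] simp del: ctop_open_subspace)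
  have "restrict (\<lambda>x\<in>{x \<in> cpoints X. f x \<in> W}. g (f x)) ({x \<in> cpoints X. f x \<in> W} \<inter> V)
      \<in> hol_sections X ({x \<in> cpoints X. f x \<in> W} \<inter> V)"
    by (rule function_sheafD_restrict[OF X hol_mapsD(5)[OF f W'(1)]])
       (use hol_mapsD(3)[OF f W'(1)] g hol_mapsD(5)[OF f W'(1)] V in auto)
  moreover have "restrict (\<lambda>x\<in>{x \<in> cpoints X. f x \<in> W}. g (f x)) ({x \<in> cpoints X. f x \<in> W} \<inter> V)
      = (\<lambda>x\<in>{x \<in> cpoints X. f x \<in> W} \<inter> V. g (restrict f V x))"
    by (auto simp: fun_eq_iff)
  ultimately show "(\<lambda>x\<in>{x \<in> cpoints (open_subspace X V). restrict f V x \<in> W}. g (restrict f V x))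
      \<in> hol_sections (open_subspace X V) {x \<in> cpoints (open_subspace X V). restrict f V x \<in> W}"
    unfolding eq by simp
qed

lemma hol_maps_inclusion:
  assumes X: "function_sheaf X" and V: "openin (ctop X) V" "openin (ctop X) W" "W \<subseteq> V"
  shows "(\<lambda>x\<in>W. x) \<in> hol_maps (open_subspace X W) (open_subspace X V)"
proof -
  have "restrict (\<lambda>x\<in>cpoints X. x) W \<in> hol_maps (open_subspace X W) (open_subspace X V)"
    by (rule hol_maps_restrict_open[OF X hol_maps_ident[OF X]])
       (use V openin_subset[OF V(2)] in auto)
  moreover have "restrict (\<lambda>x\<in>cpoints X. x) W = (\<lambda>x\<in>W. x)"
    using openin_subset[OF V(2)] by (auto simp: fun_eq_iff)
  ultimately show ?thesis by simp
qed

lemma hol_maps_inclusion_whole: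
  assumes X: "function_sheaf X" and V: "openin (ctop X) V"
  shows "(\<lambda>x\<in>V. x) \<in> hol_maps (open_subspace X V) X"
  using hol_maps_inclusion[OF X _ V, of "cpoints X"] openin_subset[OF V] by simp

lemma hol_maps_glue:
  assumes X: "function_sheaf X" and f: "f \<in> extensional (cpoints X)"
    and loc: "\<And>x. x \<in> cpoints X \<Longrightarrow>
      \<exists>V. openin (ctop X) V \<and> x \<in> V \<and> restrict f V \<in> hol_maps (open_subspace X V) Y"
  shows "f \<in> hol_maps X Y"
proof (rule hol_mapsI[OF f])
  have im: "f x \<in> cpoints Y" if x: "x \<in> cpoints X" for x
  proof -
    obtain V where V: "openin (ctop X) V" "x \<in> V" "restrict f V \<in> hol_maps (open_subspace X V) Y"
      using loc[OF x] by blast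
    then show ?thesis
      using hol_mapsD(4)[OF V(3), of x] cpoints_open_subspace[OF V(1)] by auto
  qed
  \<comment> \<open>The guarded last conjunct lets one local statement serve twice: continuity uses
    the open set \<open>V\<close>, the pullback of a section uses the implication.\<close>
  have pre: "\<exists>V. openin (ctop X) V \<and> x \<in> V \<and> V \<subseteq> {x \<in> cpoints X. f x \<in> W} \<and>
       (g \<in> hol_sections Y W \<longrightarrow> (\<lambda>x\<in>V. g (f x)) \<in> hol_sections X V)"
    if W: "openin (ctop Y) W" and x: "x \<in> cpoints X" "f x \<in> W" for W x g
  proof -
    obtain V where V: "openin (ctop X) V" "x \<in> V" "restrict f V \<in> hol_maps (open_subspace X V) Y"
      using loc[OF x(1)] by blast
    let ?V = "{x \<in> V. f x \<in> W}"
    have eq: "{x \<in> cpoints (open_subspace X V). restrict f V x \<in> W} = ?V"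
      by (auto simp: cpoints_open_subspace[OF V(1)] simp del: ctop_open_subspace)
    have "(\<lambda>x\<in>?V. g (restrict f V x)) \<in> hol_sections X ?V" if "g \<in> hol_sections Y W"
      using hol_mapsD(3)[OF V(3) W that] unfolding eq by simp
    moreover have "(\<lambda>x\<in>?V. g (restrict f V x)) = (\<lambda>x\<in>?V. g (f x))"
      by (auto simp: fun_eq_iff)
    moreover have "openin (ctop X) ?V"
      using hol_mapsD(5)[OF V(3) W] unfolding eq openin_open_subspace[OF V(1)] by simp
    ultimately show ?thesis
      using V(2) x openin_subset[OF V(1)] by (intro exI[of _ ?V]) auto
  qed
  show "continuous_map (ctop X) (ctop Y) f"
    unfolding continuous_map_def
  proof (intro conjI allI impI)
    show "f \<in> cpoints X \<rightarrow> cpoints Y" using im by auto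
    fix W assume W: "openin (ctop Y) W"
    show "openin (ctop X) {x \<in> cpoints X. f x \<in> W}"
      by (subst openin_subopen) (use pre[OF W] in blast)
  qed
  fix W g assume W: "openin (ctop Y) W" and g: "g \<in> hol_sections Y W"
  show "(\<lambda>x\<in>{x \<in> cpoints X. f x \<in> W}. g (f x)) \<in> hol_sections X {x \<in> cpoints X. f x \<in> W}"
  proof (rule function_sheafD_glue[OF X])
    show "openin (ctop X) {x \<in> cpoints X. f x \<in> W}"
      by (subst openin_subopen) (use pre[OF W] in blast)
    fix x assume "x \<in> {x \<in> cpoints X. f x \<in> W}"
    then obtain V where V: "openin (ctop X) V" "x \<in> V" "V \<subseteq> {x \<in> cpoints X. f x \<in> W}"
        "(\<lambda>x\<in>V. g (f x)) \<in> hol_sections X V"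
      using pre[OF W, of x g] g by blast
    moreover have "(\<lambda>x\<in>V. g (f x)) = restrict (\<lambda>x\<in>{x \<in> cpoints X. f x \<in> W}. g (f x)) V"
      using V(3) by (auto simp: fun_eq_iff)
    ultimately show "\<exists>V. openin (ctop X) V \<and> x \<in> V \<and> V \<subseteq> {x \<in> cpoints X. f x \<in> W} \<and>
         restrict (\<lambda>x\<in>{x \<in> cpoints X. f x \<in> W}. g (f x)) V \<in> hol_sections X V"
      by auto
  qed simp
qed

section \<open>Charts, constant maps, and charts of open subspaces\<close>

definition chart ::
  "'p cspace \<Rightarrow> 'p set \<Rightarrow> nat \<Rightarrow> (nat \<Rightarrow> complex) set \<Rightarrow> ('p \<Rightarrow> nat \<Rightarrow> complex) \<Rightarrow> ((nat \<Rightarrow> complex) \<Rightarrow> 'p) \<Rightarrow> bool"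
  where "chart X U n A \<phi> \<psi> \<longleftrightarrow>
    openin (ctop X) U \<and> analytic_model n A \<and>
    homeomorphic_maps (subtopology (ctop X) U) (top_of_set A) \<phi> \<psi> \<and>
    (\<forall>V g. openin (ctop X) V \<and> V \<subseteq> U \<and> g \<in> extensional V \<longrightarrow>
           (g \<in> hol_sections X V \<longleftrightarrow> model_holomorphic n (\<phi> ` V) (g \<circ> \<psi>)))"

lemma complex_space_iff_chart:
  "complex_space X \<longleftrightarrow> Hausdorff_space (ctop X) \<and> function_sheaf X \<and>
     (\<forall>x \<in> cpoints X. \<exists>U n A \<phi> \<psi>. x \<in> U \<and> chart X U n A \<phi> \<psi>)"
  unfolding complex_space_def chart_def
  by (intro conj_cong ball_cong refl ex_cong) blast

lemma complex_spaceD: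
  assumes "complex_space X"
  shows "Hausdorff_space (ctop X)" "function_sheaf X"
    "\<And>x. x \<in> cpoints X \<Longrightarrow> \<exists>U n A \<phi> \<psi>. x \<in> U \<and> chart X U n A \<phi> \<psi>"
  using assms unfolding complex_space_iff_chart by blast+

lemma chartD:
  assumes "chart X U n A \<phi> \<psi>"
  shows "openin (ctop X) U" "U \<subseteq> cpoints X" "\<And>x. x \<in> U \<Longrightarrow> \<phi> x \<in> A" "\<And>a. a \<in> A \<Longrightarrow> \<psi> a \<in> U"
    "\<And>x. x \<in> U \<Longrightarrow> \<psi> (\<phi> x) = x" "\<And>a. a \<in> A \<Longrightarrow> \<phi> (\<psi> a) = a"
    "continuous_map (subtopology (ctop X) U) (top_of_set A) \<phi>"
    "continuous_map (top_of_set A) (subtopology (ctop X) U) \<psi>" "A \<subseteq> Cn n"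
    "\<And>V g. \<lbrakk>openin (ctop X) V; V \<subseteq> U; g \<in> extensional V\<rbrakk> \<Longrightarrow>
       g \<in> hol_sections X V \<longleftrightarrow> model_holomorphic n (\<phi> ` V) (g \<circ> \<psi>)"
proof -
  have hm: "homeomorphic_maps (subtopology (ctop X) U) (top_of_set A) \<phi> \<psi>"
    using assms unfolding chart_def by (elim conjE)
  have am: "analytic_model n A"
    using assms unfolding chart_def by (elim conjE)
  show U: "openin (ctop X) U"
    using assms unfolding chart_def by (elim conjE)
  show c: "continuous_map (subtopology (ctop X) U) (top_of_set A) \<phi>"
    "continuous_map (top_of_set A) (subtopology (ctop X) U) \<psi>"
    using hm unfolding homeomorphic_maps_def by blast+
  show UX: "U \<subseteq> cpoints X" using openin_subset[OF U] .
  have tU: "topspace (subtopology (ctop X) U) = U" using UX by auto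
  show "\<And>x. x \<in> U \<Longrightarrow> \<phi> x \<in> A" "\<And>a. a \<in> A \<Longrightarrow> \<psi> a \<in> U"
    using c unfolding continuous_map_def tU by auto
  show "\<And>x. x \<in> U \<Longrightarrow> \<psi> (\<phi> x) = x" "\<And>a. a \<in> A \<Longrightarrow> \<phi> (\<psi> a) = a"
    using hm unfolding homeomorphic_maps_def tU by auto
  show "A \<subseteq> Cn n"
    using am openin_subset unfolding analytic_model_def by fastforce
  show "\<And>V g. \<lbrakk>openin (ctop X) V; V \<subseteq> U; g \<in> extensional V\<rbrakk> \<Longrightarrow>
       g \<in> hol_sections X V \<longleftrightarrow> model_holomorphic n (\<phi> ` V) (g \<circ> \<psi>)"
    using assms unfolding chart_def by simp
qed

lemma model_holomorphic_const: "B \<subseteq> Cn n \<Longrightarrow> (\<And>z. z \<in> B \<Longrightarrow> h z = c) \<Longrightarrow> model_holomorphic n B h"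
  unfolding model_holomorphic_def
  by (intro ballI exI[of _ "Cn n"] exI[of _ "\<lambda>_. c"])
     (auto simp: holomorphic_Cn_def)

text \<open>\<open>function_sheaf\<close> says nothing about constants; they are sections because
  constants are holomorphic on every local model, so a chart is taken around each point.\<close>

lemma const_in_hol_sections:
  assumes X: "complex_space X" and V: "openin (ctop X) V"
  shows "(\<lambda>x\<in>V. c) \<in> hol_sections X V"
proof (rule function_sheafD_glue[OF complex_spaceD(2)[OF X] V])
  fix x assume x: "x \<in> V"
  have "x \<in> cpoints X" using x openin_subset[OF V] by blast
  from complex_spaceD(3)[OF X this]
  obtain U n A \<phi> \<psi> where U: "x \<in> U" and ch: "chart X U n A \<phi> \<psi>"
    by blast
  note c = chartD[OF ch]
  have UV: "openin (ctop X) (U \<inter> V)" using V c(1) by blast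
  have "model_holomorphic n (\<phi> ` (U \<inter> V)) ((\<lambda>x\<in>U \<inter> V. c) \<circ> \<psi>)"
    by (rule model_holomorphic_const[where c = c]) (use c(3,5,9) in auto)
  then have "(\<lambda>x\<in>U \<inter> V. c) \<in> hol_sections X (U \<inter> V)"
    using c(10)[OF UV] by simp
  moreover have "restrict (\<lambda>x\<in>V. c) (U \<inter> V) = (\<lambda>x\<in>U \<inter> V. c)"
    by (auto simp: fun_eq_iff)
  ultimately show "\<exists>W. openin (ctop X) W \<and> x \<in> W \<and> W \<subseteq> V \<and> restrict (\<lambda>x\<in>V. c) W \<in> hol_sections X W"
    using UV x U by (intro exI[of _ "U \<inter> V"]) auto
qed simp

text \<open>Constant maps play the points of complex spaces later on: constant discs, the zero
  section of the line and evaluation at a point come from here.\<close>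

lemma hol_maps_const:
  assumes X: "complex_space X" and y: "y \<in> cpoints Y"
  shows "(\<lambda>x\<in>cpoints X. y) \<in> hol_maps X Y"
proof (rule hol_mapsI)
  show "continuous_map (ctop X) (ctop Y) (\<lambda>x\<in>cpoints X. y)"
    by (rule continuous_map_eq[of _ _ "\<lambda>_. y"]) (use y in auto)
  fix V g assume V: "openin (ctop Y) V" "g \<in> hol_sections Y V"
  let ?S = "{x \<in> cpoints X. (\<lambda>x\<in>cpoints X. y) x \<in> V}"
  have "?S = cpoints X \<or> ?S = {}" by auto
  then have "openin (ctop X) ?S"
    by (elim disjE) (simp_all only: openin_topspace openin_empty)
  from const_in_hol_sections[OF X this, of "g y"]
  have "(\<lambda>x\<in>?S. g y) \<in> hol_sections X ?S" .
  moreover have "(\<lambda>x\<in>?S. g y) = (\<lambda>x\<in>?S. g ((\<lambda>x\<in>cpoints X. y) x))"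
    by (auto simp: fun_eq_iff)
  ultimately show "(\<lambda>x\<in>?S. g ((\<lambda>x\<in>cpoints X. y) x)) \<in> hol_sections X ?S" by simp
qed simp

lemma function_sheaf_open_subspace:
  assumes X: "function_sheaf X" and V: "openin (ctop X) V"
  shows "function_sheaf (open_subspace X V)"
  unfolding function_sheaf_def openin_open_subspace[OF V] hol_sections_open_subspace
proof (intro conjI allI impI)
  fix U assume "openin (ctop X) U \<and> U \<subseteq> V"
  then show "hol_sections X U \<subseteq> extensional U"
    using function_sheafD_ext[OF X] by blast
next
  fix U W g
  assume "(openin (ctop X) U \<and> U \<subseteq> V) \<and> (openin (ctop X) W \<and> W \<subseteq> V) \<and> W \<subseteq> U \<and> g \<in> hol_sections X U"
  then show "restrict g W \<in> hol_sections X W"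
    using function_sheafD_restrict[OF X] by blast
next
  fix U g
  assume "(openin (ctop X) U \<and> U \<subseteq> V) \<and> g \<in> extensional U \<and>
    (\<forall>x\<in>U. \<exists>W. (openin (ctop X) W \<and> W \<subseteq> V) \<and> x \<in> W \<and> W \<subseteq> U \<and> restrict g W \<in> hol_sections X W)"
  then show "g \<in> hol_sections X U"
    by (intro function_sheafD_glue[OF X]) blast+
qed

text \<open>The same equations, on a smaller ambient open set, cut out \<open>B\<close>.\<close>

lemma analytic_model_openin:
  assumes "analytic_model n A" "openin (top_of_set A) B"
  shows "analytic_model n B"
proof -
  obtain W F where W: "openin (top_of_set (Cn n)) W" "finite F"
      "\<forall>f\<in>F. holomorphic_Cn n W f" "A = {z\<in>W. \<forall>f\<in>F. f z = 0}"
    using assms(1) unfolding analytic_model_def by blast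
  obtain T where T: "open T" "B = A \<inter> T"
    using assms(2) by (auto simp: openin_open)
  have "holomorphic_Cn n (W \<inter> T) f" if "f \<in> F" for f
  proof -
    have f: "holomorphic_Cn n W f" using W(3) that by blast
    have "(\<lambda>w. f (z(i := w))) holomorphic_on {w. z(i := w) \<in> W \<inter> T}" if "z \<in> W \<inter> T" "i < n" for z i
      by (rule holomorphic_on_subset[of _ "{w. z(i := w) \<in> W}"])
         (use f that in \<open>auto simp: holomorphic_Cn_def\<close>)
    then show ?thesis
      using f by (auto simp: holomorphic_Cn_def intro: continuous_on_subset)
  qed
  moreover have "openin (top_of_set (Cn n)) (W \<inter> T)"
    using W(1) T(1) by (metis openin_Int_open)
  moreover have "B = {z\<in>W \<inter> T. \<forall>f\<in>F. f z = 0}"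
    using W(4) T(2) by auto
  ultimately show ?thesis
    unfolding analytic_model_def using W(2) by blast
qed

lemma chart_image_openin:
  assumes "chart X U n A \<phi> \<psi>" "openin (ctop X) V" "V \<subseteq> U"
  shows "openin (top_of_set A) (\<phi> ` V)"
proof -
  note c = chartD[OF assms(1)]
  have "\<phi> ` V = {a \<in> topspace (top_of_set A). \<psi> a \<in> V}"
  proof (intro equalityI subsetI)
    fix a assume "a \<in> {a \<in> topspace (top_of_set A). \<psi> a \<in> V}"
    then have "a \<in> A" "\<psi> a \<in> V" by auto
    then show "a \<in> \<phi> ` V" using c(6)[of a] by (metis imageI)
  next
    fix a assume "a \<in> \<phi> ` V"
    then obtain v where v: "v \<in> V" "a = \<phi> v" by blast
    have "v \<in> U" using v assms(3) by blast
    then show "a \<in> {a \<in> topspace (top_of_set A). \<psi> a \<in> V}" using v c(3,5) by simp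
  qed
  moreover have "openin (subtopology (ctop X) U) V"
    using assms(2,3) c(1) by (simp add: openin_open_subtopology)
  ultimately show ?thesis
    using c(8) by (simp add: continuous_map_def)
qed

lemma chart_subset:
  assumes ch: "chart X U n A \<phi> \<psi>" and V: "openin (ctop X) V" "V \<subseteq> U"
  shows "chart X V n (\<phi> ` V) \<phi> \<psi>"
  unfolding chart_def
proof (intro conjI allI impI)
  note c = chartD[OF ch]
  show "openin (ctop X) V" by fact
  show "analytic_model n (\<phi> ` V)"
    by (rule analytic_model_openin[OF _ chart_image_openin[OF assms]])
       (use ch in \<open>simp add: chart_def\<close>)
  have VA: "\<phi> ` V \<subseteq> A" using V(2) c(3) by auto
  have "subtopology (subtopology (ctop X) U) V = subtopology (ctop X) V"
    using V(2) by (simp add: subtopology_subtopology inf_absorb2)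
  moreover have "subtopology (top_of_set A) (\<phi> ` V) = top_of_set (\<phi> ` V)"
    using VA by (simp add: subtopology_subtopology inf_absorb2)
  moreover have "homeomorphic_maps (subtopology (subtopology (ctop X) U) V) (subtopology (top_of_set A) (\<phi> ` V)) \<phi> \<psi>"
  proof (rule homeomorphic_maps_subtopologies)
    show "homeomorphic_maps (subtopology (ctop X) U) (top_of_set A) \<phi> \<psi>"
      using ch unfolding chart_def by (elim conjE)
    show "\<phi> ` (topspace (subtopology (ctop X) U) \<inter> V) = topspace (top_of_set A) \<inter> \<phi> ` V"
      using VA V c(2) by auto
  qed
  ultimately show "homeomorphic_maps (subtopology (ctop X) V) (top_of_set (\<phi> ` V)) \<phi> \<psi>"
    by simp
  fix W and g :: "'a \<Rightarrow> complex" assume "openin (ctop X) W \<and> W \<subseteq> V \<and> g \<in> extensional W"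
  then show "(g \<in> hol_sections X W) = model_holomorphic n (\<phi> ` W) (g \<circ> \<psi>)"
    using c(10) V(2) by auto
qed

lemma complex_space_open_subspace:
  assumes X: "complex_space X" and V: "openin (ctop X) V"
  shows "complex_space (open_subspace X V)"
  unfolding complex_space_iff_chart
proof (intro conjI ballI)
  show "Hausdorff_space (ctop (open_subspace X V))"
    using complex_spaceD(1)[OF X] by (simp add: Hausdorff_space_subtopology)
  show "function_sheaf (open_subspace X V)"
    using function_sheaf_open_subspace[OF complex_spaceD(2)[OF X] V] .
  fix x assume "x \<in> cpoints (open_subspace X V)"
  then have x: "x \<in> V" unfolding cpoints_open_subspace[OF V] .
  have "x \<in> cpoints X" using x openin_subset[OF V] by blast
  from complex_spaceD(3)[OF X this]
  obtain U n A \<phi> \<psi> where U: "x \<in> U" and ch: "chart X U n A \<phi> \<psi>"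
    by blast
  have UV: "openin (ctop X) (U \<inter> V)"
    using chartD(1)[OF ch] V by blast
  have eq: "subtopology (subtopology (ctop X) V) (U \<inter> V) = subtopology (ctop X) (U \<inter> V)"
    by (simp add: subtopology_subtopology inf_absorb2)
  from chart_subset[OF ch UV] have "chart (open_subspace X V) (U \<inter> V) n (\<phi> ` (U \<inter> V)) \<phi> \<psi>"
    unfolding chart_def openin_open_subspace[OF V] hol_sections_open_subspace
    unfolding ctop_open_subspace eq by blast
  then show "\<exists>U n A \<phi> \<psi>. x \<in> U \<and> chart (open_subspace X V) U n A \<phi> \<psi>"
    using x U by blast
qed

subsection \<open>Open subsets of the plane\<close>

lemma ctop_planar_space [simp]: "ctop (planar_space W) = top_of_set W"
  and hol_sections_planar_space [simp]:
    "hol_sections (planar_space W) = (\<lambda>V. {g \<in> extensional V. g holomorphic_on V})"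
  by (simp_all add: planar_space_def)

lemma openin_planar_space:
  "open W \<Longrightarrow> openin (top_of_set W) V \<longleftrightarrow> open V \<and> V \<subseteq> W"
  by (simp add: openin_open_eq)

lemma function_sheaf_planar_space:
  assumes W: "open W"
  shows "function_sheaf (planar_space W)"
  unfolding function_sheaf_def ctop_planar_space openin_planar_space[OF W] hol_sections_planar_space
proof (intro conjI allI impI)
  fix U V g
  assume "(open U \<and> U \<subseteq> W) \<and> (open V \<and> V \<subseteq> W) \<and> V \<subseteq> U \<and> g \<in> {g \<in> extensional U. g holomorphic_on U}"
  then have "g holomorphic_on V" using holomorphic_on_subset by blast
  then have "restrict g V holomorphic_on V" by (rule holomorphic_transform) simp
  then show "restrict g V \<in> {g \<in> extensional V. g holomorphic_on V}"
    by (intro CollectI conjI restrict_extensional)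
next
  fix U :: "complex set" and g :: "complex \<Rightarrow> complex"
  assume a: "(open U \<and> U \<subseteq> W) \<and> g \<in> extensional U \<and>
    (\<forall>x\<in>U. \<exists>V. (open V \<and> V \<subseteq> W) \<and> x \<in> V \<and> V \<subseteq> U \<and>
       restrict g V \<in> {g \<in> extensional V. g holomorphic_on V})"
  have "g field_differentiable at x" if "x \<in> U" for x
  proof -
    have "\<exists>V. (open V \<and> V \<subseteq> W) \<and> x \<in> V \<and> V \<subseteq> U \<and> restrict g V \<in> {g \<in> extensional V. g holomorphic_on V}"
      using a that by simp
    then obtain V where V: "open V" "x \<in> V" "restrict g V holomorphic_on V"
      by auto
    have "g holomorphic_on V"
      by (rule holomorphic_transform[OF V(3)]) simp
    then show ?thesis using V holomorphic_on_imp_differentiable_at by blast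
  qed
  then have "g holomorphic_on U"
    by (simp add: holomorphic_on_def field_differentiable_at_within)
  then show "g \<in> {g \<in> extensional U. g holomorphic_on U}" using a by simp
qed auto

lemma continuous_on_axis: "continuous_on S (\<lambda>w i::nat. if i = 0 then w else (0::complex))"
proof (rule continuous_on_coordinatewise_then_product)
  fix i :: nat
  show "continuous_on S (\<lambda>w. if i = 0 then w else 0)" by (cases "i = 0") simp_all
qed

text \<open>The model has no equations: points of \<open>Cn 1\<close> are sequences supported at
  index 0, so inserting and reading off that entry identifies it with the plane.\<close>

lemma chart_planar_space:
  assumes W: "open W"
  shows "chart (planar_space W) W 1 {z \<in> Cn 1. z 0 \<in> W} (\<lambda>w i. if i = 0 then w else 0) (\<lambda>z. z 0)"
    (is "chart _ _ _ ?A ?\<phi> ?\<psi>")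
  unfolding chart_def ctop_planar_space openin_planar_space[OF W] hol_sections_planar_space
proof (intro conjI allI impI)
  have op: "openin (top_of_set (Cn 1)) {z \<in> Cn 1. z 0 \<in> V}" if "open V" for V :: "complex set"
  proof -
    have "open ((\<lambda>z. z 0) -` V :: (nat \<Rightarrow> complex) set)"
      by (rule open_vimage[OF that continuous_on_product_coordinates])
    moreover have "{z \<in> Cn 1. z 0 \<in> V} = Cn 1 \<inter> (\<lambda>z. z 0) -` V" by auto
    ultimately show ?thesis by (simp add: openin_open_Int)
  qed
  have eq: "?\<phi> (z 0) = z" if "z \<in> Cn 1" for z
    using that by (auto simp: Cn_def fun_eq_iff)
  show "analytic_model 1 ?A"
    unfolding analytic_model_def by (intro exI[of _ ?A] exI[of _ "{}"]) (use op[OF W] in auto)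
  have "subtopology (top_of_set W) W = top_of_set W"
    by (simp add: subtopology_subtopology)
  then show "homeomorphic_maps (subtopology (top_of_set W) W) (top_of_set ?A) ?\<phi> ?\<psi>"
    unfolding homeomorphic_maps_def
    by (auto simp: eq continuous_on_axis Cn_def intro: continuous_on_subset[OF continuous_on_product_coordinates])
  fix V and g :: "complex \<Rightarrow> complex" assume V: "(open V \<and> V \<subseteq> W) \<and> V \<subseteq> W \<and> g \<in> extensional V"
  show "(g \<in> {g \<in> extensional V. g holomorphic_on V}) = model_holomorphic 1 (?\<phi> ` V) (g \<circ> ?\<psi>)"
  proof
    assume "g \<in> {g \<in> extensional V. g holomorphic_on V}"
    then have g: "g holomorphic_on V" by simp
    have c: "continuous_on {z \<in> Cn 1. z 0 \<in> V} (g \<circ> ?\<psi>)"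
      by (rule continuous_on_compose)
         (auto intro: continuous_on_subset[OF continuous_on_product_coordinates]
            continuous_on_subset[OF holomorphic_on_imp_continuous_on[OF g]])
    have "holomorphic_Cn 1 {z \<in> Cn 1. z 0 \<in> V} (g \<circ> ?\<psi>)"
      unfolding holomorphic_Cn_def
      by (intro conjI c) (auto intro!: holomorphic_on_subset[OF g])
    moreover have "z \<in> {z \<in> Cn 1. z 0 \<in> V}" if "z \<in> ?\<phi> ` V" for z
      using that by (auto simp: Cn_def)
    ultimately show "model_holomorphic 1 (?\<phi> ` V) (g \<circ> ?\<psi>)"
      unfolding model_holomorphic_def using op[of V] V by blast
  next
    assume m: "model_holomorphic 1 (?\<phi> ` V) (g \<circ> ?\<psi>)"
    have "g field_differentiable at x" if x: "x \<in> V" for x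
    proof -
      have "?\<phi> x \<in> ?\<phi> ` V" using x by blast
      then obtain O' k where k: "openin (top_of_set (Cn 1)) O'" "?\<phi> x \<in> O'" "holomorphic_Cn 1 O' k"
          "\<forall>y \<in> O' \<inter> ?\<phi> ` V. (g \<circ> ?\<psi>) y = k y"
        using m unfolding model_holomorphic_def by blast
      obtain T where T: "open T" "O' = Cn 1 \<inter> T" using k(1) by (auto simp: openin_open)
      \<comment> \<open>Changing entry 0 of an axis point runs through the axis, so holomorphy of
        \<open>k\<close> in its variable 0 is holomorphy along the plane.\<close>
      have upd: "(?\<phi> x)(0 := w) = ?\<phi> w" for w by (auto simp: fun_eq_iff)
      let ?N = "?\<phi> -` T \<inter> V"
      have oN: "open ?N"
        using open_vimage[OF T(1) continuous_on_axis] V by blast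
      have "(\<lambda>w. k (?\<phi> w)) holomorphic_on {w. ?\<phi> w \<in> O'}"
        using bspec[OF conjunct2[OF k(3)[unfolded holomorphic_Cn_def]] k(2), rule_format, of 0]
        unfolding upd by simp
      then have "(\<lambda>w. k (?\<phi> w)) holomorphic_on ?N"
        by (rule holomorphic_on_subset) (auto simp: T Cn_def)
      moreover have "k (?\<phi> w) = g w" if "w \<in> ?N" for w
      proof -
        have "?\<phi> w \<in> O' \<inter> ?\<phi> ` V" using that by (auto simp: T Cn_def)
        from bspec[OF k(4) this] show ?thesis by simp
      qed
      ultimately have "g holomorphic_on ?N"
        by (rule holomorphic_transform)
      moreover have "x \<in> ?N" using x k(2) T by auto
      ultimately show ?thesis using oN holomorphic_on_imp_differentiable_at by blast
    qed
    then show "g \<in> {g \<in> extensional V. g holomorphic_on V}"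
      using V by (simp add: holomorphic_on_def field_differentiable_at_within)
  qed
qed (use W in auto)

lemma complex_space_planar_space:
  assumes "open W"
  shows "complex_space (planar_space W)"
  unfolding complex_space_iff_chart
  using function_sheaf_planar_space[OF assms] chart_planar_space[OF assms]
  by (auto simp: Hausdorff_space_subtopology) blast

lemma hol_maps_planar_space:
  assumes "open V" "open W" "f holomorphic_on V" "f ` V \<subseteq> W"
  shows "restrict f V \<in> hol_maps (planar_space V) (planar_space W)"
proof (rule hol_mapsI)
  have cf: "continuous_on V f" using assms(3) holomorphic_on_imp_continuous_on by blast
  then have "continuous_on V (restrict f V)"
    by (rule continuous_on_eq) simp
  then show "continuous_map (ctop (planar_space V)) (ctop (planar_space W)) (restrict f V)"
    using assms(4) by auto
  fix U g assume U: "openin (ctop (planar_space W)) U" and g: "g \<in> hol_sections (planar_space W) U"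
  have eq: "{x \<in> cpoints (planar_space V). restrict f V x \<in> U} = {x \<in> V. f x \<in> U}"
    by auto
  have "(\<lambda>x. g (f x)) holomorphic_on {x \<in> V. f x \<in> U}"
    using holomorphic_on_compose_gen[of f "{x \<in> V. f x \<in> U}" g U] g assms(3)
    by (auto simp: o_def intro: holomorphic_on_subset)
  then have "(\<lambda>x\<in>{x \<in> V. f x \<in> U}. g (restrict f V x)) holomorphic_on {x \<in> V. f x \<in> U}"
    by (rule holomorphic_transform) auto
  then show "(\<lambda>x\<in>{x \<in> cpoints (planar_space V). restrict f V x \<in> U}. g (restrict f V x))
        \<in> hol_sections (planar_space V) {x \<in> cpoints (planar_space V). restrict f V x \<in> U}"
    unfolding eq by simp
qed simp

subsection \<open>Relabelling\<close>

lemma hol_sections_relabel [simp]: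
  "hol_sections (relabel j X) =
     (\<lambda>V. {g \<in> extensional V. restrict (g \<circ> j) (j -` V) \<in> hol_sections X (j -` V)})"
  by (simp add: relabel_def)

lemma openin_relabel:
  assumes "inj j"
  shows "openin (ctop (relabel j X)) V \<longleftrightarrow> V \<subseteq> j ` cpoints X \<and> openin (ctop X) (j -` V)"
proof -
  have 1: "j -` (inv_into UNIV j -` U \<inter> j ` cpoints X) = U" if "openin (ctop X) U" for U
    using openin_subset[OF that] assms by (auto dest!: injD[OF assms])
  have 2: "V = inv_into UNIV j -` (j -` V) \<inter> j ` cpoints X" if "V \<subseteq> j ` cpoints X"
    using that assms by auto
  have "openin (ctop (relabel j X)) V \<longleftrightarrow>
      (\<exists>U. openin (ctop X) U \<and> V = inv_into UNIV j -` U \<inter> j ` cpoints X)"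
    by (simp add: relabel_def openin_pullback_topology)
  also have "\<dots> \<longleftrightarrow> V \<subseteq> j ` cpoints X \<and> openin (ctop X) (j -` V)"
  proof
    assume "\<exists>U. openin (ctop X) U \<and> V = inv_into UNIV j -` U \<inter> j ` cpoints X"
    then obtain U where U: "openin (ctop X) U" "V = inv_into UNIV j -` U \<inter> j ` cpoints X" by blast
    show "V \<subseteq> j ` cpoints X \<and> openin (ctop X) (j -` V)"
      unfolding U(2) 1[OF U(1)] using U(1) by simp
  next
    assume "V \<subseteq> j ` cpoints X \<and> openin (ctop X) (j -` V)"
    then show "\<exists>U. openin (ctop X) U \<and> V = inv_into UNIV j -` U \<inter> j ` cpoints X"
      using 2 by (intro exI[of _ "j -` V"]) simp
  qed
  finally show ?thesis .
qed

lemma cpoints_relabel [simp]: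
  assumes "inj j"
  shows "cpoints (relabel j X) = j ` cpoints X"
proof -
  have "openin (ctop (relabel j X)) (j ` cpoints X)"
    using assms by (simp add: openin_relabel inj_vimage_image_eq)
  then show ?thesis
    using openin_relabel[OF assms, of X "cpoints (relabel j X)"] openin_subset
    by (metis openin_topspace subset_antisym)
qed

lemma homeomorphic_maps_relabel:
  assumes "inj j"
  shows "homeomorphic_maps (ctop (relabel j X)) (ctop X) (inv_into UNIV j) j"
  unfolding homeomorphic_maps_def
proof (intro conjI)
  show "continuous_map (ctop (relabel j X)) (ctop X) (inv_into UNIV j)"
    unfolding continuous_map_def
  proof (intro conjI allI impI)
    show "inv_into UNIV j \<in> cpoints (relabel j X) \<rightarrow> cpoints X" using assms by auto
    fix U assume U: "openin (ctop X) U"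
    have "j -` {x \<in> cpoints (relabel j X). inv_into UNIV j x \<in> U} = U"
      using openin_subset[OF U] assms by (auto dest!: injD[OF assms])
    then show "openin (ctop (relabel j X)) {x \<in> cpoints (relabel j X). inv_into UNIV j x \<in> U}"
      using U assms by (subst openin_relabel) auto
  qed
  show "continuous_map (ctop X) (ctop (relabel j X)) j"
    unfolding continuous_map_def
  proof (intro conjI allI impI)
    show "j \<in> cpoints X \<rightarrow> cpoints (relabel j X)" using assms by auto
    fix U assume U: "openin (ctop (relabel j X)) U"
    then have "openin (ctop X) (j -` U)" using openin_relabel[OF assms] by blast
    moreover have "{x \<in> cpoints X. j x \<in> U} = j -` U"
      using openin_subset[OF calculation] by auto
    ultimately show "openin (ctop X) {x \<in> cpoints X. j x \<in> U}" by simp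
  qed
qed (use assms in auto)

lemma function_sheaf_relabel:
  assumes j: "inj j" and X: "function_sheaf X"
  shows "function_sheaf (relabel j X)"
  unfolding function_sheaf_def openin_relabel[OF j] hol_sections_relabel
proof (intro conjI allI impI)
  fix U V g
  assume "(U \<subseteq> j ` cpoints X \<and> openin (ctop X) (j -` U)) \<and> (V \<subseteq> j ` cpoints X \<and> openin (ctop X) (j -` V)) \<and>
     V \<subseteq> U \<and> g \<in> {g \<in> extensional U. restrict (g \<circ> j) (j -` U) \<in> hol_sections X (j -` U)}"
  then have *: "openin (ctop X) (j -` U)" "openin (ctop X) (j -` V)" "V \<subseteq> U"
      "restrict (g \<circ> j) (j -` U) \<in> hol_sections X (j -` U)" by auto
  have "restrict (restrict (g \<circ> j) (j -` U)) (j -` V) \<in> hol_sections X (j -` V)"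
    by (rule function_sheafD_restrict[OF X *(1,2) _ *(4)]) (use *(3) in auto)
  moreover have "restrict (restrict (g \<circ> j) (j -` U)) (j -` V) = restrict (restrict g V \<circ> j) (j -` V)"
    using *(3) by (auto simp: fun_eq_iff)
  ultimately show "restrict g V \<in> {g \<in> extensional V. restrict (g \<circ> j) (j -` V) \<in> hol_sections X (j -` V)}"
    by simp
next
  fix U and g :: "'b \<Rightarrow> complex"
  assume a: "(U \<subseteq> j ` cpoints X \<and> openin (ctop X) (j -` U)) \<and> g \<in> extensional U \<and>
     (\<forall>x\<in>U. \<exists>V. (V \<subseteq> j ` cpoints X \<and> openin (ctop X) (j -` V)) \<and> x \<in> V \<and> V \<subseteq> U \<and>
       restrict g V \<in> {g \<in> extensional V. restrict (g \<circ> j) (j -` V) \<in> hol_sections X (j -` V)})"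
  have "restrict (g \<circ> j) (j -` U) \<in> hol_sections X (j -` U)"
  proof (rule function_sheafD_glue[OF X])
    fix x assume "x \<in> j -` U"
    then have "j x \<in> U" by simp
    with a have "\<exists>V. (V \<subseteq> j ` cpoints X \<and> openin (ctop X) (j -` V)) \<and> j x \<in> V \<and> V \<subseteq> U \<and>
       restrict g V \<in> {g \<in> extensional V. restrict (g \<circ> j) (j -` V) \<in> hol_sections X (j -` V)}"
      by simp
    then obtain V where V: "openin (ctop X) (j -` V)" "j x \<in> V" "V \<subseteq> U"
       "restrict (restrict g V \<circ> j) (j -` V) \<in> hol_sections X (j -` V)"
      by (elim exE conjE CollectE)
    moreover have "restrict (restrict g V \<circ> j) (j -` V) = restrict (restrict (g \<circ> j) (j -` U)) (j -` V)"
      using V(3) by (auto simp: fun_eq_iff)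
    ultimately show "\<exists>W. openin (ctop X) W \<and> x \<in> W \<and> W \<subseteq> j -` U \<and>
        restrict (restrict (g \<circ> j) (j -` U)) W \<in> hol_sections X W"
      by (intro exI[of _ "j -` V"]) auto
  qed (use a in auto)
  then show "g \<in> {g \<in> extensional U. restrict (g \<circ> j) (j -` U) \<in> hol_sections X (j -` U)}"
    using a by simp
qed auto

lemma model_holomorphic_cong:
  "(\<And>z. z \<in> B \<Longrightarrow> h z = h' z) \<Longrightarrow> model_holomorphic n B h = model_holomorphic n B h'"
  unfolding model_holomorphic_def by (intro ballI ball_cong refl ex_cong conj_cong) auto

lemma chart_relabel:
  assumes j: "inj j" and ch: "chart X U n A \<phi> \<psi>"
  shows "chart (relabel j X) (j ` U) n A (\<phi> \<circ> inv_into UNIV j) (j \<circ> \<psi>)"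
  unfolding chart_def
proof (intro conjI allI impI)
  note c = chartD[OF ch]
  show "openin (ctop (relabel j X)) (j ` U)"
    using c(1,2) j by (auto simp: openin_relabel inj_vimage_image_eq)
  show "analytic_model n A" using ch by (simp add: chart_def)
  have "j ` cpoints X \<inter> j ` U = j ` U" "cpoints X \<inter> U = U" using c(2) by auto
  then have "homeomorphic_maps (subtopology (ctop (relabel j X)) (j ` U)) (subtopology (ctop X) U) (inv_into UNIV j) j"
    by (intro homeomorphic_maps_subtopologies[OF homeomorphic_maps_relabel[OF j]])
       (simp add: j image_inv_f_f)
  moreover have "homeomorphic_maps (subtopology (ctop X) U) (top_of_set A) \<phi> \<psi>"
    using ch by (simp add: chart_def)
  ultimately show "homeomorphic_maps (subtopology (ctop (relabel j X)) (j ` U)) (top_of_set A)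
     (\<phi> \<circ> inv_into UNIV j) (j \<circ> \<psi>)"
    using homeomorphic_maps_compose by blast
  fix V and g :: "'b \<Rightarrow> complex"
  assume V: "openin (ctop (relabel j X)) V \<and> V \<subseteq> j ` U \<and> g \<in> extensional V"
  have jV: "openin (ctop X) (j -` V)" "j -` V \<subseteq> U"
    using V unfolding openin_relabel[OF j] by (auto dest!: subsetD injD[OF j])
  have im: "(\<phi> \<circ> inv_into UNIV j) ` V = \<phi> ` (j -` V)"
  proof -
    have "V = j ` (j -` V)" using V by auto
    then have "inv_into UNIV j ` V = j -` V" using image_inv_f_f[OF j] by metis
    then show ?thesis by (simp only: image_comp[symmetric])
  qed
  have "(g \<in> hol_sections (relabel j X) V) \<longleftrightarrow> restrict (g \<circ> j) (j -` V) \<in> hol_sections X (j -` V)"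
    using V by simp
  also have "\<dots> \<longleftrightarrow> model_holomorphic n (\<phi> ` (j -` V)) (restrict (g \<circ> j) (j -` V) \<circ> \<psi>)"
    using c(10)[OF jV] by simp
  also have "\<dots> \<longleftrightarrow> model_holomorphic n (\<phi> ` (j -` V)) (g \<circ> (j \<circ> \<psi>))"
    by (rule model_holomorphic_cong) (use jV(2) c(5) in auto)
  finally show "(g \<in> hol_sections (relabel j X) V) =
      model_holomorphic n ((\<phi> \<circ> inv_into UNIV j) ` V) (g \<circ> (j \<circ> \<psi>))"
    unfolding im .
qed

lemma complex_space_relabel:
  assumes j: "inj j" and X: "complex_space X"
  shows "complex_space (relabel j X)"
  unfolding complex_space_iff_chart
proof (intro conjI ballI)
  show "Hausdorff_space (ctop (relabel j X))"
    using complex_spaceD(1)[OF X] homeomorphic_Hausdorff_space homeomorphic_maps_relabel[OF j]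
    unfolding homeomorphic_space_def by metis
  show "function_sheaf (relabel j X)"
    using function_sheaf_relabel[OF j complex_spaceD(2)[OF X]] .
  fix y assume "y \<in> cpoints (relabel j X)"
  then obtain x where x: "x \<in> cpoints X" "y = j x" using j by auto
  from complex_spaceD(3)[OF X x(1)] obtain U n A \<phi> \<psi> where U: "x \<in> U" "chart X U n A \<phi> \<psi>" by blast
  show "\<exists>U n A \<phi> \<psi>. y \<in> U \<and> chart (relabel j X) U n A \<phi> \<psi>"
    using chart_relabel[OF j U(2)] U(1) x(2) by blast
qed

lemma relabel_hol_maps:
  assumes j: "inj j" and X: "function_sheaf X"
  shows "restrict j (cpoints X) \<in> hol_maps X (relabel j X)"
proof (rule hol_mapsI)
  show "continuous_map (ctop X) (ctop (relabel j X)) (restrict j (cpoints X))"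
    by (rule continuous_map_eq[of _ _ j])
       (use homeomorphic_maps_relabel[OF j] in \<open>auto simp: homeomorphic_maps_def\<close>)
  fix V g assume V: "openin (ctop (relabel j X)) V" and g: "g \<in> hol_sections (relabel j X) V"
  have o: "openin (ctop X) (j -` V)" using V openin_relabel[OF j] by blast
  have "{x \<in> cpoints X. restrict j (cpoints X) x \<in> V} = j -` V"
    using openin_subset[OF o] by auto
  moreover have "(\<lambda>x\<in>j -` V. g (restrict j (cpoints X) x)) = restrict (g \<circ> j) (j -` V)"
    using openin_subset[OF o] by (auto simp: fun_eq_iff)
  ultimately show "(\<lambda>x\<in>{x \<in> cpoints X. restrict j (cpoints X) x \<in> V}. g (restrict j (cpoints X) x))
     \<in> hol_sections X {x \<in> cpoints X. restrict j (cpoints X) x \<in> V}"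
    using g by simp
qed simp

lemma relabel_hol_maps_inv:
  assumes j: "inj j" and X: "function_sheaf X"
  shows "restrict (inv_into UNIV j) (j ` cpoints X) \<in> hol_maps (relabel j X) X"
proof (rule hol_mapsI)
  show "continuous_map (ctop (relabel j X)) (ctop X) (restrict (inv_into UNIV j) (j ` cpoints X))"
    by (rule continuous_map_eq[of _ _ "inv_into UNIV j"])
       (use homeomorphic_maps_relabel[OF j] j in \<open>auto simp: homeomorphic_maps_def\<close>)
  fix V g assume V: "openin (ctop X) V" and g: "g \<in> hol_sections X V"
  let ?i = "restrict (inv_into UNIV j) (j ` cpoints X)"
  have S: "{x \<in> cpoints (relabel j X). ?i x \<in> V} = j ` V"
    using openin_subset[OF V] j by (auto dest!: injD[OF j])
  have "restrict ((\<lambda>x\<in>j ` V. g (?i x)) \<circ> j) (j -` j ` V) = g"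
    using openin_subset[OF V] j function_sheafD_ext[OF X V g]
    by (auto simp: fun_eq_iff inj_image_mem_iff extensional_def)
  then show "(\<lambda>x\<in>{x \<in> cpoints (relabel j X). ?i x \<in> V}. g (?i x))
      \<in> hol_sections (relabel j X) {x \<in> cpoints (relabel j X). ?i x \<in> V}"
    unfolding S using g j by (simp add: inj_vimage_image_eq)
qed (use j in simp)

section \<open>Holomorphic functions of several variables along curves\<close>

text \<open>Cauchy's estimate on discs of radius \<open>r / 2\<close> around the points of
  \<open>cball w (r / 2)\<close> bounds the derivative by \<open>2 * B / r\<close>; this is why
  \<open>v\<close> is kept within half the radius.\<close>

lemma holomorphic_increment_bound:
  fixes f :: "complex \<Rightarrow> complex"
  assumes "f holomorphic_on ball w r" "continuous_on (cball w r) f" "r > 0"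
    and B: "\<And>v. v \<in> cball w r \<Longrightarrow> norm (f v) \<le> B" and v: "norm (v - w) \<le> r / 2"
  shows "norm (f v - f w) \<le> 2 * B / r * norm (v - w)"
proof -
  have "norm (deriv f u) \<le> 2 * B / r" if u: "u \<in> cball w (r / 2)" for u
  proof -
    have sub: "cball u (r / 2) \<subseteq> cball w r"
    proof
      fix x assume "x \<in> cball u (r / 2)"
      then show "x \<in> cball w r" using u dist_triangle[of w x u] by simp
    qed
    have sub': "ball u (r / 2) \<subseteq> ball w r"
      using interior_mono[OF sub] by simp
    have "norm ((deriv ^^ 1) f u) \<le> fact 1 * B / (r / 2) ^ 1"
    proof (rule Cauchy_inequality)
      show "f holomorphic_on ball u (r / 2)" using assms(1) sub' by (rule holomorphic_on_subset)
      show "continuous_on (cball u (r / 2)) f" using assms(2) sub by (rule continuous_on_subset)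
      fix x assume "norm (u - x) = r / 2"
      then have "x \<in> cball u (r / 2)" by (simp add: dist_norm)
      then show "norm (f x) \<le> B" using sub B by blast
    qed (use assms(3) in simp)
    then show ?thesis by (simp add: mult.commute)
  qed
  moreover have "(f has_field_derivative deriv f u) (at u within cball w (r / 2))" if "u \<in> cball w (r / 2)" for u
  proof -
    have "u \<in> ball w r" using that assms(3) by auto
    then show ?thesis
      using holomorphic_derivI[OF assms(1) open_ball] by blast
  qed
  ultimately show ?thesis
    using field_differentiable_bound[OF convex_cball, of w "r / 2" f "deriv f" "2 * B / r" w v] v assms(3)
    by (auto simp: dist_norm norm_minus_commute)
qed

text \<open>A chain rule from separate holomorphy and joint continuity. Apart from the mixed second
  difference \<open>E\<close>, the function \<open>H z (g z)\<close> is a sum of functions whose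
  differentiability is known from one variable; so it suffices that \<open>E\<close> has derivative
  0 at \<open>z0\<close>.\<close>

lemma holomorphic_on_diagonal:
  fixes H :: "complex \<Rightarrow> complex \<Rightarrow> complex"
  assumes W: "open W" and cont: "continuous_on W (\<lambda>p. H (fst p) (snd p))"
    and hz: "\<And>w. (\<lambda>z. H z w) holomorphic_on {z. (z, w) \<in> W}"
    and hw: "\<And>z. (\<lambda>w. H z w) holomorphic_on {w. (z, w) \<in> W}"
    and G: "open G" and g: "g holomorphic_on G" and gW: "\<And>z. z \<in> G \<Longrightarrow> (z, g z) \<in> W"
  shows "(\<lambda>z. H z (g z)) holomorphic_on G"
proof -
  have "(\<lambda>z. H z (g z)) field_differentiable at z0" if z0: "z0 \<in> G" for z0
  proof -
    define w0 where "w0 = g z0"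
    obtain A B where AB: "open A" "open B" "(z0, w0) \<in> A \<times> B" "A \<times> B \<subseteq> W"
      using open_prod_elim[OF W gW[OF z0]] unfolding w0_def by metis
    have zwAB: "z0 \<in> A" "w0 \<in> B" using AB(3) by auto
    obtain r1 where r1: "r1 > 0" "cball z0 r1 \<subseteq> A"
      using AB(1) zwAB(1) unfolding open_contains_cball by blast
    obtain r where r: "r > 0" "cball w0 r \<subseteq> B"
      using AB(2) zwAB(2) unfolding open_contains_cball by blast
    have sub: "cball z0 r1 \<times> cball w0 r \<subseteq> W" using r1 r AB by blast
    have opW: "open {z. (z, w) \<in> W}" "open {w. (z, w) \<in> W}" for z w
      using open_vimage[OF W, of "\<lambda>z. (z, w)"] open_vimage[OF W, of "\<lambda>w. (z, w)"]
      by (simp_all add: vimage_def continuous_on_Pair)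
    \<comment> \<open>\<open>E z\<close> is the increment of
      \<open>v \<mapsto> H z v - H z0 v\<close> from \<open>w0\<close> to \<open>g z\<close>. For
      \<open>z\<close> near \<open>z0\<close> this function is uniformly small on a disc, so
      Cauchy's estimate makes its increment a small multiple of \<open>norm (g z - w0)\<close>,
      hence of \<open>norm (z - z0)\<close>.\<close>
    define E where "E z = (H z (g z) - H z0 (g z)) - (H z w0 - H z0 w0)" for z
    have dg: "(g has_field_derivative deriv g z0) (at z0)"
      using holomorphic_derivI[OF g G z0] .
    have "(E has_derivative (\<lambda>_. 0)) (at z0)"
      unfolding has_derivative_at_alt
    proof (intro conjI allI impI)
      fix e :: real assume e: "e > 0"
      define c where "c = norm (deriv g z0) + 1"
      have c: "c > 0" unfolding c_def by (simp add: add_nonneg_pos)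
      obtain d1 where d1: "d1 > 0" "\<And>z. norm (z - z0) < d1 \<Longrightarrow> norm (g z - w0) \<le> c * norm (z - z0)"
      proof -
        have "(g has_derivative (*) (deriv g z0)) (at z0)"
          using dg by (simp add: has_field_derivative_def)
        then obtain d where d: "d > 0" "\<And>z. norm (z - z0) < d \<Longrightarrow>
            norm (g z - g z0 - deriv g z0 * (z - z0)) \<le> 1 * norm (z - z0)"
          unfolding has_derivative_at_alt using zero_less_one by metis
        have "norm (g z - w0) \<le> c * norm (z - z0)" if "norm (z - z0) < d" for z
        proof -
          have "norm (g z - w0) \<le> norm (g z - g z0 - deriv g z0 * (z - z0)) + norm (deriv g z0 * (z - z0))"
            unfolding w0_def by (metis diff_add_cancel norm_triangle_ineq)
          also have "\<dots> \<le> 1 * norm (z - z0) + norm (deriv g z0) * norm (z - z0)"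
            using d(2)[OF that] by (simp add: norm_mult)
          finally show ?thesis by (simp add: c_def algebra_simps)
        qed
        then show ?thesis using that d(1) by blast
      qed
      \<comment> \<open>Chosen so that \<open>2 * \<eta> / r * c = e\<close>.\<close>
      define \<eta> where "\<eta> = e * r / (2 * c)"
      have \<eta>: "\<eta> > 0" using e r c by (simp add: \<eta>_def)
      have "uniformly_continuous_on (cball z0 r1 \<times> cball w0 r) (\<lambda>p. H (fst p) (snd p))"
        by (rule compact_uniformly_continuous)
           (use continuous_on_subset[OF cont sub] in \<open>auto intro: compact_Times\<close>)
      then obtain d2 where d2: "d2 > 0" "\<And>p p'. \<lbrakk>p \<in> cball z0 r1 \<times> cball w0 r; p' \<in> cball z0 r1 \<times> cball w0 r; dist p' p < d2\<rbrakk>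
          \<Longrightarrow> dist (H (fst p') (snd p')) (H (fst p) (snd p)) < \<eta>"
        unfolding uniformly_continuous_on_def using \<eta> by metis
      \<comment> \<open>In this order the bounds secure the Lipschitz estimate of \<open>g\<close>
        at \<open>z0\<close>, uniform continuity, \<open>z \<in> cball z0 r1\<close>, and
        \<open>g z\<close> within \<open>r / 2\<close> of \<open>w0\<close>.\<close>
      define d where "d = Min {d1, d2, r1, r / (2 * c)}"
      have d: "d > 0" "d \<le> d1" "d \<le> d2" "d \<le> r1" "d \<le> r / (2 * c)"
        using d1(1) d2(1) r1(1) r c by (auto simp: d_def)
      have "norm (E z - E z0 - 0) \<le> e * norm (z - z0)" if z: "norm (z - z0) < d" for z
      proof -
        have zc: "z \<in> cball z0 r1" "z0 \<in> cball z0 r1" using z d(4) r1(1) by (auto simp: dist_norm norm_minus_commute)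
        have gz: "norm (g z - w0) \<le> c * norm (z - z0)" using d1(2) z d(2) by simp
        also have "\<dots> \<le> c * (r / (2 * c))" using z d(5) c by (intro mult_left_mono) auto
        finally have gz2: "norm (g z - w0) \<le> r / 2" using c by simp
        have "norm ((H z (g z) - H z0 (g z)) - (H z w0 - H z0 w0)) \<le> 2 * \<eta> / r * norm (g z - w0)"
        proof (rule holomorphic_increment_bound[where f = "\<lambda>v. H z v - H z0 v", OF _ _ r(1) _ gz2])
          have hol: "(\<lambda>v. H z v - H z0 v) holomorphic_on cball w0 r"
            by (intro holomorphic_on_diff holomorphic_on_subset[OF hw]) (use sub zc in auto)
          show "(\<lambda>v. H z v - H z0 v) holomorphic_on ball w0 r"
            using hol ball_subset_cball by (rule holomorphic_on_subset)
          show "continuous_on (cball w0 r) (\<lambda>v. H z v - H z0 v)"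
            using hol by (rule holomorphic_on_imp_continuous_on)
          fix v assume "v \<in> cball w0 r"
          then show "norm (H z v - H z0 v) \<le> \<eta>"
            using d2(2)[of "(z0, v)" "(z, v)"] zc z d(3) by (auto simp: dist_norm dist_Pair_Pair)
        qed
        also have "\<dots> \<le> 2 * \<eta> / r * (c * norm (z - z0))"
          using gz \<eta> r by (intro mult_left_mono) auto
        also have "\<dots> = e * norm (z - z0)" using r c by (simp add: \<eta>_def)
        finally have "norm (E z) \<le> e * norm (z - z0)" unfolding E_def .
        moreover have "E z0 = 0" by (simp add: E_def w0_def)
        ultimately show ?thesis by simp
      qed
      then show "\<exists>d>0. \<forall>y. norm (y - z0) < d \<longrightarrow> norm (E y - E z0 - 0) \<le> e * norm (y - z0)"
        using d(1) by blast
    qed simp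
    moreover have "(\<lambda>_. 0) = (*) (0::complex)" by (rule ext) simp
    ultimately have "(E has_field_derivative 0) (at z0)"
      by (simp only: has_field_derivative_def)
    then have fE: "E field_differentiable at z0"
      using field_differentiable_def by blast
    have w0W: "(z0, w0) \<in> W" unfolding w0_def using gW[OF z0] .
    have f1: "(\<lambda>z. H z w0) field_differentiable at z0"
      using hz[of w0] w0W opW(1) by (auto intro: holomorphic_on_imp_differentiable_at)
    have "(\<lambda>w. H z0 w) field_differentiable at (g z0)"
      using hw[of z0] w0W opW(2) unfolding w0_def by (auto intro: holomorphic_on_imp_differentiable_at)
    then have f2: "(\<lambda>z. H z0 (g z)) field_differentiable at z0"
      using field_differentiable_compose[of g z0 "H z0"] dg field_differentiable_def by (auto simp: o_def)
    have "(\<lambda>z. H z (g z)) = (\<lambda>z. E z + (H z0 (g z) + (H z w0 - H z0 w0)))"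
      by (auto simp: E_def)
    then show ?thesis
      by (simp only:) (intro field_differentiable_add field_differentiable_diff fE f1 f2 field_differentiable_const)
  qed
  then show ?thesis by (simp add: holomorphic_on_def field_differentiable_at_within)
qed

lemma continuous_on_fun_upd_pair:
  fixes \<gamma> :: "complex \<Rightarrow> nat \<Rightarrow> complex"
  assumes "continuous_on G \<gamma>"
  shows "continuous_on (G \<times> UNIV) (\<lambda>p. (\<gamma> (fst p))(m := snd p))"
proof (rule continuous_on_coordinatewise_then_product)
  fix i
  have "continuous_on (G \<times> UNIV) (\<lambda>p. \<gamma> (fst p))"
    by (rule continuous_on_compose2[OF assms continuous_on_fst]) auto
  then have "continuous_on (G \<times> UNIV) (\<lambda>p. \<gamma> (fst p) i)"
    by (rule continuous_on_product_then_coordinatewise)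
  then show "continuous_on (G \<times> UNIV) (\<lambda>p. ((\<gamma> (fst p))(m := snd p)) i)"
    by (cases "i = m") (auto intro: continuous_intros)
qed

text \<open>Osgood: induction on the number of nonconstant coordinates.\<close>

lemma holomorphic_Cn_compose_curve:
  fixes \<gamma> :: "complex \<Rightarrow> nat \<Rightarrow> complex"
  assumes k: "holomorphic_Cn n W k" and W: "openin (top_of_set (Cn n)) W"
    and G: "open G" and \<gamma>: "\<And>i. i < n \<Longrightarrow> (\<lambda>z. \<gamma> z i) holomorphic_on G" and \<gamma>W: "\<And>z. z \<in> G \<Longrightarrow> \<gamma> z \<in> W"
  shows "(\<lambda>z. k (\<gamma> z)) holomorphic_on G"
proof -
  obtain T where T: "open T" "W = Cn n \<inter> T" using W by (auto simp: openin_open)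
  \<comment> \<open>Coordinates from \<open>m\<close> on are constant. Both \<open>\<gamma>\<close>
    and \<open>G\<close> vary in the induction, because freezing a coordinate changes the curve and
    replaces the domain by a slice.\<close>
  have "(\<lambda>z. k (\<gamma> z)) holomorphic_on G"
    if "m \<le> n" "open G" "\<And>i. i < n \<Longrightarrow> (\<lambda>z. \<gamma> z i) holomorphic_on G" "\<And>z. z \<in> G \<Longrightarrow> \<gamma> z \<in> W"
      "\<And>i. m \<le> i \<Longrightarrow> i < n \<Longrightarrow> \<exists>c. \<forall>z\<in>G. \<gamma> z i = c" for m \<gamma> G
    using that
  proof (induction m arbitrary: \<gamma> G)
    case 0
    have "k (\<gamma> z) = k (\<gamma> z')" if "z \<in> G" "z' \<in> G" for z z'
    proof -
      have "\<gamma> z i = \<gamma> z' i" for i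
      proof (cases "i < n")
        case True then show ?thesis using 0(5)[of i] that by auto
      next
        case False then show ?thesis using 0(4) that unfolding T by (auto simp: Cn_def)
      qed
      then show ?thesis by (metis ext)
    qed
    then have "\<exists>c. \<forall>z\<in>G. k (\<gamma> z) = c" by metis
    then obtain c where "\<And>z. z \<in> G \<Longrightarrow> c = k (\<gamma> z)" by metis
    then show ?case by (rule holomorphic_transform[OF holomorphic_on_const])
  next
    case (Suc m)
    have m: "m < n" using Suc.prems(1) by simp
    have Cn_upd: "(\<gamma> z)(m := w) \<in> Cn n" if "z \<in> G" for z w
      using Suc.prems(4)[OF that] m unfolding T by (auto simp: Cn_def)
    have c\<gamma>: "continuous_on G \<gamma>"
    proof (rule continuous_on_coordinatewise_then_product)
      fix i
      show "continuous_on G (\<lambda>z. \<gamma> z i)"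
      proof (cases "i < n")
        case True
        then show ?thesis using Suc.prems(3) holomorphic_on_imp_continuous_on by blast
      next
        case False
        have "continuous_on G (\<lambda>z. 0::complex)" by simp
        then show ?thesis
          by (rule continuous_on_eq) (use False Suc.prems(4) in \<open>auto simp: T Cn_def\<close>)
      qed
    qed
    let ?u = "\<lambda>p. (\<gamma> (fst p))(m := snd p)"
    \<comment> \<open>The pairs for which entry \<open>m\<close> of the curve may be replaced by
      \<open>w\<close> without leaving \<open>W\<close>. The new point always lies in
      \<open>Cn n\<close> since \<open>m < n\<close>, so openness of \<open>T\<close> makes this set
      open.\<close>
    define \<Omega> where "\<Omega> = {p \<in> G \<times> UNIV. ?u p \<in> W}"
    have \<Omega>T: "\<Omega> = (G \<times> UNIV) \<inter> ?u -` T" using Cn_upd by (auto simp: \<Omega>_def T)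
    have cu: "continuous_on (G \<times> UNIV) ?u" using continuous_on_fun_upd_pair[OF c\<gamma>] .
    have o\<Omega>: "open \<Omega>"
      unfolding \<Omega>T by (rule continuous_open_preimage[OF cu _ T(1)]) (use Suc.prems(2) in \<open>simp add: open_Times\<close>)
    \<comment> \<open>Entry \<open>m\<close> is treated as an independent variable \<open>w\<close>:
      with \<open>w\<close> frozen the induction hypothesis gives holomorphy in \<open>z\<close>,
      with \<open>z\<close> frozen it is separate holomorphy of \<open>k\<close>. The curve itself
      is the diagonal \<open>w = \<gamma> z m\<close>.\<close>
    have "(\<lambda>z. k ((\<gamma> z)(m := \<gamma> z m))) holomorphic_on G"
    proof (rule holomorphic_on_diagonal[where H = "\<lambda>z w. k ((\<gamma> z)(m := w))", OF o\<Omega>])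
      have "continuous_on \<Omega> (\<lambda>p. k (?u p))"
        by (rule continuous_on_compose2[of W k])
           (use k continuous_on_subset[OF cu] in \<open>auto simp: holomorphic_Cn_def \<Omega>_def\<close>)
      then show "continuous_on \<Omega> (\<lambda>p. k ((\<gamma> (fst p))(m := snd p)))" .
      fix w
      have "open {z. (z, w) \<in> \<Omega>}"
        using open_vimage[OF o\<Omega>, of "\<lambda>z. (z, w)"] by (simp add: vimage_def continuous_on_Pair)
      then show "(\<lambda>z. k ((\<gamma> z)(m := w))) holomorphic_on {z. (z, w) \<in> \<Omega>}"
      proof (rule Suc.IH[where \<gamma> = "\<lambda>z. (\<gamma> z)(m := w)", OF less_imp_le[OF m]])
        fix i assume i: "i < n"
        show "(\<lambda>z. ((\<gamma> z)(m := w)) i) holomorphic_on {z. (z, w) \<in> \<Omega>}"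
          by (cases "i = m") (use holomorphic_on_subset[OF Suc.prems(3)[OF i]] in \<open>auto simp: \<Omega>_def\<close>)
      next
        fix i assume i: "i < n" and mi: "m \<le> i"
        show "\<exists>c. \<forall>z\<in>{z. (z, w) \<in> \<Omega>}. ((\<gamma> z)(m := w)) i = c"
          using mi Suc.prems(5)[of i] i by (cases "i = m") (auto simp: \<Omega>_def)
      next
        fix z assume "z \<in> {z. (z, w) \<in> \<Omega>}"
        then have "(z, w) \<in> \<Omega>" by simp
        then show "(\<gamma> z)(m := w) \<in> W" unfolding \<Omega>_def by (simp only: mem_Collect_eq fst_conv snd_conv)
      qed
    next
      fix z
      show "(\<lambda>w. k ((\<gamma> z)(m := w))) holomorphic_on {w. (z, w) \<in> \<Omega>}"
      \<comment> \<open>\<open>holomorphic_Cn\<close> speaks of coordinate lines through points of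
        \<open>W\<close>, so the slice must supply one; an empty slice is trivial.\<close>
      proof (cases "\<exists>w1. (z, w1) \<in> \<Omega>")
        case True
        then obtain w1 where w1: "z \<in> G" "(\<gamma> z)(m := w1) \<in> W" by (auto simp: \<Omega>_def)
        have "(\<lambda>w. k (((\<gamma> z)(m := w1))(m := w))) holomorphic_on {w. ((\<gamma> z)(m := w1))(m := w) \<in> W}"
          using k w1(2) m unfolding holomorphic_Cn_def by blast
        then show ?thesis using w1(1) by (simp add: \<Omega>_def)
      next
        case False
        then have "{w. (z, w) \<in> \<Omega>} = {}" by blast
        then show ?thesis by (simp add: holomorphic_on_def)
      qed
    next
      show "(\<lambda>z. \<gamma> z m) holomorphic_on G" using Suc.prems(3)[OF m] .
    qed (use Suc.prems in \<open>auto simp: \<Omega>_def\<close>)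
    then show ?case by simp
  qed
  from this[of n G \<gamma>] show ?thesis using G \<gamma> \<gamma>W by auto
qed

section \<open>Ultrafilters and equicontinuity\<close>

text \<open>Zorn's lemma yields a minimal proper filter below \<open>F\<close>. It decides every
  \<open>P\<close>: its meet with \<open>principal {x. P x}\<close> is either \<open>bot\<close> or,
  by minimality, the filter itself.\<close>

lemma ultrafilter_exists:
  fixes F :: "'a filter"
  assumes F: "F \<noteq> bot"
  obtains G where "G \<le> F" "G \<noteq> bot" "\<And>P. eventually P G \<or> eventually (\<lambda>x. \<not> P x) G"
proof -
  let ?A = "{G. G \<le> F \<and> G \<noteq> bot}"
  have "\<exists>m\<in>?A. \<forall>a\<in>?A. m \<ge> a \<longrightarrow> a = m"
  proof (rule predicate_Zorn[of ?A "\<lambda>x y. x \<ge> y"])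
    show "partial_order_on ?A (relation_of (\<lambda>x y. x \<ge> y) ?A)"
      by (rule partial_order_on_relation_ofI) auto
    fix C assume C: "C \<in> Chains (relation_of (\<lambda>x y. x \<ge> y) ?A)"
    show "\<exists>u\<in>?A. \<forall>a\<in>C. a \<ge> u"
    proof (cases "C = {}")
      case True
      then show ?thesis using F by (intro bexI[of _ F]) auto
    next
      case False
      have CA: "\<And>G. G \<in> C \<Longrightarrow> G \<in> ?A"
        using C unfolding Chains_def relation_of_def by blast
      have chain: "\<And>G H. G \<in> C \<Longrightarrow> H \<in> C \<Longrightarrow> G \<ge> H \<or> H \<ge> G"
        using C unfolding Chains_def relation_of_def by blast
      \<comment> \<open>In a chain every eventual property of the infimum is already eventual for
        one member, so the infimum is proper.\<close>
      have "eventually P (Inf C) \<longleftrightarrow> (\<exists>G\<in>C. eventually P G)" for P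
        using chain by (intro eventually_Inf_base[OF False]) (metis inf.absorb1 inf.absorb2 order_refl)
      then have "Inf C \<noteq> bot"
        using CA by (auto simp: trivial_limit_def)
      moreover have "Inf C \<le> F"
      proof -
        obtain G0 where "G0 \<in> C" using False by blast
        then have "Inf C \<le> G0" "G0 \<le> F" using CA[of G0] by (auto intro: Inf_lower)
        then show ?thesis by (rule order_trans)
      qed
      ultimately show ?thesis by (intro bexI[of _ "Inf C"]) (auto intro: Inf_lower)
    qed
  qed
  then obtain G where G: "G \<le> F" "G \<noteq> bot" and max: "\<And>H. H \<le> F \<Longrightarrow> H \<noteq> bot \<Longrightarrow> H \<le> G \<Longrightarrow> H = G"
    by blast
  have "eventually P G \<or> eventually (\<lambda>x. \<not> P x) G" for P
  proof (cases "inf G (principal {x. P x}) = bot")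
    case True
    then have "eventually (\<lambda>x. \<not> P x) G"
      by (simp add: trivial_limit_def eventually_inf_principal)
    then show ?thesis ..
  next
    case False
    then have "inf G (principal {x. P x}) = G"
      by (intro max) (auto intro: le_infI1 G(1))
    then have "G \<le> principal {x. P x}" by (metis inf.cobounded2)
    then show ?thesis by (simp add: le_principal)
  qed
  with G that show thesis by blast
qed

text \<open>A neighbourhood that does not eventually contain the values is eventually avoided by
  them. Without a limit, finitely many avoided neighbourhoods would cover the space.\<close>

lemma compact_space_ultralimit:
  assumes X: "compact_space X" and G: "G \<noteq> bot" and ultra: "\<And>P. eventually P G \<or> eventually (\<lambda>x. \<not> P x) G"
    and ev: "eventually (\<lambda>n. f n \<in> topspace X) G"
  obtains l where "l \<in> topspace X" "limitin X f l G"
proof -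
  have "\<exists>l\<in>topspace X. limitin X f l G"
  proof (rule ccontr)
    assume "\<not> (\<exists>l\<in>topspace X. limitin X f l G)"
    then have no: "\<not> limitin X f l G" if "l \<in> topspace X" for l using that by blast
    let ?\<U> = "{U. openin X U \<and> eventually (\<lambda>n. f n \<notin> U) G}"
    have "l \<in> \<Union>?\<U>" if l: "l \<in> topspace X" for l
    proof -
      obtain U where "openin X U" "l \<in> U" "\<not> eventually (\<lambda>n. f n \<in> U) G"
        using no[OF l] l unfolding limitin_def by blast
      then show ?thesis using ultra[of "\<lambda>n. f n \<in> U"] by blast
    qed
    then obtain \<F> where \<F>: "finite \<F>" "\<F> \<subseteq> ?\<U>" "topspace X \<subseteq> \<Union>\<F>"
      using X unfolding compact_space_alt by (metis (no_types, lifting) mem_Collect_eq subsetI)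
    have "eventually (\<lambda>n. \<forall>U\<in>\<F>. f n \<notin> U) G"
      using \<F> by (intro eventually_ball_finite) auto
    with ev have "eventually (\<lambda>n. False) G"
      by eventually_elim (use \<F>(3) in blast)
    then show False using G by simp
  qed
  then show thesis using that by blast
qed

text \<open>The limit inherits the Lipschitz bound; on a finite net pointwise convergence is
  uniform, and the Lipschitz bounds fill the gaps.\<close>

lemma uniform_limit_equi_lipschitz:
  fixes h :: "'n \<Rightarrow> 'a::metric_space \<Rightarrow> 'b::metric_space"
  assumes S: "compact S" and G: "G \<noteq> bot"
    and lip: "eventually (\<lambda>m. \<forall>x\<in>S. \<forall>y\<in>S. dist (h m x) (h m y) \<le> L * dist x y) G"
    and lim: "\<And>x. x \<in> S \<Longrightarrow> ((\<lambda>m. h m x) \<longlongrightarrow> l x) G"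
  shows "uniform_limit S h l G"
proof (rule uniform_limitI)
  fix e :: real assume e: "e > 0"
  have L: "dist (l x) (l y) \<le> L * dist x y" if "x \<in> S" "y \<in> S" for x y
  proof (rule tendsto_upperbound[OF tendsto_dist[OF lim lim] _ G])
    show "eventually (\<lambda>m. dist (h m x) (h m y) \<le> L * dist x y) G"
      using lip by eventually_elim (use that in blast)
  qed (use that in auto)
  \<comment> \<open>\<open>\<bar>L\<bar> + 1\<close> is positive whatever the sign of
    \<open>L\<close>, so \<open>L * t \<le> e / 4\<close> for
    \<open>0 \<le> t \<le> d\<close>.\<close>
  define d where "d = e / (4 * (\<bar>L\<bar> + 1))"
  have d: "d > 0" using e by (simp add: d_def add_nonneg_pos)
  have Ld: "L * t \<le> e / 4" if "0 \<le> t" "t \<le> d" for t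
  proof -
    have "L * t \<le> (\<bar>L\<bar> + 1) * d" using that by (intro mult_mono) auto
    also have "\<dots> = e / 4" unfolding d_def by (simp add: field_simps add_nonneg_eq_0_iff)
    finally show ?thesis .
  qed
  obtain K where K: "finite K" "K \<subseteq> S" "S \<subseteq> (\<Union>x\<in>K. ball x d)"
    using compactE_image[OF S, of S "\<lambda>x. ball x d"] d by (metis UN_I centre_in_ball open_ball subsetI)
  have "eventually (\<lambda>m. \<forall>x\<in>K. dist (h m x) (l x) < e / 4) G"
    using K(1,2) lim e by (intro eventually_ball_finite ballI tendstoD) auto
  with lip show "eventually (\<lambda>m. \<forall>x\<in>S. dist (h m x) (l x) < e) G"
  proof eventually_elim
    case (elim m)
    show ?case
    proof
      fix x assume x: "x \<in> S"
      then obtain y where y: "y \<in> K" "dist y x < d" using K(3) by auto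
      have yS: "y \<in> S" using y K(2) by blast
      have xy: "L * dist x y \<le> e / 4" using Ld[of "dist x y"] y(2) by (simp add: dist_commute)
      have "dist (h m x) (h m y) \<le> e / 4" using elim(1) x yS xy by (blast intro: order_trans)
      moreover have "dist (l x) (l y) \<le> e / 4" using L[OF x yS] xy by (rule order_trans)
      moreover have "dist (h m y) (l y) < e / 4" using elim(2) y(1) by blast
      moreover have "dist (h m x) (l x) \<le> dist (h m x) (h m y) + dist (h m y) (l y) + dist (l y) (l x)"
        using dist_triangle[of "h m x" "l x" "h m y"] dist_triangle[of "h m y" "l x" "l y"] by linarith
      ultimately show "dist (h m x) (l x) < e" using e by (simp add: dist_commute)
    qed
  qed
qed

text \<open>All points of \<open>Cn n\<close> agree from index \<open>n\<close> on, so a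
  neighbourhood in the product topology amounts to finitely many conditions, which share one
  radius.\<close>

lemma Cn_neighbourhood:
  assumes T: "open T" "p \<in> T" and p: "p \<in> Cn n"
  obtains e where "e > 0" "\<And>z. z \<in> Cn n \<Longrightarrow> (\<And>k. k < n \<Longrightarrow> cmod (z k - p k) < e) \<Longrightarrow> z \<in> T"
proof -
  have "openin (product_topology (\<lambda>i::nat. euclidean) UNIV) T"
    using T(1) by (simp add: euclidean_product_topology)
  then obtain B where B: "p \<in> (\<Pi>\<^sub>E i\<in>UNIV. B i)" "\<And>i. open (B i)" "(\<Pi>\<^sub>E i\<in>UNIV. B i) \<subseteq> T"
    using product_topology_open_contains_basis[of "\<lambda>_. euclidean" UNIV T p] T(2) by auto
  have "\<exists>e>0. ball (p k) e \<subseteq> B k" for k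
    using B(1,2) open_contains_ball by (metis PiE_mem UNIV_I)
  then obtain e where e: "\<And>k. e k > 0" "\<And>k. ball (p k) (e k) \<subseteq> B k" by metis
  \<comment> \<open>The 1 keeps the minimum meaningful for \<open>n = 0\<close>.\<close>
  define d where "d = Min (insert 1 (e ` {..<n}))"
  have d: "d > 0" "\<And>k. k < n \<Longrightarrow> d \<le> e k" using e(1) by (auto simp: d_def)
  show thesis
  proof (rule that[OF d(1)])
    fix z assume z: "z \<in> Cn n" "\<And>k. k < n \<Longrightarrow> cmod (z k - p k) < d"
    have "z k \<in> B k" for k
    proof (cases "k < n")
      case True
      then have "z k \<in> ball (p k) (e k)" using z(2)[OF True] d(2)[OF True] by (simp add: dist_norm norm_minus_commute)
      then show ?thesis using e(2) by blast
    next
      case False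
      then have "z k = p k" using z(1) p by (simp add: Cn_def)
      then show ?thesis using B(1) by auto
    qed
    then show "z \<in> T" using B(3) by auto
  qed
qed

section \<open>A length function on a compact complex space\<close>

text \<open>The cutoff functions \<open>\<kappa> i\<close> vanish on the open sets \<open>Q i\<close>, which together with the chart
  domains cover the space. Hence sums over the charts involving \<open>\<kappa> i\<close> are unaffected by the junk
  values of \<open>\<phi> i\<close> off \<open>U i\<close>.\<close>

locale brody_atlas =
  fixes X :: "'p cspace" and I :: "'i set" and U :: "'i \<Rightarrow> 'p set" and n :: "'i \<Rightarrow> nat"
    and A :: "'i \<Rightarrow> (nat \<Rightarrow> complex) set" and \<phi> :: "'i \<Rightarrow> 'p \<Rightarrow> nat \<Rightarrow> complex"
    and \<psi> :: "'i \<Rightarrow> (nat \<Rightarrow> complex) \<Rightarrow> 'p" and \<kappa> :: "'i \<Rightarrow> 'p \<Rightarrow> real"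
    and V :: "'i \<Rightarrow> 'p set" and Q :: "'i \<Rightarrow> 'p set"
  assumes X: "complex_space X" and compact: "compact_space (ctop X)"
    and fin: "finite I"
    and ch: "i \<in> I \<Longrightarrow> chart X (U i) (n i) (A i) (\<phi> i) (\<psi> i)"
    and \<kappa>: "i \<in> I \<Longrightarrow> continuous_map (ctop X) euclideanreal (\<kappa> i)" "\<And>y. 0 \<le> \<kappa> i y" "\<And>y. \<kappa> i y \<le> 1"
    and V: "i \<in> I \<Longrightarrow> openin (ctop X) (V i)" "i \<in> I \<Longrightarrow> V i \<subseteq> U i" "i \<in> I \<Longrightarrow> y \<in> V i \<Longrightarrow> \<kappa> i y = 1"
    and Q: "i \<in> I \<Longrightarrow> openin (ctop X) (Q i)" "i \<in> I \<Longrightarrow> cpoints X \<subseteq> U i \<union> Q i" "i \<in> I \<Longrightarrow> y \<in> Q i \<Longrightarrow> \<kappa> i y = 0"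
    and cover: "cpoints X \<subseteq> (\<Union>i\<in>I. V i)"

text \<open>A compact Hausdorff space is normal, so each chart domain carries a Urysohn function
  \<open>f x\<close> that is 1 at \<open>x\<close> and 0 off the domain. Compactness leaves finitely
  many of the sets where it exceeds 1/2; the charts are indexed by their points.\<close>

lemma brody_atlas_exists:
  fixes X :: "'p cspace"
  assumes X: "complex_space X" and compact: "compact_space (ctop X)"
  obtains I and U :: "'p \<Rightarrow> 'p set" and n A \<phi> \<psi> \<kappa> V Q where "brody_atlas X I U n A \<phi> \<psi> \<kappa> V Q"
proof -
  have H: "Hausdorff_space (ctop X)" using complex_spaceD(1)[OF X] .
  have N: "normal_space (ctop X)"
    using compact H by (rule compact_Hausdorff_or_regular_imp_normal_space[OF _ disjI1])
  have "\<exists>U n A \<phi> \<psi> f. x \<in> U \<and> chart X U n A \<phi> \<psi> \<and> continuous_map (ctop X) euclideanreal f \<and>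
      f x = 1 \<and> (\<forall>y \<in> cpoints X - U. f y = 0)" if x: "x \<in> cpoints X" for x
  proof -
    obtain U n A \<phi> \<psi> where U: "x \<in> U" "chart X U n A \<phi> \<psi>"
      using complex_spaceD(3)[OF X x] by blast
    have "closedin (ctop X) {x}" using closedin_Hausdorff_singleton[OF H x] .
    moreover have "closedin (ctop X) (cpoints X - U)" using chartD(1)[OF U(2)] by blast
    moreover have "disjnt {x} (cpoints X - U)" using U(1) by simp
    ultimately obtain f where "continuous_map (ctop X) euclideanreal f" "f ` {x} \<subseteq> {1}" "f ` (cpoints X - U) \<subseteq> {0}"
      using Urysohn_lemma_alt[OF N] by metis
    then have "continuous_map (ctop X) euclideanreal f \<and> f x = 1 \<and> (\<forall>y \<in> cpoints X - U. f y = 0)" by auto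
    with U show ?thesis by blast
  qed
  then have "\<forall>x\<in>cpoints X. \<exists>U n A \<phi> \<psi> f. x \<in> U \<and> chart X U n A \<phi> \<psi> \<and>
      continuous_map (ctop X) euclideanreal f \<and> f x = 1 \<and> (\<forall>y \<in> cpoints X - U. f y = 0)" by blast
  then obtain U n A \<phi> \<psi> f where "\<forall>x\<in>cpoints X. x \<in> U x \<and> chart X (U x) (n x) (A x) (\<phi> x) (\<psi> x) \<and>
      continuous_map (ctop X) euclideanreal (f x) \<and> f x x = 1 \<and> (\<forall>y \<in> cpoints X - U x. f x y = 0)"
    unfolding bchoice_iff by (elim exE)
  then have *: "\<And>x. x \<in> cpoints X \<Longrightarrow> x \<in> U x"
      "\<And>x. x \<in> cpoints X \<Longrightarrow> chart X (U x) (n x) (A x) (\<phi> x) (\<psi> x)"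
      "\<And>x. x \<in> cpoints X \<Longrightarrow> continuous_map (ctop X) euclideanreal (f x)"
      "\<And>x. x \<in> cpoints X \<Longrightarrow> f x x = (1::real)" "\<And>x y. x \<in> cpoints X \<Longrightarrow> y \<in> cpoints X - U x \<Longrightarrow> f x y = 0"
    by simp_all
  \<comment> \<open>Two levels of \<open>f x\<close> leave room between the open sets:
    \<open>4 * f x y - 1\<close>, clipped to the unit interval, is 1 where \<open>f x\<close>
    exceeds 1/2 and 0 where it is below 1/4. Off the chart domain \<open>f x\<close> is 0, so
    \<open>Q x\<close> covers the rest.\<close>
  define V where "V x = {y \<in> cpoints X. f x y \<in> {1/2<..}}" for x
  define Q where "Q x = {y \<in> cpoints X. f x y \<in> {..<1/4}}" for x
  define \<kappa> where "\<kappa> x y = min 1 (max 0 (4 * f x y - 1))" for x y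
  have oV: "openin (ctop X) (V x)" and oQ: "openin (ctop X) (Q x)" if "x \<in> cpoints X" for x
    unfolding V_def Q_def by (rule openin_continuous_map_preimage[OF *(3)[OF that]], simp)+
  have "\<exists>F. finite F \<and> F \<subseteq> V ` cpoints X \<and> cpoints X \<subseteq> \<Union>F"
  proof -
    have "cpoints X \<subseteq> \<Union>(V ` cpoints X)" using *(4) by (auto simp: V_def)
    then show ?thesis using compact oV by (simp add: compact_space_alt)
  qed
  then obtain F where F: "finite F" "F \<subseteq> V ` cpoints X" "cpoints X \<subseteq> \<Union>F" by blast
  obtain I where I: "I \<subseteq> cpoints X" "finite I" "F = V ` I"
    using finite_subset_image[OF F(1,2)] by blast
  have "brody_atlas X I U n A \<phi> \<psi> \<kappa> V Q"
  proof
    fix i assume i: "i \<in> I"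
    then have ix: "i \<in> cpoints X" using I by blast
    show "chart X (U i) (n i) (A i) (\<phi> i) (\<psi> i)" using *(2)[OF ix] .
    show "continuous_map (ctop X) euclideanreal (\<kappa> i)"
      unfolding \<kappa>_def
      by (intro continuous_map_real_min continuous_map_real_max continuous_map_diff continuous_map_real_mult
          continuous_map_canonical_const *(3)[OF ix])
    show "openin (ctop X) (V i)" "openin (ctop X) (Q i)" using oV oQ ix by blast+
    show "V i \<subseteq> U i"
    proof
      fix y assume "y \<in> V i"
      then show "y \<in> U i" using *(5)[OF ix, of y] by (force simp: V_def)
    qed
    show "cpoints X \<subseteq> U i \<union> Q i"
    proof
      fix y assume "y \<in> cpoints X"
      then show "y \<in> U i \<union> Q i" using *(5)[OF ix, of y] by (cases "y \<in> U i") (auto simp: Q_def)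
    qed
    show "y \<in> V i \<Longrightarrow> \<kappa> i y = 1" for y by (simp add: V_def \<kappa>_def)
    show "y \<in> Q i \<Longrightarrow> \<kappa> i y = 0" for y by (simp add: Q_def \<kappa>_def)
  next
    show "cpoints X \<subseteq> (\<Union>i\<in>I. V i)" using F(3) I(3) by simp
  qed (use X compact I in \<open>auto simp: \<kappa>_def\<close>)
  then show thesis using that by blast
qed

section \<open>Chart coordinates along curves, and Lipschitz bounds on segments\<close>

lemma chart_coordinate_section:
  assumes ch: "chart X U n A \<phi> \<psi>" and k: "k < n"
  shows "(\<lambda>y\<in>U. \<phi> y k) \<in> hol_sections X U"
proof -
  note c = chartD[OF ch]
  have hol: "holomorphic_Cn n (Cn n) (\<lambda>z. z k)"
    unfolding holomorphic_Cn_def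
  proof (intro conjI ballI allI impI)
    show "continuous_on (Cn n) (\<lambda>z. z k)"
      by (rule continuous_on_subset[OF continuous_on_product_coordinates]) simp
    fix z i
    show "(\<lambda>w. (z(i := w)) k) holomorphic_on {w. z(i := w) \<in> Cn n}"
      by (cases "i = k") auto
  qed
  have "model_holomorphic n (\<phi> ` U) ((\<lambda>y\<in>U. \<phi> y k) \<circ> \<psi>)"
    unfolding model_holomorphic_def
  proof (intro ballI exI conjI)
    fix z y assume "z \<in> \<phi> ` U"
    then show "z \<in> Cn n" using c(3,9) by blast
    assume "y \<in> Cn n \<inter> \<phi> ` U"
    then show "((\<lambda>y\<in>U. \<phi> y k) \<circ> \<psi>) y = y k" using c(3,5) by auto
  qed (use hol in auto)
  then show ?thesis using c(10)[OF c(1)] by simp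
qed

lemma chart_coordinate_holomorphic:
  assumes ch: "chart X U n A \<phi> \<psi>" and k: "k < n" and W: "open W" and f: "f \<in> hol_maps (planar_space W) X"
  shows "open {z \<in> W. f z \<in> U}" "(\<lambda>z. \<phi> (f z) k) holomorphic_on {z \<in> W. f z \<in> U}"
proof -
  note c = chartD[OF ch]
  have "openin (top_of_set W) {z \<in> W. f z \<in> U}"
    using hol_mapsD(5)[OF f c(1)] by simp
  then show "open {z \<in> W. f z \<in> U}" using W by (simp add: openin_planar_space)
  have "(\<lambda>z\<in>{z \<in> W. f z \<in> U}. (\<lambda>y\<in>U. \<phi> y k) (f z)) holomorphic_on {z \<in> W. f z \<in> U}"
    using hol_mapsD(3)[OF f c(1) chart_coordinate_section[OF ch k]] by simp
  then show "(\<lambda>z. \<phi> (f z) k) holomorphic_on {z \<in> W. f z \<in> U}"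
    by (rule holomorphic_transform) simp
qed

lemma continuous_map_chart_coordinate:
  assumes "chart X U n A \<phi> \<psi>"
  shows "continuous_map (subtopology (ctop X) U) euclidean (\<lambda>y. \<phi> y k)"
proof -
  have "continuous_map (subtopology (ctop X) U) euclidean \<phi>"
    using chartD(7)[OF assms] continuous_map_into_fulltopology by blast
  moreover have "continuous_map euclidean euclidean (\<lambda>z::nat \<Rightarrow> complex. z k)"
    using continuous_on_product_coordinates[of k] by simp
  ultimately have "continuous_map (subtopology (ctop X) U) euclidean ((\<lambda>z. z k) \<circ> \<phi>)"
    by (rule continuous_map_compose)
  then show ?thesis by (simp add: o_def)
qed

text \<open>The estimate \<open>P\<close> is additive over adjacent intervals and holds on short
  intervals around each point, so the compactness principle \<open>Bolzano\<close> applies.\<close>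

lemma local_lipschitz_segment:
  fixes v :: "real \<Rightarrow> real"
  assumes "a \<le> b"
    and loc: "\<And>x. a \<le> x \<Longrightarrow> x \<le> b \<Longrightarrow> \<exists>d>0. \<forall>s t. \<bar>s - x\<bar> < d \<and> \<bar>t - x\<bar> < d \<and> s \<in> {a..b} \<and> t \<in> {a..b} \<longrightarrow> \<bar>v s - v t\<bar> \<le> L * \<bar>s - t\<bar>"
  shows "\<bar>v b - v a\<bar> \<le> L * (b - a)"
proof -
  define P where "P s t \<longleftrightarrow> (a \<le> s \<and> t \<le> b \<and> s \<le> t \<longrightarrow> \<bar>v t - v s\<bar> \<le> L * (t - s))" for s t
  have "P a b"
  proof (rule Bolzano[OF \<open>a \<le> b\<close>])
    fix r s t assume *: "P r s" "P s t" "r \<le> s" "s \<le> t"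
    show "P r t"
      unfolding P_def
    proof
      assume "a \<le> r \<and> t \<le> b \<and> r \<le> t"
      then have "\<bar>v s - v r\<bar> \<le> L * (s - r)" "\<bar>v t - v s\<bar> \<le> L * (t - s)"
        using * by (auto simp: P_def)
      then show "\<bar>v t - v r\<bar> \<le> L * (t - r)" by (simp add: algebra_simps)
    qed
  next
    fix x assume x: "a \<le> x" "x \<le> b"
    obtain d where d: "d > 0" "\<forall>s t. \<bar>s - x\<bar> < d \<and> \<bar>t - x\<bar> < d \<and> s \<in> {a..b} \<and> t \<in> {a..b} \<longrightarrow> \<bar>v s - v t\<bar> \<le> L * \<bar>s - t\<bar>"
      using loc[OF x] by blast
    have "P s t" if st: "s \<le> x \<and> x \<le> t \<and> t - s < d" for s t
      unfolding P_def
    proof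
      assume "a \<le> s \<and> t \<le> b \<and> s \<le> t"
      then show "\<bar>v t - v s\<bar> \<le> L * (t - s)"
        using d(2)[rule_format, of t s] st by auto
    qed
    then show "\<exists>d>0. \<forall>s t. s \<le> x \<and> x \<le> t \<and> t - s < d \<longrightarrow> P s t" using d(1) by blast
  qed
  then show ?thesis using \<open>a \<le> b\<close> by (simp add: P_def)
qed

section \<open>The speed of a curve, and distances measured in charts\<close>

context brody_atlas
begin

text \<open>The substitute for the length of the derivative in a hermitian metric: coordinates are
  differentiated along a curve, which makes sense at singular points too.\<close>

definition speed :: "(complex \<Rightarrow> 'p) \<Rightarrow> complex \<Rightarrow> real" where
  "speed f z = (\<Sum>i\<in>I. \<Sum>k<n i. \<kappa> i (f z) * cmod (deriv (\<lambda>w. \<phi> i (f w) k) z))"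

lemma speed_nonneg: "0 \<le> speed f z"
  unfolding speed_def by (intro sum_nonneg mult_nonneg_nonneg \<kappa>(2)) simp

text \<open>Each summand is continuous on the preimage of \<open>U i\<close>, where the coordinate
  is holomorphic, and zero on the preimage of \<open>Q i\<close>; these open sets cover
  \<open>W\<close>.\<close>

lemma continuous_on_speed:
  assumes W: "open W" and f: "f \<in> hol_maps (planar_space W) X"
  shows "continuous_on W (speed f)"
  unfolding speed_def
proof (intro continuous_on_sum)
  fix i k assume i: "i \<in> I" and k: "k \<in> {..<n i}"
  let ?t = "\<lambda>z. \<kappa> i (f z) * cmod (deriv (\<lambda>w. \<phi> i (f w) k) z)"
  note h = chart_coordinate_holomorphic[OF ch[OF i] _ W f, of k]
  have fX: "f z \<in> cpoints X" if "z \<in> W" for z using hol_mapsD(4)[OF f, of z] that by simp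
  have cf: "continuous_on W (\<lambda>z. \<kappa> i (f z))"
    using continuous_map_compose[OF hol_mapsD(2)[OF f] \<kappa>(1)[OF i]] by (simp add: o_def)
  have "(deriv (\<lambda>w. \<phi> i (f w) k)) holomorphic_on {z \<in> W. f z \<in> U i}"
    using h k by (intro holomorphic_deriv) auto
  then have 1: "continuous_on {z \<in> W. f z \<in> U i} ?t"
    by (intro continuous_intros continuous_on_subset[OF cf] holomorphic_on_imp_continuous_on) auto
  have 2: "continuous_on {z \<in> W. f z \<in> Q i} ?t"
    by (rule continuous_on_eq[OF continuous_on_const[of _ 0]]) (use Q(3)[OF i] in auto)
  have "openin (top_of_set W) {z \<in> W. f z \<in> Q i}"
    using hol_mapsD(5)[OF f Q(1)[OF i]] by simp
  then have o2: "open {z \<in> W. f z \<in> Q i}" using W by (simp add: openin_planar_space)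
  have "W = {z \<in> W. f z \<in> U i} \<union> {z \<in> W. f z \<in> Q i}" using Q(2)[OF i] fX by blast
  then show "continuous_on W ?t"
    using continuous_on_open_Un[OF _ o2 1 2] h(1) k by auto
qed

lemma speed_cong:
  assumes "open W" "z \<in> W" "\<And>w. w \<in> W \<Longrightarrow> f w = g w"
  shows "speed f z = speed g z"
proof -
  have "deriv (\<lambda>w. \<phi> i (f w) k) z = deriv (\<lambda>w. \<phi> i (g w) k) z" for i k
  proof (rule deriv_cong_ev)
    show "\<forall>\<^sub>F x in nhds z. \<phi> i (f x) k = \<phi> i (g x) k"
      using eventually_nhds_in_open[OF assms(1,2)] by eventually_elim (simp add: assms(3))
  qed simp
  then show ?thesis unfolding speed_def using assms(3)[OF assms(2)] by simp
qed

text \<open>The chain rule on \<open>U i\<close>; elsewhere the weight vanishes on both sides. This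
  handles both rescaling and recentring of discs.\<close>

lemma speed_affine:
  assumes W: "open W" and f: "f \<in> hol_maps (planar_space W) X" and z: "a + c * z \<in> W"
  shows "speed (\<lambda>w. f (a + c * w)) z = cmod c * speed f (a + c * z)"
proof -
  have "\<kappa> i (f (a + c * z)) * cmod (deriv (\<lambda>w. \<phi> i (f (a + c * w)) k) z)
      = cmod c * (\<kappa> i (f (a + c * z)) * cmod (deriv (\<lambda>w. \<phi> i (f w) k) (a + c * z)))"
    if i: "i \<in> I" and k: "k < n i" for i k
  proof (cases "f (a + c * z) \<in> U i")
    case True
    note h = chart_coordinate_holomorphic[OF ch[OF i] k W f]
    have 1: "((\<lambda>w. \<phi> i (f w) k) has_field_derivative deriv (\<lambda>w. \<phi> i (f w) k) (a + c * z)) (at (a + c * z))"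
      by (rule holomorphic_derivI[OF h(2,1)]) (use True z in simp)
    have 2: "((\<lambda>w. a + c * w) has_field_derivative c) (at z)"
      by (auto intro!: derivative_eq_intros)
    have "((\<lambda>w. \<phi> i (f (a + c * w)) k) has_field_derivative deriv (\<lambda>w. \<phi> i (f w) k) (a + c * z) * c) (at z)"
      using DERIV_chain2[OF 1 2] .
    then show ?thesis by (simp add: DERIV_imp_deriv norm_mult)
  next
    case False
    then have "f (a + c * z) \<in> Q i"
      using Q(2)[OF i] hol_mapsD(4)[OF f, of "a + c * z"] z by auto
    then show ?thesis using Q(3)[OF i] by simp
  qed
  then show ?thesis unfolding speed_def sum_distrib_left by (intro sum.cong refl) simp
qed

text \<open>The weight is 1 on \<open>V i\<close>, so the derivative is one of the nonnegative
  summands.\<close>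

lemma deriv_le_speed:
  assumes i: "i \<in> I" and k: "k < n i" and z: "f z \<in> V i"
  shows "cmod (deriv (\<lambda>w. \<phi> i (f w) k) z) \<le> speed f z"
proof -
  have "cmod (deriv (\<lambda>w. \<phi> i (f w) k) z) = \<kappa> i (f z) * cmod (deriv (\<lambda>w. \<phi> i (f w) k) z)"
    using V(3)[OF i z] by simp
  also have "\<dots> \<le> (\<Sum>k<n i. \<kappa> i (f z) * cmod (deriv (\<lambda>w. \<phi> i (f w) k) z))"
    using k by (intro member_le_sum mult_nonneg_nonneg \<kappa>(2)) auto
  also have "\<dots> \<le> speed f z"
    unfolding speed_def using i fin by (intro member_le_sum sum_nonneg mult_nonneg_nonneg \<kappa>(2)) auto
  finally show ?thesis .
qed

lemma coordinate_lipschitz: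
  assumes W: "open W" and f: "f \<in> hol_maps (planar_space W) X" and M: "\<And>z. z \<in> W \<Longrightarrow> speed f z \<le> M"
    and S: "convex S" "S \<subseteq> W" and i: "i \<in> I" and k: "k < n i" and fS: "\<And>z. z \<in> S \<Longrightarrow> f z \<in> V i"
    and z: "z \<in> S" "z' \<in> S"
  shows "cmod (\<phi> i (f z) k - \<phi> i (f z') k) \<le> M * cmod (z - z')"
proof (rule field_differentiable_bound[OF S(1)])
  fix w assume w: "w \<in> S"
  note h = chart_coordinate_holomorphic[OF ch[OF i] k W f]
  show "((\<lambda>w. \<phi> i (f w) k) has_field_derivative deriv (\<lambda>w. \<phi> i (f w) k) w) (at w within S)"
    by (rule holomorphic_derivI[OF h(2,1)]) (use w S(2) fS V(2)[OF i] in auto)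
  show "cmod (deriv (\<lambda>w. \<phi> i (f w) k) w) \<le> M"
    using deriv_le_speed[of i k f w, OF i k fS[OF w]] M[of w] w S(2) by force
qed (use z in auto)

text \<open>The l^1 distance from \<open>p\<close> in the coordinates of chart \<open>i\<close>,
  meaningful on \<open>U i\<close>.\<close>

definition offset :: "'i \<Rightarrow> 'p \<Rightarrow> 'p \<Rightarrow> real" where
  "offset i p y = (\<Sum>k<n i. cmod (\<phi> i y k - \<phi> i p k))"

lemma continuous_map_offset:
  assumes "i \<in> I"
  shows "continuous_map (subtopology (ctop X) (U i)) euclideanreal (offset i p)"
  unfolding offset_def
  by (intro continuous_map_sum continuous_map_norm continuous_map_diff
      continuous_map_chart_coordinate[OF ch[OF assms]]) auto

lemma offset_self: "offset i p p = 0"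
  by (simp add: offset_def)

lemma openin_offset_ball:
  assumes "i \<in> I"
  shows "openin (ctop X) {y \<in> U i. offset i p y < e}"
proof -
  note c = chartD[OF ch[OF assms]]
  have "openin (subtopology (ctop X) (U i)) {y \<in> topspace (subtopology (ctop X) (U i)). offset i p y \<in> {..<e}}"
    by (rule openin_continuous_map_preimage[OF continuous_map_offset[OF assms]]) simp
  moreover have "{y \<in> topspace (subtopology (ctop X) (U i)). offset i p y \<in> {..<e}} = {y \<in> U i. offset i p y < e}"
    using c(2) by auto
  ultimately show ?thesis using openin_open_subtopology[OF c(1)] by auto
qed

text \<open>The chart is a homeomorphism onto a subset of \<open>Cn (n i)\<close>, whose topology is
  governed by the first \<open>n i\<close> coordinates, so small offsets form a neighbourhood base
  at \<open>p\<close>.\<close>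

lemma offset_neighbourhood:
  assumes i: "i \<in> I" and p: "p \<in> U i" and T: "openin (ctop X) T" "p \<in> T"
  obtains e where "e > 0" "{y \<in> U i. offset i p y < e} \<subseteq> T"
proof -
  note c = chartD[OF ch[OF i]]
  have "openin (top_of_set (A i)) (\<phi> i ` (U i \<inter> T))"
    by (rule chart_image_openin[OF ch[OF i]]) (use c(1) T(1) in auto)
  then obtain T' where T': "open T'" "\<phi> i ` (U i \<inter> T) = A i \<inter> T'" by (auto simp: openin_open)
  have "\<phi> i p \<in> T'" using T' p T(2) by blast
  moreover have "\<phi> i p \<in> Cn (n i)" using c(3,9) p by blast
  ultimately obtain e where e: "e > 0" "\<And>z. z \<in> Cn (n i) \<Longrightarrow> (\<And>k. k < n i \<Longrightarrow> cmod (z k - \<phi> i p k) < e) \<Longrightarrow> z \<in> T'"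
    using Cn_neighbourhood[OF T'(1)] by blast
  show thesis
  proof (rule that[OF e(1)], clarify)
    fix y assume y: "y \<in> U i" "offset i p y < e"
    have "cmod (\<phi> i y k - \<phi> i p k) < e" if "k < n i" for k
    proof -
      have "cmod (\<phi> i y k - \<phi> i p k) \<le> offset i p y"
        unfolding offset_def using that by (intro member_le_sum) auto
      then show ?thesis using y(2) by simp
    qed
    moreover have "\<phi> i y \<in> Cn (n i)" using c(3,9) y(1) by blast
    ultimately have "\<phi> i y \<in> A i \<inter> T'" using e(2) c(3) y(1) by blast
    then have "\<phi> i y \<in> \<phi> i ` (U i \<inter> T)" using T'(2) by simp
    then obtain y' where "y' \<in> U i \<inter> T" "\<phi> i y = \<phi> i y'" by blast
    then show "y \<in> T" using c(5) y(1) by (metis IntD1 IntD2)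
  qed
qed

text \<open>Continuity of the offset gives closedness in \<open>U i\<close> only. Regularity
  provides a closed set \<open>C\<close> inside \<open>V i \<inter> T\<close> that contains a small
  sublevel set, and closed in \<open>C\<close> is closed in the space. Closedness will keep limits
  inside and leave an open complement.\<close>

lemma closed_offset_neighbourhood:
  assumes i: "i \<in> I" and p: "p \<in> V i" and T: "openin (ctop X) T" "p \<in> T"
  obtains e where "e > 0" "closedin (ctop X) {y \<in> U i. offset i p y \<le> e}" "{y \<in> U i. offset i p y \<le> e} \<subseteq> V i \<inter> T"
proof -
  note c = chartD[OF ch[OF i]]
  have pU: "p \<in> U i" using V(2)[OF i] p by blast
  have reg: "regular_space (ctop X)"
    using compact_Hausdorff_imp_regular_space compact complex_spaceD(1)[OF X] by blast
  have "openin (ctop X) (V i \<inter> T)" using V(1)[OF i] T(1) by blast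
  then obtain S C where S: "openin (ctop X) S" "closedin (ctop X) C" "p \<in> S" "S \<subseteq> C" "C \<subseteq> V i \<inter> T"
    using reg p T(2) unfolding neighbourhood_base_of_closedin[symmetric] neighbourhood_base_of
    by (metis IntI)
  obtain e where e: "e > 0" "{y \<in> U i. offset i p y < e} \<subseteq> S"
    using offset_neighbourhood[OF i pU S(1,3)] by blast
  \<comment> \<open>Half the radius passes from the strict to the weak inequality.\<close>
  have sub: "{y \<in> U i. offset i p y \<le> e / 2} \<subseteq> S" using e by force
  have CU: "C \<subseteq> U i" using S(5) V(2)[OF i] by blast
  have "continuous_map (subtopology (ctop X) C) euclideanreal (offset i p)"
    using continuous_map_from_subtopology_mono[OF continuous_map_offset[OF i] CU] .
  then have "closedin (subtopology (ctop X) C) {y \<in> topspace (subtopology (ctop X) C). offset i p y \<in> {..e / 2}}"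
    by (rule closedin_continuous_map_preimage) simp
  moreover have "{y \<in> topspace (subtopology (ctop X) C). offset i p y \<in> {..e / 2}} = {y \<in> U i. offset i p y \<le> e / 2}"
    using CU sub S(4) c(2) by auto
  ultimately have "closedin (subtopology (ctop X) C) {y \<in> U i. offset i p y \<le> e / 2}" by simp
  then have "closedin (ctop X) {y \<in> U i. offset i p y \<le> e / 2}"
    unfolding closedin_closed_subtopology[OF S(2)] ..
  then show thesis using that[of "e / 2"] e(1) sub S(4,5) by auto
qed

text \<open>Capping extends the offset to the whole space, so that it can be followed along curves
  that leave the chart.\<close>

definition capped_offset :: "real \<Rightarrow> 'i \<Rightarrow> 'p \<Rightarrow> 'p \<Rightarrow> real" where
  "capped_offset e i p y = (if y \<in> U i then min e (offset i p y) else e)"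

text \<open>Where \<open>f z \<in> V i\<close> the coordinates are Lipschitz, at the cost of
  \<open>M\<close> for each of the \<open>n i\<close> coordinates. Near any other point the curve
  avoids the closed sublevel set, where the function is constantly \<open>e\<close>. The local
  bounds add up along the segment, as \<open>W\<close> is convex.\<close>

lemma capped_offset_lipschitz:
  fixes M :: real
  assumes W: "open W" "convex W" and f: "f \<in> hol_maps (planar_space W) X"
    and M: "\<And>z. z \<in> W \<Longrightarrow> speed f z \<le> M" and i: "i \<in> I"
    and N: "closedin (ctop X) {y \<in> U i. offset i p y \<le> e}" "{y \<in> U i. offset i p y \<le> e} \<subseteq> V i"
    and z: "z0 \<in> W" "z1 \<in> W"
  shows "\<bar>capped_offset e i p (f z1) - capped_offset e i p (f z0)\<bar> \<le> real (n i) * M * cmod (z1 - z0)"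
proof -
  let ?u = "capped_offset e i p" and ?N = "{y \<in> U i. offset i p y \<le> e}"
  have fX: "f z \<in> cpoints X" if "z \<in> W" for z using hol_mapsD(4)[OF f, of z] that by simp
  have M0: "M \<ge> 0" using M[OF z(1)] speed_nonneg[of f z0] by linarith
  have loc: "\<exists>d>0. \<forall>s\<in>ball z d. \<forall>t\<in>ball z d. \<bar>?u (f s) - ?u (f t)\<bar> \<le> real (n i) * M * cmod (s - t)" if z: "z \<in> W" for z
  proof (cases "f z \<in> V i")
    case True
    have "openin (top_of_set W) {z \<in> W. f z \<in> V i}" using hol_mapsD(5)[OF f V(1)[OF i]] by simp
    then have "open {z \<in> W. f z \<in> V i}" using W(1) by (simp add: openin_planar_space)
    then obtain d where d: "d > 0" "ball z d \<subseteq> {z \<in> W. f z \<in> V i}"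
      using z True unfolding open_contains_ball by blast
    have "\<bar>?u (f s) - ?u (f t)\<bar> \<le> real (n i) * M * cmod (s - t)" if st: "s \<in> ball z d" "t \<in> ball z d" for s t
    proof -
      have inU: "f s \<in> U i" "f t \<in> U i" using st d(2) V(2)[OF i] by auto
      have "\<bar>offset i p (f s) - offset i p (f t)\<bar>
          = \<bar>\<Sum>k<n i. cmod (\<phi> i (f s) k - \<phi> i p k) - cmod (\<phi> i (f t) k - \<phi> i p k)\<bar>"
        by (simp add: offset_def sum_subtractf)
      also have "\<dots> \<le> (\<Sum>k<n i. M * cmod (s - t))"
      proof (rule order_trans[OF sum_abs], rule sum_mono)
        fix k assume k: "k \<in> {..<n i}"
        have "\<bar>cmod (\<phi> i (f s) k - \<phi> i p k) - cmod (\<phi> i (f t) k - \<phi> i p k)\<bar> \<le> cmod (\<phi> i (f s) k - \<phi> i (f t) k)"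
          using norm_triangle_ineq3[of "\<phi> i (f s) k - \<phi> i p k" "\<phi> i (f t) k - \<phi> i p k"] by simp
        also have "\<dots> \<le> M * cmod (s - t)"
          by (rule coordinate_lipschitz[OF W(1) f M convex_ball _ i _ _ st]) (use k d(2) in auto)
        finally show "\<bar>cmod (\<phi> i (f s) k - \<phi> i p k) - cmod (\<phi> i (f t) k - \<phi> i p k)\<bar> \<le> M * cmod (s - t)" .
      qed
      also have "\<dots> = real (n i) * M * cmod (s - t)" by simp
      finally have "\<bar>offset i p (f s) - offset i p (f t)\<bar> \<le> real (n i) * M * cmod (s - t)" .
      then show ?thesis using inU by (auto simp: capped_offset_def min_def)
    qed
    then show ?thesis using d(1) by blast
  next
    case False
    have "openin (ctop X) (cpoints X - ?N)" using N(1) by blast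
    then have "openin (top_of_set W) {z \<in> W. f z \<in> cpoints X - ?N}"
      using hol_mapsD(5)[OF f, of "cpoints X - ?N"]
      by (simp only: ctop_planar_space topspace_euclidean_subtopology)
    then have "open {z \<in> W. f z \<in> cpoints X - ?N}" using W(1) by (simp add: openin_planar_space)
    moreover have "z \<in> {z \<in> W. f z \<in> cpoints X - ?N}" using z fX[OF z] False N(2) by blast
    ultimately obtain d where d: "d > 0" "ball z d \<subseteq> {z \<in> W. f z \<in> cpoints X - ?N}"
      unfolding open_contains_ball by blast
    have "?u (f s) = e" if "s \<in> ball z d" for s
    proof -
      have "f s \<notin> ?N" using that d(2) by blast
      then show ?thesis by (auto simp: capped_offset_def)
    qed
    then show ?thesis using d(1) M0 by (intro exI[of _ d]) auto
  qed
  define v where "v t = ?u (f (z0 + of_real t * (z1 - z0)))" for t :: real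
  have seg: "z0 + of_real t * (z1 - z0) \<in> W" if "0 \<le> t" "t \<le> 1" for t :: real
    using convexD_alt[OF W(2) z(1) z(2), of t] that by (simp add: scaleR_conv_of_real algebra_simps)
  have "\<bar>v 1 - v 0\<bar> \<le> (real (n i) * M * cmod (z1 - z0)) * (1 - 0)"
  proof (rule local_lipschitz_segment)
    fix x :: real assume x: "0 \<le> x" "x \<le> 1"
    let ?z = "\<lambda>t. z0 + of_real t * (z1 - z0)"
    obtain d where d: "d > 0" "\<And>s t. s\<in>ball (?z x) d \<Longrightarrow> t\<in>ball (?z x) d \<Longrightarrow> \<bar>?u (f s) - ?u (f t)\<bar> \<le> real (n i) * M * cmod (s - t)"
      using loc[OF seg[OF x]] by blast
    \<comment> \<open>Converts the radius \<open>d\<close> in the plane into one for the parameter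
      of the segment; the summand 1 covers \<open>z0 = z1\<close>.\<close>
    define d' where "d' = d / (cmod (z1 - z0) + 1)"
    have d': "d' > 0" using d(1) by (simp add: d'_def add_nonneg_pos)
    have zz: "cmod (?z s - ?z t) = \<bar>s - t\<bar> * cmod (z1 - z0)" for s t :: real
    proof -
      have "?z s - ?z t = of_real (s - t) * (z1 - z0)" by (simp add: algebra_simps)
      then show ?thesis by (simp only: norm_mult norm_of_real)
    qed
    have near: "?z s \<in> ball (?z x) d" if "\<bar>s - x\<bar> < d'" for s :: real
    proof -
      have "\<bar>s - x\<bar> * cmod (z1 - z0) \<le> \<bar>s - x\<bar> * (cmod (z1 - z0) + 1)" by (simp add: algebra_simps)
      also have "\<dots> < d' * (cmod (z1 - z0) + 1)"
        using that by (intro mult_strict_right_mono) (auto simp: add_nonneg_pos)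
      also have "\<dots> = d" by (simp add: d'_def add_nonneg_eq_0_iff)
      finally show ?thesis using zz[of s x] by (simp add: dist_commute dist_norm)
    qed
    have "\<bar>v s - v t\<bar> \<le> real (n i) * M * cmod (z1 - z0) * \<bar>s - t\<bar>" if "\<bar>s - x\<bar> < d'" "\<bar>t - x\<bar> < d'" for s t
      using d(2)[OF near[OF that(1)] near[OF that(2)]] zz[of s t] by (simp add: v_def mult_ac)
    then show "\<exists>d>0. \<forall>s t. \<bar>s - x\<bar> < d \<and> \<bar>t - x\<bar> < d \<and> s \<in> {0..1} \<and> t \<in> {0..1} \<longrightarrow>
        \<bar>v s - v t\<bar> \<le> real (n i) * M * cmod (z1 - z0) * \<bar>s - t\<bar>"
      using d' by blast
  qed simp
  then show ?thesis by (simp add: v_def)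
qed

end

section \<open>Brody's theorem\<close>

lemma open_subspace_planar_space:
  "B \<subseteq> W \<Longrightarrow> open_subspace (planar_space W) B = planar_space B"
  by (simp add: open_subspace_def planar_space_def subtopology_subtopology inf_absorb2)

text \<open>Converse to \<open>chart_coordinate_holomorphic\<close>. Continuity comes from the
  inverse chart \<open>\<psi>\<close>. In the chart a section is locally a holomorphic function
  \<open>k\<close> on an open subset of \<open>Cn n\<close>, so its pullback is \<open>k\<close>
  along the coordinate curve, to which \<open>holomorphic_Cn_compose_curve\<close> applies.\<close>

lemma hol_maps_into_chart:
  assumes ch: "chart X U n A \<phi> \<psi>" and X: "function_sheaf X" and B: "open B" and fU: "f ` B \<subseteq> U"
    and hol: "\<And>k. k < n \<Longrightarrow> (\<lambda>z. \<phi> (f z) k) holomorphic_on B"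
  shows "restrict f B \<in> hol_maps (planar_space B) X"
proof (rule hol_mapsI)
  note c = chartD[OF ch]
  define \<gamma> where "\<gamma> z = \<phi> (f z)" for z
  have \<gamma>A: "\<gamma> z \<in> A" if "z \<in> B" for z using c(3) fU that by (auto simp: \<gamma>_def)
  have \<psi>\<gamma>: "\<psi> (\<gamma> z) = f z" if "z \<in> B" for z using c(5) fU that by (auto simp: \<gamma>_def)
  have c\<gamma>: "continuous_on B \<gamma>"
  proof (rule continuous_on_coordinatewise_then_product)
    fix k
    show "continuous_on B (\<lambda>z. \<gamma> z k)"
    proof (cases "k < n")
      case True
      then show ?thesis using hol holomorphic_on_imp_continuous_on unfolding \<gamma>_def by blast
    next
      case False
      have "continuous_on B (\<lambda>z. 0::complex)" by simp
      moreover have "0 = \<gamma> z k" if "z \<in> B" for z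
        using \<gamma>A[OF that] c(9) False by (auto simp: Cn_def)
      ultimately show ?thesis by (rule continuous_on_eq)
    qed
  qed
  have "continuous_map (top_of_set B) (top_of_set A) \<gamma>"
    using c\<gamma> \<gamma>A by (simp add: image_subset_iff)
  then have "continuous_map (top_of_set B) (subtopology (ctop X) U) (\<psi> \<circ> \<gamma>)"
    using c(8) by (rule continuous_map_compose)
  then have "continuous_map (top_of_set B) (ctop X) (\<psi> \<circ> \<gamma>)"
    using continuous_map_into_fulltopology by blast
  then have cm: "continuous_map (top_of_set B) (ctop X) (restrict f B)"
    by (rule continuous_map_eq) (simp add: \<psi>\<gamma>)
  then show "continuous_map (ctop (planar_space B)) (ctop X) (restrict f B)" by simp
  fix V g assume V: "openin (ctop X) V" and g: "g \<in> hol_sections X V"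
  let ?S = "{z \<in> B. f z \<in> V}"
  have eq: "{z \<in> cpoints (planar_space B). restrict f B z \<in> V} = ?S" by auto
  have "openin (top_of_set B) {z \<in> topspace (top_of_set B). restrict f B z \<in> V}"
    using cm V unfolding continuous_map_def by blast
  moreover have "{z \<in> topspace (top_of_set B). restrict f B z \<in> V} = ?S" by auto
  ultimately have oS: "open ?S" using B by (simp add: openin_planar_space)
  have UV: "openin (ctop X) (U \<inter> V)" using c(1) V by blast
  have "restrict g (U \<inter> V) \<in> hol_sections X (U \<inter> V)"
    by (rule function_sheafD_restrict[OF X V UV _ g]) simp
  then have mh: "model_holomorphic n (\<phi> ` (U \<inter> V)) (restrict g (U \<inter> V) \<circ> \<psi>)"
    using c(10)[OF UV] by simp
  have "(\<lambda>z. g (f z)) field_differentiable at z1" if z1: "z1 \<in> ?S" for z1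
  proof -
    have in1: "\<gamma> z \<in> \<phi> ` (U \<inter> V)" if "z \<in> ?S" for z using that fU by (auto simp: \<gamma>_def)
    obtain W k where k: "openin (top_of_set (Cn n)) W" "\<gamma> z1 \<in> W" "holomorphic_Cn n W k"
        "\<forall>y \<in> W \<inter> \<phi> ` (U \<inter> V). (restrict g (U \<inter> V) \<circ> \<psi>) y = k y"
      using bspec[OF mh[unfolded model_holomorphic_def] in1[OF z1]] by blast
    obtain T where T: "open T" "W = Cn n \<inter> T" using k(1) by (auto simp: openin_open)
    let ?S' = "?S \<inter> \<gamma> -` T"
    have oS': "open ?S'"
      by (rule continuous_open_preimage[OF continuous_on_subset[OF c\<gamma>] oS T(1)]) auto
    have \<gamma>W: "\<gamma> z \<in> W" if "z \<in> ?S'" for z using \<gamma>A c(9) that by (auto simp: T(2))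
    have "(\<lambda>z. k (\<gamma> z)) holomorphic_on ?S'"
    proof (rule holomorphic_Cn_compose_curve[OF k(3,1) oS' _ \<gamma>W])
      fix i assume "i < n"
      then show "(\<lambda>z. \<gamma> z i) holomorphic_on ?S'"
        unfolding \<gamma>_def by (intro holomorphic_on_subset[OF hol]) auto
    qed
    moreover have "k (\<gamma> z) = g (f z)" if "z \<in> ?S'" for z
    proof -
      have "\<gamma> z \<in> W \<inter> \<phi> ` (U \<inter> V)" using \<gamma>W[OF that] in1 that by blast
      from bspec[OF k(4) this] show ?thesis using \<psi>\<gamma>[of z] that fU by (auto simp: image_subset_iff)
    qed
    ultimately have "(\<lambda>z. g (f z)) holomorphic_on ?S'" by (rule holomorphic_transform)
    moreover have "z1 \<in> ?S'" using z1 k(2) by (simp add: T(2))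
    ultimately show ?thesis using oS' holomorphic_on_imp_differentiable_at by blast
  qed
  then have "(\<lambda>z. g (f z)) holomorphic_on ?S"
    by (simp add: holomorphic_on_def field_differentiable_at_within)
  then have "(\<lambda>z\<in>?S. g (restrict f B z)) holomorphic_on ?S"
    by (rule holomorphic_transform) simp
  then show "(\<lambda>z\<in>{z \<in> cpoints (planar_space B). restrict f B z \<in> V}. g (restrict f B z))
      \<in> hol_sections (planar_space B) {z \<in> cpoints (planar_space B). restrict f B z \<in> V}"
    unfolding eq by simp
qed simp

section \<open>Limits of curves of bounded speed, and rescaling\<close>

context brody_atlas
begin

text \<open>The speed bound makes the coordinates equi-Lipschitz. This first confines the curves
  near a point to one chart and then turns pointwise into uniform convergence, so the limit is
  holomorphic. Were it constant, Cauchy's estimate would send \<open>speed (f m) 0\<close> to 0,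
  against its normalization.\<close>

lemma entire_limit:
  assumes f: "\<And>m. f m \<in> hol_maps (planar_space (ball 0 (real (Suc m)))) X"
    and bound: "\<And>m z. z \<in> ball 0 (real (Suc m)) \<Longrightarrow> speed (f m) z \<le> 2"
    and speed0: "\<And>m. speed (f m) 0 = 1"
  obtains g z where "g \<in> hol_maps (planar_space UNIV) X" "g z \<noteq> g 0"
proof -
  obtain G where G: "G \<le> sequentially" "G \<noteq> bot" and ultra: "\<And>P. eventually P G \<or> eventually (\<lambda>x. \<not> P x) G"
    using ultrafilter_exists[OF sequentially_bot] by metis
  \<comment> \<open>Every closed disc eventually lies in the growing domains; with
    \<open>d = 0\<close> this also treats single points.\<close>
  have ev_ball: "eventually (\<lambda>m. cball z d \<subseteq> ball 0 (real (Suc m))) G" for z :: complex and d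
  proof -
    obtain N :: nat where N: "norm z + \<bar>d\<bar> < real N" using reals_Archimedean2 by blast
    have "eventually (\<lambda>m. m \<ge> N) G" using G(1) eventually_ge_at_top filter_leD by blast
    then show ?thesis
    proof eventually_elim
      case (elim m)
      show ?case
      proof
        fix w assume "w \<in> cball z d"
        then have "norm w \<le> norm z + d" using norm_triangle_ineq2[of w z] by (simp add: dist_norm norm_minus_commute)
        then show "w \<in> ball 0 (real (Suc m))" using N elim by simp
      qed
    qed
  qed
  have "\<exists>l. limitin (ctop X) (\<lambda>m. f m z) l G" for z
  proof -
    have "eventually (\<lambda>m. f m z \<in> cpoints X) G"
      using ev_ball[of z 0] by eventually_elim (use hol_mapsD(4)[OF f] in auto)
    then show ?thesis using compact_space_ultralimit[OF compact G(2) ultra] by metis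
  qed
  then obtain g where g: "\<And>z. limitin (ctop X) (\<lambda>m. f m z) (g z) G" by metis
  have gX: "g z \<in> cpoints X" for z using g limitin_topspace by metis
  have local_limit: "\<exists>i\<in>I. \<exists>d>0. eventually (\<lambda>m. cball z0 d \<subseteq> ball 0 (real (Suc m)) \<and> (\<forall>z\<in>cball z0 d. f m z \<in> V i)) G \<and>
      (\<forall>z\<in>cball z0 d. g z \<in> V i) \<and>
      (\<forall>k<n i. uniform_limit (cball z0 d) (\<lambda>m z. \<phi> i (f m z) k) (\<lambda>z. \<phi> i (g z) k) G)" for z0
  proof -
    obtain i where i: "i \<in> I" "g z0 \<in> V i" using cover gX by blast
    obtain e where e: "e > 0" "closedin (ctop X) {y \<in> U i. offset i (g z0) y \<le> e}"
        "{y \<in> U i. offset i (g z0) y \<le> e} \<subseteq> V i \<inter> cpoints X"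
      using closed_offset_neighbourhood[OF i openin_topspace gX] by blast
    let ?N = "{y \<in> U i. offset i (g z0) y \<le> e}" and ?u = "capped_offset e i (g z0)"
    \<comment> \<open>The capped offset is below \<open>e / 2\<close> at \<open>z0\<close> and,
      having Lipschitz constant \<open>2 * n i\<close>, gains less than \<open>e / 2\<close> on
      \<open>cball z0 d\<close>; so the curve stays in the sublevel set.\<close>
    define d where "d = e / (4 * (real (n i) + 1))"
    have d: "d > 0" "real (n i) * 2 * d < e / 2" using e(1) by (auto simp: d_def field_simps)
    have "eventually (\<lambda>m. f m z0 \<in> {y \<in> U i. offset i (g z0) y < e / 2}) G"
    proof -
      have "g z0 \<in> {y \<in> U i. offset i (g z0) y < e / 2}"
        using i V(2)[OF i(1)] e(1) offset_self by auto
      then show ?thesis using g[of z0] openin_offset_ball[OF i(1)] unfolding limitin_def by blast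
    qed
    then have inN: "eventually (\<lambda>m. cball z0 d \<subseteq> ball 0 (real (Suc m)) \<and> (\<forall>z\<in>cball z0 d. f m z \<in> ?N)) G"
      using ev_ball[of z0 d]
    proof eventually_elim
      case (elim m)
      have "f m z \<in> ?N" if z: "z \<in> cball z0 d" for z
      proof -
        have zb: "z0 \<in> ball 0 (real (Suc m))" "z \<in> ball 0 (real (Suc m))"
          using subsetD[OF elim(2) z] subsetD[OF elim(2), of z0] d(1) by simp_all
        have "\<bar>?u (f m z) - ?u (f m z0)\<bar> \<le> real (n i) * 2 * cmod (z - z0)"
          by (rule capped_offset_lipschitz[OF open_ball convex_ball f bound i(1) e(2) _ zb]) (use e(3) in auto)
        also have "\<dots> \<le> real (n i) * 2 * d"
          using z by (intro mult_left_mono) (auto simp: dist_norm norm_minus_commute)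
        also have "\<dots> < e / 2" by (rule d(2))
        finally have "?u (f m z) < ?u (f m z0) + e / 2" by linarith
        moreover have "?u (f m z0) < e / 2"
          using elim(1) by (auto simp: capped_offset_def min_def)
        ultimately have "?u (f m z) < e" by linarith
        then show ?thesis using e(1) by (auto simp: capped_offset_def split: if_splits)
      qed
      then show ?case using elim(2) by blast
    qed
    \<comment> \<open>The sublevel set is closed, so the limit stays in it too.\<close>
    have gN: "g z \<in> ?N" if z: "z \<in> cball z0 d" for z
    proof (rule limitin_closedin[OF g e(2) _ G(2)])
      show "eventually (\<lambda>m. f m z \<in> ?N) G" using inN by eventually_elim (use z in blast)
    qed
    have "uniform_limit (cball z0 d) (\<lambda>m z. \<phi> i (f m z) k) (\<lambda>z. \<phi> i (g z) k) G" if k: "k < n i" for k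
    proof (rule uniform_limit_equi_lipschitz[OF compact_cball G(2)])
      show "eventually (\<lambda>m. \<forall>x\<in>cball z0 d. \<forall>y\<in>cball z0 d. dist (\<phi> i (f m x) k) (\<phi> i (f m y) k) \<le> 2 * dist x y) G"
        using inN
      proof eventually_elim
        case (elim m)
        show ?case
          unfolding dist_norm
          by (intro ballI coordinate_lipschitz[OF open_ball f bound convex_cball _ i(1) k]) (use elim e(3) in auto)
      qed
      fix x assume x: "x \<in> cball z0 d"
      have "limitin (subtopology (ctop X) (U i)) (\<lambda>m. f m x) (g x) G"
        unfolding limitin_subtopology
      proof (intro conjI g)
        show "g x \<in> U i" using gN[OF x] by blast
        show "eventually (\<lambda>m. f m x \<in> U i) G" using inN by eventually_elim (use x in blast)
      qed
      from continuous_map_limit[OF continuous_map_chart_coordinate[OF ch[OF i(1)]] this, of k]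
      show "((\<lambda>m. \<phi> i (f m x) k) \<longlongrightarrow> \<phi> i (g x) k) G" by (simp add: o_def)
    qed
    moreover have "eventually (\<lambda>m. cball z0 d \<subseteq> ball 0 (real (Suc m)) \<and> (\<forall>z\<in>cball z0 d. f m z \<in> V i)) G"
      using inN by eventually_elim (use e(3) in blast)
    moreover have "\<forall>z\<in>cball z0 d. g z \<in> V i" using gN e(3) by blast
    ultimately show ?thesis using i(1) d(1) by blast
  qed
  have hol_coord: "continuous_on (cball z0 d) (\<lambda>z. \<phi> i (f m z) k) \<and> (\<lambda>z. \<phi> i (f m z) k) holomorphic_on ball z0 d"
    if "i \<in> I" "k < n i" "cball z0 d \<subseteq> ball 0 (real (Suc m))" "\<forall>z\<in>cball z0 d. f m z \<in> U i" for i k m z0 d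
  proof -
    have "(\<lambda>z. \<phi> i (f m z) k) holomorphic_on cball z0 d"
      by (rule holomorphic_on_subset[OF chart_coordinate_holomorphic(2)[OF ch[OF that(1)] that(2) open_ball f]])
         (use that in auto)
    then show ?thesis
      using holomorphic_on_imp_continuous_on holomorphic_on_subset[OF _ ball_subset_cball] by blast
  qed
  have "g \<in> hol_maps (planar_space UNIV) X"
  proof (rule hol_maps_glue[OF function_sheaf_planar_space[OF open_UNIV]])
    fix z0 :: complex
    obtain i d where i: "i \<in> I" "d > 0"
      "eventually (\<lambda>m. cball z0 d \<subseteq> ball 0 (real (Suc m)) \<and> (\<forall>z\<in>cball z0 d. f m z \<in> V i)) G"
      "\<forall>z\<in>cball z0 d. g z \<in> V i"
      and "\<forall>k<n i. uniform_limit (cball z0 d) (\<lambda>m z. \<phi> i (f m z) k) (\<lambda>z. \<phi> i (g z) k) G"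
      using local_limit[of z0] by (elim bexE exE conjE) (rule that)
    then have unif: "uniform_limit (cball z0 d) (\<lambda>m z. \<phi> i (f m z) k) (\<lambda>z. \<phi> i (g z) k) G" if "k < n i" for k
      using that by blast
    have "restrict g (ball z0 d) \<in> hol_maps (planar_space (ball z0 d)) X"
    proof (rule hol_maps_into_chart[OF ch[OF i(1)] complex_spaceD(2)[OF X] open_ball])
      show "g ` ball z0 d \<subseteq> U i" using i(4) V(2)[OF i(1)] by auto
      fix k assume k: "k < n i"
      have "eventually (\<lambda>m. continuous_on (cball z0 d) (\<lambda>z. \<phi> i (f m z) k) \<and>
          (\<lambda>z. \<phi> i (f m z) k) holomorphic_on ball z0 d) G"
        using i(3) by eventually_elim (use hol_coord[OF i(1) k] V(2)[OF i(1)] in blast)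
      from holomorphic_uniform_limit[OF this unif[OF k] G(2)]
      show "(\<lambda>z. \<phi> i (g z) k) holomorphic_on ball z0 d" by blast
    qed
    then show "\<exists>B. openin (ctop (planar_space UNIV)) B \<and> z0 \<in> B \<and>
        restrict g B \<in> hol_maps (open_subspace (planar_space UNIV) B) X"
      using i(2) by (intro exI[of _ "ball z0 d"]) (simp add: open_subspace_planar_space)
  qed simp
  moreover have "\<exists>z. g z \<noteq> g 0"
  proof (rule ccontr)
    assume "\<nexists>z. g z \<noteq> g 0"
    then have const: "g z = g 0" for z by blast
    obtain j d where j: "j \<in> I" "d > 0"
      "eventually (\<lambda>m. cball (0::complex) d \<subseteq> ball 0 (real (Suc m)) \<and> (\<forall>z\<in>cball 0 d. f m z \<in> V j)) G"
      "\<forall>z\<in>cball 0 d. g z \<in> V j"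
      and "\<forall>k<n j. uniform_limit (cball 0 d) (\<lambda>m z. \<phi> j (f m z) k) (\<lambda>z. \<phi> j (g z) k) G"
      using local_limit[of 0] by (elim bexE exE conjE) (rule that)
    then have unif: "uniform_limit (cball 0 d) (\<lambda>m z. \<phi> j (f m z) k) (\<lambda>z. \<phi> j (g z) k) G" if "k < n j" for k
      using that by blast
    have g0j: "g 0 \<in> U j" using j(2,4) V(2)[OF j(1)] by auto
    \<comment> \<open>When the limit is constant, uniform convergence in chart \<open>j\<close>
      pushes the whole disc into any neighbourhood of \<open>g 0\<close>. Thus the same disc serves
      the coordinates of all the other charts.\<close>
    have shrink: "eventually (\<lambda>m. \<forall>z\<in>cball 0 d. f m z \<in> T) G" if T: "openin (ctop X) T" "g 0 \<in> T" for T
    proof -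
      obtain e where e: "e > 0" "{y \<in> U j. offset j (g 0) y < e} \<subseteq> T"
        using offset_neighbourhood[OF j(1) g0j T] by blast
      define e' where "e' = e / (real (n j) + 1)"
      have e': "e' > 0" "real (n j) * e' < e" using e(1) by (auto simp: e'_def field_simps)
      have "eventually (\<lambda>m. \<forall>k\<in>{..<n j}. \<forall>z\<in>cball 0 d. dist (\<phi> j (f m z) k) (\<phi> j (g z) k) < e') G"
        by (intro eventually_ball_finite ballI uniform_limitD[OF unif e'(1)]) auto
      with j(3) show ?thesis
      proof eventually_elim
        case (elim m)
        show ?case
        proof
          fix z :: complex assume z: "z \<in> cball 0 d"
          have "offset j (g 0) (f m z) \<le> (\<Sum>k<n j. e')"
            unfolding offset_def
          proof (rule sum_mono)
            fix k assume "k \<in> {..<n j}"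
            then have "dist (\<phi> j (f m z) k) (\<phi> j (g z) k) < e'" using elim(2) z by blast
            then show "cmod (\<phi> j (f m z) k - \<phi> j (g 0) k) \<le> e'"
              unfolding const[of z] dist_norm by (rule less_imp_le)
          qed
          also have "\<dots> < e" using e'(2) by simp
          finally show "f m z \<in> T" using e(2) elim(1) z V(2)[OF j(1)] by blast
        qed
      qed
    qed
    have "((\<lambda>m. \<kappa> i (f m 0) * cmod (deriv (\<lambda>w. \<phi> i (f m w) k) 0)) \<longlongrightarrow> 0) G"
      if i: "i \<in> I" and k: "k < n i" for i k
    proof (cases "g 0 \<in> U i")
      case False
      \<comment> \<open>Here the coordinates of chart \<open>i\<close> are meaningless at
        \<open>g 0\<close>, but the weight vanishes on the neighbourhood \<open>Q i\<close>.\<close>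
      then have "g 0 \<in> Q i" using Q(2)[OF i] gX by blast
      then have "eventually (\<lambda>m. \<forall>z\<in>cball 0 d. f m z \<in> Q i) G" using shrink Q(1)[OF i] by blast
      then have "eventually (\<lambda>m. \<kappa> i (f m 0) * cmod (deriv (\<lambda>w. \<phi> i (f m w) k) 0) = 0) G"
        by eventually_elim (use j(2) Q(3)[OF i] in auto)
      then show ?thesis by (rule tendsto_eventually)
    next
      case True
      show ?thesis
      proof (rule tendstoI)
        fix \<eta> :: real assume \<eta>: "\<eta> > 0"
        note c = chartD[OF ch[OF i]]
        \<comment> \<open>The radius is tuned so that Cauchy's estimate on \<open>ball 0 d\<close>
          bounds the derivative by \<open>\<eta> / 2\<close>.\<close>
        let ?T = "{y \<in> topspace (subtopology (ctop X) (U i)). \<phi> i y k \<in> ball (\<phi> i (g 0) k) (\<eta> * d / 2)}"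
        have "openin (subtopology (ctop X) (U i)) ?T"
          by (rule openin_continuous_map_preimage[OF continuous_map_chart_coordinate[OF ch[OF i]]]) simp
        then have "openin (ctop X) ?T" using openin_open_subtopology[OF c(1)] by blast
        moreover have "g 0 \<in> ?T" using True gX \<eta> j(2) by simp
        ultimately have "eventually (\<lambda>m. \<forall>z\<in>cball 0 d. f m z \<in> ?T) G" by (rule shrink)
        with j(3) show "eventually (\<lambda>m. dist (\<kappa> i (f m 0) * cmod (deriv (\<lambda>w. \<phi> i (f m w) k) 0)) 0 < \<eta>) G"
        proof eventually_elim
          case (elim m)
          let ?F = "\<lambda>w. \<phi> i (f m w) k"
          have h: "continuous_on (cball 0 d) ?F" "?F holomorphic_on ball 0 d"
            using hol_coord[OF i k, of 0 d m] elim by auto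
          have "cmod ((deriv ^^ 1) (\<lambda>w. ?F w - \<phi> i (g 0) k) 0) \<le> fact 1 * (\<eta> * d / 2) / d ^ 1"
          proof (rule Cauchy_inequality)
            show "(\<lambda>w. ?F w - \<phi> i (g 0) k) holomorphic_on ball 0 d" by (intro holomorphic_intros h(2))
            show "continuous_on (cball 0 d) (\<lambda>w. ?F w - \<phi> i (g 0) k)" by (intro continuous_intros h(1))
            fix x assume "cmod (0 - x) = d"
            then have "x \<in> cball 0 d" by simp
            then have "f m x \<in> ?T" using elim(2) by blast
            then show "cmod (?F x - \<phi> i (g 0) k) \<le> \<eta> * d / 2" by (simp add: dist_norm norm_minus_commute)
          qed (rule j(2))
          moreover have "?F field_differentiable at 0"
            using h(2) j(2) by (intro holomorphic_on_imp_differentiable_at[of _ "ball 0 d"]) auto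
          then have "deriv (\<lambda>w. ?F w - \<phi> i (g 0) k) 0 = deriv ?F 0"
            by (subst deriv_diff) auto
          ultimately have "cmod (deriv ?F 0) \<le> \<eta> / 2" using j(2) by simp
          then have "\<kappa> i (f m 0) * cmod (deriv ?F 0) \<le> 1 * (\<eta> / 2)"
            using \<kappa>(2,3) by (intro mult_mono) auto
          then show ?case using \<eta> \<kappa>(2)[of i "f m 0"] by (simp add: abs_mult)
        qed
      qed
    qed
    then have "((\<lambda>m. speed (f m) 0) \<longlongrightarrow> (\<Sum>i\<in>I. \<Sum>k<n i. 0)) G"
      unfolding speed_def by (intro tendsto_sum) auto
    then have "((\<lambda>m. 1 :: real) \<longlongrightarrow> 0) G" by (simp add: speed0)
    then show False using tendsto_unique[OF G(2) tendsto_const] by fastforce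
  qed
  ultimately show thesis using that by blast
qed

text \<open>Maximize \<open>speed f z * (1/2 - cmod z)\<close> and rescale around the maximum.\<close>

lemma brody_reparametrization:
  assumes f: "f \<in> hol_maps unit_disc X" and r: "r > 0" and large: "speed f 0 > 4 * r"
  obtains g where "g \<in> hol_maps (planar_space (ball 0 r)) X" "speed g 0 = 1"
    "\<And>z. z \<in> ball 0 r \<Longrightarrow> speed g z \<le> 2"
proof -
  let ?F = "\<lambda>z. speed f z * (1/2 - cmod z)"
  \<comment> \<open>The closed half disc is compact inside the open disc, so a maximum exists; the
    weight vanishes on its boundary, which keeps the maximum in the interior.\<close>
  have "continuous_on (cball 0 (1/2)) ?F"
    by (intro continuous_intros continuous_on_subset[OF continuous_on_speed[OF open_ball f]]) auto
  then obtain z1 where z1: "z1 \<in> cball 0 (1/2)" "\<And>z. z \<in> cball 0 (1/2) \<Longrightarrow> ?F z \<le> ?F z1"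
    using continuous_attains_sup[of "cball (0::complex) (1/2)" ?F] by auto
  define s where "s = speed f z1"
  \<comment> \<open>At 0 the weight is 1/2, hence the factor 4 in the hypothesis.\<close>
  have M: "?F z1 > 2 * r" using z1(2)[of 0] large by simp
  have s0: "s > 0" and z1h: "cmod z1 < 1/2"
  proof -
    have "?F z1 > 0" using M r by linarith
    then show "s > 0" "cmod z1 < 1/2"
      using speed_nonneg[of f z1] unfolding s_def by (auto simp: zero_less_mult_iff)
  qed
  \<comment> \<open>Scaling by \<open>1 / s\<close> takes \<open>ball 0 r\<close> into a disc about
    \<open>z1\<close> of radius less than half the distance to the boundary of the half disc. There
    the weight is at least half its value at \<open>z1\<close>, so maximality bounds the speed of
    \<open>f\<close> by \<open>2 * s\<close>.\<close>
  have sr: "r / s < (1/2 - cmod z1) / 2"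
    using M s0 unfolding s_def by (simp add: field_simps)
  have near: "cmod (z1 + of_real (1/s) * z) < 1/2 - (1/2 - cmod z1) / 2" if "z \<in> ball 0 r" for z
  proof -
    have "cmod (z1 + of_real (1/s) * z) \<le> cmod z1 + cmod z / s"
      using norm_triangle_ineq[of z1 "of_real (1/s) * z"] s0 by (simp add: norm_mult norm_divide)
    moreover have "cmod z / s < r / s" using that s0 by (simp add: divide_strict_right_mono)
    moreover have "a < 1/2 - (1/2 - b) / 2" if "a \<le> b + c" "c < d" "d < (1/2 - b) / 2" for a b c d :: real
      using that by (simp add: field_simps)
    ultimately show ?thesis using sr by blast
  qed
  have sub: "(\<lambda>z. z1 + of_real (1/s) * z) ` ball 0 r \<subseteq> ball 0 1"
  proof (rule image_subsetI)
    fix z :: complex assume "z \<in> ball 0 r"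
    note near[OF this] z1h
    moreover have "a < 1" if "a < 1/2 - (1/2 - b) / 2" "b < 1/2" for a b :: real
      using that by (simp add: field_simps)
    ultimately have "cmod (z1 + of_real (1/s) * z) < 1" by blast
    then show "z1 + of_real (1/s) * z \<in> ball 0 1" by (simp only: mem_ball_0)
  qed
  let ?a = "restrict (\<lambda>z. z1 + of_real (1/s) * z) (ball 0 r)"
  have "?a \<in> hol_maps (planar_space (ball 0 r)) unit_disc"
    by (rule hol_maps_planar_space) (use sub in \<open>auto intro!: holomorphic_intros\<close>)
  from hol_maps_compose[OF this f]
  have g: "compose (ball 0 r) f ?a \<in> hol_maps (planar_space (ball 0 r)) X" by simp
  have speed_g: "speed (compose (ball 0 r) f ?a) z = speed f (z1 + of_real (1/s) * z) / s" if z: "z \<in> ball 0 r" for z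
  proof -
    have "speed (compose (ball 0 r) f ?a) z = speed (\<lambda>z. f (z1 + of_real (1/s) * z)) z"
      by (rule speed_cong[OF open_ball z]) (simp add: compose_def)
    also have "\<dots> = cmod (of_real (1/s)) * speed f (z1 + of_real (1/s) * z)"
      by (rule speed_affine[OF open_ball f]) (use sub z in blast)
    finally show ?thesis using s0 by (simp add: norm_divide)
  qed
  show thesis
  proof (rule that[OF g])
    show "speed (compose (ball 0 r) f ?a) 0 = 1"
      using speed_g[of 0] r s0 by (simp add: s_def)
    fix z :: complex assume z: "z \<in> ball 0 r"
    let ?w = "z1 + of_real (1/s) * z"
    have w: "cmod ?w < 1/2 - (1/2 - cmod z1) / 2" using near[OF z] .
    have "a \<le> 1/2" if "a < 1/2 - (1/2 - b) / 2" "b < 1/2" for a b :: real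
      using that by (simp add: field_simps)
    then have "cmod ?w \<le> 1/2" using w z1h by blast
    then have win: "?w \<in> cball 0 (1/2)" by (simp only: mem_cball_0)
    have "speed f ?w * ((1/2 - cmod z1) / 2) \<le> speed f ?w * (1/2 - cmod ?w)"
    proof (intro mult_left_mono speed_nonneg)
      have "(1/2 - b) / 2 \<le> 1/2 - a" if "a < 1/2 - (1/2 - b) / 2" for a b :: real
        using that by (simp add: field_simps)
      then show "(1/2 - cmod z1) / 2 \<le> 1/2 - cmod ?w" using w by blast
    qed
    also have "\<dots> \<le> s * (1/2 - cmod z1)"
      using z1(2)[OF win] by (simp only: s_def)
    finally have le: "speed f ?w * ((1/2 - cmod z1) / 2) \<le> s * (1/2 - cmod z1)" .
    have "t \<le> 2 * s" if "t * (h / 2) \<le> s * h" "h > 0" for t h :: real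
    proof -
      from that(1) have "t * h \<le> (2 * s) * h" by simp
      then show ?thesis using that(2) by (rule mult_right_le_imp_le)
    qed
    from this[OF le] have "speed f ?w \<le> 2 * s" using z1h by simp
    then show "speed (compose (ball 0 r) f ?a) z \<le> 2"
      unfolding speed_g[OF z] using s0 by (simp add: field_simps)
  qed
qed

text \<open>Unbounded speeds at the origin yield, after rescaling, curves on discs of every radius
  \<open>m + 1\<close> to which \<open>entire_limit\<close> applies. An affine substitution will
  later move the bound to other points.\<close>

lemma speed_bounded:
  assumes "\<And>g z. g \<in> hol_maps (planar_space UNIV) X \<Longrightarrow> g z = g 0"
  obtains C where "C \<ge> 0" "\<And>f. f \<in> hol_maps unit_disc X \<Longrightarrow> speed f 0 \<le> C"
proof -
  have "\<exists>C. \<forall>f\<in>hol_maps unit_disc X. speed f 0 \<le> C"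
  proof (rule ccontr)
    assume "\<nexists>C. \<forall>f\<in>hol_maps unit_disc X. speed f 0 \<le> C"
    then have unb: "\<exists>f\<in>hol_maps unit_disc X. speed f 0 > C" for C by (meson not_le)
    have "\<exists>g. g \<in> hol_maps (planar_space (ball 0 (real (Suc m)))) X \<and> speed g 0 = 1 \<and>
        (\<forall>z\<in>ball 0 (real (Suc m)). speed g z \<le> 2)" for m
    proof -
      obtain f where "f \<in> hol_maps unit_disc X" "speed f 0 > 4 * real (Suc m)" using unb by blast
      then show ?thesis using brody_reparametrization[of f "real (Suc m)"] by (metis of_nat_0_less_iff zero_less_Suc)
    qed
    then obtain g where "\<And>m. g m \<in> hol_maps (planar_space (ball 0 (real (Suc m)))) X" "\<And>m. speed (g m) 0 = 1"
        "\<And>m z. z\<in>ball 0 (real (Suc m)) \<Longrightarrow> speed (g m) z \<le> 2"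
      by metis
    then obtain h z where "h \<in> hol_maps (planar_space UNIV) X" "h z \<noteq> h 0"
      using entire_limit[of g] by metis
    then show False using assms by blast
  qed
  then obtain C where "\<forall>f\<in>hol_maps unit_disc X. speed f 0 \<le> C" by blast
  then show thesis using that[of "max C 0"] by fastforce
qed

end

section \<open>The Kobayashi pseudodistance\<close>

text \<open>Up to sign the quotient is the Moebius map that takes \<open>a\<close> to 0, evaluated
  at \<open>b\<close>.\<close>

lemma pseudohyperbolic_less_1:
  assumes "a \<in> ball 0 1" "b \<in> ball 0 1"
  shows "cmod ((a - b) / (1 - cnj a * b)) < 1"
proof -
  have "cmod (Moebius_function 0 a b) < 1"
    using Moebius_function_norm_lt_1[of a b 0] assms by simp
  then show ?thesis
    unfolding Moebius_function_simple by (metis minus_diff_eq minus_divide_left norm_minus_cancel)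
qed

lemma artanh_ge_self:
  fixes x :: real
  assumes "0 \<le> x" "x < 1"
  shows "x \<le> artanh x"
proof -
  have "(\<lambda>x. artanh x - x) 0 \<le> (\<lambda>x. artanh x - x) x"
  proof (rule DERIV_nonneg_imp_nondecreasing[OF assms(1)])
    fix t assume t: "0 \<le> t" "t \<le> x"
    have t1: "\<bar>t\<bar> < 1" and tt: "t * t < 1"
      using t assms mult_strict_mono'[of t 1 t 1] by auto
    have "((\<lambda>x. artanh x - x) has_real_derivative (1 / (1 - t ^ 2) - 1)) (at t)"
      using t1 by (auto intro!: derivative_eq_intros)
    moreover have "1 / (1 - t ^ 2) - 1 \<ge> 0"
      using tt t(1) by (simp add: power2_eq_square field_simps)
    ultimately show "\<exists>y. ((\<lambda>x. artanh x - x) has_real_derivative y) (at t) \<and> 0 \<le> y" by blast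
  qed
  then show ?thesis by simp
qed

lemma poincare_dist_bound:
  assumes "a \<in> ball 0 1" "b \<in> ball 0 1"
  shows "cmod ((a - b) / (1 - cnj a * b)) \<le> poincare_dist a b" "0 \<le> poincare_dist a b"
  using artanh_ge_self[OF norm_ge_zero pseudohyperbolic_less_1[OF assms]]
    norm_ge_zero[of "(a - b) / (1 - cnj a * b)"]
  unfolding poincare_dist_def by linarith+

lemma poincare_dist_commute: "poincare_dist a b = poincare_dist b a"
proof -
  have "1 - cnj b * a = cnj (1 - cnj a * b)" by simp
  then have "cmod ((a - b) / (1 - cnj a * b)) = cmod ((b - a) / (1 - cnj b * a))"
    by (simp only: norm_divide complex_mod_cnj norm_minus_commute)
  then show ?thesis unfolding poincare_dist_def by simp
qed

lemma poincare_dist_same: "poincare_dist a a = 0"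
  by (simp add: poincare_dist_def)

section \<open>Chains of discs and the axioms of a distance\<close>

lemma chain_length_nonneg:
  assumes "disc_chain X p q \<alpha>"
  shows "0 \<le> chain_length \<alpha>"
  unfolding chain_length_def
proof (rule sum_list_nonneg)
  fix x assume "x \<in> set (map (\<lambda>(f, a, b). poincare_dist a b) \<alpha>)"
  then show "0 \<le> x"
    using assms poincare_dist_bound(2) unfolding disc_chain_def by fastforce
qed

lemma kobayashi_dist_le: "disc_chain X p q \<alpha> \<Longrightarrow> kobayashi_dist X p q \<le> ennreal (chain_length \<alpha>)"
  unfolding kobayashi_dist_def by (rule INF_lower) simp

lemma disc_chain_rev:
  assumes "disc_chain X p q \<alpha>"
  shows "disc_chain X q p (rev (map (\<lambda>(f, a, b). (f, b, a)) \<alpha>))"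
    "chain_length (rev (map (\<lambda>(f, a, b). (f, b, a)) \<alpha>)) = chain_length \<alpha>"
proof -
  let ?\<beta> = "rev (map (\<lambda>(f, a, b). (f, b, a)) \<alpha>)"
  obtain r where r: "r 0 = p" "r (length \<alpha>) = q" "\<And>i. i < length \<alpha> \<Longrightarrow> case \<alpha> ! i of (f, a, b) \<Rightarrow> f a = r i \<and> f b = r (Suc i)"
    using assms unfolding disc_chain_def by blast
  define r' where "r' i = r (length \<alpha> - i)" for i
  have "case ?\<beta> ! i of (f, a, b) \<Rightarrow> f a = r' i \<and> f b = r' (Suc i)" if i: "i < length ?\<beta>" for i
  proof -
    have i': "i < length \<alpha>" using i by simp
    have "?\<beta> ! i = (\<lambda>(f, a, b). (f, b, a)) (\<alpha> ! (length \<alpha> - Suc i))"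
      using i' by (simp add: rev_nth)
    moreover have "Suc (length \<alpha> - Suc i) = length \<alpha> - i" using i' by simp
    ultimately show ?thesis
      using r(3)[of "length \<alpha> - Suc i"] i' by (auto simp: r'_def split: prod.splits)
  qed
  moreover have "\<alpha> \<noteq> []" "\<forall>(f, a, b) \<in> set \<alpha>. f \<in> hol_maps unit_disc X \<and> a \<in> ball 0 1 \<and> b \<in> ball 0 1"
    using assms unfolding disc_chain_def by blast+
  then have "?\<beta> \<noteq> []" "\<forall>(f, a, b) \<in> set ?\<beta>. f \<in> hol_maps unit_disc X \<and> a \<in> ball 0 1 \<and> b \<in> ball 0 1"
    by auto
  moreover have "r' 0 = q" "r' (length ?\<beta>) = p" using r by (simp_all add: r'_def)
  ultimately show "disc_chain X q p ?\<beta>" unfolding disc_chain_def by blast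
  let ?g = "\<lambda>(f, a, b). poincare_dist a b"
  have "map ?g ?\<beta> = rev (map (?g \<circ> (\<lambda>(f, a, b). (f, b, a))) \<alpha>)"
    by (simp add: rev_map)
  also have "map (?g \<circ> (\<lambda>(f, a, b). (f, b, a))) \<alpha> = map ?g \<alpha>"
    by (intro map_cong refl) (auto simp: poincare_dist_commute)
  finally show "chain_length ?\<beta> = chain_length \<alpha>"
    unfolding chain_length_def by (simp only: sum_list_rev)
qed

lemma disc_chain_append:
  assumes \<alpha>: "disc_chain X p q \<alpha>" and \<beta>: "disc_chain X q s \<beta>"
  shows "disc_chain X p s (\<alpha> @ \<beta>)"
proof -
  obtain r where r: "r 0 = p" "r (length \<alpha>) = q" "\<And>i. i < length \<alpha> \<Longrightarrow> case \<alpha> ! i of (f, a, b) \<Rightarrow> f a = r i \<and> f b = r (Suc i)"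
    using \<alpha> unfolding disc_chain_def by blast
  obtain t where t: "t 0 = q" "t (length \<beta>) = s" "\<And>i. i < length \<beta> \<Longrightarrow> case \<beta> ! i of (f, a, b) \<Rightarrow> f a = t i \<and> f b = t (Suc i)"
    using \<beta> unfolding disc_chain_def by blast
  define u where "u i = (if i \<le> length \<alpha> then r i else t (i - length \<alpha>))" for i
  have "case (\<alpha> @ \<beta>) ! i of (f, a, b) \<Rightarrow> f a = u i \<and> f b = u (Suc i)" if i: "i < length (\<alpha> @ \<beta>)" for i
  proof (cases "i < length \<alpha>")
    case True
    then show ?thesis using r(3)[OF True] by (simp add: u_def nth_append)
  next
    case False
    have "u i = t (i - length \<alpha>)" using False r(2) t(1) by (simp add: u_def)
    moreover have "u (Suc i) = t (Suc (i - length \<alpha>))" using False by (simp add: u_def Suc_diff_le)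
    ultimately show ?thesis using t(3)[of "i - length \<alpha>"] False i by (simp add: nth_append)
  qed
  moreover have "u 0 = p" using r(1) by (simp add: u_def)
  moreover have "u (length (\<alpha> @ \<beta>)) = s" using r(2) t by (cases "\<beta> = []") (auto simp: u_def)
  moreover have "\<alpha> @ \<beta> \<noteq> []" "\<forall>(f, a, b) \<in> set (\<alpha> @ \<beta>). f \<in> hol_maps unit_disc X \<and> a \<in> ball 0 1 \<and> b \<in> ball 0 1"
    using \<alpha> \<beta> unfolding disc_chain_def by auto
  ultimately show ?thesis unfolding disc_chain_def by blast
qed

lemma kobayashi_dist_commute_le: "kobayashi_dist X p q \<le> kobayashi_dist X q p"
  unfolding kobayashi_dist_def[of X q p]
  by (rule INF_greatest) (metis disc_chain_rev kobayashi_dist_le mem_Collect_eq)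

lemma kobayashi_dist_triangle: "kobayashi_dist X p r \<le> kobayashi_dist X p q + kobayashi_dist X q r"
proof (rule ennreal_le_epsilon)
  \<comment> \<open>\<open>ennreal_le_epsilon\<close> lets the right side be taken finite, so both
    infima can be approached strictly.\<close>
  fix e :: real assume fin: "kobayashi_dist X p q + kobayashi_dist X q r < top_class.top" and e: "e > 0"
  have "\<exists>\<alpha>. disc_chain X p q \<alpha> \<and> ennreal (chain_length \<alpha>) < kobayashi_dist X p q + ennreal (e / 2)"
    if "kobayashi_dist X p q < top_class.top" for p q
  proof -
    have "kobayashi_dist X p q < kobayashi_dist X p q + ennreal (e / 2)"
      using that e ennreal_add_left_cancel_less[of "kobayashi_dist X p q" 0 "ennreal (e / 2)"] by simp
    then show ?thesis by (subst (asm) (1) kobayashi_dist_def) (auto simp: INF_less_iff)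
  qed
  then obtain \<alpha> \<beta> where \<alpha>: "disc_chain X p q \<alpha>" "ennreal (chain_length \<alpha>) < kobayashi_dist X p q + ennreal (e / 2)"
    and \<beta>: "disc_chain X q r \<beta>" "ennreal (chain_length \<beta>) < kobayashi_dist X q r + ennreal (e / 2)"
    using fin by (metis ennreal_add_less_top)
  have "kobayashi_dist X p r \<le> ennreal (chain_length (\<alpha> @ \<beta>))"
    using kobayashi_dist_le[OF disc_chain_append[OF \<alpha>(1) \<beta>(1)]] .
  also have "\<dots> = ennreal (chain_length \<alpha>) + ennreal (chain_length \<beta>)"
    using chain_length_nonneg[OF \<alpha>(1)] chain_length_nonneg[OF \<beta>(1)]
    by (simp add: chain_length_def ennreal_plus)
  also have "\<dots> \<le> (kobayashi_dist X p q + ennreal (e / 2)) + (kobayashi_dist X q r + ennreal (e / 2))"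
    using \<alpha>(2) \<beta>(2) by (intro add_mono less_imp_le)
  also have "\<dots> = kobayashi_dist X p q + kobayashi_dist X q r + (ennreal (e / 2) + ennreal (e / 2))"
    by (simp add: ac_simps)
  also have "ennreal (e / 2) + ennreal (e / 2) = ennreal e"
    using e by (subst ennreal_plus[symmetric]) auto
  finally show "kobayashi_dist X p r \<le> kobayashi_dist X p q + kobayashi_dist X q r + ennreal e" .
qed

lemma disc_chain_single:
  "\<lbrakk>f \<in> hol_maps unit_disc X; a \<in> ball 0 1; b \<in> ball 0 1\<rbrakk> \<Longrightarrow> disc_chain X (f a) (f b) [(f, a, b)]"
  unfolding disc_chain_def by (auto intro!: exI[of _ "\<lambda>i. if i = 0 then f a else f b"])

lemma kobayashi_dist_self:
  assumes "p \<in> cpoints X"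
  shows "kobayashi_dist X p p = 0"
proof -
  let ?c = "\<lambda>x\<in>cpoints unit_disc. p"
  have "?c \<in> hol_maps unit_disc X"
    by (rule hol_maps_const[OF complex_space_planar_space assms]) simp
  from kobayashi_dist_le[OF disc_chain_single[OF this, of 0 0]]
  show ?thesis by (simp add: chain_length_def poincare_dist_same)
qed

text \<open>Reversed chains give symmetry, concatenated chains the triangle inequality and constant
  discs the zero on the diagonal, so separation of points remains.\<close>

lemma kobayashi_hyperbolic_iff:
  "kobayashi_hyperbolic X \<longleftrightarrow> (\<forall>p\<in>cpoints X. \<forall>q\<in>cpoints X. kobayashi_dist X p q = 0 \<longrightarrow> p = q)"
proof -
  have "kobayashi_dist X p q = kobayashi_dist X q p" for p q
    using kobayashi_dist_commute_le by (intro antisym)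
  note comm = this
  show ?thesis
  proof
    assume "kobayashi_hyperbolic X"
    then show "\<forall>p\<in>cpoints X. \<forall>q\<in>cpoints X. kobayashi_dist X p q = 0 \<longrightarrow> p = q"
      unfolding kobayashi_hyperbolic_def is_distance_def by blast
  next
    assume R: "\<forall>p\<in>cpoints X. \<forall>q\<in>cpoints X. kobayashi_dist X p q = 0 \<longrightarrow> p = q"
    show "kobayashi_hyperbolic X"
      unfolding kobayashi_hyperbolic_def is_distance_def
    proof (intro conjI ballI)
      fix p q assume "p \<in> cpoints X" "q \<in> cpoints X"
      then show "(kobayashi_dist X p q = 0) = (p = q)" using R[rule_format, of p q] kobayashi_dist_self[of p X] by auto
      show "kobayashi_dist X p q = kobayashi_dist X q p" by (rule comm)
    next
      fix p q r
      show "kobayashi_dist X p r \<le> kobayashi_dist X p q + kobayashi_dist X q r"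
        by (rule kobayashi_dist_triangle)
    qed
  qed
qed

text \<open>The disc \<open>u \<mapsto> f (N * u)\<close> joins \<open>f z\<close> to
  \<open>f w\<close> by way of the points \<open>z / N\<close> and \<open>w / N\<close>, whose
  Poincare distance tends to 0.\<close>

lemma kobayashi_hyperbolic_entire_const:
  assumes hyp: "kobayashi_hyperbolic X" and f: "f \<in> hol_maps (planar_space UNIV) X"
  shows "f z = f w"
proof -
  have bd: "kobayashi_dist X (f z) (f w) \<le> ennreal (poincare_dist (z / of_nat N) (w / of_nat N))"
    if N: "cmod z < real N" "cmod w < real N" for N
  proof -
    have N0: "real N > 0" using N(1) norm_ge_zero[of z] by linarith
    let ?s = "restrict (\<lambda>u. of_nat N * u) (ball 0 1)"
    have "?s \<in> hol_maps unit_disc (planar_space UNIV)"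
      by (rule hol_maps_planar_space) (auto intro!: holomorphic_intros)
    from hol_maps_compose[OF this f]
    have g: "compose (ball 0 1) f ?s \<in> hol_maps unit_disc X" by simp
    have zw: "z / of_nat N \<in> ball 0 1" "w / of_nat N \<in> ball 0 1"
      using N N0 by (simp_all add: norm_divide)
    have "disc_chain X (f z) (f w) [(compose (ball 0 1) f ?s, z / of_nat N, w / of_nat N)]"
      using disc_chain_single[OF g zw] zw N0 by (simp add: compose_def)
    from kobayashi_dist_le[OF this] show ?thesis by (simp add: chain_length_def)
  qed
  obtain N0 :: nat where N0: "max (cmod z) (cmod w) < real N0" using reals_Archimedean2 by blast
  have ev: "eventually (\<lambda>N. kobayashi_dist X (f z) (f w) \<le> ennreal (poincare_dist (z / of_nat N) (w / of_nat N))) sequentially"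
    using eventually_ge_at_top[of N0]
  proof eventually_elim
    case (elim N)
    then have "real N0 \<le> real N" by simp
    then show ?case using N0 by (intro bd) auto
  qed
  have "(\<lambda>N. poincare_dist (z / of_nat N) (w / of_nat N)) \<longlonglongrightarrow> 2 * artanh (cmod ((0 - 0) / (1 - cnj 0 * 0)))"
  proof -
    have "(\<lambda>N. u / of_nat N) \<longlonglongrightarrow> 0" for u :: complex
      by (rule lim_const_over_n)
    then show ?thesis
      unfolding poincare_dist_def
      by (intro tendsto_intros) auto
  qed
  then have lim: "(\<lambda>N. ennreal (poincare_dist (z / of_nat N) (w / of_nat N))) \<longlonglongrightarrow> ennreal 0"
    by (intro tendsto_ennrealI) simp
  have "kobayashi_dist X (f z) (f w) \<le> ennreal 0"
    by (rule tendsto_lowerbound[OF lim ev sequentially_bot])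
  then have "kobayashi_dist X (f z) (f w) = 0" by simp
  then show ?thesis
    using hyp hol_mapsD(4)[OF f] unfolding kobayashi_hyperbolic_iff by simp
qed

section \<open>The pseudodistance separates points\<close>

context brody_atlas
begin

text \<open>For a suitable \<open>e\<close> the function \<open>capped_offset e i p\<close> is 0 at
  \<open>p\<close> and \<open>e\<close> at \<open>q\<close>. Along each short link of a chain it is
  Lipschitz for the Poincare distance, so a chain from \<open>p\<close> to \<open>q\<close> cannot
  be arbitrarily short.\<close>

lemma kobayashi_dist_pos:
  assumes ent: "\<And>g z. g \<in> hol_maps (planar_space UNIV) X \<Longrightarrow> g z = g 0"
    and p: "p \<in> cpoints X" and q: "q \<in> cpoints X" and pq: "p \<noteq> q"
  shows "kobayashi_dist X p q \<noteq> 0"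
proof -
  obtain C where C: "C \<ge> 0" "\<And>f. f \<in> hol_maps unit_disc X \<Longrightarrow> speed f 0 \<le> C"
    using speed_bounded[OF ent] by blast
  \<comment> \<open>The affine disc of radius 1/2 about \<open>z\<close> stays in the unit disc and
    halves the speed, so the bound \<open>C\<close> at its centre becomes
    \<open>2 * C\<close>.\<close>
  have bound: "speed f z \<le> 2 * C" if f: "f \<in> hol_maps unit_disc X" and z: "z \<in> ball 0 (1/2)" for f z
  proof -
    let ?s = "restrict (\<lambda>u. z + of_real (1/2) * u) (ball 0 1)"
    have im: "z + of_real (1/2) * u \<in> ball 0 1" if "u \<in> ball 0 1" for u
    proof -
      have "cmod (z + of_real (1/2) * u) \<le> cmod z + cmod u / 2"
        using norm_triangle_ineq[of z "of_real (1/2) * u"] by (simp add: norm_mult)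
      then show ?thesis using z that by simp
    qed
    have "?s \<in> hol_maps unit_disc unit_disc"
      by (rule hol_maps_planar_space) (use im in \<open>auto intro!: holomorphic_intros\<close>)
    from C(2)[OF hol_maps_compose[OF this f]]
    have "speed (compose (ball 0 1) f ?s) 0 \<le> C" by simp
    also have "speed (compose (ball 0 1) f ?s) 0 = speed (\<lambda>u. f (z + of_real (1/2) * u)) 0"
      by (rule speed_cong[OF open_ball, of 0 0 1]) (auto simp: compose_def)
    also have "\<dots> = cmod (of_real (1/2)) * speed f (z + of_real (1/2) * 0)"
      by (rule speed_affine[OF open_ball f]) (use im[of 0] in simp)
    finally show ?thesis by simp
  qed
  obtain i where i: "i \<in> I" "p \<in> V i" using cover p by blast
  have "openin (ctop X) (cpoints X - {q})"
    using closedin_Hausdorff_singleton[OF complex_spaceD(1)[OF X] q] by blast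
  then obtain e where e: "e > 0" "closedin (ctop X) {y \<in> U i. offset i p y \<le> e}"
      "{y \<in> U i. offset i p y \<le> e} \<subseteq> V i \<inter> (cpoints X - {q})"
    using closed_offset_neighbourhood[OF i] p pq by blast
  let ?u = "capped_offset e i p"
  define L where "L = real (n i) * (2 * C)"
  have L: "L \<ge> 0" using C(1) by (simp add: L_def)
  have up: "?u p = 0" using i V(2)[OF i(1)] e(1) by (auto simp: capped_offset_def offset_self)
  have uq: "?u q = e" using e(3) by (auto simp: capped_offset_def)
  \<comment> \<open>Recentring moves \<open>a\<close> to 0 and \<open>b\<close> to a point whose
    modulus is at most the Poincare distance. As this is below 1/2, the segment between them lies
    where the speed is at most \<open>2 * C\<close>.\<close>
  have link: "\<bar>?u (f b) - ?u (f a)\<bar> \<le> L * poincare_dist a b"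
    if f: "f \<in> hol_maps unit_disc X" and ab: "a \<in> ball 0 1" "b \<in> ball 0 1" and small: "poincare_dist a b < 1/2" for f a b
  proof -
    let ?m = "restrict (Moebius_function 0 (- a)) (ball 0 1)" and ?b = "Moebius_function 0 a b"
    have a: "cmod a < 1" "cmod (- a) < 1" using ab by auto
    have "?m \<in> hol_maps unit_disc unit_disc"
      by (rule hol_maps_planar_space)
         (use Moebius_function_holomorphic[OF a(2)] Moebius_function_norm_lt_1[OF a(2)] in auto)
    from hol_maps_compose[OF this f]
    have g: "compose (ball 0 1) f ?m \<in> hol_maps unit_disc X" by simp
    have b1: "cmod ?b \<le> poincare_dist a b"
    proof -
      have "?b = - ((a - b) / (1 - cnj a * b))"
        unfolding Moebius_function_simple by (metis minus_diff_eq minus_divide_left)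
      then have "cmod ?b = cmod ((a - b) / (1 - cnj a * b))" by (simp only: norm_minus_cancel)
      then show ?thesis using poincare_dist_bound(1)[OF ab] by simp
    qed
    then have b2: "?b \<in> ball 0 (1/2)" using small by simp
    let ?g = "restrict (compose (ball 0 1) f ?m) (ball 0 (1/2))"
    have "?g \<in> hol_maps (open_subspace unit_disc (ball 0 (1/2))) (open_subspace X (cpoints X))"
      by (rule hol_maps_restrict_open[OF function_sheaf_planar_space[OF open_ball] g])
         (use hol_mapsD(4)[OF g] in \<open>auto simp: openin_planar_space\<close>)
    then have g': "?g \<in> hol_maps (planar_space (ball 0 (1/2))) X"
      by (subst (asm) open_subspace_planar_space) auto
    have sp: "speed ?g z \<le> 2 * C" if "z \<in> ball 0 (1/2)" for z
    proof -
      have "speed ?g z = speed (compose (ball 0 1) f ?m) z"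
        by (rule speed_cong[OF open_ball that]) simp
      then show ?thesis using bound[OF g that] by simp
    qed
    have "\<bar>?u (?g ?b) - ?u (?g 0)\<bar> \<le> real (n i) * (2 * C) * cmod (?b - 0)"
      by (rule capped_offset_lipschitz[OF open_ball convex_ball g' sp i(1) e(2)]) (use e(3) b2 in auto)
    moreover have "?g 0 = f a" by (simp add: compose_def Moebius_function_of_zero)
    moreover have "Moebius_function 0 (- a) ?b = b"
      using Moebius_function_compose[of "- a" a b] ab by simp
    then have "?g ?b = f b" using b2 by (simp add: compose_def)
    ultimately have "\<bar>?u (f b) - ?u (f a)\<bar> \<le> L * cmod ?b" by (simp add: L_def)
    also have "\<dots> \<le> L * poincare_dist a b" using b1 L by (intro mult_left_mono)
    finally show ?thesis .
  qed
  \<comment> \<open>A chain of length at least 1/2 satisfies the bound at once; in a shorter one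
    every link is below 1/2, as \<open>link\<close> requires. The denominator \<open>L + 1\<close>
    is positive even for \<open>L = 0\<close>.\<close>
  have chain: "min (1/2) (e / (L + 1)) \<le> chain_length \<alpha>" if \<alpha>: "disc_chain X p q \<alpha>" for \<alpha>
  proof (cases "chain_length \<alpha> < 1/2")
    case True
    obtain r where r: "r 0 = p" "r (length \<alpha>) = q" "\<And>j. j < length \<alpha> \<Longrightarrow> case \<alpha> ! j of (f, a, b) \<Rightarrow> f a = r j \<and> f b = r (Suc j)"
      using \<alpha> unfolding disc_chain_def by blast
    let ?d = "\<lambda>j. case \<alpha> ! j of (f, a, b) \<Rightarrow> poincare_dist a b"
    have len: "chain_length \<alpha> = (\<Sum>j<length \<alpha>. ?d j)"
      unfolding chain_length_def by (simp add: sum_list_sum_nth atLeast0LessThan)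
    have mem: "case \<alpha> ! j of (f, a, b) \<Rightarrow> f \<in> hol_maps unit_disc X \<and> a \<in> ball 0 1 \<and> b \<in> ball 0 1" if "j < length \<alpha>" for j
      using \<alpha> nth_mem[OF that] unfolding disc_chain_def by (elim conjE) (erule (1) bspec)
    have dpos: "0 \<le> ?d j" if "j < length \<alpha>" for j
      using mem[OF that] poincare_dist_bound(2) by (auto split: prod.splits)
    have dsmall: "?d j < 1/2" if "j < length \<alpha>" for j
    proof -
      have "?d j \<le> (\<Sum>j<length \<alpha>. ?d j)" using that dpos by (intro member_le_sum) auto
      then show ?thesis using True len by simp
    qed
    have step: "\<bar>?u (r (Suc j)) - ?u (r j)\<bar> \<le> L * ?d j" if j: "j < length \<alpha>" for j
    proof -
      obtain f a b where fab: "\<alpha> ! j = (f, a, b)" using prod_cases3 by blast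
      show ?thesis using link[of f a b] mem[OF j] dsmall[OF j] r(3)[OF j] unfolding fab by simp
    qed
    have "m \<le> length \<alpha> \<Longrightarrow> \<bar>?u (r m) - ?u p\<bar> \<le> L * (\<Sum>j<m. ?d j)" for m
    proof (induction m)
      case 0
      then show ?case using r(1) by simp
    next
      case (Suc m)
      then show ?case using step[of m] by (simp add: distrib_left)
    qed
    from this[of "length \<alpha>"] have "e \<le> L * chain_length \<alpha>"
      using r(2) up uq e(1) len by simp
    also have "\<dots> \<le> (L + 1) * chain_length \<alpha>"
      using chain_length_nonneg[OF \<alpha>] by (intro mult_right_mono) auto
    finally have "e / (L + 1) \<le> chain_length \<alpha>" using L by (simp add: field_simps)
    then show ?thesis by simp
  qed simp
  have "ennreal (min (1/2) (e / (L + 1))) \<le> kobayashi_dist X p q"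
    unfolding kobayashi_dist_def by (rule INF_greatest) (use chain in \<open>auto intro!: ennreal_leI\<close>)
  moreover have "min (1/2) (e / (L + 1)) > 0" using e(1) L by simp
  ultimately show ?thesis by (metis ennreal_eq_0_iff le_zero_eq not_le)
qed

end

theorem kobayashi_hyperbolic_iff_entire_const:
  fixes X :: "'p cspace"
  assumes X: "complex_space X" and compact: "compact_space (ctop X)"
  shows "kobayashi_hyperbolic X \<longleftrightarrow> (\<forall>f \<in> hol_maps (planar_space UNIV) X. \<forall>z. f z = f 0)"
proof
  assume "kobayashi_hyperbolic X"
  then show "\<forall>f \<in> hol_maps (planar_space UNIV) X. \<forall>z. f z = f 0"
    using kobayashi_hyperbolic_entire_const by blast
next
  assume ent: "\<forall>f \<in> hol_maps (planar_space UNIV) X. \<forall>z. f z = f 0"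
  obtain I and U :: "'p \<Rightarrow> 'p set" and n A \<phi> \<psi> \<kappa> V Q where "brody_atlas X I U n A \<phi> \<psi> \<kappa> V Q"
    using brody_atlas_exists[OF assms] by blast
  then interpret brody_atlas X I U n A \<phi> \<psi> \<kappa> V Q .
  show "kobayashi_hyperbolic X"
    unfolding kobayashi_hyperbolic_iff using kobayashi_dist_pos ent by blast
qed

section \<open>From here on: morphisms into a represented sheaf in the localized category\<close>

section \<open>Quotients\<close>

lemma equiv_equiv_gen: "equiv UNIV (equiv_gen r)"
  unfolding equiv_gen_def
  by (intro equivI refl_onI sym_rtrancl trans_rtrancl) (auto simp: sym_def)

lemma equiv_gen_least:
  assumes "r \<subseteq> R" "equiv UNIV R"
  shows "equiv_gen r \<subseteq> R"
proof -
  have R: "sym R" "trans R" "refl R"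
    using assms(2) by (auto elim: equivE)
  have "(r \<union> r\<inverse>)\<^sup>* \<subseteq> R\<^sup>*"
    by (rule rtrancl_mono) (use assms(1) R(1) in \<open>auto simp: sym_def\<close>)
  also have "R\<^sup>* \<subseteq> R"
  proof clarify
    fix a b assume "(a, b) \<in> R\<^sup>*"
    then show "(a, b) \<in> R"
      by (induction rule: rtrancl_induct) (use R(2,3) in \<open>auto simp: refl_on_def dest: transD\<close>)
  qed
  finally show ?thesis unfolding equiv_gen_def .
qed

lemma equiv_gen_generator: "(a, b) \<in> r \<Longrightarrow> (a, b) \<in> equiv_gen r"
  by (auto simp: equiv_gen_def)

lemma equiv_gen_refl: "(a, a) \<in> equiv_gen r"
  by (simp add: equiv_gen_def)

lemma equiv_gen_sym: "(a, b) \<in> equiv_gen r \<Longrightarrow> (b, a) \<in> equiv_gen r"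
  using equiv_equiv_gen[of r] by (auto elim!: equivE dest: symD)

lemma equiv_gen_trans: "(a, b) \<in> equiv_gen r \<Longrightarrow> (b, c) \<in> equiv_gen r \<Longrightarrow> (a, c) \<in> equiv_gen r"
  using equiv_equiv_gen[of r] by (auto elim!: equivE dest: transD)

text \<open>Compatibility is asked for pairs starting at \<open>a\<close> only, which suits maps
  that behave well on genuine cells or local sections but not on the whole type.\<close>

lemma quot_map_class:
  assumes "sym R" "trans R" "(a, a) \<in> S" "\<And>b. (a, b) \<in> S \<Longrightarrow> (f a, f b) \<in> R"
  shows "quot_map R f (S `` {a}) = R `` {f a}"
  unfolding quot_map_def
proof (intro equalityI subsetI)
  fix y assume "y \<in> R `` (f ` (S `` {a}))"
  then obtain b where "(a, b) \<in> S" "(f b, y) \<in> R" by blast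
  with assms show "y \<in> R `` {f a}" by (auto dest: transD)
next
  fix y assume "y \<in> R `` {f a}"
  then show "y \<in> R `` (f ` (S `` {a}))" using assms(3) by blast
qed

section \<open>Morphisms to local objects in a localization\<close>

text \<open>\<open>F\<close> sees every arrow of \<open>W\<close> as invertible. The category laws
  concern composites that end at \<open>F\<close>, since the zigzags to be evaluated end
  there.\<close>

locale local_object =
  fixes C :: "('o, 'm) category" and W :: "'o \<Rightarrow> 'o \<Rightarrow> 'm set" and F :: 'o
  assumes F: "F \<in> Ob C"
    and Idt: "Idt C F \<in> Hom C F F"
    and Cmp: "\<lbrakk>A \<in> Ob C; B \<in> Ob C; f \<in> Hom C A B; g \<in> Hom C B F\<rbrakk> \<Longrightarrow> Cmp C A g f \<in> Hom C A F"
    and left_Idt: "\<lbrakk>A \<in> Ob C; f \<in> Hom C A F\<rbrakk> \<Longrightarrow> Cmp C A (Idt C F) f = f"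
    and right_Idt: "\<lbrakk>A \<in> Ob C; f \<in> Hom C A F\<rbrakk> \<Longrightarrow> Cmp C A f (Idt C A) = f"
    and assoc: "\<lbrakk>A \<in> Ob C; B \<in> Ob C; D \<in> Ob C; f \<in> Hom C A B; g \<in> Hom C B D; h \<in> Hom C D F\<rbrakk>
      \<Longrightarrow> Cmp C A (Cmp C B h g) f = Cmp C A h (Cmp C A g f)"
    and W_Hom: "\<lbrakk>S \<in> Ob C; T \<in> Ob C; w \<in> W S T\<rbrakk> \<Longrightarrow> w \<in> Hom C S T"
    and W_bij: "\<lbrakk>S \<in> Ob C; T \<in> Ob C; w \<in> W S T\<rbrakk>
      \<Longrightarrow> bij_betw (\<lambda>h. Cmp C S h w) (Hom C T F) (Hom C S F)"
begin

text \<open>The genuine morphism represented by a zigzag into \<open>F\<close>, built from its end: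
  a forward step composes, a backward step divides by \<open>w\<close>, which \<open>W_bij\<close>
  permits.\<close>

fun transport :: "('o, 'm) zstep list \<Rightarrow> 'm" where
  "transport [] = Idt C F"
| "transport (Fwd S T f # zs) = Cmp C S (transport zs) f"
| "transport (Bwd S T w # zs) = (THE h. h \<in> Hom C T F \<and> Cmp C S h w = transport zs)"

lemma zigzag_Ob: "zigzag C W A u B \<Longrightarrow> A \<in> Ob C"
  by (induction C W A u B rule: zigzag.induct) auto

lemma W_divide:
  assumes "S \<in> Ob C" "T \<in> Ob C" "w \<in> W S T" "g \<in> Hom C S F"
  shows "(THE h. h \<in> Hom C T F \<and> Cmp C S h w = g) \<in> Hom C T F"
    "Cmp C S (THE h. h \<in> Hom C T F \<and> Cmp C S h w = g) w = g"
proof -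
  have b: "inj_on (\<lambda>h. Cmp C S h w) (Hom C T F)" "(\<lambda>h. Cmp C S h w) ` Hom C T F = Hom C S F"
    using W_bij[OF assms(1-3)] by (simp_all add: bij_betw_def)
  obtain h where "h \<in> Hom C T F" "Cmp C S h w = g"
    using assms(4) unfolding b(2)[symmetric] by (elim imageE) simp
  then have "\<exists>!h. h \<in> Hom C T F \<and> Cmp C S h w = g"
    using inj_onD[OF b(1)] by (intro ex1I[of _ h]) simp_all
  from theI'[OF this] show "(THE h. h \<in> Hom C T F \<and> Cmp C S h w = g) \<in> Hom C T F"
    "Cmp C S (THE h. h \<in> Hom C T F \<and> Cmp C S h w = g) w = g" by auto
qed

lemma W_divide_Cmp:
  assumes "S \<in> Ob C" "T \<in> Ob C" "w \<in> W S T" "h \<in> Hom C T F"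
  shows "(THE h'. h' \<in> Hom C T F \<and> Cmp C S h' w = Cmp C S h w) = h"
proof (rule the_equality)
  fix h' assume h': "h' \<in> Hom C T F \<and> Cmp C S h' w = Cmp C S h w"
  have "inj_on (\<lambda>h. Cmp C S h w) (Hom C T F)"
    using W_bij[OF assms(1-3)] by (simp add: bij_betw_def)
  from inj_onD[OF this, of h' h] h' assms(4) show "h' = h" by simp
qed (use assms(4) in simp)

lemma transport_Hom: "zigzag C W A u F \<Longrightarrow> transport u \<in> Hom C A F"
proof (induction u arbitrary: A)
  case Nil
  then show ?case using Idt by simp
next
  case (Cons x u)
  show ?case
  proof (cases x)
    case (Fwd S T f)
    then have *: "A \<in> Ob C" "A = S" "f \<in> Hom C S T" "zigzag C W T u F"
      using Cons.prems by auto
    show ?thesis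
      using Cmp[OF _ zigzag_Ob[OF *(4)] *(3) Cons.IH[OF *(4)]] * Fwd by simp
  next
    case (Bwd S T w)
    then have *: "A \<in> Ob C" "A = T" "w \<in> W S T" "zigzag C W S u F"
      using Cons.prems by auto
    show ?thesis
      using W_divide(1)[OF zigzag_Ob[OF *(4)] _ *(3) Cons.IH[OF *(4)]] * Bwd by simp
  qed
qed

text \<open>The four reductions match, in order, the right identity law, associativity, existence
  and uniqueness of the quotient by \<open>w\<close>.\<close>

lemma transport_zreduce:
  assumes "zreduce C u v" "zigzag C W A (u @ q) F" "zigzag C W A (v @ q) F"
  shows "transport (u @ q) = transport (v @ q)"
  using assms
proof (cases rule: zreduce.cases)
  case (1 D)
  then show ?thesis using assms transport_Hom[of D q] right_Idt by auto
next
  case (2 D B f E g)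
  then have z: "D \<in> Ob C" "f \<in> Hom C D B" "B \<in> Ob C" "g \<in> Hom C B E" "zigzag C W E q F"
    using assms(2) by auto
  show ?thesis
    using assoc[OF z(1,3) zigzag_Ob[OF z(5)] z(2,4) transport_Hom[OF z(5)]] 2 by simp
next
  case (3 D B w)
  then have z: "D \<in> Ob C" "B \<in> Ob C" "w \<in> W D B" "zigzag C W D q F"
    using assms(2) by auto
  show ?thesis
    using W_divide(2)[OF z(1-3) transport_Hom[OF z(4)]] 3 by simp
next
  case (4 D B w)
  then have z: "D \<in> Ob C" "B \<in> Ob C" "w \<in> W D B" "zigzag C W B q F"
    using assms(2) by auto
  show ?thesis
    using W_divide_Cmp[OF z(1-3) transport_Hom[OF z(4)]] 4 by simp
qed

lemma transport_zreduce_context: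
  assumes "zreduce C u v" "zigzag C W A (p @ u @ q) F" "zigzag C W A (p @ v @ q) F"
  shows "transport (p @ u @ q) = transport (p @ v @ q)"
  using assms(2,3)
proof (induction p arbitrary: A)
  case Nil
  then show ?case using transport_zreduce[OF assms(1)] by simp
next
  case (Cons x p)
  then show ?case by (cases x) auto
qed

lemma transport_equiv:
  assumes "(u, v) \<in> zigzag_equiv C W A F"
  shows "transport u = transport v"
proof -
  have "zigzag_equiv C W A F \<subseteq> {(u, v). transport u = transport v}"
    unfolding zigzag_equiv_def
    by (rule equiv_gen_least)
       (use transport_zreduce_context in \<open>auto intro!: equivI refl_onI symI transI\<close>)
  then show ?thesis using assms by auto
qed

text \<open>A new first step joins the left context \<open>p\<close> of every reduction.\<close>

lemma zigzag_equiv_Cons: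
  assumes x: "\<And>zs. zigzag C W T zs B \<Longrightarrow> zigzag C W S (x # zs) B"
    and uv: "(u, v) \<in> zigzag_equiv C W T B"
  shows "(x # u, x # v) \<in> zigzag_equiv C W S B"
proof -
  have "zigzag_equiv C W T B \<subseteq> {(u, v). (x # u, x # v) \<in> zigzag_equiv C W S B}"
    unfolding zigzag_equiv_def[of C W T B]
  proof (rule equiv_gen_least)
    show "equiv UNIV {(u, v). (x # u, x # v) \<in> zigzag_equiv C W S B}"
      unfolding zigzag_equiv_def
      by (auto intro!: equivI refl_onI symI transI equiv_gen_refl
            intro: equiv_gen_sym equiv_gen_trans)
    show "{(p @ u @ q, p @ v @ q) |p q u v. zreduce C u v \<and>
        zigzag C W T (p @ u @ q) B \<and> zigzag C W T (p @ v @ q) B}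
      \<subseteq> {(u, v). (x # u, x # v) \<in> zigzag_equiv C W S B}"
    proof clarify
      fix p q u v
      assume *: "zreduce C u v" "zigzag C W T (p @ u @ q) B" "zigzag C W T (p @ v @ q) B"
      show "(x # p @ u @ q, x # p @ v @ q) \<in> zigzag_equiv C W S B"
        unfolding zigzag_equiv_def
        by (rule equiv_gen_generator, rule CollectI, rule exI[of _ "x # p"], rule exI[of _ q],
            rule exI[of _ u], rule exI[of _ v]) (simp add: *(1) x[OF *(2)] x[OF *(3)])
    qed
  qed
  then show ?thesis using uv by auto
qed

lemma equiv_zigzag_equiv: "equiv UNIV (zigzag_equiv C W A B)"
  unfolding zigzag_equiv_def by (rule equiv_equiv_gen)

lemma zigzag_equiv_zreduce:
  assumes "zreduce C u v" "zigzag C W A (p @ u @ q) B" "zigzag C W A (p @ v @ q) B"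
  shows "(p @ u @ q, p @ v @ q) \<in> zigzag_equiv C W A B"
  unfolding zigzag_equiv_def by (rule equiv_gen_generator) (use assms in blast)

text \<open>By induction a zigzag collapses to a single forward arrow, so every class in the
  localization comes from a plain morphism.\<close>

lemma zigzag_equiv_transport:
  "zigzag C W A u F \<Longrightarrow> (u, [Fwd A F (transport u)]) \<in> zigzag_equiv C W A F"
proof (induction u arbitrary: A)
  case Nil
  then have A: "A = F" by simp
  have "([] @ [Fwd F F (Idt C F)] @ [], [] @ [] @ []) \<in> zigzag_equiv C W F F"
    by (rule zigzag_equiv_zreduce) (use zreduce.intros(1)[of C F] F Idt in auto)
  then show ?case
    using A unfolding zigzag_equiv_def by (simp add: equiv_gen_sym)
next
  case (Cons x u)
  show ?case
  proof (cases x)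
    case (Fwd S T f)
    then have *: "A \<in> Ob C" "A = S" "f \<in> Hom C S T" "zigzag C W T u F"
      using Cons.prems by auto
    note T = zigzag_Ob[OF *(4)] and h = transport_Hom[OF *(4)]
    have "(x # u, x # [Fwd T F (transport u)]) \<in> zigzag_equiv C W A F"
      by (rule zigzag_equiv_Cons[OF _ Cons.IH[OF *(4)]]) (use * Fwd in auto)
    moreover have "([] @ [Fwd S T f, Fwd T F (transport u)] @ [], [] @ [Fwd S F (Cmp C S (transport u) f)] @ [])
        \<in> zigzag_equiv C W A F"
      by (rule zigzag_equiv_zreduce)
         (use zreduce.intros(2)[of C S T f F "transport u"] * T h F Cmp[of S T f "transport u"] in auto)
    ultimately show ?thesis
      unfolding zigzag_equiv_def using Fwd *(2) by (auto intro: equiv_gen_trans)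
  next
    case (Bwd S T w)
    then have *: "A \<in> Ob C" "A = T" "w \<in> W S T" "zigzag C W S u F"
      using Cons.prems by auto
    note S = zigzag_Ob[OF *(4)] and g = transport_Hom[OF *(4)]
    define h where "h = transport (x # u)"
    have h: "h \<in> Hom C T F" "Cmp C S h w = transport u"
      using W_divide[OF S _ *(3) g] *(1,2) Bwd by (simp_all add: h_def)
    have w: "w \<in> Hom C S T" using W_Hom[OF S _ *(3)] *(1,2) by simp
    \<comment> \<open>Since \<open>transport u\<close> is \<open>h\<close> after \<open>w\<close>,
      the arrow following \<open>x\<close> splits into \<open>w\<close> and \<open>h\<close>; then
      \<open>Bwd S T w\<close> cancels against \<open>Fwd S T w\<close>.\<close>
    have "(x # u, x # [Fwd S F (transport u)]) \<in> zigzag_equiv C W A F"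
      by (rule zigzag_equiv_Cons[OF _ Cons.IH[OF *(4)]]) (use * Bwd in auto)
    moreover have "([x] @ [Fwd S T w, Fwd T F h] @ [], [x] @ [Fwd S F (Cmp C S h w)] @ [])
        \<in> zigzag_equiv C W A F"
      by (rule zigzag_equiv_zreduce)
         (use zreduce.intros(2)[of C S T w F h] * S g F w h Bwd in auto)
    moreover have "([] @ [Bwd S T w, Fwd S T w] @ [Fwd T F h], [] @ [] @ [Fwd T F h])
        \<in> zigzag_equiv C W A F"
      by (rule zigzag_equiv_zreduce)
         (use zreduce.intros(4)[of C S T w] * S g F w h Bwd in auto)
    ultimately have "(x # u, [Fwd T F h]) \<in> zigzag_equiv C W A F"
      unfolding zigzag_equiv_def h(2) using Bwd
      by (simp del: transport.simps) (meson equiv_gen_trans equiv_gen_sym)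
    then show ?thesis using *(2) by (simp add: h_def del: transport.simps)
  qed
qed

abbreviation loc_class :: "'o \<Rightarrow> 'm \<Rightarrow> ('o, 'm) zstep list set" where
  "loc_class A h \<equiv> zigzag_equiv C W A F `` {[Fwd A F h]}"

lemma bij_betw_loc_class:
  assumes A: "A \<in> Ob C"
  shows "bij_betw (loc_class A) (Hom C A F) (loc_hom C W A F)"
  unfolding bij_betw_def
proof
  have zz: "zigzag C W A [Fwd A F h] F" if "h \<in> Hom C A F" for h
    using A F that by simp
  show "inj_on (loc_class A) (Hom C A F)"
  proof (rule inj_onI)
    fix h h' assume hh: "h \<in> Hom C A F" "h' \<in> Hom C A F" "loc_class A h = loc_class A h'"
    have "[Fwd A F h'] \<in> loc_class A h'"
      unfolding zigzag_equiv_def by (simp add: equiv_gen_refl)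
    then have "([Fwd A F h], [Fwd A F h']) \<in> zigzag_equiv C W A F"
      using hh(3) by blast
    then show "h = h'"
      using transport_equiv[of "[Fwd A F h]" "[Fwd A F h']" A] hh left_Idt[OF A] by simp
  qed
  show "loc_class A ` Hom C A F = loc_hom C W A F"
  proof (intro equalityI subsetI)
    fix c assume "c \<in> loc_class A ` Hom C A F"
    then show "c \<in> loc_hom C W A F"
      using zz unfolding loc_hom_def by (auto intro: quotientI)
  next
    fix c assume "c \<in> loc_hom C W A F"
    then obtain u where u: "zigzag C W A u F" "c = zigzag_equiv C W A F `` {u}"
      unfolding loc_hom_def by (auto elim: quotientE)
    have "c = loc_class A (transport u)"
      using equiv_class_eq[OF equiv_zigzag_equiv zigzag_equiv_transport[OF u(1)]] u(2) by simp
    then show "c \<in> loc_class A ` Hom C A F"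
      using transport_Hom[OF u(1)] by blast
  qed
qed

lemma loc_precomp_loc_class:
  assumes P: "P \<in> Ob C" "A \<in> Ob C" "p \<in> Hom C P A" and h: "h \<in> Hom C A F"
  shows "loc_precomp C W P A F p (loc_class A h) = loc_class P (Cmp C P h p)"
proof -
  have "loc_precomp C W P A F p (loc_class A h) = zigzag_equiv C W P F `` {Fwd P A p # [Fwd A F h]}"
    unfolding loc_precomp_def
  proof (rule quot_map_class)
    show "sym (zigzag_equiv C W P F)" "trans (zigzag_equiv C W P F)"
      using equiv_zigzag_equiv by (auto elim: equivE)
    show "([Fwd A F h], [Fwd A F h]) \<in> zigzag_equiv C W A F"
      unfolding zigzag_equiv_def by (rule equiv_gen_refl)
    fix b assume "([Fwd A F h], b) \<in> zigzag_equiv C W A F"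
    then show "([Fwd P A p, Fwd A F h], Fwd P A p # b) \<in> zigzag_equiv C W P F"
      by (rule zigzag_equiv_Cons[rotated]) (use P in auto)
  qed
  also have "([] @ [Fwd P A p, Fwd A F h] @ [], [] @ [Fwd P F (Cmp C P h p)] @ []) \<in> zigzag_equiv C W P F"
    by (rule zigzag_equiv_zreduce)
       (use zreduce.intros(2)[of C P A p F h] P h F Cmp[OF P h] in auto)
  then have "zigzag_equiv C W P F `` {Fwd P A p # [Fwd A F h]} = loc_class P (Cmp C P h p)"
    using equiv_class_eq[OF equiv_zigzag_equiv] by fastforce
  finally show ?thesis .
qed

text \<open>The bijections \<open>loc_class\<close> identify both sides with plain Hom sets and turn
  \<open>loc_precomp\<close> into composition with \<open>p\<close>.\<close>

lemma bij_betw_loc_precomp_iff: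
  assumes P: "P \<in> Ob C" "A \<in> Ob C" "p \<in> Hom C P A"
  shows "bij_betw (loc_precomp C W P A F p) (loc_hom C W A F) (loc_hom C W P F) \<longleftrightarrow>
    bij_betw (\<lambda>h. Cmp C P h p) (Hom C A F) (Hom C P F)"
proof -
  have "bij_betw (loc_precomp C W P A F p) (loc_hom C W A F) (loc_hom C W P F) \<longleftrightarrow>
    bij_betw (loc_precomp C W P A F p \<circ> loc_class A) (Hom C A F) (loc_hom C W P F)"
    by (rule bij_betw_comp_iff[OF bij_betw_loc_class[OF P(2)]])
  also have "\<dots> \<longleftrightarrow> bij_betw (loc_class P \<circ> (\<lambda>h. Cmp C P h p)) (Hom C A F) (loc_hom C W P F)"
    by (rule bij_betw_cong) (simp add: loc_precomp_loc_class[OF P])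
  also have "\<dots> \<longleftrightarrow> bij_betw (\<lambda>h. Cmp C P h p) (Hom C A F) (Hom C P F)"
    by (rule bij_betw_comp_iff2[OF bij_betw_loc_class[OF P(1)], symmetric]) (use Cmp[OF P] in auto)
  finally show ?thesis .
qed

end

section \<open>Path components of realizations\<close>

lemma istopology_realization:
  "istopology (\<lambda>\<U>. \<U> \<subseteq> realization_cells K // realization_rel K \<and>
     (\<forall>n. \<forall>s \<in> simplices K n. openin (top_of_set (standard_simplex n))
        {t \<in> standard_simplex n. realization_rel K `` {(n, s, t)} \<in> \<U>}))"
  unfolding istopology_def
proof (intro conjI allI impI ballI)
  fix S T n s
  assume S: "S \<subseteq> realization_cells K // realization_rel K \<and>
      (\<forall>n. \<forall>s \<in> simplices K n. openin (top_of_set (standard_simplex n))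
        {t \<in> standard_simplex n. realization_rel K `` {(n, s, t)} \<in> S})"
    and T: "T \<subseteq> realization_cells K // realization_rel K \<and>
      (\<forall>n. \<forall>s \<in> simplices K n. openin (top_of_set (standard_simplex n))
        {t \<in> standard_simplex n. realization_rel K `` {(n, s, t)} \<in> T})"
    and s: "s \<in> simplices K n"
  have "{t \<in> standard_simplex n. realization_rel K `` {(n, s, t)} \<in> S \<inter> T} =
      {t \<in> standard_simplex n. realization_rel K `` {(n, s, t)} \<in> S} \<inter>
      {t \<in> standard_simplex n. realization_rel K `` {(n, s, t)} \<in> T}" by blast
  then show "openin (top_of_set (standard_simplex n))
      {t \<in> standard_simplex n. realization_rel K `` {(n, s, t)} \<in> S \<inter> T}"
    using S T s by (simp add: openin_Int)
next
  fix \<K> n s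
  assume \<K>: "\<forall>S\<in>\<K>. S \<subseteq> realization_cells K // realization_rel K \<and>
      (\<forall>n. \<forall>s \<in> simplices K n. openin (top_of_set (standard_simplex n))
        {t \<in> standard_simplex n. realization_rel K `` {(n, s, t)} \<in> S})"
    and s: "s \<in> simplices K n"
  have "{t \<in> standard_simplex n. realization_rel K `` {(n, s, t)} \<in> \<Union>\<K>} =
      (\<Union>S\<in>\<K>. {t \<in> standard_simplex n. realization_rel K `` {(n, s, t)} \<in> S})" by blast
  moreover have "openin (top_of_set (standard_simplex n)) \<dots>"
    by (rule openin_clauses(3)) (use \<K> s in auto)
  ultimately show "openin (top_of_set (standard_simplex n))
      {t \<in> standard_simplex n. realization_rel K `` {(n, s, t)} \<in> \<Union>\<K>}" by simp
qed blast+

lemma openin_realization: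
  "openin (realization K) \<U> \<longleftrightarrow> \<U> \<subseteq> realization_cells K // realization_rel K \<and>
     (\<forall>n. \<forall>s \<in> simplices K n. openin (top_of_set (standard_simplex n))
        {t \<in> standard_simplex n. realization_rel K `` {(n, s, t)} \<in> \<U>})"
  unfolding realization_def using istopology_realization[of K] by (simp add: topology_inverse')

definition cell_point :: "'a sset \<Rightarrow> nat \<Rightarrow> 'a \<Rightarrow> (nat \<Rightarrow> real) \<Rightarrow> (nat \<times> 'a \<times> (nat \<Rightarrow> real)) set" where
  "cell_point K n s t = realization_rel K `` {(n, s, t)}"

lemma cell_point_in_quotient:
  "s \<in> simplices K n \<Longrightarrow> t \<in> standard_simplex n \<Longrightarrow> cell_point K n s t \<in> realization_cells K // realization_rel K"
  unfolding cell_point_def by (rule quotientI) (simp add: realization_cells_def)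

lemma topspace_realization: "topspace (realization K) = realization_cells K // realization_rel K"
proof
  show "topspace (realization K) \<subseteq> realization_cells K // realization_rel K"
    using openin_realization[of K "topspace (realization K)"] by simp
  have "openin (realization K) (realization_cells K // realization_rel K)"
    unfolding openin_realization
  proof (intro conjI allI ballI)
    fix n s assume s: "s \<in> simplices K n"
    have "{t \<in> standard_simplex n. realization_rel K `` {(n, s, t)} \<in> realization_cells K // realization_rel K}
       = standard_simplex n"
      using cell_point_in_quotient[OF s] unfolding cell_point_def by blast
    then show "openin (top_of_set (standard_simplex n)) {t \<in> standard_simplex n.
        realization_rel K `` {(n, s, t)} \<in> realization_cells K // realization_rel K}" by simp
  qed simp
  then show "realization_cells K // realization_rel K \<subseteq> topspace (realization K)"
    by (rule openin_subset)
qed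

lemma cell_point_cases:
  assumes "c \<in> topspace (realization K)"
  obtains n s t where "s \<in> simplices K n" "t \<in> standard_simplex n" "c = cell_point K n s t"
  using assms unfolding topspace_realization cell_point_def
  by (auto elim!: quotientE simp: realization_cells_def)

lemma cell_point_in_topspace:
  "s \<in> simplices K n \<Longrightarrow> t \<in> standard_simplex n \<Longrightarrow> cell_point K n s t \<in> topspace (realization K)"
  unfolding topspace_realization by (rule cell_point_in_quotient)

lemma equiv_realization_rel: "equiv UNIV (realization_rel K)"
  unfolding realization_rel_def by (rule equiv_equiv_gen)

lemma cell_point_eqI: "((n, s, t), (m, s', t')) \<in> realization_rel K \<Longrightarrow> cell_point K n s t = cell_point K m s' t'"
  unfolding cell_point_def by (rule equiv_class_eq[OF equiv_realization_rel])

lemma cell_point_sface: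
  assumes "i \<le> Suc n" "s \<in> simplices K (Suc n)" "t \<in> standard_simplex n"
  shows "cell_point K n (sface K n i s) t = cell_point K (Suc n) s (simplical_face i t)"
  unfolding realization_rel_def
  by (rule cell_point_eqI, unfold realization_rel_def, rule equiv_gen_generator) (use assms in blast)

lemma cell_point_sdegen:
  assumes "i \<le> n" "s \<in> simplices K n" "t \<in> standard_simplex (Suc n)"
  shows "cell_point K (Suc n) (sdegen K n i s) t = cell_point K n s (simplicial_collapse i t)"
  by (rule cell_point_eqI, unfold realization_rel_def, rule equiv_gen_generator) (use assms in blast)

lemma simplical_face_standard_simplex:
  "i \<le> Suc n \<Longrightarrow> t \<in> standard_simplex n \<Longrightarrow> simplical_face i t \<in> standard_simplex (Suc n)"
  using simplical_face_in_standard_simplex[of "Suc n" i t] by simp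

lemma simplicial_collapse_standard_simplex:
  assumes i: "i \<le> n" and t: "t \<in> standard_simplex (Suc n)"
  shows "simplicial_collapse i t \<in> standard_simplex n"
proof -
  let ?c = "simplicial_collapse i t"
  have t0: "\<And>j. 0 \<le> t j" "\<And>j. j > Suc n \<Longrightarrow> t j = 0" "(\<Sum>j\<le>Suc n. t j) = 1"
    using t by (auto simp: standard_simplex_def)
  \<comment> \<open>A partial sum that includes index \<open>i\<close> contains the merged entry, so
    it equals the sum of one more entry of \<open>t\<close>.\<close>
  have "(\<Sum>j\<le>m. ?c j) = (\<Sum>j\<le>Suc m. t j)" if "i \<le> m" for m
    using that
  proof (induction m rule: dec_induct)
    case base
    have "(\<Sum>j<i. ?c j) = (\<Sum>j<i. t j)" by (rule sum.cong) (auto simp: simplicial_collapse_def)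
    then show ?case by (simp add: simplicial_collapse_def lessThan_Suc_atMost[symmetric])
  next
    case (step m)
    then show ?case by (simp add: simplicial_collapse_def)
  qed
  then have s: "(\<Sum>j\<le>n. ?c j) = 1" using t0(3) i by simp
  have c0: "0 \<le> ?c j" for j using t0(1) by (simp add: simplicial_collapse_def)
  have cz: "?c j = 0" if "j > n" for j using t0(2) that i by (simp add: simplicial_collapse_def)
  have "?c j \<le> 1" for j
  proof (cases "j \<le> n")
    case True
    then have "?c j \<le> (\<Sum>j\<le>n. ?c j)" using c0 by (intro member_le_sum) auto
    then show ?thesis using s by simp
  next
    case False then show ?thesis using cz[of j] by simp
  qed
  then show ?thesis unfolding standard_simplex_def using c0 cz s by simp
qed

lemma path_component_of_cell:
  assumes s: "s \<in> simplices K n" and t: "t \<in> standard_simplex n" "t' \<in> standard_simplex n"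
  shows "path_component_of (realization K) (cell_point K n s t) (cell_point K n s t')"
proof -
  have "continuous_map (top_of_set (standard_simplex n)) (realization K) (cell_point K n s)"
    unfolding continuous_map_def
  proof (intro conjI allI impI)
    show "cell_point K n s \<in> topspace (top_of_set (standard_simplex n)) \<rightarrow> topspace (realization K)"
      using cell_point_in_topspace[OF s] by auto
    fix U assume "openin (realization K) U"
    then have "openin (top_of_set (standard_simplex n)) {t \<in> standard_simplex n. cell_point K n s t \<in> U}"
      unfolding openin_realization cell_point_def using s by blast
    then show "openin (top_of_set (standard_simplex n))
        {t \<in> topspace (top_of_set (standard_simplex n)). cell_point K n s t \<in> U}" by simp
  qed
  moreover have "path_connectedin (top_of_set (standard_simplex n)) (standard_simplex n)"
    using path_connectedin_standard_simplex[of n]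
    by (simp add: path_connectedin_subtopology euclidean_product_topology)
  ultimately have "path_connectedin (realization K) (cell_point K n s ` standard_simplex n)"
    by (rule path_connectedin_continuous_map_image)
  then show ?thesis
    unfolding path_component_of using t
    by (auto simp: path_connectedin_def)
qed

text \<open>A map to a discrete simplicial set, written without naming the target; in effect a
  function on path components.\<close>

definition simplicially_constant :: "'a sset \<Rightarrow> (nat \<Rightarrow> 'a \<Rightarrow> 'b) \<Rightarrow> bool" where
  "simplicially_constant K h \<longleftrightarrow>
     (\<forall>n. \<forall>i \<le> Suc n. \<forall>s \<in> simplices K (Suc n). h n (sface K n i s) = h (Suc n) s) \<and>
     (\<forall>n. \<forall>i \<le> n. \<forall>s \<in> simplices K n. h (Suc n) (sdegen K n i s) = h n s)"

text \<open>\<open>h\<close> descends to a function on the realization all of whose level sets are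
  open, and a path, being connected, stays in one of them.\<close>

lemma simplicially_constant_path_component:
  assumes h: "simplicially_constant K h"
    and s: "s \<in> simplices K n" "t \<in> standard_simplex n" and s': "s' \<in> simplices K m" "t' \<in> standard_simplex m"
    and path: "path_component_of (realization K) (cell_point K n s t) (cell_point K m s' t')"
  shows "h n s = h m s'"
proof (rule ccontr)
  assume ne: "h n s \<noteq> h m s'"
  define g where "g = (\<lambda>(n :: nat, s, t :: nat \<Rightarrow> real). h n s)"
  have "realization_rel K \<subseteq> {(a, b). g a = g b}"
    unfolding realization_rel_def
    by (rule equiv_gen_least)
       (use h in \<open>auto simp: simplicially_constant_def g_def intro!: equivI refl_onI symI transI\<close>)
  then have rel: "g a = g b" if "(a, b) \<in> realization_rel K" for a b using that by blast
  \<comment> \<open>By \<open>rel\<close> the value does not depend on the representative.\<close>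
  define H where "H c = g (SOME a. a \<in> c)" for c
  have H: "H (cell_point K n s t) = h n s" for n s t
  proof -
    have "(n, s, t) \<in> cell_point K n s t"
      unfolding cell_point_def realization_rel_def by (simp add: equiv_gen_refl)
    then have "(SOME a. a \<in> cell_point K n s t) \<in> cell_point K n s t" by (rule someI)
    then have "((n, s, t), (SOME a. a \<in> cell_point K n s t)) \<in> realization_rel K"
      unfolding cell_point_def by simp
    from rel[OF this] show ?thesis by (simp add: H_def g_def)
  qed
  \<comment> \<open>\<open>H\<close> is constant on each cell, so the preimage in a simplex is
    everything or nothing.\<close>
  have op: "openin (realization K) {c \<in> topspace (realization K). P (H c)}" for P
    unfolding openin_realization
  proof (intro conjI allI ballI)
    fix n s assume s: "s \<in> simplices K n"
    have "{t \<in> standard_simplex n. realization_rel K `` {(n, s, t)} \<in> {c \<in> topspace (realization K). P (H c)}}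
        = (if P (h n s) then standard_simplex n else {})"
      using H cell_point_in_topspace[OF s] unfolding cell_point_def by auto
    then show "openin (top_of_set (standard_simplex n)) {t \<in> standard_simplex n.
        realization_rel K `` {(n, s, t)} \<in> {c \<in> topspace (realization K). P (H c)}}" by simp
  qed (auto simp: topspace_realization)
  have "connected_component_of (realization K) (cell_point K n s t) (cell_point K m s' t')"
    using path by (rule path_imp_connected_component_of)
  then obtain T where T: "connectedin (realization K) T" "cell_point K n s t \<in> T" "cell_point K m s' t' \<in> T"
    unfolding connected_component_of_def by blast
  have sub: "T \<subseteq> topspace (realization K)" using T(1) connectedin_subset_topspace by blast
  let ?A = "{c \<in> topspace (realization K). H c = h n s}" and ?B = "{c \<in> topspace (realization K). H c \<noteq> h n s}"
  have "?A \<inter> T = {} \<or> ?B \<inter> T = {}"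
    using connectedinD[OF T(1) op[of "\<lambda>x. x = h n s"] op[of "\<lambda>x. x \<noteq> h n s"]] sub by blast
  moreover have "cell_point K n s t \<in> ?A \<inter> T" "cell_point K m s' t' \<in> ?B \<inter> T"
    using T sub ne by (auto simp: H)
  ultimately show False by blast
qed

text \<open>\<open>realization_rel\<close> is reflexive on the whole type, while a simplicial map
  respects it on genuine cells; the guard \<open>P\<close> keeps the pulled back relation an
  equivalence.\<close>

lemma equiv_restricted_vimage:
  assumes "equiv UNIV R"
  shows "equiv UNIV {(a, b). (P a \<longleftrightarrow> P b) \<and> (P a \<longrightarrow> (F a, F b) \<in> R)}"
proof -
  have "refl R" "sym R" "trans R" using assms by (auto elim: equivE)
  then show ?thesis
    by (intro equivI refl_onI symI transI) (auto dest: symD transD reflD)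
qed

section \<open>Simplicial maps and weak equivalences on path components\<close>

locale sset_morphism =
  fixes K :: "'a sset" and L :: "'b sset" and f :: "nat \<Rightarrow> 'a \<Rightarrow> 'b"
  assumes K_sface: "\<lbrakk>i \<le> Suc n; s \<in> simplices K (Suc n)\<rbrakk> \<Longrightarrow> sface K n i s \<in> simplices K n"
    and K_sdegen: "\<lbrakk>i \<le> n; s \<in> simplices K n\<rbrakk> \<Longrightarrow> sdegen K n i s \<in> simplices K (Suc n)"
    and L_sface: "\<lbrakk>i \<le> Suc n; l \<in> simplices L (Suc n)\<rbrakk> \<Longrightarrow> sface L n i l \<in> simplices L n"
    and L_sdegen: "\<lbrakk>i \<le> n; l \<in> simplices L n\<rbrakk> \<Longrightarrow> sdegen L n i l \<in> simplices L (Suc n)"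
    and f_simplices: "s \<in> simplices K n \<Longrightarrow> f n s \<in> simplices L n"
    and f_sface: "\<lbrakk>i \<le> Suc n; s \<in> simplices K (Suc n)\<rbrakk> \<Longrightarrow> f n (sface K n i s) = sface L n i (f (Suc n) s)"
    and f_sdegen: "\<lbrakk>i \<le> n; s \<in> simplices K n\<rbrakk> \<Longrightarrow> f (Suc n) (sdegen K n i s) = sdegen L n i (f n s)"
begin

definition realization_map :: "(nat \<times> 'a \<times> (nat \<Rightarrow> real)) set \<Rightarrow> (nat \<times> 'b \<times> (nat \<Rightarrow> real)) set" where
  "realization_map = quot_map (realization_rel L) (\<lambda>(n, s, t). (n, f n s, t))"

lemma realization_map_cell_point:
  assumes "s \<in> simplices K n" "t \<in> standard_simplex n"
  shows "realization_map (cell_point K n s t) = cell_point L n (f n s) t"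
proof -
  let ?F = "\<lambda>(n, s, t). (n, f n s, t)" and ?C = "realization_cells K"
  let ?R = "{(a, b). (a \<in> ?C \<longleftrightarrow> b \<in> ?C) \<and> (a \<in> ?C \<longrightarrow> (?F a, ?F b) \<in> realization_rel L)}"
  have "realization_rel K \<subseteq> ?R"
    unfolding realization_rel_def[of K]
  proof (rule equiv_gen_least)
    show "equiv UNIV ?R"
      by (rule equiv_restricted_vimage[OF equiv_realization_rel])
    show "{((n, sface K n i s, t), (Suc n, s, simplical_face i t)) | n i s t.
         i \<le> Suc n \<and> s \<in> simplices K (Suc n) \<and> t \<in> standard_simplex n} \<union>
      {((Suc n, sdegen K n i s, t), (n, s, simplicial_collapse i t)) | n i s t.
         i \<le> n \<and> s \<in> simplices K n \<and> t \<in> standard_simplex (Suc n)} \<subseteq> ?R"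
    proof (intro Un_least subsetI)
      fix p assume "p \<in> {((n, sface K n i s, t), (Suc n, s, simplical_face i t)) | n i s t.
         i \<le> Suc n \<and> s \<in> simplices K (Suc n) \<and> t \<in> standard_simplex n}"
      then obtain n i s t where p: "p = ((n, sface K n i s, t), (Suc n, s, simplical_face i t))"
        and *: "i \<le> Suc n" "s \<in> simplices K (Suc n)" "t \<in> standard_simplex n" by blast
      have "((n, sface L n i (f (Suc n) s), t), (Suc n, f (Suc n) s, simplical_face i t)) \<in> realization_rel L"
        unfolding realization_rel_def by (rule equiv_gen_generator) (use * f_simplices in blast)
      then show "p \<in> ?R"
        unfolding p realization_cells_def
        using * K_sface[OF *(1,2)] simplical_face_standard_simplex[OF *(1,3)] f_sface[OF *(1,2)] by simp
    next
      fix p assume "p \<in> {((Suc n, sdegen K n i s, t), (n, s, simplicial_collapse i t)) | n i s t.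
         i \<le> n \<and> s \<in> simplices K n \<and> t \<in> standard_simplex (Suc n)}"
      then obtain n i s t where p: "p = ((Suc n, sdegen K n i s, t), (n, s, simplicial_collapse i t))"
        and *: "i \<le> n" "s \<in> simplices K n" "t \<in> standard_simplex (Suc n)" by blast
      have "((Suc n, sdegen L n i (f n s), t), (n, f n s, simplicial_collapse i t)) \<in> realization_rel L"
        unfolding realization_rel_def by (rule equiv_gen_generator) (use * f_simplices in blast)
      then show "p \<in> ?R"
        unfolding p realization_cells_def
        using * K_sdegen[OF *(1,2)] simplicial_collapse_standard_simplex[OF *(1,3)] f_sdegen[OF *(1,2)] by simp
    qed
  qed
  then have R: "(?F a, ?F b) \<in> realization_rel L" if "(a, b) \<in> realization_rel K" "a \<in> ?C" for a b
    using that by blast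
  have "realization_map (realization_rel K `` {(n, s, t)}) = realization_rel L `` {?F (n, s, t)}"
    unfolding realization_map_def
  proof (rule quot_map_class)
    show "sym (realization_rel L)" "trans (realization_rel L)"
      using equiv_realization_rel by (auto elim: equivE)
    show "((n, s, t), (n, s, t)) \<in> realization_rel K"
      unfolding realization_rel_def by (rule equiv_gen_refl)
    fix b assume "((n, s, t), b) \<in> realization_rel K"
    then show "(?F (n, s, t), ?F b) \<in> realization_rel L"
      by (rule R) (use assms in \<open>simp add: realization_cells_def\<close>)
  qed
  then show ?thesis unfolding cell_point_def by simp
qed

end

locale sset_equivalence = sset_morphism +
  assumes weq: "sset_weak_equivalence K L f"
begin

lemma continuous_realization_map: "continuous_map (realization K) (realization L) realization_map"
  using weq unfolding sset_weak_equivalence_def weak_homotopy_equivalence_def realization_map_def by blast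

lemma realization_map_path_components:
  assumes x: "x \<in> topspace (realization K)"
  shows "quot_map {(y, y'). path_component_of (realization L) y y'} realization_map
      (path_component_of_set (realization K) x) = path_component_of_set (realization L) (realization_map x)"
proof -
  let ?R = "{(y, y'). path_component_of (realization L) y y'}" and ?S = "{(y, y'). path_component_of (realization K) y y'}"
  have "quot_map ?R realization_map (?S `` {x}) = ?R `` {realization_map x}"
  proof (rule quot_map_class)
    show "sym ?R" by (auto intro!: symI simp: path_component_of_sym)
    show "trans ?R" by (auto intro!: transI intro: path_component_of_trans)
    show "(x, x) \<in> ?S" using x by (simp add: path_component_of_refl)
    fix b assume "(x, b) \<in> ?S"
    then show "(realization_map x, realization_map b) \<in> ?R"
      using path_component_of_continuous_image[OF continuous_realization_map] by blast
  qed
  then show ?thesis by (simp add: Image_def)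
qed

lemma bij_path_components:
  "bij_betw (quot_map {(y, y'). path_component_of (realization L) y y'} realization_map)
     (path_components_of (realization K)) (path_components_of (realization L))"
  using weq unfolding sset_weak_equivalence_def weak_homotopy_equivalence_def realization_map_def by blast

text \<open>Surjectivity on path components, expressed by cells.\<close>

lemma realization_map_meets_components:
  assumes l: "l \<in> simplices L n" and t: "t \<in> standard_simplex n"
  obtains m s t' where "s \<in> simplices K m" "t' \<in> standard_simplex m"
    "path_component_of (realization L) (cell_point L n l t) (cell_point L m (f m s) t')"
proof -
  let ?R = "{(y, y'). path_component_of (realization L) y y'}"
  have "path_component_of_set (realization L) (cell_point L n l t) \<in> path_components_of (realization L)"
    unfolding path_components_of_def using cell_point_in_topspace[OF l t] by blast
  then have "path_component_of_set (realization L) (cell_point L n l t)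
      \<in> quot_map ?R realization_map ` path_components_of (realization K)"
    using bij_path_components by (simp add: bij_betw_def)
  then obtain c where c: "c \<in> path_components_of (realization K)"
      "quot_map ?R realization_map c = path_component_of_set (realization L) (cell_point L n l t)"
    by (elim imageE) simp
  then obtain x where x: "x \<in> topspace (realization K)" "c = path_component_of_set (realization K) x"
    unfolding path_components_of_def by blast
  obtain m s t' where s: "s \<in> simplices K m" "t' \<in> standard_simplex m" "x = cell_point K m s t'"
    using cell_point_cases[OF x(1)] by blast
  have "path_component_of_set (realization L) (cell_point L m (f m s) t') =
     path_component_of_set (realization L) (cell_point L n l t)"
    using realization_map_path_components[OF x(1)] c(2) x(2) s realization_map_cell_point[OF s(1,2)] by simp
  moreover have "cell_point L m (f m s) t' \<in> path_component_of_set (realization L) (cell_point L m (f m s) t')"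
    using cell_point_in_topspace[OF f_simplices[OF s(1)] s(2)] by (simp add: path_component_of_refl)
  ultimately have "cell_point L m (f m s) t' \<in> path_component_of_set (realization L) (cell_point L n l t)"
    by (simp only:)
  then have "path_component_of (realization L) (cell_point L n l t) (cell_point L m (f m s) t')"
    by simp
  with s that show thesis by blast
qed

text \<open>Injectivity on path components, expressed by cells.\<close>

lemma path_component_reflect:
  assumes s: "s \<in> simplices K n" "t \<in> standard_simplex n" and s': "s' \<in> simplices K m" "t' \<in> standard_simplex m"
    and path: "path_component_of (realization L) (cell_point L n (f n s) t) (cell_point L m (f m s') t')"
  shows "path_component_of (realization K) (cell_point K n s t) (cell_point K m s' t')"
proof -
  let ?x = "cell_point K n s t" and ?y = "cell_point K m s' t'"
  have xy: "?x \<in> topspace (realization K)" "?y \<in> topspace (realization K)"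
    using cell_point_in_topspace[OF s] cell_point_in_topspace[OF s'] by simp_all
  have "path_component_of_set (realization L) (realization_map ?x) = path_component_of_set (realization L) (realization_map ?y)"
    unfolding realization_map_cell_point[OF s] realization_map_cell_point[OF s']
    using path path_component_of_equiv by metis
  then have "path_component_of_set (realization K) ?x = path_component_of_set (realization K) ?y"
    using bij_path_components realization_map_path_components xy
    unfolding bij_betw_def path_components_of_def
    by (intro inj_onD[OF conjunct1[OF bij_path_components[unfolded bij_betw_def]]])
       (auto simp: path_components_of_def)
  moreover have "?y \<in> path_component_of_set (realization K) ?y"
    using xy(2) by (simp add: path_component_of_refl)
  ultimately have "?y \<in> path_component_of_set (realization K) ?x" by (simp only:)
  then show ?thesis by simp
qed

lemma simplicially_constant_unique:
  assumes h: "simplicially_constant L h" "simplicially_constant L h'"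
    and eq: "\<And>n s. s \<in> simplices K n \<Longrightarrow> h n (f n s) = h' n (f n s)"
    and l: "l \<in> simplices L n"
  shows "h n l = h' n l"
proof -
  obtain t where t: "t \<in> standard_simplex n" using nonempty_standard_simplex by blast
  obtain m s t' where s: "s \<in> simplices K m" "t' \<in> standard_simplex m"
    "path_component_of (realization L) (cell_point L n l t) (cell_point L m (f m s) t')"
    using realization_map_meets_components[OF l t] by blast
  note * = simplicially_constant_path_component[OF _ l t f_simplices[OF s(1)] s(2,3)]
  show ?thesis using *[OF h(1)] *[OF h(2)] eq[OF s(1)] by simp
qed

text \<open>Every cell of \<open>L\<close> lies in the component of an image cell and receives the
  value of \<open>g\<close> there; \<open>path_component_reflect\<close> makes this independent of
  the image cell.\<close>

lemma simplicially_constant_extend: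
  assumes g: "simplicially_constant K g"
  obtains h where "simplicially_constant L h" "\<And>n s. s \<in> simplices K n \<Longrightarrow> h n (f n s) = g n s"
proof -
  define Q where "Q n l v \<longleftrightarrow> (\<exists>t m s t'. t \<in> standard_simplex n \<and> s \<in> simplices K m \<and> t' \<in> standard_simplex m \<and>
    path_component_of (realization L) (cell_point L n l t) (cell_point L m (f m s) t') \<and> g m s = v)" for n l v
  have QI: "Q n l (g m s)" if "t \<in> standard_simplex n" "s \<in> simplices K m" "t' \<in> standard_simplex m"
    "path_component_of (realization L) (cell_point L n l t) (cell_point L m (f m s) t')" for n l m s t t'
    unfolding Q_def using that by blast
  have ex: "\<exists>v. Q n l v" if l: "l \<in> simplices L n" for n l
  proof -
    obtain t where t: "t \<in> standard_simplex n" using nonempty_standard_simplex by blast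
    show ?thesis using realization_map_meets_components[OF l t] QI[OF t] by metis
  qed
  have uniq: "v = v'" if l: "l \<in> simplices L n" and v: "Q n l v" and v': "Q n l v'" for n l v v'
  proof -
    obtain t m s t' where 1: "t \<in> standard_simplex n" "s \<in> simplices K m" "t' \<in> standard_simplex m"
       "path_component_of (realization L) (cell_point L n l t) (cell_point L m (f m s) t')" "g m s = v"
      using v unfolding Q_def by blast
    obtain u k r u' where 2: "u \<in> standard_simplex n" "r \<in> simplices K k" "u' \<in> standard_simplex k"
       "path_component_of (realization L) (cell_point L n l u) (cell_point L k (f k r) u')" "g k r = v'"
      using v' unfolding Q_def by blast
    \<comment> \<open>The witnesses may use different points \<open>t\<close> and \<open>u\<close>
      of the same cell, which is path connected.\<close>
    have "path_component_of (realization L) (cell_point L m (f m s) t') (cell_point L k (f k r) u')"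
      using 1(4) 2(4) path_component_of_cell[OF l 1(1) 2(1)]
      by (meson path_component_of_sym path_component_of_trans)
    then have "path_component_of (realization K) (cell_point K m s t') (cell_point K k r u')"
      by (rule path_component_reflect[OF 1(2,3) 2(2,3)])
    from simplicially_constant_path_component[OF g 1(2,3) 2(2,3) this]
    show ?thesis using 1(5) 2(5) by simp
  qed
  define h where "h n l = (SOME v. Q n l v)" for n l
  have hQ: "Q n l (h n l)" if "l \<in> simplices L n" for n l
    unfolding h_def using someI_ex[OF ex[OF that]] .
  show thesis
  proof
    show "h n (f n s) = g n s" if s: "s \<in> simplices K n" for n s
    proof -
      obtain t where t: "t \<in> standard_simplex n" using nonempty_standard_simplex by blast
      have "Q n (f n s) (g n s)"
        by (rule QI[OF t s t]) (use cell_point_in_topspace[OF f_simplices[OF s] t] in \<open>simp add: path_component_of_refl\<close>)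
      then show ?thesis using uniq[OF f_simplices[OF s] hQ[OF f_simplices[OF s]]] by blast
    qed
    show "simplicially_constant L h"
      unfolding simplicially_constant_def
    proof (intro conjI allI impI ballI)
      fix n i l assume i: "i \<le> Suc n" and l: "l \<in> simplices L (Suc n)"
      obtain t m s t' where 1: "t \<in> standard_simplex n" "s \<in> simplices K m" "t' \<in> standard_simplex m"
         "path_component_of (realization L) (cell_point L n (sface L n i l) t) (cell_point L m (f m s) t')"
         "g m s = h n (sface L n i l)"
        using hQ[OF L_sface[OF i l]] unfolding Q_def by blast
      \<comment> \<open>Point \<open>t\<close> of the face is the point
        \<open>simplical_face i t\<close> of the cell of \<open>l\<close>, so the same witness
        serves \<open>l\<close>.\<close>
      have "Q (Suc n) l (g m s)"
        using QI[OF simplical_face_standard_simplex[OF i 1(1)] 1(2,3)] 1(4) cell_point_sface[OF i l 1(1)] by simp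
      then show "h n (sface L n i l) = h (Suc n) l"
        using uniq[OF l _ hQ[OF l]] 1(5) by simp
    next
      fix n i l assume i: "i \<le> n" and l: "l \<in> simplices L n"
      obtain t m s t' where 1: "t \<in> standard_simplex (Suc n)" "s \<in> simplices K m" "t' \<in> standard_simplex m"
         "path_component_of (realization L) (cell_point L (Suc n) (sdegen L n i l) t) (cell_point L m (f m s) t')"
         "g m s = h (Suc n) (sdegen L n i l)"
        using hQ[OF L_sdegen[OF i l]] unfolding Q_def by blast
      have "Q n l (g m s)"
        using QI[OF simplicial_collapse_standard_simplex[OF i 1(1)] 1(2,3)] 1(4) cell_point_sdegen[OF i l 1(1)] by simp
      then show "h (Suc n) (sdegen L n i l) = h n l"
        using uniq[OF l _ hQ[OF l]] 1(5) by simp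
    qed
  qed
qed

end

section \<open>Sheaves and simplicial sheaves\<close>

lemma is_presheafD:
  assumes "is_presheaf F"
  shows "\<lbrakk>complex_space U; complex_space V; f \<in> hol_maps V U; s \<in> sec F U\<rbrakk> \<Longrightarrow> res F V U f s \<in> sec F V"
    and "\<lbrakk>complex_space U; s \<in> sec F U\<rbrakk> \<Longrightarrow> res F U U (\<lambda>x \<in> cpoints U. x) s = s"
    and "\<lbrakk>complex_space U; complex_space V; complex_space W; f \<in> hol_maps V U; g \<in> hol_maps W V; s \<in> sec F U\<rbrakk>
      \<Longrightarrow> res F W V g (res F V U f s) = res F W U (compose (cpoints W) f g) s"
proof -
  have "\<forall>U V f. complex_space U \<and> complex_space V \<and> f \<in> hol_maps V U \<longrightarrow> res F V U f \<in> sec F U \<rightarrow> sec F V"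
    using assms unfolding is_presheaf_def by (elim conjE)
  then show "\<lbrakk>complex_space U; complex_space V; f \<in> hol_maps V U; s \<in> sec F U\<rbrakk> \<Longrightarrow> res F V U f s \<in> sec F V"
    by (simp add: Pi_iff)
  show "\<lbrakk>complex_space U; s \<in> sec F U\<rbrakk> \<Longrightarrow> res F U U (\<lambda>x \<in> cpoints U. x) s = s"
    using assms unfolding is_presheaf_def by (elim conjE) simp
  show "\<lbrakk>complex_space U; complex_space V; complex_space W; f \<in> hol_maps V U; g \<in> hol_maps W V; s \<in> sec F U\<rbrakk>
      \<Longrightarrow> res F W V g (res F V U f s) = res F W U (compose (cpoints W) f g) s"
    using assms unfolding is_presheaf_def by (elim conjE) simp
qed

lemma is_sheafD_presheaf: "is_sheaf F \<Longrightarrow> is_presheaf F"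
  by (simp add: is_sheaf_def)

lemma is_sheafI:
  assumes "is_presheaf F"
    and "\<And>U \<V> s. \<lbrakk>complex_space U; \<And>V. V \<in> \<V> \<Longrightarrow> openin (ctop U) V; \<Union>\<V> = cpoints U;
        \<And>V. V \<in> \<V> \<Longrightarrow> s V \<in> sec F (open_subspace U V);
        \<And>V V'. V \<in> \<V> \<Longrightarrow> V' \<in> \<V> \<Longrightarrow> open_res F U V (V \<inter> V') (s V) = open_res F U V' (V \<inter> V') (s V')\<rbrakk>
      \<Longrightarrow> \<exists>t. t \<in> sec F U \<and> (\<forall>V\<in>\<V>. res F (open_subspace U V) U (\<lambda>x\<in>V. x) t = s V)"
    and "\<And>U \<V> t t'. \<lbrakk>complex_space U; \<And>V. V \<in> \<V> \<Longrightarrow> openin (ctop U) V; \<Union>\<V> = cpoints U; t \<in> sec F U; t' \<in> sec F U;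
        \<And>V. V \<in> \<V> \<Longrightarrow> res F (open_subspace U V) U (\<lambda>x\<in>V. x) t = res F (open_subspace U V) U (\<lambda>x\<in>V. x) t'\<rbrakk>
      \<Longrightarrow> t = t'"
  shows "is_sheaf F"
  unfolding is_sheaf_def
proof (intro conjI assms(1) allI impI; elim conjE)
  fix U \<V> s
  assume a: "complex_space U" "\<forall>V\<in>\<V>. openin (ctop U) V" "\<Union>\<V> = cpoints U"
    "\<forall>V\<in>\<V>. s V \<in> sec F (open_subspace U V)"
    "\<forall>V\<in>\<V>. \<forall>V'\<in>\<V>. open_res F U V (V \<inter> V') (s V) = open_res F U V' (V \<inter> V') (s V')"
  have "\<exists>t. t \<in> sec F U \<and> (\<forall>V\<in>\<V>. res F (open_subspace U V) U (\<lambda>x\<in>V. x) t = s V)"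
    by (rule assms(2)[OF a(1) a(2)[rule_format] a(3) a(4)[rule_format] a(5)[rule_format]])
  then obtain t where t: "t \<in> sec F U" "\<forall>V\<in>\<V>. res F (open_subspace U V) U (\<lambda>x\<in>V. x) t = s V" by blast
  show "\<exists>!t. t \<in> sec F U \<and> (\<forall>V\<in>\<V>. res F (open_subspace U V) U (\<lambda>x\<in>V. x) t = s V)"
  proof (rule ex1I[of _ t])
    fix t' assume t': "t' \<in> sec F U \<and> (\<forall>V\<in>\<V>. res F (open_subspace U V) U (\<lambda>x\<in>V. x) t' = s V)"
    show "t' = t"
      by (rule assms(3)[OF a(1) _ a(3)]) (use a(2) t t' in simp_all)
  qed (use t in simp)
qed

text \<open>Uniqueness is extracted from the \<open>\<exists>!\<close> of the sheaf axiom by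
  applying it to the family of restrictions of \<open>t\<close>.\<close>

lemma is_sheafD:
  assumes "is_sheaf F" "complex_space U" "\<And>V. V \<in> \<V> \<Longrightarrow> openin (ctop U) V" "\<Union>\<V> = cpoints U"
  shows "\<lbrakk>\<And>V. V \<in> \<V> \<Longrightarrow> s V \<in> sec F (open_subspace U V);
        \<And>V V'. V \<in> \<V> \<Longrightarrow> V' \<in> \<V> \<Longrightarrow> open_res F U V (V \<inter> V') (s V) = open_res F U V' (V \<inter> V') (s V')\<rbrakk>
      \<Longrightarrow> \<exists>t. t \<in> sec F U \<and> (\<forall>V\<in>\<V>. res F (open_subspace U V) U (\<lambda>x\<in>V. x) t = s V)"
    and "\<lbrakk>t \<in> sec F U; t' \<in> sec F U;
        \<And>V. V \<in> \<V> \<Longrightarrow> res F (open_subspace U V) U (\<lambda>x\<in>V. x) t = res F (open_subspace U V) U (\<lambda>x\<in>V. x) t'\<rbrakk>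
      \<Longrightarrow> t = t'"
proof -
  have *: "\<exists>!t. t \<in> sec F U \<and> (\<forall>V\<in>\<V>. res F (open_subspace U V) U (\<lambda>x\<in>V. x) t = s V)"
    if "\<And>V. V \<in> \<V> \<Longrightarrow> s V \<in> sec F (open_subspace U V)"
        "\<And>V V'. V \<in> \<V> \<Longrightarrow> V' \<in> \<V> \<Longrightarrow> open_res F U V (V \<inter> V') (s V) = open_res F U V' (V \<inter> V') (s V')" for s
  proof -
    have "(complex_space U \<and> (\<forall>V\<in>\<V>. openin (ctop U) V) \<and> \<Union>\<V> = cpoints U \<and>
        (\<forall>V\<in>\<V>. s V \<in> sec F (open_subspace U V)) \<and>
        (\<forall>V\<in>\<V>. \<forall>V'\<in>\<V>. open_res F U V (V \<inter> V') (s V) = open_res F U V' (V \<inter> V') (s V'))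
        \<longrightarrow> (\<exists>!t. t \<in> sec F U \<and> (\<forall>V\<in>\<V>. res F (open_subspace U V) U (\<lambda>x\<in>V. x) t = s V)))"
      using assms(1) unfolding is_sheaf_def by (elim conjE) (erule allE, erule allE, erule allE)
    then show ?thesis
    proof (rule mp)
      show "complex_space U \<and> (\<forall>V\<in>\<V>. openin (ctop U) V) \<and> \<Union>\<V> = cpoints U \<and>
        (\<forall>V\<in>\<V>. s V \<in> sec F (open_subspace U V)) \<and>
        (\<forall>V\<in>\<V>. \<forall>V'\<in>\<V>. open_res F U V (V \<inter> V') (s V) = open_res F U V' (V \<inter> V') (s V'))"
        by (intro conjI ballI assms(2-4) that)
    qed
  qed
  show "\<exists>t. t \<in> sec F U \<and> (\<forall>V\<in>\<V>. res F (open_subspace U V) U (\<lambda>x\<in>V. x) t = s V)"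
    if "\<And>V. V \<in> \<V> \<Longrightarrow> s V \<in> sec F (open_subspace U V)"
      "\<And>V V'. V \<in> \<V> \<Longrightarrow> V' \<in> \<V> \<Longrightarrow> open_res F U V (V \<inter> V') (s V) = open_res F U V' (V \<inter> V') (s V')"
    using *[OF that] by (rule ex1_implies_ex)
  note P = is_presheafD[OF is_sheafD_presheaf[OF assms(1)]]
  have fs: "function_sheaf U" using complex_spaceD(2)[OF assms(2)] .
  have os: "complex_space (open_subspace U V)" "(\<lambda>x\<in>V. x) \<in> hol_maps (open_subspace U V) U" if "V \<in> \<V>" for V
    using complex_space_open_subspace[OF assms(2) assms(3)[OF that]] hol_maps_inclusion_whole[OF fs assms(3)[OF that]] .
  assume t: "t \<in> sec F U" "t' \<in> sec F U"
    and eq: "\<And>V. V \<in> \<V> \<Longrightarrow> res F (open_subspace U V) U (\<lambda>x\<in>V. x) t = res F (open_subspace U V) U (\<lambda>x\<in>V. x) t'"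
  let ?s = "\<lambda>V. res F (open_subspace U V) U (\<lambda>x\<in>V. x) t"
  \<comment> \<open>By functoriality the restricted restriction is the restriction of
    \<open>t\<close> to the overlap, so the family matches.\<close>
  have comp: "open_res F U V (V \<inter> V') (?s V) = res F (open_subspace U (V \<inter> V')) U (\<lambda>x\<in>V \<inter> V'. x) t"
    if V: "V \<in> \<V>" and W: "openin (ctop U) (V \<inter> V')" for V V'
  proof -
    have "compose (cpoints (open_subspace U (V \<inter> V'))) (\<lambda>x\<in>V. x) (\<lambda>x\<in>V \<inter> V'. x) = (\<lambda>x\<in>V \<inter> V'. x)"
      unfolding cpoints_open_subspace[OF W] by (auto simp: compose_def fun_eq_iff)
    then show ?thesis
      unfolding open_res_def
      using P(3)[OF assms(2) os(1)[OF V] complex_space_open_subspace[OF assms(2) W] os(2)[OF V]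
          hol_maps_inclusion[OF fs assms(3)[OF V] W] t(1)] by simp
  qed
  have "\<exists>!u. u \<in> sec F U \<and> (\<forall>V\<in>\<V>. res F (open_subspace U V) U (\<lambda>x\<in>V. x) u = ?s V)"
  proof (rule *)
    show "?s V \<in> sec F (open_subspace U V)" if "V \<in> \<V>" for V
      using P(1)[OF assms(2) os(1)[OF that] os(2)[OF that] t(1)] .
    fix V V' assume V: "V \<in> \<V>" "V' \<in> \<V>"
    have "openin (ctop U) (V \<inter> V')" using assms(3) V by blast
    then show "open_res F U V (V \<inter> V') (?s V) = open_res F U V' (V \<inter> V') (?s V')"
      using comp[OF V(1), of V'] comp[OF V(2), of V] by (simp add: Int_commute)
  qed
  then show "t = t'" using t eq by (elim ex1E) (metis (no_types, lifting))
qed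

lemma compose_ident_right:
  "f \<in> extensional S \<Longrightarrow> compose S f (\<lambda>x\<in>S. x) = f"
  by (auto simp: compose_def fun_eq_iff extensional_def)

lemma compose_inclusion: "compose W f (\<lambda>x\<in>W. x) = restrict f W"
  by (auto simp: compose_def fun_eq_iff)

lemma sec_represented [simp]: "sec (represented X) U = Mor ` hol_maps U X"
  and res_represented [simp]: "res (represented X) V U f = precomp_elem (cpoints V) f"
  by (simp_all add: represented_def)

lemma is_sheaf_represented:
  fixes X :: "'p cspace"
  shows "is_sheaf (represented X :: ('p, ('p, 'w) elem) sheaf)" (is "is_sheaf ?F")
proof (rule is_sheafI)
  show "is_presheaf ?F"
    unfolding is_presheaf_def
  proof (intro conjI allI impI ballI; (elim conjE)?)
    fix U V :: "'p cspace" and f assume "f \<in> hol_maps V U"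
    then show "res ?F V U f \<in> sec ?F U \<rightarrow> sec ?F V"
      by (auto intro: hol_maps_compose)
  next
    fix U :: "'p cspace" and s :: "('p, 'w) elem" assume "s \<in> sec ?F U"
    then obtain g where "s = Mor g" "g \<in> hol_maps U X" by auto
    then show "res ?F U U (\<lambda>x \<in> cpoints U. x) s = s"
      using compose_ident_right[OF hol_mapsD(1)] by simp
  next
    fix U V W :: "'p cspace" and f g and s :: "('p, 'w) elem"
    assume fg: "f \<in> hol_maps V U" "g \<in> hol_maps W V" and "s \<in> sec ?F U"
    then obtain h where h: "s = Mor h" by auto
    have "compose (cpoints W) h (compose (cpoints W) f g) = compose (cpoints W) (compose (cpoints V) h f) g"
      using hol_mapsD(4)[OF fg(2)] by (auto simp: compose_def fun_eq_iff)
    then show "res ?F W U (compose (cpoints W) f g) s = res ?F W V g (res ?F V U f s)"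
      by (simp add: h)
  qed
next
  fix U \<V> and s :: "'p set \<Rightarrow> ('p, 'w) elem"
  assume U: "complex_space U" and V: "\<And>V. V \<in> \<V> \<Longrightarrow> openin (ctop U) V" "\<Union>\<V> = cpoints U"
    and s: "\<And>V. V \<in> \<V> \<Longrightarrow> s V \<in> sec ?F (open_subspace U V)"
    and eq: "\<And>V V'. V \<in> \<V> \<Longrightarrow> V' \<in> \<V> \<Longrightarrow>
       open_res ?F U V (V \<inter> V') (s V) = open_res ?F U V' (V \<inter> V') (s V')"
  have "\<forall>V\<in>\<V>. \<exists>m. s V = Mor m \<and> m \<in> hol_maps (open_subspace U V) X" using s by auto
  then obtain m where m: "\<And>V. V \<in> \<V> \<Longrightarrow> s V = Mor (m V)" "\<And>V. V \<in> \<V> \<Longrightarrow> m V \<in> hol_maps (open_subspace U V) X"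
    by (metis)
  have agree: "m V x = m V' x" if VV: "V \<in> \<V>" "V' \<in> \<V>" "x \<in> V" "x \<in> V'" for V V' x
  proof -
    have o: "openin (ctop U) (V \<inter> V')" using V(1) VV by blast
    have "restrict (m V) (V \<inter> V') = restrict (m V') (V \<inter> V')"
      using eq[OF VV(1,2)] unfolding open_res_def res_represented m(1)[OF VV(1)] m(1)[OF VV(2)]
        precomp_elem.simps elem.inject cpoints_open_subspace[OF o] compose_inclusion .
    from fun_cong[OF this, of x] show ?thesis using VV by simp
  qed
  \<comment> \<open>A covering set is chosen at each point; \<open>agree\<close> makes the choice
    immaterial.\<close>
  define t where "t = (\<lambda>x\<in>cpoints U. m (SOME V. V \<in> \<V> \<and> x \<in> V) x)"
  have t: "restrict t V = m V" if "V \<in> \<V>" for V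
  proof
    fix x
    show "restrict t V x = m V x"
    proof (cases "x \<in> V")
      case True
      let ?V = "SOME V. V \<in> \<V> \<and> x \<in> V"
      have "?V \<in> \<V> \<and> x \<in> ?V" by (rule someI[of _ V]) (use that True in simp)
      moreover have "x \<in> cpoints U" using True that V by blast
      ultimately show ?thesis using agree[of ?V V x] that True by (simp add: t_def)
    next
      case False
      have "m V \<in> extensional V"
        using hol_mapsD(1)[OF m(2)[OF that]] cpoints_open_subspace[OF V(1)[OF that]] by simp
      then show ?thesis using False by (simp add: extensional_def)
    qed
  qed
  have "t \<in> hol_maps U X"
  proof (rule hol_maps_glue[OF complex_spaceD(2)[OF U]])
    fix x assume "x \<in> cpoints U"
    then obtain V0 where "V0 \<in> \<V>" "x \<in> V0" using V(2) by blast
    then show "\<exists>V. openin (ctop U) V \<and> x \<in> V \<and> restrict t V \<in> hol_maps (open_subspace U V) X"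
      using V(1) m(2) t by (intro exI[of _ V0]) simp
  qed (simp add: t_def)
  moreover have "res ?F (open_subspace U V) U (\<lambda>x\<in>V. x) (Mor t) = s V" if "V \<in> \<V>" for V
    unfolding res_represented precomp_elem.simps cpoints_open_subspace[OF V(1)[OF that]] compose_inclusion
    using t[OF that] m(1)[OF that] by simp
  ultimately show "\<exists>t. t \<in> sec ?F U \<and>
      (\<forall>V\<in>\<V>. res ?F (open_subspace U V) U (\<lambda>x\<in>V. x) t = s V)"
    by (intro exI[of _ "Mor t"]) auto
next
  fix U \<V> and t t' :: "('p, 'w) elem"
  assume U: "complex_space U" and V: "\<And>V. V \<in> \<V> \<Longrightarrow> openin (ctop U) V" "\<Union>\<V> = cpoints U"
    and t: "t \<in> sec ?F U" "t' \<in> sec ?F U"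
    and eq: "\<And>V. V \<in> \<V> \<Longrightarrow> res ?F (open_subspace U V) U (\<lambda>x\<in>V. x) t =
       res ?F (open_subspace U V) U (\<lambda>x\<in>V. x) t'"
  obtain m m' where m: "t = Mor m" "m \<in> hol_maps U X" "t' = Mor m'" "m' \<in> hol_maps U X" using t by auto
  have "m = m'"
  proof (rule extensionalityI[OF hol_mapsD(1)[OF m(2)] hol_mapsD(1)[OF m(4)]])
    fix x assume "x \<in> cpoints U"
    then obtain V0 where V0: "V0 \<in> \<V>" "x \<in> V0" using V(2) by blast
    have "restrict m V0 = restrict m' V0"
      using eq[OF V0(1)] unfolding m(1,3) res_represented precomp_elem.simps elem.inject
        cpoints_open_subspace[OF V(1)[OF V0(1)]] compose_inclusion .
    from fun_cong[OF this, of x] show "m x = m' x" using V0(2) by simp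
  qed
  then show "t = t'" using m by simp
qed

lemma const_ssheaf_simps [simp]:
  "level (const_ssheaf F) n = F" "fc (const_ssheaf F) n i U s = s" "dg (const_ssheaf F) n i U s = s"
  by (simp_all add: const_ssheaf_def)

lemma simplicial_sheaf_const_ssheaf:
  assumes "is_sheaf F"
  shows "simplicial_sheaf (const_ssheaf F)"
  using assms unfolding simplicial_sheaf_def
  by (simp add: simplicial_set_def sections_sset_def const_ssheaf_def)

lemma simplicial_sheafD:
  assumes "simplicial_sheaf A"
  shows "is_sheaf (level A n)" "is_presheaf (level A n)"
    and "\<lbrakk>complex_space U; i \<le> Suc n; s \<in> sec (level A (Suc n)) U\<rbrakk> \<Longrightarrow> fc A n i U s \<in> sec (level A n) U"
    and "\<lbrakk>complex_space U; i \<le> n; s \<in> sec (level A n) U\<rbrakk> \<Longrightarrow> dg A n i U s \<in> sec (level A (Suc n)) U"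
    and "\<lbrakk>complex_space U; complex_space V; f \<in> hol_maps V U; i \<le> Suc n; s \<in> sec (level A (Suc n)) U\<rbrakk>
      \<Longrightarrow> fc A n i V (res (level A (Suc n)) V U f s) = res (level A n) V U f (fc A n i U s)"
    and "\<lbrakk>complex_space U; complex_space V; f \<in> hol_maps V U; i \<le> n; s \<in> sec (level A n) U\<rbrakk>
      \<Longrightarrow> dg A n i V (res (level A n) V U f s) = res (level A (Suc n)) V U f (dg A n i U s)"
proof -
  show "is_sheaf (level A n)" using assms unfolding simplicial_sheaf_def by blast
  then show "is_presheaf (level A n)" by (rule is_sheafD_presheaf)
  have ss: "simplicial_set (sections_sset A U)" if "complex_space U" for U
    using assms that unfolding simplicial_sheaf_def by blast
  have fd: "\<forall>i\<le>Suc n. fc A n i U \<in> sec (level A (Suc n)) U \<rightarrow> sec (level A n) U"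
      "\<forall>i\<le>n. dg A n i U \<in> sec (level A n) U \<rightarrow> sec (level A (Suc n)) U" if "complex_space U"
    using ss[OF that] unfolding simplicial_set_def sections_sset_def by (elim conjE, simp)+
  show "\<lbrakk>complex_space U; i \<le> Suc n; s \<in> sec (level A (Suc n)) U\<rbrakk> \<Longrightarrow> fc A n i U s \<in> sec (level A n) U"
    using fd(1) by (simp add: Pi_iff)
  show "\<lbrakk>complex_space U; i \<le> n; s \<in> sec (level A n) U\<rbrakk> \<Longrightarrow> dg A n i U s \<in> sec (level A (Suc n)) U"
    using fd(2) by (simp add: Pi_iff)
  show "\<lbrakk>complex_space U; complex_space V; f \<in> hol_maps V U; i \<le> Suc n; s \<in> sec (level A (Suc n)) U\<rbrakk>
      \<Longrightarrow> fc A n i V (res (level A (Suc n)) V U f s) = res (level A n) V U f (fc A n i U s)"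
    using assms unfolding simplicial_sheaf_def by (elim conjE) simp
  show "\<lbrakk>complex_space U; complex_space V; f \<in> hol_maps V U; i \<le> n; s \<in> sec (level A n) U\<rbrakk>
      \<Longrightarrow> dg A n i V (res (level A n) V U f s) = res (level A (Suc n)) V U f (dg A n i U s)"
    using assms unfolding simplicial_sheaf_def by (elim conjE) simp
qed

section \<open>Products of simplicial sheaves\<close>

lemma prod_ssheaf_simps:
  "sec (level (prod_ssheaf A B) n) U = {Pr a b | a b. a \<in> sec (level A n) U \<and> b \<in> sec (level B n) U}"
  "res (level (prod_ssheaf A B) n) V U f (Pr a b) = Pr (res (level A n) V U f a) (res (level B n) V U f b)"
  "fc (prod_ssheaf A B) n i U (Pr a b) = Pr (fc A n i U a) (fc B n i U b)"
  "dg (prod_ssheaf A B) n i U (Pr a b) = Pr (dg A n i U a) (dg B n i U b)"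
  by (simp_all add: prod_ssheaf_def)

lemma sec_prod_ssheafE:
  assumes "s \<in> sec (level (prod_ssheaf A B) n) U"
  obtains a b where "s = Pr a b" "a \<in> sec (level A n) U" "b \<in> sec (level B n) U"
  using assms by (auto simp: prod_ssheaf_simps)

lemma simplicial_set_prod:
  assumes "simplicial_set (sections_sset A U)" "simplicial_set (sections_sset B U)"
  shows "simplicial_set (sections_sset (prod_ssheaf A B) U)"
  using assms unfolding simplicial_set_def sections_sset_def
  by (simp add: prod_ssheaf_def Pi_iff; safe; simp)

lemma is_sheaf_prod:
  fixes A B :: "('p, ('p, 'w) elem) ssheaf"
  assumes A: "is_sheaf (level A n)" and B: "is_sheaf (level B n)"
  shows "is_sheaf (level (prod_ssheaf A B) n)"
proof (rule is_sheafI)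
  note PA = is_presheafD[OF is_sheafD_presheaf[OF A]] and PB = is_presheafD[OF is_sheafD_presheaf[OF B]]
  show "is_presheaf (level (prod_ssheaf A B) n)"
    unfolding is_presheaf_def
  proof (intro conjI allI impI ballI funcsetI; (elim conjE)?)
    fix U V :: "'p cspace" and f s assume U: "complex_space U" "complex_space V" "f \<in> hol_maps V U" and s: "s \<in> sec (level (prod_ssheaf A B) n) U"
    obtain a b where ab: "s = Pr a b" "a \<in> sec (level A n) U" "b \<in> sec (level B n) U"
      using s by (rule sec_prod_ssheafE)
    show "res (level (prod_ssheaf A B) n) V U f s \<in> sec (level (prod_ssheaf A B) n) V"
      using PA(1)[OF U ab(2)] PB(1)[OF U ab(3)] by (simp add: ab(1) prod_ssheaf_simps)
  next
    fix U :: "'p cspace" and s assume U: "complex_space U" and s: "s \<in> sec (level (prod_ssheaf A B) n) U"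
    obtain a b where ab: "s = Pr a b" "a \<in> sec (level A n) U" "b \<in> sec (level B n) U"
      using s by (rule sec_prod_ssheafE)
    show "res (level (prod_ssheaf A B) n) U U (\<lambda>x\<in>cpoints U. x) s = s"
      using PA(2)[OF U ab(2)] PB(2)[OF U ab(3)] by (simp add: ab(1) prod_ssheaf_simps)
  next
    fix U V W :: "'p cspace" and f g s
    assume U: "complex_space U" "complex_space V" "complex_space W" "f \<in> hol_maps V U" "g \<in> hol_maps W V"
      and s: "s \<in> sec (level (prod_ssheaf A B) n) U"
    obtain a b where ab: "s = Pr a b" "a \<in> sec (level A n) U" "b \<in> sec (level B n) U"
      using s by (rule sec_prod_ssheafE)
    show "res (level (prod_ssheaf A B) n) W U (compose (cpoints W) f g) s =
        res (level (prod_ssheaf A B) n) W V g (res (level (prod_ssheaf A B) n) V U f s)"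
      using PA(3)[OF U ab(2)] PB(3)[OF U ab(3)] by (simp add: ab(1) prod_ssheaf_simps)
  qed
next
  fix U \<V> s
  assume U: "complex_space U" and V: "\<And>V. V \<in> \<V> \<Longrightarrow> openin (ctop U) V" "\<Union>\<V> = cpoints U"
    and s: "\<And>V. V \<in> \<V> \<Longrightarrow> s V \<in> sec (level (prod_ssheaf A B) n) (open_subspace U V)"
    and eq: "\<And>V V'. V \<in> \<V> \<Longrightarrow> V' \<in> \<V> \<Longrightarrow> open_res (level (prod_ssheaf A B) n) U V (V \<inter> V') (s V) =
      open_res (level (prod_ssheaf A B) n) U V' (V \<inter> V') (s V')"
  have "\<forall>V\<in>\<V>. \<exists>a b. s V = Pr a b \<and> a \<in> sec (level A n) (open_subspace U V) \<and> b \<in> sec (level B n) (open_subspace U V)"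
    using s by (blast elim: sec_prod_ssheafE)
  then obtain a b where ab: "\<And>V. V \<in> \<V> \<Longrightarrow> s V = Pr (a V) (b V)"
      "\<And>V. V \<in> \<V> \<Longrightarrow> a V \<in> sec (level A n) (open_subspace U V)" "\<And>V. V \<in> \<V> \<Longrightarrow> b V \<in> sec (level B n) (open_subspace U V)"
    unfolding bchoice_iff by (elim exE) simp
  have eq': "open_res (level A n) U V (V \<inter> V') (a V) = open_res (level A n) U V' (V \<inter> V') (a V') \<and>
      open_res (level B n) U V (V \<inter> V') (b V) = open_res (level B n) U V' (V \<inter> V') (b V')"
    if "V \<in> \<V>" "V' \<in> \<V>" for V V'
    using eq[OF that] ab(1) that by (simp add: open_res_def prod_ssheaf_simps)
  obtain ta where ta: "ta \<in> sec (level A n) U" "\<forall>V\<in>\<V>. res (level A n) (open_subspace U V) U (\<lambda>x\<in>V. x) ta = a V"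
    using is_sheafD(1)[OF A U V, where s = a] ab(2) eq' by auto
  obtain tb where tb: "tb \<in> sec (level B n) U" "\<forall>V\<in>\<V>. res (level B n) (open_subspace U V) U (\<lambda>x\<in>V. x) tb = b V"
    using is_sheafD(1)[OF B U V, where s = b] ab(3) eq' by auto
  show "\<exists>t. t \<in> sec (level (prod_ssheaf A B) n) U \<and>
      (\<forall>V\<in>\<V>. res (level (prod_ssheaf A B) n) (open_subspace U V) U (\<lambda>x\<in>V. x) t = s V)"
    using ta tb ab(1) by (intro exI[of _ "Pr ta tb"]) (simp add: prod_ssheaf_simps)
next
  fix U \<V> t t'
  assume U: "complex_space U" and V: "\<And>V. V \<in> \<V> \<Longrightarrow> openin (ctop U) V" "\<Union>\<V> = cpoints U"
    and t: "t \<in> sec (level (prod_ssheaf A B) n) U" "t' \<in> sec (level (prod_ssheaf A B) n) U"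
    and eq: "\<And>V. V \<in> \<V> \<Longrightarrow> res (level (prod_ssheaf A B) n) (open_subspace U V) U (\<lambda>x\<in>V. x) t =
      res (level (prod_ssheaf A B) n) (open_subspace U V) U (\<lambda>x\<in>V. x) t'"
  obtain a b where ab: "t = Pr a b" "a \<in> sec (level A n) U" "b \<in> sec (level B n) U" using t(1) by (rule sec_prod_ssheafE)
  obtain a' b' where ab': "t' = Pr a' b'" "a' \<in> sec (level A n) U" "b' \<in> sec (level B n) U" using t(2) by (rule sec_prod_ssheafE)
  have "a = a'"
    by (rule is_sheafD(2)[OF A U V ab(2) ab'(2)]) (use eq in \<open>simp_all add: ab(1) ab'(1) prod_ssheaf_simps\<close>)
  moreover have "b = b'"
    by (rule is_sheafD(2)[OF B U V ab(3) ab'(3)]) (use eq in \<open>simp_all add: ab(1) ab'(1) prod_ssheaf_simps\<close>)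
  ultimately show "t = t'" by (simp add: ab(1) ab'(1))
qed

lemma simplicial_sheaf_prod_ssheaf:
  fixes A B :: "('p, ('p, 'w) elem) ssheaf"
  assumes A: "simplicial_sheaf A" and B: "simplicial_sheaf B"
  shows "simplicial_sheaf (prod_ssheaf A B)"
  unfolding simplicial_sheaf_def
proof (intro conjI allI impI ballI; (elim conjE)?)
  show "is_sheaf (level (prod_ssheaf A B) n)" for n
    using is_sheaf_prod simplicial_sheafD(1)[OF A] simplicial_sheafD(1)[OF B] .
  show "simplicial_set (sections_sset (prod_ssheaf A B) U)" if "complex_space U" for U :: "'p cspace"
    by (rule simplicial_set_prod) (use A B that in \<open>auto simp: simplicial_sheaf_def\<close>)
next
  fix U V :: "'p cspace" and f n i s
  assume U: "complex_space U" "complex_space V" "f \<in> hol_maps V U" and i: "i \<le> Suc n"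
    and s: "s \<in> sec (level (prod_ssheaf A B) (Suc n)) U"
  obtain a b where ab: "s = Pr a b" "a \<in> sec (level A (Suc n)) U" "b \<in> sec (level B (Suc n)) U"
    using s by (rule sec_prod_ssheafE)
  show "fc (prod_ssheaf A B) n i V (res (level (prod_ssheaf A B) (Suc n)) V U f s) =
      res (level (prod_ssheaf A B) n) V U f (fc (prod_ssheaf A B) n i U s)"
    using simplicial_sheafD(5)[OF A U i ab(2)] simplicial_sheafD(5)[OF B U i ab(3)]
    by (simp add: ab(1) prod_ssheaf_simps)
next
  fix U V :: "'p cspace" and f n i s
  assume U: "complex_space U" "complex_space V" "f \<in> hol_maps V U" and i: "i \<le> n"
    and s: "s \<in> sec (level (prod_ssheaf A B) n) U"
  obtain a b where ab: "s = Pr a b" "a \<in> sec (level A n) U" "b \<in> sec (level B n) U"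
    using s by (rule sec_prod_ssheafE)
  show "dg (prod_ssheaf A B) n i V (res (level (prod_ssheaf A B) n) V U f s) =
      res (level (prod_ssheaf A B) (Suc n)) V U f (dg (prod_ssheaf A B) n i U s)"
    using simplicial_sheafD(6)[OF A U i ab(2)] simplicial_sheafD(6)[OF B U i ab(3)]
    by (simp add: ab(1) prod_ssheaf_simps)
qed

section \<open>Morphisms of simplicial sheaves and their composition\<close>

lemma ssheaf_homD:
  assumes "\<phi> \<in> ssheaf_hom A B"
  shows "\<phi> n \<in> extensional (Collect complex_space)"
    and "complex_space U \<Longrightarrow> \<phi> n U \<in> extensional (sec (level A n) U)"
    and "\<lbrakk>complex_space U; s \<in> sec (level A n) U\<rbrakk> \<Longrightarrow> \<phi> n U s \<in> sec (level B n) U"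
    and "\<lbrakk>complex_space U; complex_space V; f \<in> hol_maps V U; s \<in> sec (level A n) U\<rbrakk>
      \<Longrightarrow> \<phi> n V (res (level A n) V U f s) = res (level B n) V U f (\<phi> n U s)"
    and "\<lbrakk>complex_space U; i \<le> Suc n; s \<in> sec (level A (Suc n)) U\<rbrakk>
      \<Longrightarrow> \<phi> n U (fc A n i U s) = fc B n i U (\<phi> (Suc n) U s)"
    and "\<lbrakk>complex_space U; i \<le> n; s \<in> sec (level A n) U\<rbrakk>
      \<Longrightarrow> \<phi> (Suc n) U (dg A n i U s) = dg B n i U (\<phi> n U s)"
proof -
  have P: "\<phi> n \<in> (\<Pi>\<^sub>E U \<in> Collect complex_space. sec (level A n) U \<rightarrow>\<^sub>E sec (level B n) U)" for n
    using assms by (simp add: ssheaf_hom_def)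
  show "\<phi> n \<in> extensional (Collect complex_space)" using P by (simp add: PiE_def)
  have Q: "\<phi> n U \<in> sec (level A n) U \<rightarrow>\<^sub>E sec (level B n) U" if "complex_space U"
    using P[of n] that by (auto simp: PiE_def Pi_def)
  show "complex_space U \<Longrightarrow> \<phi> n U \<in> extensional (sec (level A n) U)" using Q by (simp add: PiE_def)
  show "\<lbrakk>complex_space U; s \<in> sec (level A n) U\<rbrakk> \<Longrightarrow> \<phi> n U s \<in> sec (level B n) U"
    using Q by (simp add: PiE_def Pi_def)
  show "\<lbrakk>complex_space U; complex_space V; f \<in> hol_maps V U; s \<in> sec (level A n) U\<rbrakk>
      \<Longrightarrow> \<phi> n V (res (level A n) V U f s) = res (level B n) V U f (\<phi> n U s)"
    using assms unfolding ssheaf_hom_def mem_Collect_eq by (elim conjE) simp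
  show "\<lbrakk>complex_space U; i \<le> Suc n; s \<in> sec (level A (Suc n)) U\<rbrakk>
      \<Longrightarrow> \<phi> n U (fc A n i U s) = fc B n i U (\<phi> (Suc n) U s)"
    using assms unfolding ssheaf_hom_def mem_Collect_eq by (elim conjE) simp
  show "\<lbrakk>complex_space U; i \<le> n; s \<in> sec (level A n) U\<rbrakk>
      \<Longrightarrow> \<phi> (Suc n) U (dg A n i U s) = dg B n i U (\<phi> n U s)"
    using assms unfolding ssheaf_hom_def mem_Collect_eq by (elim conjE) simp
qed

lemma ssheaf_homI:
  assumes "\<And>n. \<phi> n \<in> extensional (Collect complex_space)"
    and "\<And>n U. complex_space U \<Longrightarrow> \<phi> n U \<in> extensional (sec (level A n) U)"
    and "\<And>n U s. \<lbrakk>complex_space U; s \<in> sec (level A n) U\<rbrakk> \<Longrightarrow> \<phi> n U s \<in> sec (level B n) U"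
    and "\<And>n U V f s. \<lbrakk>complex_space U; complex_space V; f \<in> hol_maps V U; s \<in> sec (level A n) U\<rbrakk>
      \<Longrightarrow> \<phi> n V (res (level A n) V U f s) = res (level B n) V U f (\<phi> n U s)"
    and "\<And>n U i s. \<lbrakk>complex_space U; i \<le> Suc n; s \<in> sec (level A (Suc n)) U\<rbrakk>
      \<Longrightarrow> \<phi> n U (fc A n i U s) = fc B n i U (\<phi> (Suc n) U s)"
    and "\<And>n U i s. \<lbrakk>complex_space U; i \<le> n; s \<in> sec (level A n) U\<rbrakk>
      \<Longrightarrow> \<phi> (Suc n) U (dg A n i U s) = dg B n i U (\<phi> n U s)"
  shows "\<phi> \<in> ssheaf_hom A B"
  unfolding ssheaf_hom_def mem_Collect_eq using assms by (simp add: PiE_def Pi_def)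

lemma ssheaf_hom_eqI:
  assumes "\<phi> \<in> ssheaf_hom A B" "\<psi> \<in> ssheaf_hom A B"
    and "\<And>n U s. \<lbrakk>complex_space U; s \<in> sec (level A n) U\<rbrakk> \<Longrightarrow> \<phi> n U s = \<psi> n U s"
  shows "\<phi> = \<psi>"
proof
  fix n
  show "\<phi> n = \<psi> n"
  proof (rule extensionalityI[OF ssheaf_homD(1)[OF assms(1)] ssheaf_homD(1)[OF assms(2)]])
    fix U assume "U \<in> Collect (complex_space :: 'a cspace \<Rightarrow> bool)"
    then have U: "complex_space U" by simp
    show "\<phi> n U = \<psi> n U"
      by (rule extensionalityI[OF ssheaf_homD(2)[OF assms(1) U] ssheaf_homD(2)[OF assms(2) U] assms(3)[OF U]])
  qed
qed

lemma ssheaf_cat_simps [simp]: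
  "Ob ssheaf_cat = Collect simplicial_sheaf" "Hom ssheaf_cat = ssheaf_hom"
  by (simp_all add: ssheaf_cat_def)

lemma Idt_ssheaf_cat [simp]:
  "complex_space U \<Longrightarrow> s \<in> sec (level A n) U \<Longrightarrow> Idt ssheaf_cat A n U s = s"
  by (simp add: ssheaf_cat_def)

lemma Cmp_ssheaf_cat [simp]:
  "complex_space U \<Longrightarrow> s \<in> sec (level A n) U \<Longrightarrow> Cmp ssheaf_cat A \<psi> \<phi> n U s = \<psi> n U (\<phi> n U s)"
  by (simp add: ssheaf_cat_def compose_def)

lemma Cmp_ssheaf_hom:
  assumes A: "simplicial_sheaf A" and \<phi>: "\<phi> \<in> ssheaf_hom A B" and \<psi>: "\<psi> \<in> ssheaf_hom B D"
  shows "Cmp ssheaf_cat A \<psi> \<phi> \<in> ssheaf_hom A D"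
proof (rule ssheaf_homI)
  note a = simplicial_sheafD[OF A] and f = ssheaf_homD[OF \<phi>] and g = ssheaf_homD[OF \<psi>]
  show "Cmp ssheaf_cat A \<psi> \<phi> n \<in> extensional (Collect complex_space)" for n
    by (simp add: ssheaf_cat_def)
  show "Cmp ssheaf_cat A \<psi> \<phi> n U \<in> extensional (sec (level A n) U)" if "complex_space U" for n U
    using that by (simp add: ssheaf_cat_def compose_extensional)
  show "Cmp ssheaf_cat A \<psi> \<phi> n U s \<in> sec (level D n) U" if "complex_space U" "s \<in> sec (level A n) U" for n U s
    using that by (simp add: f(3) g(3))
  show "Cmp ssheaf_cat A \<psi> \<phi> n V (res (level A n) V U r s) = res (level D n) V U r (Cmp ssheaf_cat A \<psi> \<phi> n U s)"
    if "complex_space U" "complex_space V" "r \<in> hol_maps V U" "s \<in> sec (level A n) U" for n U V r s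
    using that by (simp add: is_presheafD(1)[OF a(2)] f(3,4) g(4))
  show "Cmp ssheaf_cat A \<psi> \<phi> n U (fc A n i U s) = fc D n i U (Cmp ssheaf_cat A \<psi> \<phi> (Suc n) U s)"
    if "complex_space U" "i \<le> Suc n" "s \<in> sec (level A (Suc n)) U" for n U i s
    using that by (simp add: a(3) f(3,5) g(5))
  show "Cmp ssheaf_cat A \<psi> \<phi> (Suc n) U (dg A n i U s) = dg D n i U (Cmp ssheaf_cat A \<psi> \<phi> n U s)"
    if "complex_space U" "i \<le> n" "s \<in> sec (level A n) U" for n U i s
    using that by (simp add: a(4) f(3,6) g(6))
qed

lemma Idt_ssheaf_hom:
  assumes A: "simplicial_sheaf A"
  shows "Idt ssheaf_cat A \<in> ssheaf_hom A A"
proof (rule ssheaf_homI)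
  note a = simplicial_sheafD[OF A]
  show "Idt ssheaf_cat A n \<in> extensional (Collect complex_space)" for n
    by (simp add: ssheaf_cat_def)
  show "Idt ssheaf_cat A n U \<in> extensional (sec (level A n) U)" if "complex_space U" for n U
    using that by (simp add: ssheaf_cat_def)
qed (simp_all add: is_presheafD(1)[OF simplicial_sheafD(2)[OF A]] simplicial_sheafD(3,4)[OF A])

section \<open>Stalks\<close>

lemma open_res_in_sec:
  assumes F: "is_presheaf F" and U: "complex_space U" and V: "openin (ctop U) V" "openin (ctop U) W" "W \<subseteq> V"
    and s: "s \<in> sec F (open_subspace U V)"
  shows "open_res F U V W s \<in> sec F (open_subspace U W)"
  unfolding open_res_def
  by (rule is_presheafD(1)[OF F complex_space_open_subspace[OF U V(1)] complex_space_open_subspace[OF U V(2)]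
        hol_maps_inclusion[OF complex_spaceD(2)[OF U] V] s])

lemma open_res_open_res:
  assumes F: "is_presheaf F" and U: "complex_space U"
    and V: "openin (ctop U) V" "openin (ctop U) W" "W \<subseteq> V" "openin (ctop U) W'" "W' \<subseteq> W"
    and s: "s \<in> sec F (open_subspace U V)"
  shows "open_res F U W W' (open_res F U V W s) = open_res F U V W' s"
proof -
  note fs = complex_spaceD(2)[OF U]
  have "compose (cpoints (open_subspace U W')) (\<lambda>x\<in>W. x) (\<lambda>x\<in>W'. x) = (\<lambda>x\<in>W'. x)"
    unfolding cpoints_open_subspace[OF V(4)] compose_inclusion using V(5) by (auto simp: fun_eq_iff)
  then show ?thesis
    unfolding open_res_def
    using is_presheafD(3)[OF F complex_space_open_subspace[OF U V(1)] complex_space_open_subspace[OF U V(2)]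
        complex_space_open_subspace[OF U V(4)] hol_maps_inclusion[OF fs V(1,2,3)] hol_maps_inclusion[OF fs V(2,4,5)] s]
    by simp
qed

lemma mem_local_sections:
  "(V, s) \<in> local_sections F U x \<longleftrightarrow> openin (ctop U) V \<and> x \<in> V \<and> s \<in> sec F (open_subspace U V)"
  by (simp add: local_sections_def)

lemma mem_germ_rel:
  "((V, s), (V', s')) \<in> germ_rel F U x \<longleftrightarrow> (V, s) \<in> local_sections F U x \<and> (V', s') \<in> local_sections F U x \<and>
     (\<exists>W. openin (ctop U) W \<and> x \<in> W \<and> W \<subseteq> V \<inter> V' \<and> open_res F U V W s = open_res F U V' W s')"
  by (simp add: germ_rel_def)

lemma germ_rel_refl: "(V, s) \<in> local_sections F U x \<Longrightarrow> ((V, s), (V, s)) \<in> germ_rel F U x"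
  unfolding mem_germ_rel mem_local_sections by blast

lemma sym_germ_rel: "sym (germ_rel F U x)"
proof (rule symI)
  fix p q assume pq: "(p, q) \<in> germ_rel F U x"
  obtain V s V' s' where e: "p = (V, s)" "q = (V', s')" by (metis prod.exhaust)
  obtain W where "openin (ctop U) W" "x \<in> W" "W \<subseteq> V \<inter> V'" "open_res F U V W s = open_res F U V' W s'"
    using pq unfolding e mem_germ_rel by blast
  then show "(q, p) \<in> germ_rel F U x"
    using pq unfolding e mem_germ_rel by (intro conjI exI[of _ W]) auto
qed

lemma trans_germ_rel:
  assumes F: "is_presheaf F" and U: "complex_space U"
  shows "trans (germ_rel F U x)"
proof (rule transI)
  fix p q r assume pq: "(p, q) \<in> germ_rel F U x" and qr: "(q, r) \<in> germ_rel F U x"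
  obtain V s V' s' V'' s'' where e: "p = (V, s)" "q = (V', s')" "r = (V'', s'')" by (metis prod.exhaust)
  obtain W where W: "openin (ctop U) W" "x \<in> W" "W \<subseteq> V \<inter> V'" "open_res F U V W s = open_res F U V' W s'"
    using pq unfolding e mem_germ_rel by blast
  obtain W' where W': "openin (ctop U) W'" "x \<in> W'" "W' \<subseteq> V' \<inter> V''" "open_res F U V' W' s' = open_res F U V'' W' s''"
    using qr unfolding e mem_germ_rel by blast
  have l: "openin (ctop U) V" "s \<in> sec F (open_subspace U V)" "openin (ctop U) V'" "s' \<in> sec F (open_subspace U V')"
      "openin (ctop U) V''" "s'' \<in> sec F (open_subspace U V'')"
    using pq qr unfolding e mem_germ_rel mem_local_sections by auto
  have o: "openin (ctop U) (W \<inter> W')" using W W' by blast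
  have "open_res F U V (W \<inter> W') s = open_res F U W (W \<inter> W') (open_res F U V W s)"
    by (rule open_res_open_res[symmetric, OF F U l(1) W(1) _ o _ l(2)]) (use W in auto)
  also have "\<dots> = open_res F U V' (W \<inter> W') s'"
    unfolding W(4) by (rule open_res_open_res[OF F U l(3) W(1) _ o _ l(4)]) (use W in auto)
  also have "\<dots> = open_res F U W' (W \<inter> W') (open_res F U V' W' s')"
    by (rule open_res_open_res[symmetric, OF F U l(3) W'(1) _ o _ l(4)]) (use W' in auto)
  also have "\<dots> = open_res F U V'' (W \<inter> W') s''"
    unfolding W'(4) by (rule open_res_open_res[OF F U l(5) W'(1) _ o _ l(6)]) (use W' in auto)
  finally show "(p, r) \<in> germ_rel F U x"
    using pq qr W W' o unfolding e mem_germ_rel by (intro conjI exI[of _ "W \<inter> W'"]) auto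
qed

definition germ :: "('p, 'v) sheaf \<Rightarrow> 'p cspace \<Rightarrow> 'p \<Rightarrow> 'p set \<Rightarrow> 'v \<Rightarrow> ('p set \<times> 'v) set" where
  "germ F U x V s = germ_rel F U x `` {(V, s)}"

lemma germ_eqI:
  assumes F: "is_presheaf F" "complex_space U" and "((V, s), (V', s')) \<in> germ_rel F U x"
  shows "germ F U x V s = germ F U x V' s'"
  using assms(3) sym_germ_rel[of F U x] trans_germ_rel[OF F, of x] unfolding germ_def
  by (auto dest: symD transD)

lemma germ_open_res:
  assumes F: "is_presheaf F" "complex_space U" and l: "(V, s) \<in> local_sections F U x"
    and W: "openin (ctop U) W" "x \<in> W" "W \<subseteq> V"
  shows "germ F U x W (open_res F U V W s) = germ F U x V s"
proof (rule germ_eqI[OF F])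
  have V: "openin (ctop U) V" "s \<in> sec F (open_subspace U V)" using l by (auto simp: mem_local_sections)
  have "(W, open_res F U V W s) \<in> local_sections F U x"
    using open_res_in_sec[OF F V(1) W(1,3) V(2)] W by (simp add: mem_local_sections)
  moreover have "open_res F U W W (open_res F U V W s) = open_res F U V W s"
    by (rule open_res_open_res[OF F V(1) W(1,3) W(1) order_refl V(2)])
  ultimately show "((W, open_res F U V W s), V, s) \<in> germ_rel F U x"
    unfolding mem_germ_rel using l W by blast
qed

text \<open>Faces, degeneracies and morphisms all act on germs through representatives;
  compatibility with restriction makes the action well defined.\<close>

lemma quot_map_germ:
  assumes F': "is_presheaf F'" and U: "complex_space U" and l: "(V, s) \<in> local_sections F U x"
    and h: "\<And>V s. (V, s) \<in> local_sections F U x \<Longrightarrow> (V, h V s) \<in> local_sections F' U x"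
    and res: "\<And>V s W. (V, s) \<in> local_sections F U x \<Longrightarrow> openin (ctop U) W \<Longrightarrow> W \<subseteq> V \<Longrightarrow>
       open_res F' U V W (h V s) = h W (open_res F U V W s)"
  shows "quot_map (germ_rel F' U x) (\<lambda>(V, s). (V, h V s)) (germ F U x V s) = germ F' U x V (h V s)"
proof -
  have "quot_map (germ_rel F' U x) (\<lambda>(V, s). (V, h V s)) (germ_rel F U x `` {(V, s)}) =
      germ_rel F' U x `` {(\<lambda>(V, s). (V, h V s)) (V, s)}"
  proof (rule quot_map_class[OF sym_germ_rel trans_germ_rel[OF F' U] germ_rel_refl[OF l]])
    fix q assume q: "((V, s), q) \<in> germ_rel F U x"
    obtain V' s' where e: "q = (V', s')" by fastforce
    obtain W where W: "openin (ctop U) W" "x \<in> W" "W \<subseteq> V \<inter> V'" "open_res F U V W s = open_res F U V' W s'"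
      using q unfolding e mem_germ_rel by blast
    have l': "(V', s') \<in> local_sections F U x" using q unfolding e mem_germ_rel by blast
    have "open_res F' U V W (h V s) = open_res F' U V' W (h V' s')"
      using res[OF l W(1)] res[OF l' W(1)] W(3,4) by simp
    then show "((\<lambda>(V, s). (V, h V s)) (V, s), (\<lambda>(V, s). (V, h V s)) q) \<in> germ_rel F' U x"
      unfolding e prod.case mem_germ_rel using W h[OF l] h[OF l'] by blast
  qed
  then show ?thesis by (simp add: germ_def)
qed

lemma simplices_stalk: "simplices (stalk A U x) n = local_sections (level A n) U x // germ_rel (level A n) U x"
  by (simp add: stalk_def)

lemma germ_in_stalk:
  "(V, s) \<in> local_sections (level A n) U x \<Longrightarrow> germ (level A n) U x V s \<in> simplices (stalk A U x) n"
  unfolding simplices_stalk germ_def by (rule quotientI)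

lemma stalk_cases:
  assumes "c \<in> simplices (stalk A U x) n"
  obtains V s where "(V, s) \<in> local_sections (level A n) U x" "c = germ (level A n) U x V s"
  using assms unfolding simplices_stalk germ_def by (auto elim!: quotientE)

lemma local_sections_fc:
  assumes A: "simplicial_sheaf A" and U: "complex_space U" and i: "i \<le> Suc n"
    and l: "(V, s) \<in> local_sections (level A (Suc n)) U x"
  shows "(V, fc A n i (open_subspace U V) s) \<in> local_sections (level A n) U x"
    "\<lbrakk>openin (ctop U) W; W \<subseteq> V\<rbrakk> \<Longrightarrow> open_res (level A n) U V W (fc A n i (open_subspace U V) s) =
       fc A n i (open_subspace U W) (open_res (level A (Suc n)) U V W s)"
proof -
  have V: "openin (ctop U) V" "s \<in> sec (level A (Suc n)) (open_subspace U V)"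
    using l by (auto simp: mem_local_sections)
  show "(V, fc A n i (open_subspace U V) s) \<in> local_sections (level A n) U x"
    using simplicial_sheafD(3)[OF A complex_space_open_subspace[OF U V(1)] i V(2)] l by (simp add: mem_local_sections)
  assume W: "openin (ctop U) W" "W \<subseteq> V"
  show "open_res (level A n) U V W (fc A n i (open_subspace U V) s) =
       fc A n i (open_subspace U W) (open_res (level A (Suc n)) U V W s)"
    unfolding open_res_def
    by (rule simplicial_sheafD(5)[symmetric, OF A complex_space_open_subspace[OF U V(1)]
          complex_space_open_subspace[OF U W(1)] hol_maps_inclusion[OF complex_spaceD(2)[OF U] V(1) W] i V(2)])
qed

lemma local_sections_dg:
  assumes A: "simplicial_sheaf A" and U: "complex_space U" and i: "i \<le> n"
    and l: "(V, s) \<in> local_sections (level A n) U x"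
  shows "(V, dg A n i (open_subspace U V) s) \<in> local_sections (level A (Suc n)) U x"
    "\<lbrakk>openin (ctop U) W; W \<subseteq> V\<rbrakk> \<Longrightarrow> open_res (level A (Suc n)) U V W (dg A n i (open_subspace U V) s) =
       dg A n i (open_subspace U W) (open_res (level A n) U V W s)"
proof -
  have V: "openin (ctop U) V" "s \<in> sec (level A n) (open_subspace U V)"
    using l by (auto simp: mem_local_sections)
  show "(V, dg A n i (open_subspace U V) s) \<in> local_sections (level A (Suc n)) U x"
    using simplicial_sheafD(4)[OF A complex_space_open_subspace[OF U V(1)] i V(2)] l by (simp add: mem_local_sections)
  assume W: "openin (ctop U) W" "W \<subseteq> V"
  show "open_res (level A (Suc n)) U V W (dg A n i (open_subspace U V) s) =
       dg A n i (open_subspace U W) (open_res (level A n) U V W s)"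
    unfolding open_res_def
    by (rule simplicial_sheafD(6)[symmetric, OF A complex_space_open_subspace[OF U V(1)]
          complex_space_open_subspace[OF U W(1)] hol_maps_inclusion[OF complex_spaceD(2)[OF U] V(1) W] i V(2)])
qed

lemma local_sections_hom:
  assumes \<phi>: "\<phi> \<in> ssheaf_hom A B" and U: "complex_space U"
    and l: "(V, s) \<in> local_sections (level A n) U x"
  shows "(V, \<phi> n (open_subspace U V) s) \<in> local_sections (level B n) U x"
    "\<lbrakk>openin (ctop U) W; W \<subseteq> V\<rbrakk> \<Longrightarrow> open_res (level B n) U V W (\<phi> n (open_subspace U V) s) =
       \<phi> n (open_subspace U W) (open_res (level A n) U V W s)"
proof -
  have V: "openin (ctop U) V" "s \<in> sec (level A n) (open_subspace U V)"
    using l by (auto simp: mem_local_sections)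
  show "(V, \<phi> n (open_subspace U V) s) \<in> local_sections (level B n) U x"
    using ssheaf_homD(3)[OF \<phi> complex_space_open_subspace[OF U V(1)] V(2)] l by (simp add: mem_local_sections)
  assume W: "openin (ctop U) W" "W \<subseteq> V"
  show "open_res (level B n) U V W (\<phi> n (open_subspace U V) s) =
       \<phi> n (open_subspace U W) (open_res (level A n) U V W s)"
    unfolding open_res_def
    by (rule ssheaf_homD(4)[symmetric, OF \<phi> complex_space_open_subspace[OF U V(1)]
          complex_space_open_subspace[OF U W(1)] hol_maps_inclusion[OF complex_spaceD(2)[OF U] V(1) W] V(2)])
qed

lemma sface_stalk_germ:
  assumes A: "simplicial_sheaf A" and U: "complex_space U" and i: "i \<le> Suc n"
    and l: "(V, s) \<in> local_sections (level A (Suc n)) U x"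
  shows "sface (stalk A U x) n i (germ (level A (Suc n)) U x V s) = germ (level A n) U x V (fc A n i (open_subspace U V) s)"
  unfolding stalk_def sset.simps
  by (rule quot_map_germ[OF simplicial_sheafD(2)[OF A] U l])
     (use local_sections_fc[OF A U i] in blast)+

lemma sdegen_stalk_germ:
  assumes A: "simplicial_sheaf A" and U: "complex_space U" and i: "i \<le> n"
    and l: "(V, s) \<in> local_sections (level A n) U x"
  shows "sdegen (stalk A U x) n i (germ (level A n) U x V s) = germ (level A (Suc n)) U x V (dg A n i (open_subspace U V) s)"
  unfolding stalk_def sset.simps
  by (rule quot_map_germ[OF simplicial_sheafD(2)[OF A] U l])
     (use local_sections_dg[OF A U i] in blast)+

lemma stalk_map_germ:
  assumes B: "simplicial_sheaf B" and \<phi>: "\<phi> \<in> ssheaf_hom A B" and U: "complex_space U"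
    and l: "(V, s) \<in> local_sections (level A n) U x"
  shows "stalk_map B \<phi> U x n (germ (level A n) U x V s) = germ (level B n) U x V (\<phi> n (open_subspace U V) s)"
  unfolding stalk_map_def
  by (rule quot_map_germ[OF simplicial_sheafD(2)[OF B] U l])
     (use local_sections_hom[OF \<phi> U] in blast)+

text \<open>A \<open>germ_family\<close> is a map from the stalk to a constant simplicial set, described on representatives.\<close>

definition germ_family :: "('p, 'v) ssheaf \<Rightarrow> 'p cspace \<Rightarrow> 'p \<Rightarrow> (nat \<Rightarrow> 'p set \<Rightarrow> 'v \<Rightarrow> 'b) \<Rightarrow> bool" where
  "germ_family A U x H \<longleftrightarrow>
     (\<forall>n V s W. (V, s) \<in> local_sections (level A n) U x \<and> openin (ctop U) W \<and> x \<in> W \<and> W \<subseteq> V \<longrightarrow>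
        H n W (open_res (level A n) U V W s) = H n V s) \<and>
     (\<forall>n i V s. i \<le> Suc n \<and> (V, s) \<in> local_sections (level A (Suc n)) U x \<longrightarrow>
        H n V (fc A n i (open_subspace U V) s) = H (Suc n) V s) \<and>
     (\<forall>n i V s. i \<le> n \<and> (V, s) \<in> local_sections (level A n) U x \<longrightarrow>
        H (Suc n) V (dg A n i (open_subspace U V) s) = H n V s)"

lemma germ_familyI:
  assumes "\<And>n V s W. \<lbrakk>(V, s) \<in> local_sections (level A n) U x; openin (ctop U) W; x \<in> W; W \<subseteq> V\<rbrakk>
      \<Longrightarrow> H n W (open_res (level A n) U V W s) = H n V s"
    and "\<And>n i V s. \<lbrakk>i \<le> Suc n; (V, s) \<in> local_sections (level A (Suc n)) U x\<rbrakk>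
      \<Longrightarrow> H n V (fc A n i (open_subspace U V) s) = H (Suc n) V s"
    and "\<And>n i V s. \<lbrakk>i \<le> n; (V, s) \<in> local_sections (level A n) U x\<rbrakk>
      \<Longrightarrow> H (Suc n) V (dg A n i (open_subspace U V) s) = H n V s"
  shows "germ_family A U x H"
  unfolding germ_family_def using assms by simp

lemma germ_familyD:
  assumes "germ_family A U x H"
  shows "\<lbrakk>(V, s) \<in> local_sections (level A n) U x; openin (ctop U) W; x \<in> W; W \<subseteq> V\<rbrakk>
      \<Longrightarrow> H n W (open_res (level A n) U V W s) = H n V s"
    and "\<lbrakk>i \<le> Suc n; (V, s) \<in> local_sections (level A (Suc n)) U x\<rbrakk>
      \<Longrightarrow> H n V (fc A n i (open_subspace U V) s) = H (Suc n) V s"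
    and "\<lbrakk>i \<le> n; (V, s) \<in> local_sections (level A n) U x\<rbrakk>
      \<Longrightarrow> H (Suc n) V (dg A n i (open_subspace U V) s) = H n V s"
  using assms unfolding germ_family_def by simp_all

text \<open>Two representatives of a germ agree on a smaller neighbourhood, where the first clause
  of \<open>germ_family\<close> equates their values.\<close>

lemma germ_family_stalk:
  assumes A: "simplicial_sheaf A" and U: "complex_space U" and H: "germ_family A U x H"
  obtains h where "simplicially_constant (stalk A U x) h"
    "\<And>n V s. (V, s) \<in> local_sections (level A n) U x \<Longrightarrow> h n (germ (level A n) U x V s) = H n V s"
proof -
  have inv: "H n V s = H n V' s'" if r: "((V, s), (V', s')) \<in> germ_rel (level A n) U x" for n V s V' s'
  proof -
    obtain W where W: "openin (ctop U) W" "x \<in> W" "W \<subseteq> V \<inter> V'"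
        "open_res (level A n) U V W s = open_res (level A n) U V' W s'"
      using r unfolding mem_germ_rel by blast
    have "(V, s) \<in> local_sections (level A n) U x" "(V', s') \<in> local_sections (level A n) U x"
      using r unfolding mem_germ_rel by blast+
    then show ?thesis
      using germ_familyD(1)[OF H, of V s n W] germ_familyD(1)[OF H, of V' s' n W] W by simp
  qed
  define h where "h n c = (case SOME p. p \<in> c of (V, s) \<Rightarrow> H n V s)" for n and c :: "('a set \<times> 'b) set"
  have h: "h n (germ (level A n) U x V s) = H n V s" if l: "(V, s) \<in> local_sections (level A n) U x" for n V s
  proof -
    let ?c = "germ (level A n) U x V s"
    obtain V' s' where e: "(SOME p. p \<in> ?c) = (V', s')" by fastforce
    have "(V, s) \<in> ?c" using germ_rel_refl[OF l] by (simp add: germ_def)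
    then have "(SOME p. p \<in> ?c) \<in> ?c" by (rule someI)
    then have "((V, s), (V', s')) \<in> germ_rel (level A n) U x" unfolding e by (simp add: germ_def)
    then show ?thesis using inv unfolding h_def e by simp
  qed
  have "simplicially_constant (stalk A U x) h"
    unfolding simplicially_constant_def
  proof (intro conjI allI impI ballI)
    fix n i c assume i: "i \<le> Suc n" and c: "c \<in> simplices (stalk A U x) (Suc n)"
    obtain V s where l: "(V, s) \<in> local_sections (level A (Suc n)) U x" "c = germ (level A (Suc n)) U x V s"
      using c by (rule stalk_cases)
    show "h n (sface (stalk A U x) n i c) = h (Suc n) c"
      unfolding l(2) sface_stalk_germ[OF A U i l(1)]
      using h[OF local_sections_fc(1)[OF A U i l(1)]] h[OF l(1)] germ_familyD(2)[OF H i l(1)] by simp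
  next
    fix n i c assume i: "i \<le> n" and c: "c \<in> simplices (stalk A U x) n"
    obtain V s where l: "(V, s) \<in> local_sections (level A n) U x" "c = germ (level A n) U x V s"
      using c by (rule stalk_cases)
    show "h (Suc n) (sdegen (stalk A U x) n i c) = h n c"
      unfolding l(2) sdegen_stalk_germ[OF A U i l(1)]
      using h[OF local_sections_dg(1)[OF A U i l(1)]] h[OF l(1)] germ_familyD(3)[OF H i l(1)] by simp
  qed
  then show thesis using that h by blast
qed

section \<open>Germ families along a simplicial weak equivalence\<close>

locale ssheaf_equivalence =
  fixes A B :: "('p, 'v) ssheaf" and w :: "('p, 'v) smap"
  assumes A: "simplicial_sheaf A" and B: "simplicial_sheaf B" and w: "w \<in> simplicial_weak_equivalences A B"
begin

lemma w_hom: "w \<in> ssheaf_hom A B"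
  using w unfolding simplicial_weak_equivalences_def by blast

lemma sset_equivalence_stalk:
  assumes U: "complex_space U" and x: "x \<in> cpoints U"
  shows "sset_equivalence (stalk A U x) (stalk B U x) (stalk_map B w U x)"
proof
  have face: "sface (stalk D U x) n i c \<in> simplices (stalk D U x) n"
    if D: "simplicial_sheaf D" and i: "i \<le> Suc n" and c: "c \<in> simplices (stalk D U x) (Suc n)" for D :: "('p, 'v) ssheaf" and n i c
  proof -
    obtain V s where l: "(V, s) \<in> local_sections (level D (Suc n)) U x" "c = germ (level D (Suc n)) U x V s"
      using c by (rule stalk_cases)
    show ?thesis
      unfolding l(2) sface_stalk_germ[OF D U i l(1)] by (rule germ_in_stalk[OF local_sections_fc(1)[OF D U i l(1)]])
  qed
  have degen: "sdegen (stalk D U x) n i c \<in> simplices (stalk D U x) (Suc n)"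
    if D: "simplicial_sheaf D" and i: "i \<le> n" and c: "c \<in> simplices (stalk D U x) n" for D :: "('p, 'v) ssheaf" and n i c
  proof -
    obtain V s where l: "(V, s) \<in> local_sections (level D n) U x" "c = germ (level D n) U x V s"
      using c by (rule stalk_cases)
    show ?thesis
      unfolding l(2) sdegen_stalk_germ[OF D U i l(1)] by (rule germ_in_stalk[OF local_sections_dg(1)[OF D U i l(1)]])
  qed
  show "sface (stalk A U x) n i s \<in> simplices (stalk A U x) n" if "i \<le> Suc n" "s \<in> simplices (stalk A U x) (Suc n)" for n i s
    using face[OF A that] .
  show "sdegen (stalk A U x) n i s \<in> simplices (stalk A U x) (Suc n)" if "i \<le> n" "s \<in> simplices (stalk A U x) n" for n i s
    using degen[OF A that] .
  show "sface (stalk B U x) n i s \<in> simplices (stalk B U x) n" if "i \<le> Suc n" "s \<in> simplices (stalk B U x) (Suc n)" for n i s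
    using face[OF B that] .
  show "sdegen (stalk B U x) n i s \<in> simplices (stalk B U x) (Suc n)" if "i \<le> n" "s \<in> simplices (stalk B U x) n" for n i s
    using degen[OF B that] .
next
  fix s n assume "s \<in> simplices (stalk A U x) n"
  then obtain V t where l: "(V, t) \<in> local_sections (level A n) U x" "s = germ (level A n) U x V t"
    by (rule stalk_cases)
  show "stalk_map B w U x n s \<in> simplices (stalk B U x) n"
    unfolding l(2) stalk_map_germ[OF B w_hom U l(1)] by (rule germ_in_stalk[OF local_sections_hom(1)[OF w_hom U l(1)]])
next
  fix i n s assume i: "i \<le> Suc n" and s: "s \<in> simplices (stalk A U x) (Suc n)"
  obtain V t where l: "(V, t) \<in> local_sections (level A (Suc n)) U x" "s = germ (level A (Suc n)) U x V t"
    using s by (rule stalk_cases)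
  have "openin (ctop U) V" "t \<in> sec (level A (Suc n)) (open_subspace U V)"
    using l(1) by (auto simp: mem_local_sections)
  then show "stalk_map B w U x n (sface (stalk A U x) n i s) = sface (stalk B U x) n i (stalk_map B w U x (Suc n) s)"
    unfolding l(2) sface_stalk_germ[OF A U i l(1)] stalk_map_germ[OF B w_hom U l(1)]
      stalk_map_germ[OF B w_hom U local_sections_fc(1)[OF A U i l(1)]]
      sface_stalk_germ[OF B U i local_sections_hom(1)[OF w_hom U l(1)]]
    using ssheaf_homD(5)[OF w_hom complex_space_open_subspace[OF U] i] by simp
next
  fix i n s assume i: "i \<le> n" and s: "s \<in> simplices (stalk A U x) n"
  obtain V t where l: "(V, t) \<in> local_sections (level A n) U x" "s = germ (level A n) U x V t"
    using s by (rule stalk_cases)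
  have "openin (ctop U) V" "t \<in> sec (level A n) (open_subspace U V)"
    using l(1) by (auto simp: mem_local_sections)
  then show "stalk_map B w U x (Suc n) (sdegen (stalk A U x) n i s) = sdegen (stalk B U x) n i (stalk_map B w U x n s)"
    unfolding l(2) sdegen_stalk_germ[OF A U i l(1)] stalk_map_germ[OF B w_hom U l(1)]
      stalk_map_germ[OF B w_hom U local_sections_dg(1)[OF A U i l(1)]]
      sdegen_stalk_germ[OF B U i local_sections_hom(1)[OF w_hom U l(1)]]
    using ssheaf_homD(6)[OF w_hom complex_space_open_subspace[OF U] i] by simp
next
  show "sset_weak_equivalence (stalk A U x) (stalk B U x) (stalk_map B w U x)"
    using w U x unfolding simplicial_weak_equivalences_def by blast
qed

text \<open>The source of all later identities on \<open>B\<close>: the stalk map is surjective on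
  path components, so a germ family is determined on sections coming from \<open>A\<close>.\<close>

lemma germ_family_unique:
  assumes U: "complex_space U" and x: "x \<in> cpoints U"
    and H: "germ_family B U x H" "germ_family B U x H'"
    and eq: "\<And>n V s. (V, s) \<in> local_sections (level A n) U x \<Longrightarrow>
       H n V (w n (open_subspace U V) s) = H' n V (w n (open_subspace U V) s)"
    and l: "(V, s) \<in> local_sections (level B n) U x"
  shows "H n V s = H' n V s"
proof -
  interpret E: sset_equivalence "stalk A U x" "stalk B U x" "stalk_map B w U x"
    using sset_equivalence_stalk[OF U x] .
  obtain h where h: "simplicially_constant (stalk B U x) h"
    "\<And>n V s. (V, s) \<in> local_sections (level B n) U x \<Longrightarrow> h n (germ (level B n) U x V s) = H n V s"
    using germ_family_stalk[OF B U H(1)] by blast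
  obtain h' where h': "simplicially_constant (stalk B U x) h'"
    "\<And>n V s. (V, s) \<in> local_sections (level B n) U x \<Longrightarrow> h' n (germ (level B n) U x V s) = H' n V s"
    using germ_family_stalk[OF B U H(2)] by blast
  have "h n (germ (level B n) U x V s) = h' n (germ (level B n) U x V s)"
  proof (rule E.simplicially_constant_unique[OF h(1) h'(1) _ germ_in_stalk[OF l]])
    fix n c assume "c \<in> simplices (stalk A U x) n"
    then obtain V s where l: "(V, s) \<in> local_sections (level A n) U x" "c = germ (level A n) U x V s"
      by (rule stalk_cases)
    show "h n (stalk_map B w U x n c) = h' n (stalk_map B w U x n c)"
      unfolding l(2) stalk_map_germ[OF B w_hom U l(1)]
      using h(2)[OF local_sections_hom(1)[OF w_hom U l(1)]] h'(2)[OF local_sections_hom(1)[OF w_hom U l(1)]] eq[OF l(1)]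
      by simp
  qed
  then show ?thesis using h(2)[OF l] h'(2)[OF l] by simp
qed

lemma germ_family_extend:
  assumes U: "complex_space U" and x: "x \<in> cpoints U" and G: "germ_family A U x G"
  obtains H where "germ_family B U x H"
    "\<And>n V s. (V, s) \<in> local_sections (level A n) U x \<Longrightarrow> H n V (w n (open_subspace U V) s) = G n V s"
proof -
  interpret E: sset_equivalence "stalk A U x" "stalk B U x" "stalk_map B w U x"
    using sset_equivalence_stalk[OF U x] .
  obtain g where g: "simplicially_constant (stalk A U x) g"
    "\<And>n V s. (V, s) \<in> local_sections (level A n) U x \<Longrightarrow> g n (germ (level A n) U x V s) = G n V s"
    using germ_family_stalk[OF A U G] by blast
  obtain h where h: "simplicially_constant (stalk B U x) h"
    "\<And>n c. c \<in> simplices (stalk A U x) n \<Longrightarrow> h n (stalk_map B w U x n c) = g n c"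
    using E.simplicially_constant_extend[OF g(1)] by blast
  define H where "H n V s = h n (germ (level B n) U x V s)" for n V s
  show thesis
  proof (rule that[of H])
    show "germ_family B U x H"
    proof (rule germ_familyI)
      fix n V s W
      assume l: "(V, s) \<in> local_sections (level B n) U x" and W: "openin (ctop U) W" "x \<in> W" "W \<subseteq> V"
      then show "H n W (open_res (level B n) U V W s) = H n V s"
        unfolding H_def by (simp only: germ_open_res[OF simplicial_sheafD(2)[OF B] U l W])
    next
      fix n i V s assume i: "i \<le> Suc n" and l: "(V, s) \<in> local_sections (level B (Suc n)) U x"
      show "H n V (fc B n i (open_subspace U V) s) = H (Suc n) V s"
        unfolding H_def sface_stalk_germ[OF B U i l, symmetric]
        using h(1) i germ_in_stalk[OF l] unfolding simplicially_constant_def by blast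
    next
      fix n i V s assume i: "i \<le> n" and l: "(V, s) \<in> local_sections (level B n) U x"
      show "H (Suc n) V (dg B n i (open_subspace U V) s) = H n V s"
        unfolding H_def sdegen_stalk_germ[OF B U i l, symmetric]
        using h(1) i germ_in_stalk[OF l] unfolding simplicially_constant_def by blast
    qed
    fix n V s assume l: "(V, s) \<in> local_sections (level A n) U x"
    show "H n V (w n (open_subspace U V) s) = G n V s"
      unfolding H_def stalk_map_germ[OF B w_hom U l, symmetric] h(2)[OF germ_in_stalk[OF l]] by (rule g(2)[OF l])
  qed
qed

end

section \<open>Representable sheaves are local for simplicial weak equivalences\<close>

text \<open>The \<open>id\<close> is a dummy value for elements that are not maps.\<close>

fun map_of_elem :: "('p, 'w) elem \<Rightarrow> 'p \<Rightarrow> 'p" where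
  "map_of_elem (Mor g) = g"
| "map_of_elem e = id"

text \<open>Restriction to a smaller neighbourhood preserves the value at \<open>x\<close>, and
  faces and degeneracies of the target are identities.\<close>

lemma germ_family_hom_represented:
  fixes A :: "('p, ('p, 'w) elem) ssheaf"
  assumes \<phi>: "\<phi> \<in> ssheaf_hom A (const_ssheaf (represented X))" and U: "complex_space U"
  shows "germ_family A U x (\<lambda>n V s. map_of_elem (\<phi> n (open_subspace U V) s) x)"
proof (rule germ_familyI)
  fix n V s W
  assume l: "(V, s) \<in> local_sections (level A n) U x" and W: "openin (ctop U) W" "x \<in> W" "W \<subseteq> V"
  have V: "openin (ctop U) V" "s \<in> sec (level A n) (open_subspace U V)"
    using l by (auto simp: mem_local_sections)
  obtain m where m: "\<phi> n (open_subspace U V) s = Mor m"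
    using ssheaf_homD(3)[OF \<phi> complex_space_open_subspace[OF U V(1)] V(2)] by auto
  have "open_res (represented X) U V W (Mor m :: ('p, 'w) elem) = Mor (restrict m W)"
    unfolding open_res_def res_represented precomp_elem.simps cpoints_open_subspace[OF W(1)] compose_inclusion ..
  then have "\<phi> n (open_subspace U W) (open_res (level A n) U V W s) = Mor (restrict m W)"
    using local_sections_hom(2)[OF \<phi> U l W(1,3)] m by simp
  then show "map_of_elem (\<phi> n (open_subspace U W) (open_res (level A n) U V W s)) x
      = map_of_elem (\<phi> n (open_subspace U V) s) x"
    using W(2) m by simp
next
  fix n i V s assume i: "i \<le> Suc n" and l: "(V, s) \<in> local_sections (level A (Suc n)) U x"
  have V: "openin (ctop U) V" "s \<in> sec (level A (Suc n)) (open_subspace U V)"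
    using l by (auto simp: mem_local_sections)
  show "map_of_elem (\<phi> n (open_subspace U V) (fc A n i (open_subspace U V) s)) x
      = map_of_elem (\<phi> (Suc n) (open_subspace U V) s) x"
    using ssheaf_homD(5)[OF \<phi> complex_space_open_subspace[OF U V(1)] i V(2)] by simp
next
  fix n i V s assume i: "i \<le> n" and l: "(V, s) \<in> local_sections (level A n) U x"
  have V: "openin (ctop U) V" "s \<in> sec (level A n) (open_subspace U V)"
    using l by (auto simp: mem_local_sections)
  show "map_of_elem (\<phi> (Suc n) (open_subspace U V) (dg A n i (open_subspace U V) s)) x
      = map_of_elem (\<phi> n (open_subspace U V) s) x"
    using ssheaf_homD(6)[OF \<phi> complex_space_open_subspace[OF U V(1)] i V(2)] by simp
qed

lemma global_local_section:
  "x \<in> cpoints U \<Longrightarrow> s \<in> sec F U \<Longrightarrow> (cpoints U, s) \<in> local_sections F U x"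
  by (simp add: mem_local_sections)

text \<open>Base change of a local section along \<open>f\<close>, which carries germs at
  \<open>f x\<close> to germs at \<open>x\<close>.\<close>

definition open_pullback :: "('p, 'v) sheaf \<Rightarrow> 'p cspace \<Rightarrow> 'p cspace \<Rightarrow> ('p \<Rightarrow> 'p) \<Rightarrow> 'p set \<Rightarrow> 'v \<Rightarrow> 'v" where
  "open_pullback F T U f V =
     res F (open_subspace T {x \<in> cpoints T. f x \<in> V}) (open_subspace U V) (restrict f {x \<in> cpoints T. f x \<in> V})"

lemma pullback_hol_maps:
  assumes T: "complex_space T" and f: "f \<in> hol_maps T U" and V: "openin (ctop U) V"
  shows "openin (ctop T) {x \<in> cpoints T. f x \<in> V}"
    "restrict f {x \<in> cpoints T. f x \<in> V} \<in> hol_maps (open_subspace T {x \<in> cpoints T. f x \<in> V}) (open_subspace U V)"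
proof -
  show o: "openin (ctop T) {x \<in> cpoints T. f x \<in> V}" using hol_mapsD(5)[OF f V] .
  show "restrict f {x \<in> cpoints T. f x \<in> V} \<in> hol_maps (open_subspace T {x \<in> cpoints T. f x \<in> V}) (open_subspace U V)"
    by (rule hol_maps_restrict_open[OF complex_spaceD(2)[OF T] f o V]) auto
qed

lemma open_pullback_open_res:
  assumes F: "is_presheaf F" and T: "complex_space T" and U: "complex_space U" and f: "f \<in> hol_maps T U"
    and V: "openin (ctop U) V" "openin (ctop U) W" "W \<subseteq> V" and s: "s \<in> sec F (open_subspace U V)"
  shows "open_pullback F T U f W (open_res F U V W s) =
    open_res F T {x \<in> cpoints T. f x \<in> V} {x \<in> cpoints T. f x \<in> W} (open_pullback F T U f V s)"
proof -
  let ?P = "\<lambda>V. {x \<in> cpoints T. f x \<in> V}"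
  note fT = complex_spaceD(2)[OF T] and fU = complex_spaceD(2)[OF U]
  have oV: "openin (ctop T) (?P V)" and oW: "openin (ctop T) (?P W)"
    using pullback_hol_maps(1)[OF T f] V by auto
  have sub: "?P W \<subseteq> ?P V" using V(3) by blast
  have "open_pullback F T U f W (open_res F U V W s) =
      res F (open_subspace T (?P W)) (open_subspace U V) (compose (cpoints (open_subspace T (?P W))) (\<lambda>x\<in>W. x) (restrict f (?P W))) s"
    unfolding open_pullback_def open_res_def
    by (rule is_presheafD(3)[OF F complex_space_open_subspace[OF U V(1)] complex_space_open_subspace[OF U V(2)]
          complex_space_open_subspace[OF T oW] hol_maps_inclusion[OF fU V] pullback_hol_maps(2)[OF T f V(2)] s])
  also have "compose (cpoints (open_subspace T (?P W))) (\<lambda>x\<in>W. x) (restrict f (?P W)) =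
      compose (cpoints (open_subspace T (?P W))) (restrict f (?P V)) (\<lambda>x\<in>?P W. x)"
    unfolding cpoints_open_subspace[OF oW] using V(3) by (auto simp: compose_def fun_eq_iff)
  also have "res F (open_subspace T (?P W)) (open_subspace U V) \<dots> s =
      open_res F T (?P V) (?P W) (open_pullback F T U f V s)"
    unfolding open_pullback_def open_res_def
    by (rule is_presheafD(3)[symmetric, OF F complex_space_open_subspace[OF U V(1)] complex_space_open_subspace[OF T oV]
          complex_space_open_subspace[OF T oW] pullback_hol_maps(2)[OF T f V(1)] hol_maps_inclusion[OF fT oV oW sub] s])
  finally show ?thesis .
qed

text \<open>A family at \<open>x\<close> becomes one at \<open>f x\<close>, so that families chosen
  at these two points can be compared by \<open>germ_family_unique\<close>.\<close>

lemma germ_family_pullback: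
  assumes A: "simplicial_sheaf A" and T: "complex_space T" and U: "complex_space U" and f: "f \<in> hol_maps T U"
    and x: "x \<in> cpoints T" and H: "germ_family A T x H"
  shows "germ_family A U (f x) (\<lambda>n V s. H n {x \<in> cpoints T. f x \<in> V} (open_pullback (level A n) T U f V s))"
proof -
  let ?P = "\<lambda>V. {x \<in> cpoints T. f x \<in> V}"
  have l': "(?P V, open_pullback (level A n) T U f V s) \<in> local_sections (level A n) T x"
    if l: "(V, s) \<in> local_sections (level A n) U (f x)" for n V s
  proof -
    have V: "openin (ctop U) V" "f x \<in> V" "s \<in> sec (level A n) (open_subspace U V)"
      using l by (auto simp: mem_local_sections)
    note P = pullback_hol_maps[OF T f V(1)]
    show ?thesis
      unfolding mem_local_sections open_pullback_def
      using P(1) x V(2) is_presheafD(1)[OF simplicial_sheafD(2)[OF A] complex_space_open_subspace[OF U V(1)]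
          complex_space_open_subspace[OF T P(1)] P(2) V(3)] by simp
  qed
  show ?thesis
  proof (rule germ_familyI)
    fix n V s W
    assume l: "(V, s) \<in> local_sections (level A n) U (f x)" and W: "openin (ctop U) W" "f x \<in> W" "W \<subseteq> V"
    have V: "openin (ctop U) V" "s \<in> sec (level A n) (open_subspace U V)"
      using l by (auto simp: mem_local_sections)
    show "H n (?P W) (open_pullback (level A n) T U f W (open_res (level A n) U V W s)) =
        H n (?P V) (open_pullback (level A n) T U f V s)"
      unfolding open_pullback_open_res[OF simplicial_sheafD(2)[OF A] T U f V(1) W(1,3) V(2)]
      by (rule germ_familyD(1)[OF H l'[OF l] pullback_hol_maps(1)[OF T f W(1)]]) (use x W in auto)
  next
    fix n i V s assume i: "i \<le> Suc n" and l: "(V, s) \<in> local_sections (level A (Suc n)) U (f x)"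
    have V: "openin (ctop U) V" "s \<in> sec (level A (Suc n)) (open_subspace U V)"
      using l by (auto simp: mem_local_sections)
    note P = pullback_hol_maps[OF T f V(1)]
    have "open_pullback (level A n) T U f V (fc A n i (open_subspace U V) s) =
        fc A n i (open_subspace T (?P V)) (open_pullback (level A (Suc n)) T U f V s)"
      unfolding open_pullback_def
      by (rule simplicial_sheafD(5)[symmetric, OF A complex_space_open_subspace[OF U V(1)]
            complex_space_open_subspace[OF T P(1)] P(2) i V(2)])
    then show "H n (?P V) (open_pullback (level A n) T U f V (fc A n i (open_subspace U V) s)) =
        H (Suc n) (?P V) (open_pullback (level A (Suc n)) T U f V s)"
      using germ_familyD(2)[OF H i l'[OF l]] by simp
  next
    fix n i V s assume i: "i \<le> n" and l: "(V, s) \<in> local_sections (level A n) U (f x)"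
    have V: "openin (ctop U) V" "s \<in> sec (level A n) (open_subspace U V)"
      using l by (auto simp: mem_local_sections)
    note P = pullback_hol_maps[OF T f V(1)]
    have "open_pullback (level A (Suc n)) T U f V (dg A n i (open_subspace U V) s) =
        dg A n i (open_subspace T (?P V)) (open_pullback (level A n) T U f V s)"
      unfolding open_pullback_def
      by (rule simplicial_sheafD(6)[symmetric, OF A complex_space_open_subspace[OF U V(1)]
            complex_space_open_subspace[OF T P(1)] P(2) i V(2)])
    then show "H (Suc n) (?P V) (open_pullback (level A (Suc n)) T U f V (dg A n i (open_subspace U V) s)) =
        H n (?P V) (open_pullback (level A n) T U f V s)"
      using germ_familyD(3)[OF H i l'[OF l]] by simp
  qed
qed

lemma (in ssheaf_equivalence) open_pullback_w:
  assumes T: "complex_space T" and U: "complex_space U" and f: "f \<in> hol_maps T U"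
    and V: "openin (ctop U) V" and s: "s \<in> sec (level A n) (open_subspace U V)"
  shows "open_pullback (level B n) T U f V (w n (open_subspace U V) s) =
    w n (open_subspace T {x \<in> cpoints T. f x \<in> V}) (open_pullback (level A n) T U f V s)"
  unfolding open_pullback_def
  by (rule ssheaf_homD(4)[symmetric, OF w_hom complex_space_open_subspace[OF U V]
        complex_space_open_subspace[OF T pullback_hol_maps(1)[OF T f V]] pullback_hol_maps(2)[OF T f V] s])

section \<open>Composition with a weak equivalence on morphisms into a represented sheaf\<close>

context
  fixes A B :: "('p, ('p, 'w) elem) ssheaf" and w :: "('p, ('p, 'w) elem) smap" and X :: "'p cspace"
  assumes equivalence: "ssheaf_equivalence A B w"
begin

interpretation ssheaf_equivalence A B w by (rule equivalence)

abbreviation target :: "('p, ('p, 'w) elem) ssheaf" where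
  "target \<equiv> const_ssheaf (represented X)"

text \<open>Sections of the target are compared by their values at points, and these are germ
  families that agree on sections coming from \<open>A\<close>.\<close>

lemma inj_on_precomposition:
  "inj_on (\<lambda>h. Cmp ssheaf_cat A h w) (ssheaf_hom B target)"
proof (rule inj_onI)
  fix h h' assume h: "h \<in> ssheaf_hom B target" "h' \<in> ssheaf_hom B target"
    and eq: "Cmp ssheaf_cat A h w = Cmp ssheaf_cat A h' w"
  show "h = h'"
  proof (rule ssheaf_hom_eqI[OF h])
    fix n U b assume U: "complex_space U" and b: "b \<in> sec (level B n) U"
    obtain m m' where m: "h n U b = Mor m" "m \<in> hol_maps U X" "h' n U b = Mor m'" "m' \<in> hol_maps U X"
      using ssheaf_homD(3)[OF h(1) U b] ssheaf_homD(3)[OF h(2) U b] by auto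
    have "m = m'"
    proof (rule extensionalityI[OF hol_mapsD(1)[OF m(2)] hol_mapsD(1)[OF m(4)]])
      fix x assume x: "x \<in> cpoints U"
      have "map_of_elem (h n (open_subspace U (cpoints U)) b) x = map_of_elem (h' n (open_subspace U (cpoints U)) b) x"
      proof (rule germ_family_unique[OF U x germ_family_hom_represented[OF h(1) U] germ_family_hom_represented[OF h(2) U]
            _ global_local_section[OF x b]])
        fix n V s assume "(V, s) \<in> local_sections (level A n) U x"
        then have V: "openin (ctop U) V" "s \<in> sec (level A n) (open_subspace U V)"
          by (auto simp: mem_local_sections)
        have "h n (open_subspace U V) (w n (open_subspace U V) s) = h' n (open_subspace U V) (w n (open_subspace U V) s)"
          using Cmp_ssheaf_cat[OF complex_space_open_subspace[OF U V(1)] V(2)] eq by metis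
        then show "map_of_elem (h n (open_subspace U V) (w n (open_subspace U V) s)) x =
            map_of_elem (h' n (open_subspace U V) (w n (open_subspace U V) s)) x" by simp
      qed
      then show "m x = m' x" by (simp add: m)
    qed
    then show "h n U b = h' n U b" using m by simp
  qed
qed

text \<open>The value of the extension at \<open>x\<close> is found from the stalk at
  \<open>x\<close> alone. The families \<open>H U x\<close> are chosen independently of one another;
  naturality and holomorphy are forced afterwards by \<open>germ_family_unique\<close>, as both hold
  on sections coming from \<open>A\<close>.\<close>

lemma surj_precomposition:
  assumes g: "g \<in> ssheaf_hom A target"
  shows "\<exists>h \<in> ssheaf_hom B target. Cmp ssheaf_cat A h w = g"
proof -
  let ?G = "\<lambda>U x n V s. map_of_elem (g n (open_subspace U V) s) x"
  have "\<exists>H. germ_family B U x H \<and> (\<forall>n V s. (V, s) \<in> local_sections (level A n) U x \<longrightarrow>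
      H n V (w n (open_subspace U V) s) = ?G U x n V s)" if U: "complex_space U" and x: "x \<in> cpoints U" for U x
    using germ_family_extend[OF U x germ_family_hom_represented[OF g U]] by metis
  then obtain H where H: "\<And>U x. complex_space U \<Longrightarrow> x \<in> cpoints U \<Longrightarrow> germ_family B U x (H U x)"
    and Hw: "\<And>U x n V s. complex_space U \<Longrightarrow> x \<in> cpoints U \<Longrightarrow> (V, s) \<in> local_sections (level A n) U x \<Longrightarrow>
      H U x n V (w n (open_subspace U V) s) = ?G U x n V s"
    by metis
  \<comment> \<open>Both sides are germ families on \<open>B\<close> at \<open>f x\<close>; on
    sections coming from \<open>A\<close> the equation is the naturality of
    \<open>g\<close>.\<close>
  have nat: "H T x n {x \<in> cpoints T. f x \<in> V} (open_pullback (level B n) T U f V s) = H U (f x) n V s"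
    if T: "complex_space T" and U: "complex_space U" and f: "f \<in> hol_maps T U" and x: "x \<in> cpoints T"
      and l: "(V, s) \<in> local_sections (level B n) U (f x)" for T U f x n V s
  proof (rule germ_family_unique[OF U hol_mapsD(4)[OF f x] germ_family_pullback[OF B T U f x H[OF T x]]
        H[OF U hol_mapsD(4)[OF f x]] _ l])
    fix n V s assume l: "(V, s) \<in> local_sections (level A n) U (f x)"
    have V: "openin (ctop U) V" "f x \<in> V" "s \<in> sec (level A n) (open_subspace U V)"
      using l by (auto simp: mem_local_sections)
    let ?P = "{x \<in> cpoints T. f x \<in> V}"
    note P = pullback_hol_maps[OF T f V(1)]
    let ?s = "open_pullback (level A n) T U f V s"
    have s': "?s \<in> sec (level A n) (open_subspace T ?P)"
      unfolding open_pullback_def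
      by (rule is_presheafD(1)[OF simplicial_sheafD(2)[OF A] complex_space_open_subspace[OF U V(1)]
            complex_space_open_subspace[OF T P(1)] P(2) V(3)])
    have l': "(?P, ?s) \<in> local_sections (level A n) T x"
      using s' P(1) x V(2) by (simp add: mem_local_sections)
    obtain m where m: "g n (open_subspace U V) s = Mor m"
      using ssheaf_homD(3)[OF g complex_space_open_subspace[OF U V(1)] V(3)] by auto
    have "g n (open_subspace T ?P) ?s = Mor (compose ?P m (restrict f ?P))"
      unfolding open_pullback_def
      using ssheaf_homD(4)[OF g complex_space_open_subspace[OF U V(1)] complex_space_open_subspace[OF T P(1)] P(2) V(3)]
      unfolding m const_ssheaf_simps res_represented precomp_elem.simps cpoints_open_subspace[OF P(1)] .
    then have "?G T x n ?P ?s = ?G U (f x) n V s"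
      using x V(2) m by (simp add: compose_def)
    then show "H T x n ?P (open_pullback (level B n) T U f V (w n (open_subspace U V) s)) =
        H U (f x) n V (w n (open_subspace U V) s)"
      unfolding open_pullback_w[OF T U f V(1,3)]
      using Hw[OF T x l'] Hw[OF U hol_mapsD(4)[OF f x] l] by simp
  qed
  have hol: "(\<lambda>x\<in>cpoints U. H U x n (cpoints U) b) \<in> hol_maps U X"
    if U: "complex_space U" and b: "b \<in> sec (level B n) U" for U n b
  proof (rule hol_maps_glue[OF complex_spaceD(2)[OF U]])
    fix x assume x: "x \<in> cpoints U"
    \<comment> \<open>Holomorphy near \<open>x\<close> as a germ family of truth values: shrinking,
      faces and degeneracies do not affect it, so it can be tested on sections coming from
      \<open>A\<close>.\<close>
    let ?P = "\<lambda>n V s. \<exists>W. openin (ctop U) W \<and> x \<in> W \<and> W \<subseteq> V \<and>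
       restrict (\<lambda>y. H U y n V s) W \<in> hol_maps (open_subspace U W) X"
    have shrink: "restrict m W' \<in> hol_maps (open_subspace U W') X"
      if m: "restrict m W \<in> hol_maps (open_subspace U W) X" and W: "openin (ctop U) W" "openin (ctop U) W'" "W' \<subseteq> W" for m W W'
    proof -
      have "restrict (restrict m W) W' \<in> hol_maps (open_subspace (open_subspace U W) W') (open_subspace X (cpoints X))"
      proof (rule hol_maps_restrict_open[OF function_sheaf_open_subspace[OF complex_spaceD(2)[OF U] W(1)] m])
        show "openin (ctop (open_subspace U W)) W'" using openin_open_subspace[OF W(1)] W by blast
        show "restrict m W ` W' \<subseteq> cpoints X"
          using hol_mapsD(4)[OF m] W(3) unfolding cpoints_open_subspace[OF W(1)] by blast
      qed simp
      moreover have "restrict (restrict m W) W' = restrict m W'" using W(3) by (auto simp: fun_eq_iff)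
      ultimately show ?thesis using W(3) by (simp add: open_subspace_open_subspace)
    qed
    have P: "germ_family B U x ?P"
    proof (rule germ_familyI)
      fix n V s V'
      assume l: "(V, s) \<in> local_sections (level B n) U x" and V': "openin (ctop U) V'" "x \<in> V'" "V' \<subseteq> V"
      have V: "openin (ctop U) V" "s \<in> sec (level B n) (open_subspace U V)"
        using l by (auto simp: mem_local_sections)
      have eq: "restrict (\<lambda>y. H U y n V' (open_res (level B n) U V V' s)) W = restrict (\<lambda>y. H U y n V s) W"
        if W: "W \<subseteq> V'" for W
      proof (rule restrict_ext)
        fix y assume y: "y \<in> W"
        have yU: "y \<in> cpoints U" using y W openin_subset[OF V'(1)] by blast
        show "H U y n V' (open_res (level B n) U V V' s) = H U y n V s"
          by (rule germ_familyD(1)[OF H[OF U yU] _ V'(1) _ V'(3)])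
             (use y W V' V in \<open>auto simp: mem_local_sections\<close>)
      qed
      show "?P n V' (open_res (level B n) U V V' s) = ?P n V s"
      proof
        assume "?P n V' (open_res (level B n) U V V' s)"
        then obtain W where W: "openin (ctop U) W" "x \<in> W" "W \<subseteq> V'"
           "restrict (\<lambda>y. H U y n V' (open_res (level B n) U V V' s)) W \<in> hol_maps (open_subspace U W) X" by blast
        then show "?P n V s" unfolding eq[OF W(3)] using V'(3) by blast
      next
        assume "?P n V s"
        then obtain W where W: "openin (ctop U) W" "x \<in> W" "W \<subseteq> V"
           "restrict (\<lambda>y. H U y n V s) W \<in> hol_maps (open_subspace U W) X" by blast
        have o: "openin (ctop U) (W \<inter> V')" using W(1) V'(1) by blast
        have "restrict (\<lambda>y. H U y n V s) (W \<inter> V') \<in> hol_maps (open_subspace U (W \<inter> V')) X"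
          by (rule shrink[OF W(4,1) o]) simp
        then show "?P n V' (open_res (level B n) U V V' s)"
          using o W(2) V'(2) eq[of "W \<inter> V'"] by (intro exI[of _ "W \<inter> V'"]) simp
      qed
    next
      fix n i V s assume i: "i \<le> Suc n" and l: "(V, s) \<in> local_sections (level B (Suc n)) U x"
      have V: "openin (ctop U) V" "s \<in> sec (level B (Suc n)) (open_subspace U V)"
        using l by (auto simp: mem_local_sections)
      have eq: "restrict (\<lambda>y. H U y n V (fc B n i (open_subspace U V) s)) W = restrict (\<lambda>y. H U y (Suc n) V s) W"
        if W: "W \<subseteq> V" for W
        by (rule restrict_ext, rule germ_familyD(2)[OF H[OF U] i])
           (use W V openin_subset[OF V(1)] in \<open>auto simp: mem_local_sections\<close>)
      show "?P n V (fc B n i (open_subspace U V) s) = ?P (Suc n) V s"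
        by (intro ex_cong) (auto simp: eq)
    next
      fix n i V s assume i: "i \<le> n" and l: "(V, s) \<in> local_sections (level B n) U x"
      have V: "openin (ctop U) V" "s \<in> sec (level B n) (open_subspace U V)"
        using l by (auto simp: mem_local_sections)
      have eq: "restrict (\<lambda>y. H U y (Suc n) V (dg B n i (open_subspace U V) s)) W = restrict (\<lambda>y. H U y n V s) W"
        if W: "W \<subseteq> V" for W
        by (rule restrict_ext, rule germ_familyD(3)[OF H[OF U] i])
           (use W V openin_subset[OF V(1)] in \<open>auto simp: mem_local_sections\<close>)
      show "?P (Suc n) V (dg B n i (open_subspace U V) s) = ?P n V s"
        by (intro ex_cong) (auto simp: eq)
    qed
    \<comment> \<open>Stated as an equation so that \<open>germ_family_unique\<close> can compare
      \<open>?P\<close> with the constant family \<open>True\<close>.\<close>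
    have "?P n (cpoints U) b = True"
    proof (rule germ_family_unique[where H = ?P and H' = "\<lambda>n V s. True", OF U x P _ _ global_local_section[OF x b]])
      show "germ_family B U x (\<lambda>n V s. True)" by (rule germ_familyI) simp_all
      fix n V s assume l: "(V, s) \<in> local_sections (level A n) U x"
      have V: "openin (ctop U) V" "x \<in> V" "s \<in> sec (level A n) (open_subspace U V)"
        using l by (auto simp: mem_local_sections)
      obtain m where m: "g n (open_subspace U V) s = Mor m" "m \<in> hol_maps (open_subspace U V) X"
        using ssheaf_homD(3)[OF g complex_space_open_subspace[OF U V(1)] V(3)] by auto
      have "restrict (\<lambda>y. H U y n V (w n (open_subspace U V) s)) V = restrict m V"
      proof (rule restrict_ext)
        fix y assume y: "y \<in> V"
        have yU: "y \<in> cpoints U" using y openin_subset[OF V(1)] by blast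
        show "H U y n V (w n (open_subspace U V) s) = m y"
          using Hw[OF U yU, of V s n] V y m by (simp add: mem_local_sections)
      qed
      also have "restrict m V = m"
        using hol_mapsD(1)[OF m(2)] unfolding cpoints_open_subspace[OF V(1)] by (simp add: extensional_restrict)
      finally show "?P n V (w n (open_subspace U V) s) = True"
        using V m(2) by (intro iffI TrueI exI[of _ V]) simp
    qed
    then obtain W where W: "openin (ctop U) W" "x \<in> W" "W \<subseteq> cpoints U"
       "restrict (\<lambda>y. H U y n (cpoints U) b) W \<in> hol_maps (open_subspace U W) X" by blast
    have "restrict (\<lambda>x\<in>cpoints U. H U x n (cpoints U) b) W = restrict (\<lambda>y. H U y n (cpoints U) b) W"
      using W(3) by (auto simp: fun_eq_iff)
    then show "\<exists>V. openin (ctop U) V \<and> x \<in> V \<and>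
        restrict (\<lambda>x\<in>cpoints U. H U x n (cpoints U) b) V \<in> hol_maps (open_subspace U V) X"
      using W by (intro exI[of _ W]) simp
  qed simp
  define h where "h n = (\<lambda>U\<in>Collect complex_space. \<lambda>b\<in>sec (level B n) U. Mor (\<lambda>x\<in>cpoints U. H U x n (cpoints U) b) :: ('p, 'w) elem)" for n
  have h: "h n U b = Mor (\<lambda>x\<in>cpoints U. H U x n (cpoints U) b)" if "complex_space U" "b \<in> sec (level B n) U" for n U b
    using that by (simp add: h_def)
  have "h \<in> ssheaf_hom B target"
  proof (rule ssheaf_homI)
    show "h n \<in> extensional (Collect complex_space)" for n by (simp add: h_def)
    show "h n U \<in> extensional (sec (level B n) U)" if "complex_space U" for n U
      using that by (simp add: h_def)
    show "h n U b \<in> sec (level target n) U" if "complex_space U" "b \<in> sec (level B n) U" for n U b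
      using hol[OF that] h[OF that] by simp
  next
    fix n and U T :: "'p cspace" and f b
    assume U: "complex_space U" and T: "complex_space T" and f: "f \<in> hol_maps T U" and b: "b \<in> sec (level B n) U"
    have fT: "{x \<in> cpoints T. f x \<in> cpoints U} = cpoints T" using hol_mapsD(4)[OF f] by auto
    have pb: "open_pullback (level B n) T U f (cpoints U) b = res (level B n) T U f b"
      unfolding open_pullback_def fT open_subspace_cpoints using hol_mapsD(1)[OF f] by (simp add: extensional_restrict)
    have "H T x n (cpoints T) (res (level B n) T U f b) = H U (f x) n (cpoints U) b" if x: "x \<in> cpoints T" for x
      using nat[OF T U f x global_local_section[OF hol_mapsD(4)[OF f x] b]] unfolding fT pb .
    then have "(\<lambda>x\<in>cpoints T. H T x n (cpoints T) (res (level B n) T U f b)) =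
        compose (cpoints T) (\<lambda>x\<in>cpoints U. H U x n (cpoints U) b) f"
      using hol_mapsD(4)[OF f] by (auto simp: compose_def fun_eq_iff)
    then show "h n T (res (level B n) T U f b) = res (level target n) T U f (h n U b)"
      using h[OF U b] h[OF T is_presheafD(1)[OF simplicial_sheafD(2)[OF B] U T f b]] by simp
  next
    fix n U i b assume U: "complex_space U" and i: "i \<le> Suc n" and b: "b \<in> sec (level B (Suc n)) U"
    have "H U x n (cpoints U) (fc B n i U b) = H U x (Suc n) (cpoints U) b" if x: "x \<in> cpoints U" for x
      using germ_familyD(2)[OF H[OF U x] i global_local_section[OF x b]] by simp
    then show "h n U (fc B n i U b) = fc target n i U (h (Suc n) U b)"
      using h[OF U b] h[OF U simplicial_sheafD(3)[OF B U i b]] by (simp cong: restrict_cong)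
  next
    fix n U i b assume U: "complex_space U" and i: "i \<le> n" and b: "b \<in> sec (level B n) U"
    have "H U x (Suc n) (cpoints U) (dg B n i U b) = H U x n (cpoints U) b" if x: "x \<in> cpoints U" for x
      using germ_familyD(3)[OF H[OF U x] i global_local_section[OF x b]] by simp
    then show "h (Suc n) U (dg B n i U b) = dg target n i U (h n U b)"
      using h[OF U b] h[OF U simplicial_sheafD(4)[OF B U i b]] by (simp cong: restrict_cong)
  qed
  moreover have "Cmp ssheaf_cat A h w = g"
  proof (rule ssheaf_hom_eqI[OF Cmp_ssheaf_hom[OF A w_hom calculation] g])
    fix n U s assume U: "complex_space U" and s: "s \<in> sec (level A n) U"
    obtain m where m: "g n U s = Mor m" "m \<in> hol_maps U X"
      using ssheaf_homD(3)[OF g U s] by auto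
    have "H U x n (cpoints U) (w n U s) = m x" if x: "x \<in> cpoints U" for x
      using Hw[OF U x global_local_section[OF x s]] m by simp
    then have "(\<lambda>x\<in>cpoints U. H U x n (cpoints U) (w n U s)) = m"
      using hol_mapsD(1)[OF m(2)] by (auto simp: fun_eq_iff extensional_def)
    then show "Cmp ssheaf_cat A h w n U s = g n U s"
      using h[OF U ssheaf_homD(3)[OF w_hom U s]] U s m by simp
  qed
  ultimately show ?thesis by blast
qed

lemma bij_betw_precomposition:
  "bij_betw (\<lambda>h. Cmp ssheaf_cat A h w) (ssheaf_hom B target) (ssheaf_hom A target)"
  unfolding bij_betw_def
  using inj_on_precomposition surj_precomposition Cmp_ssheaf_hom[OF A w_hom]
  by (auto simp: image_iff)

end

lemma local_object_represented:
  fixes X :: "'p cspace"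
  shows "local_object ssheaf_cat simplicial_weak_equivalences
    (const_ssheaf (represented X) :: ('p, ('p, 'w) elem) ssheaf)"
proof
  let ?F = "const_ssheaf (represented X) :: ('p, ('p, 'w) elem) ssheaf"
  show F: "?F \<in> Ob ssheaf_cat"
    using simplicial_sheaf_const_ssheaf[OF is_sheaf_represented] by simp
  show "Idt ssheaf_cat ?F \<in> Hom ssheaf_cat ?F ?F"
    using Idt_ssheaf_hom F by simp
next
  let ?F = "const_ssheaf (represented X) :: ('p, ('p, 'w) elem) ssheaf"
  fix A B :: "('p, ('p, 'w) elem) ssheaf" and f g
  assume "A \<in> Ob ssheaf_cat" "f \<in> Hom ssheaf_cat A B" "g \<in> Hom ssheaf_cat B ?F"
  then show "Cmp ssheaf_cat A g f \<in> Hom ssheaf_cat A ?F"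
    using Cmp_ssheaf_hom by simp
next
  let ?F = "const_ssheaf (represented X) :: ('p, ('p, 'w) elem) ssheaf"
  fix A :: "('p, ('p, 'w) elem) ssheaf" and f
  assume A: "A \<in> Ob ssheaf_cat" and f: "f \<in> Hom ssheaf_cat A ?F"
  have A': "simplicial_sheaf A" and f': "f \<in> ssheaf_hom A ?F" using A f by simp_all
  have F: "simplicial_sheaf ?F" using simplicial_sheaf_const_ssheaf[OF is_sheaf_represented] .
  show "Cmp ssheaf_cat A (Idt ssheaf_cat ?F) f = f"
    by (rule ssheaf_hom_eqI[OF Cmp_ssheaf_hom[OF A' f' Idt_ssheaf_hom[OF F]] f'])
       (simp del: const_ssheaf_simps add: ssheaf_homD(3)[OF f'])
  show "Cmp ssheaf_cat A f (Idt ssheaf_cat A) = f"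
    by (rule ssheaf_hom_eqI[OF Cmp_ssheaf_hom[OF A' Idt_ssheaf_hom[OF A'] f'] f']) simp
next
  let ?F = "const_ssheaf (represented X) :: ('p, ('p, 'w) elem) ssheaf"
  fix A B D :: "('p, ('p, 'w) elem) ssheaf" and f g h
  assume "A \<in> Ob ssheaf_cat" "B \<in> Ob ssheaf_cat" "D \<in> Ob ssheaf_cat"
    "f \<in> Hom ssheaf_cat A B" "g \<in> Hom ssheaf_cat B D" "h \<in> Hom ssheaf_cat D ?F"
  then have *: "simplicial_sheaf A" "simplicial_sheaf B" "f \<in> ssheaf_hom A B" "g \<in> ssheaf_hom B D" "h \<in> ssheaf_hom D ?F"
    by simp_all
  show "Cmp ssheaf_cat A (Cmp ssheaf_cat B h g) f = Cmp ssheaf_cat A h (Cmp ssheaf_cat A g f)"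
    by (rule ssheaf_hom_eqI[OF Cmp_ssheaf_hom[OF *(1,3) Cmp_ssheaf_hom[OF *(2,4,5)]]
          Cmp_ssheaf_hom[OF *(1) Cmp_ssheaf_hom[OF *(1,3,4)] *(5)]])
       (simp add: ssheaf_homD(3)[OF *(3)])
next
  let ?F = "const_ssheaf (represented X) :: ('p, ('p, 'w) elem) ssheaf"
  fix S T :: "('p, ('p, 'w) elem) ssheaf" and w
  assume ST: "S \<in> Ob ssheaf_cat" "T \<in> Ob ssheaf_cat" "w \<in> simplicial_weak_equivalences S T"
  then have E: "ssheaf_equivalence S T w" by (simp add: ssheaf_equivalence_def)
  show "w \<in> Hom ssheaf_cat S T" using ssheaf_equivalence.w_hom[OF E] by simp
  show "bij_betw (\<lambda>h. Cmp ssheaf_cat S h w) (Hom ssheaf_cat T ?F) (Hom ssheaf_cat S ?F)"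
    using bij_betw_precomposition[OF E, of X] by simp
qed

section \<open>Hyperbolicity of represented sheaves\<close>

abbreviation line_space :: "(complex + 'a) cspace" where
  "line_space \<equiv> relabel Inl (planar_space UNIV)"

lemma complex_space_line_space: "complex_space line_space"
  by (rule complex_space_relabel[OF inj_Inl complex_space_planar_space[OF open_UNIV]])

lemma simplicial_sheaf_line_ssheaf: "simplicial_sheaf line_ssheaf"
  unfolding line_ssheaf_def by (rule simplicial_sheaf_const_ssheaf[OF is_sheaf_represented])

lemma line_ssheaf_simps:
  "sec (level line_ssheaf n) U = Mor ` hol_maps U line_space"
  "res (level line_ssheaf n) V U f = precomp_elem (cpoints V) f"
  "fc line_ssheaf n i U s = s" "dg line_ssheaf n i U s = s"
  by (simp_all add: line_ssheaf_def)

lemma proj_ssheaf_simps: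
  "\<lbrakk>complex_space U; a \<in> sec (level A n) U; b \<in> sec (level B n) U\<rbrakk> \<Longrightarrow> proj_ssheaf A B n U (Pr a b) = a"
  by (simp add: proj_ssheaf_def prod_ssheaf_simps)

lemma proj_ssheaf_hom:
  fixes A B :: "('p, ('p, 'w) elem) ssheaf"
  assumes A: "simplicial_sheaf A" and B: "simplicial_sheaf B"
  shows "proj_ssheaf A B \<in> ssheaf_hom (prod_ssheaf A B) A"
proof (rule ssheaf_homI)
  show "proj_ssheaf A B n \<in> extensional (Collect complex_space)" for n by (simp add: proj_ssheaf_def)
  show "proj_ssheaf A B n U \<in> extensional (sec (level (prod_ssheaf A B) n) U)" if "complex_space U" for n U
    using that by (simp add: proj_ssheaf_def)
next
  fix n U s assume U: "complex_space U" and s: "s \<in> sec (level (prod_ssheaf A B) n) U"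
  obtain a b where ab: "s = Pr a b" "a \<in> sec (level A n) U" "b \<in> sec (level B n) U" using s by (rule sec_prod_ssheafE)
  show "proj_ssheaf A B n U s \<in> sec (level A n) U" unfolding ab(1) proj_ssheaf_simps[OF U ab(2,3)] by (rule ab(2))
next
  fix n and U V :: "'p cspace" and f s
  assume U: "complex_space U" "complex_space V" "f \<in> hol_maps V U" and s: "s \<in> sec (level (prod_ssheaf A B) n) U"
  obtain a b where ab: "s = Pr a b" "a \<in> sec (level A n) U" "b \<in> sec (level B n) U" using s by (rule sec_prod_ssheafE)
  show "proj_ssheaf A B n V (res (level (prod_ssheaf A B) n) V U f s) = res (level A n) V U f (proj_ssheaf A B n U s)"
    unfolding ab(1) proj_ssheaf_simps[OF U(1) ab(2,3)] prod_ssheaf_simps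
    by (rule proj_ssheaf_simps[OF U(2)])
       (use is_presheafD(1)[OF simplicial_sheafD(2)[OF A] U ab(2)] is_presheafD(1)[OF simplicial_sheafD(2)[OF B] U ab(3)] in simp_all)
next
  fix n U i s assume U: "complex_space U" and i: "i \<le> Suc n" and s: "s \<in> sec (level (prod_ssheaf A B) (Suc n)) U"
  obtain a b where ab: "s = Pr a b" "a \<in> sec (level A (Suc n)) U" "b \<in> sec (level B (Suc n)) U" using s by (rule sec_prod_ssheafE)
  show "proj_ssheaf A B n U (fc (prod_ssheaf A B) n i U s) = fc A n i U (proj_ssheaf A B (Suc n) U s)"
    unfolding ab(1) proj_ssheaf_simps[OF U(1) ab(2,3)] prod_ssheaf_simps
    by (rule proj_ssheaf_simps[OF U]) (use simplicial_sheafD(3)[OF A U i ab(2)] simplicial_sheafD(3)[OF B U i ab(3)] in simp_all)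
next
  fix n U i s assume U: "complex_space U" and i: "i \<le> n" and s: "s \<in> sec (level (prod_ssheaf A B) n) U"
  obtain a b where ab: "s = Pr a b" "a \<in> sec (level A n) U" "b \<in> sec (level B n) U" using s by (rule sec_prod_ssheafE)
  show "proj_ssheaf A B (Suc n) U (dg (prod_ssheaf A B) n i U s) = dg A n i U (proj_ssheaf A B n U s)"
    unfolding ab(1) proj_ssheaf_simps[OF U(1) ab(2,3)] prod_ssheaf_simps
    by (rule proj_ssheaf_simps[OF U]) (use simplicial_sheafD(4)[OF A U i ab(2)] simplicial_sheafD(4)[OF B U i ab(3)] in simp_all)
qed

lemma hyperbolic_represented_iff:
  fixes X :: "(complex + 'a) cspace"
  shows "hyperbolic (const_ssheaf (represented X) :: (complex + 'a, (complex + 'a, 'w) elem) ssheaf) \<longleftrightarrow>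
    (\<forall>Y :: (complex + 'a, (complex + 'a, 'w) elem) ssheaf. simplicial_sheaf Y \<longrightarrow>
      bij_betw (\<lambda>h. Cmp ssheaf_cat (prod_ssheaf Y line_ssheaf) h (proj_ssheaf Y line_ssheaf))
        (ssheaf_hom Y (const_ssheaf (represented X)))
        (ssheaf_hom (prod_ssheaf Y line_ssheaf) (const_ssheaf (represented X))))"
proof -
  let ?F = "const_ssheaf (represented X) :: (complex + 'a, (complex + 'a, 'w) elem) ssheaf"
  interpret local_object ssheaf_cat simplicial_weak_equivalences ?F
    by (rule local_object_represented)
  show ?thesis
    unfolding hyperbolic_def Hs_hom_def
  proof (intro all_cong)
    fix Y :: "(complex + 'a, (complex + 'a, 'w) elem) ssheaf" assume Y: "simplicial_sheaf Y"
    have "prod_ssheaf Y line_ssheaf \<in> Ob ssheaf_cat" "Y \<in> Ob ssheaf_cat"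
      "proj_ssheaf Y line_ssheaf \<in> Hom ssheaf_cat (prod_ssheaf Y line_ssheaf) Y"
      using simplicial_sheaf_prod_ssheaf[OF Y simplicial_sheaf_line_ssheaf] Y
        proj_ssheaf_hom[OF Y simplicial_sheaf_line_ssheaf] by simp_all
    from bij_betw_loc_precomp_iff[OF this]
    show "bij_betw (loc_precomp ssheaf_cat simplicial_weak_equivalences (prod_ssheaf Y line_ssheaf) Y ?F (proj_ssheaf Y line_ssheaf))
       (loc_hom ssheaf_cat simplicial_weak_equivalences Y ?F)
       (loc_hom ssheaf_cat simplicial_weak_equivalences (prod_ssheaf Y line_ssheaf) ?F) \<longleftrightarrow>
      bij_betw (\<lambda>h. Cmp ssheaf_cat (prod_ssheaf Y line_ssheaf) h (proj_ssheaf Y line_ssheaf))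
        (ssheaf_hom Y ?F) (ssheaf_hom (prod_ssheaf Y line_ssheaf) ?F)"
      by simp
  qed
qed

text \<open>Pairing with it splits the projection from the product with the line.\<close>

abbreviation zero_section :: "(complex + 'a) cspace \<Rightarrow> (complex + 'a, 'w) elem" where
  "zero_section U \<equiv> Mor (\<lambda>x\<in>cpoints U. Inl 0)"

lemma zero_section_sec: "complex_space U \<Longrightarrow> zero_section U \<in> sec (level line_ssheaf n) U"
  unfolding line_ssheaf_simps by (intro imageI hol_maps_const) auto

lemma res_zero_section:
  "f \<in> hol_maps V U \<Longrightarrow> res (level line_ssheaf n) V U f (zero_section U) = zero_section V"
  unfolding line_ssheaf_simps using hol_mapsD(4)[of f V U] by (auto simp: compose_def fun_eq_iff)

text \<open>Restricting along the constant map \<open>\<complex> \<rightarrow> U\<close> at a point exhibits the values of \<open>\<phi>\<close> there as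
  values of a single entire curve.\<close>

lemma hom_from_line_product_pointwise:
  fixes X :: "(complex + 'a) cspace" and Y :: "(complex + 'a, (complex + 'a, 'w) elem) ssheaf"
  assumes Y: "simplicial_sheaf Y" and \<phi>: "\<phi> \<in> ssheaf_hom (prod_ssheaf Y line_ssheaf) (const_ssheaf (represented X))"
    and U: "complex_space U" and s: "s \<in> sec (level Y n) U" and x: "x \<in> cpoints U"
  obtains \<gamma> where "\<gamma> \<in> hol_maps line_space X"
    "\<And>c. c \<in> hol_maps U line_space \<Longrightarrow> map_of_elem (\<phi> n U (Pr s (Mor c))) x = \<gamma> (c x)"
proof -
  let ?L = "line_space :: (complex + 'a) cspace"
  have L: "complex_space ?L" by (rule complex_space_line_space)
  note P = is_presheafD[OF simplicial_sheafD(2)[OF Y]]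
  define \<iota> where "\<iota> = (\<lambda>u\<in>cpoints ?L. x)"
  have \<iota>: "\<iota> \<in> hol_maps ?L U" unfolding \<iota>_def by (rule hol_maps_const[OF L x])
  define s' where "s' = res (level Y n) ?L U \<iota> s"
  have s': "s' \<in> sec (level Y n) ?L" unfolding s'_def by (rule P(1)[OF U L \<iota> s])
  define e where "e = (\<lambda>u\<in>cpoints ?L. u)"
  have e: "e \<in> hol_maps ?L ?L" unfolding e_def by (rule hol_maps_ident[OF complex_spaceD(2)[OF L]])
  have "Pr s' (Mor e) \<in> sec (level (prod_ssheaf Y line_ssheaf) n) ?L"
    using s' e by (simp add: prod_ssheaf_simps line_ssheaf_simps)
  from ssheaf_homD(3)[OF \<phi> L this] obtain \<gamma> where \<gamma>: "\<phi> n ?L (Pr s' (Mor e)) = Mor \<gamma>" "\<gamma> \<in> hol_maps ?L X"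
    by auto
  show thesis
  proof (rule that[OF \<gamma>(2)])
    fix c assume c: "c \<in> hol_maps U ?L"
    define k where "k = (\<lambda>u\<in>cpoints ?L. c x)"
    have k: "k \<in> hol_maps ?L ?L" unfolding k_def by (rule hol_maps_const[OF L hol_mapsD(4)[OF c x]])
    have ps: "Pr s (Mor c) \<in> sec (level (prod_ssheaf Y line_ssheaf) n) U"
      using s c by (simp add: prod_ssheaf_simps line_ssheaf_simps)
    from ssheaf_homD(3)[OF \<phi> U this] obtain m where m: "\<phi> n U (Pr s (Mor c)) = Mor m" by auto
    have c1: "compose (cpoints ?L) e k = k" "compose (cpoints ?L) c \<iota> = k" "compose (cpoints ?L) \<iota> k = \<iota>"
      using hol_mapsD(4)[OF k] hol_mapsD(4)[OF c x] by (auto simp: compose_def fun_eq_iff e_def k_def \<iota>_def)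
    \<comment> \<open>\<open>s'\<close> is pulled back along the constant map
      \<open>\<iota>\<close>, so \<open>k\<close> leaves it fixed; hence both restrictions below
      give \<open>Pr s' (Mor k)\<close>.\<close>
    have "res (level Y n) ?L ?L k s' = s'"
      unfolding s'_def using P(3)[OF U L L \<iota> k s] c1(3) by simp
    then have "res (level (prod_ssheaf Y line_ssheaf) n) ?L ?L k (Pr s' (Mor e)) = Pr s' (Mor k)"
      by (simp only: prod_ssheaf_simps line_ssheaf_simps precomp_elem.simps c1)
    moreover have "res (level (prod_ssheaf Y line_ssheaf) n) ?L U \<iota> (Pr s (Mor c)) = Pr s' (Mor k)"
      by (simp only: prod_ssheaf_simps line_ssheaf_simps precomp_elem.simps c1 s'_def)
    ultimately have "res (level (const_ssheaf (represented X)) n) ?L ?L k (Mor \<gamma>) =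
        res (level (const_ssheaf (represented X)) n) ?L U \<iota> (Mor m :: (complex + 'a, 'w) elem)"
      using ssheaf_homD(4)[OF \<phi> L L k \<open>Pr s' (Mor e) \<in> _\<close>] ssheaf_homD(4)[OF \<phi> U L \<iota> ps] \<gamma>(1) m by metis
    then have "compose (cpoints ?L) \<gamma> k = compose (cpoints ?L) m \<iota>"
      by (simp only: const_ssheaf_simps res_represented precomp_elem.simps elem.inject)
    \<comment> \<open>Both composites are constant on the line, so any point of it serves.\<close>
    from fun_cong[OF this, of "Inl 0"] have "\<gamma> (c x) = m x"
      by (simp add: compose_def k_def \<iota>_def)
    then show "map_of_elem (\<phi> n U (Pr s (Mor c))) x = \<gamma> (c x)" by (simp add: m)
  qed
qed

text \<open>Restriction to the zero section is the inverse. The projection is split, which gives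
  injectivity. For surjectivity, the value of \<open>\<phi>\<close> at a pair is that of an entire
  curve at \<open>c x\<close>, and constancy moves \<open>c x\<close> to the origin.\<close>

lemma hyperbolic_if_entire_const:
  fixes X :: "(complex + 'a) cspace"
  assumes const: "\<And>(\<gamma> :: complex + 'a \<Rightarrow> complex + 'a) u v. \<lbrakk>\<gamma> \<in> hol_maps line_space X; u \<in> cpoints line_space; v \<in> cpoints line_space\<rbrakk> \<Longrightarrow> \<gamma> u = \<gamma> v"
  shows "hyperbolic (const_ssheaf (represented X) :: (complex + 'a, (complex + 'a, 'w) elem) ssheaf)"
  unfolding hyperbolic_represented_iff
proof (intro allI impI)
  let ?F = "const_ssheaf (represented X) :: (complex + 'a, (complex + 'a, 'w) elem) ssheaf"
  fix Y :: "(complex + 'a, (complex + 'a, 'w) elem) ssheaf" assume Y: "simplicial_sheaf Y"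
  let ?YL = "prod_ssheaf Y line_ssheaf" and ?p = "proj_ssheaf Y line_ssheaf"
  note L = simplicial_sheaf_line_ssheaf
  note YL = simplicial_sheaf_prod_ssheaf[OF Y L] and p = proj_ssheaf_hom[OF Y L]
  have zs: "Pr s (zero_section U) \<in> sec (level ?YL n) U" if "complex_space U" "s \<in> sec (level Y n) U" for U s n
    using zero_section_sec[OF that(1)] that(2) by (simp add: prod_ssheaf_simps)
  show "bij_betw (\<lambda>h. Cmp ssheaf_cat ?YL h ?p) (ssheaf_hom Y ?F) (ssheaf_hom ?YL ?F)"
    unfolding bij_betw_def
  proof
    show "inj_on (\<lambda>h. Cmp ssheaf_cat ?YL h ?p) (ssheaf_hom Y ?F)"
    proof (rule inj_onI)
      fix h h' assume h: "h \<in> ssheaf_hom Y ?F" "h' \<in> ssheaf_hom Y ?F"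
        and eq: "Cmp ssheaf_cat ?YL h ?p = Cmp ssheaf_cat ?YL h' ?p"
      show "h = h'"
      proof (rule ssheaf_hom_eqI[OF h])
        fix n U s assume U: "complex_space U" and s: "s \<in> sec (level Y n) U"
        have pz: "?p n U (Pr s (zero_section U)) = s"
          by (rule proj_ssheaf_simps[OF U s zero_section_sec[OF U]])
        have "Cmp ssheaf_cat ?YL h ?p n U (Pr s (zero_section U)) = Cmp ssheaf_cat ?YL h' ?p n U (Pr s (zero_section U))"
          using eq by simp
        then show "h n U s = h' n U s"
          unfolding Cmp_ssheaf_cat[OF U zs[OF U s]] pz .
      qed
    qed
    show "(\<lambda>h. Cmp ssheaf_cat ?YL h ?p) ` ssheaf_hom Y ?F = ssheaf_hom ?YL ?F"
    proof (intro equalityI subsetI)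
      fix \<phi> assume "\<phi> \<in> (\<lambda>h. Cmp ssheaf_cat ?YL h ?p) ` ssheaf_hom Y ?F"
      then show "\<phi> \<in> ssheaf_hom ?YL ?F" using Cmp_ssheaf_hom[OF YL p] by blast
    next
      fix \<phi> assume \<phi>: "\<phi> \<in> ssheaf_hom ?YL ?F"
      define h where "h n = (\<lambda>U\<in>Collect complex_space. \<lambda>s\<in>sec (level Y n) U. \<phi> n U (Pr s (zero_section U)))" for n
      have h: "h n U s = \<phi> n U (Pr s (zero_section U))" if "complex_space U" "s \<in> sec (level Y n) U" for n U s
        using that by (simp add: h_def)
      have "h \<in> ssheaf_hom Y ?F"
      proof (rule ssheaf_homI)
        show "h n \<in> extensional (Collect complex_space)" for n by (simp add: h_def)
        show "h n U \<in> extensional (sec (level Y n) U)" if "complex_space U" for n U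
          using that by (simp add: h_def)
        show "h n U s \<in> sec (level ?F n) U" if "complex_space U" "s \<in> sec (level Y n) U" for n U s
          unfolding h[OF that] by (rule ssheaf_homD(3)[OF \<phi> that(1) zs[OF that]])
      next
        fix n and U V :: "(complex + 'a) cspace" and f s
        assume U: "complex_space U" "complex_space V" "f \<in> hol_maps V U" and s: "s \<in> sec (level Y n) U"
        have "res (level ?YL n) V U f (Pr s (zero_section U)) = Pr (res (level Y n) V U f s) (zero_section V)"
          unfolding prod_ssheaf_simps res_zero_section[OF U(3)] ..
        then show "h n V (res (level Y n) V U f s) = res (level ?F n) V U f (h n U s)"
          unfolding h[OF U(1) s] h[OF U(2) is_presheafD(1)[OF simplicial_sheafD(2)[OF Y] U s]]
          using ssheaf_homD(4)[OF \<phi> U zs[OF U(1) s]] by simp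
      next
        fix n U i s assume U: "complex_space U" and i: "i \<le> Suc n" and s: "s \<in> sec (level Y (Suc n)) U"
        have "fc ?YL n i U (Pr s (zero_section U)) = Pr (fc Y n i U s) (zero_section U)"
          unfolding prod_ssheaf_simps line_ssheaf_simps ..
        then show "h n U (fc Y n i U s) = fc ?F n i U (h (Suc n) U s)"
          unfolding h[OF U s] h[OF U simplicial_sheafD(3)[OF Y U i s]]
          using ssheaf_homD(5)[OF \<phi> U i zs[OF U s]] by simp
      next
        fix n U i s assume U: "complex_space U" and i: "i \<le> n" and s: "s \<in> sec (level Y n) U"
        have "dg ?YL n i U (Pr s (zero_section U)) = Pr (dg Y n i U s) (zero_section U)"
          unfolding prod_ssheaf_simps line_ssheaf_simps ..
        then show "h (Suc n) U (dg Y n i U s) = dg ?F n i U (h n U s)"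
          unfolding h[OF U s] h[OF U simplicial_sheafD(4)[OF Y U i s]]
          using ssheaf_homD(6)[OF \<phi> U i zs[OF U s]] by simp
      qed
      moreover have "Cmp ssheaf_cat ?YL h ?p = \<phi>"
      proof (rule ssheaf_hom_eqI[OF Cmp_ssheaf_hom[OF YL p calculation] \<phi>])
        fix n U t assume U: "complex_space U" and t: "t \<in> sec (level ?YL n) U"
        obtain s b where sb: "t = Pr s b" "s \<in> sec (level Y n) U" "b \<in> sec (level line_ssheaf n) U"
          using t by (rule sec_prod_ssheafE)
        obtain c where c: "b = Mor c" "c \<in> hol_maps U line_space" using sb(3) by (auto simp: line_ssheaf_simps)
        have z: "(\<lambda>x\<in>cpoints U. Inl 0) \<in> hol_maps U line_space" by (rule hol_maps_const[OF U]) simp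
        obtain m where m: "\<phi> n U (Pr s (Mor c)) = Mor m" "m \<in> hol_maps U X"
          using ssheaf_homD(3)[OF \<phi> U t] sb(1) c(1) by auto
        obtain m' where m': "\<phi> n U (Pr s (zero_section U)) = Mor m'" "m' \<in> hol_maps U X"
          using ssheaf_homD(3)[OF \<phi> U zs[OF U sb(2)]] by auto
        have "m = m'"
        proof (rule extensionalityI[OF hol_mapsD(1)[OF m(2)] hol_mapsD(1)[OF m'(2)]])
          fix x assume x: "x \<in> cpoints U"
          obtain \<gamma> where \<gamma>: "\<gamma> \<in> hol_maps line_space X"
            "\<And>c. c \<in> hol_maps U line_space \<Longrightarrow> map_of_elem (\<phi> n U (Pr s (Mor c))) x = \<gamma> (c x)"
            using hom_from_line_product_pointwise[OF Y \<phi> U sb(2) x] by blast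
          have "m x = \<gamma> (c x)" using \<gamma>(2)[OF c(2)] m(1) by simp
          also have "\<dots> = \<gamma> ((\<lambda>x\<in>cpoints U. Inl 0) x)"
            by (rule const[OF \<gamma>(1) hol_mapsD(4)[OF c(2) x] hol_mapsD(4)[OF z x]])
          also have "\<dots> = m' x" using \<gamma>(2)[OF z] m'(1) by simp
          finally show "m x = m' x" .
        qed
        then show "Cmp ssheaf_cat ?YL h ?p n U t = \<phi> n U t"
          unfolding Cmp_ssheaf_cat[OF U t] unfolding sb(1) proj_ssheaf_simps[OF U sb(2,3)] h[OF U sb(2)]
          using m(1) m'(1) c(1) by simp
      qed
      ultimately show "\<phi> \<in> (\<lambda>h. Cmp ssheaf_cat ?YL h ?p) ` ssheaf_hom Y ?F" by blast
    qed
  qed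
qed

text \<open>The terminal sheaf; \<open>Mor id\<close> is an arbitrary name for its one
  section.\<close>

definition point_sheaf :: "('p, ('p, 'w) elem) sheaf" where
  "point_sheaf = \<lparr>sec = \<lambda>U. {Mor id}, res = \<lambda>V U f s. s\<rparr>"

lemma is_sheaf_point_sheaf: "is_sheaf point_sheaf"
  by (rule is_sheafI) (auto simp: is_presheaf_def point_sheaf_def)

text \<open>Take a point for \<open>Y\<close>: composition with \<open>\<gamma>\<close> is a
  morphism from the product to \<open>X\<close>. Factoring through the point, it cannot distinguish
  the identity of the line from the constant map at \<open>v\<close>.\<close>

lemma entire_const_if_hyperbolic:
  fixes X :: "(complex + 'a) cspace" and \<gamma> :: "complex + 'a \<Rightarrow> complex + 'a"
  assumes hyp: "hyperbolic (const_ssheaf (represented X) :: (complex + 'a, (complex + 'a, 'w) elem) ssheaf)"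
    and \<gamma>: "\<gamma> \<in> hol_maps line_space X" and u: "u \<in> cpoints line_space" and v: "v \<in> cpoints line_space"
  shows "\<gamma> u = \<gamma> v"
proof -
  let ?F = "const_ssheaf (represented X) :: (complex + 'a, (complex + 'a, 'w) elem) ssheaf"
  let ?Y = "const_ssheaf point_sheaf :: (complex + 'a, (complex + 'a, 'w) elem) ssheaf"
  let ?L = "line_space :: (complex + 'a) cspace"
  let ?YL = "prod_ssheaf ?Y line_ssheaf" and ?p = "proj_ssheaf ?Y line_ssheaf" and ?e = "Mor id :: (complex + 'a, 'w) elem"
  have Y: "simplicial_sheaf ?Y" by (rule simplicial_sheaf_const_ssheaf[OF is_sheaf_point_sheaf])
  have L: "complex_space ?L" by (rule complex_space_line_space)
  have secYL: "sec (level ?YL n) U = {Pr ?e (Mor c) | c. c \<in> hol_maps U ?L}" for n U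
    by (auto simp: prod_ssheaf_simps line_ssheaf_simps point_sheaf_def)
  define \<phi> :: "(complex + 'a, (complex + 'a, 'w) elem) smap" where
    "\<phi> n = (\<lambda>U\<in>Collect complex_space. \<lambda>t\<in>sec (level ?YL n) U.
       case t of Pr a b \<Rightarrow> Mor (compose (cpoints U) \<gamma> (map_of_elem b)) | _ \<Rightarrow> t)" for n
  have \<phi>: "\<phi> n U (Pr ?e (Mor c)) = Mor (compose (cpoints U) \<gamma> c)" if "complex_space U" "c \<in> hol_maps U ?L" for n U c
    using that by (auto simp: \<phi>_def secYL)
  have "\<phi> \<in> ssheaf_hom ?YL ?F"
  proof (rule ssheaf_homI)
    show "\<phi> n \<in> extensional (Collect complex_space)" for n by (simp add: \<phi>_def)
    show "\<phi> n U \<in> extensional (sec (level ?YL n) U)" if "complex_space U" for n U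
      using that by (simp add: \<phi>_def)
    show "\<phi> n U t \<in> sec (level ?F n) U" if "complex_space U" "t \<in> sec (level ?YL n) U" for n U t
      using that \<phi>[OF that(1)] hol_maps_compose[OF _ \<gamma>] by (auto simp: secYL intro!: imageI)
  next
    fix n and U V :: "(complex + 'a) cspace" and f t
    assume U: "complex_space U" "complex_space V" "f \<in> hol_maps V U" and t: "t \<in> sec (level ?YL n) U"
    obtain c where c: "t = Pr ?e (Mor c)" "c \<in> hol_maps U ?L" using t by (auto simp: secYL)
    have "compose (cpoints V) \<gamma> (compose (cpoints V) c f) = compose (cpoints V) (compose (cpoints U) \<gamma> c) f"
      using hol_mapsD(4)[OF U(3)] by (auto simp: compose_def fun_eq_iff)
    moreover have "res (level ?YL n) V U f t = Pr ?e (Mor (compose (cpoints V) c f))"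
      unfolding c(1) prod_ssheaf_simps line_ssheaf_simps by (simp add: point_sheaf_def)
    ultimately show "\<phi> n V (res (level ?YL n) V U f t) = res (level ?F n) V U f (\<phi> n U t)"
      using \<phi>[OF U(1) c(2), of n] \<phi>[OF U(2) hol_maps_compose[OF U(3) c(2)], of n] c(1) by simp
  next
    fix n U i t assume U: "complex_space U" and i: "i \<le> Suc n" and t: "t \<in> sec (level ?YL (Suc n)) U"
    obtain c where c: "t = Pr ?e (Mor c)" "c \<in> hol_maps U ?L" using t by (auto simp: secYL)
    have "fc ?YL n i U t = t" unfolding c(1) prod_ssheaf_simps line_ssheaf_simps by simp
    then show "\<phi> n U (fc ?YL n i U t) = fc ?F n i U (\<phi> (Suc n) U t)"
      using \<phi>[OF U c(2)] c(1) by simp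
  next
    fix n U i t assume U: "complex_space U" and i: "i \<le> n" and t: "t \<in> sec (level ?YL n) U"
    obtain c where c: "t = Pr ?e (Mor c)" "c \<in> hol_maps U ?L" using t by (auto simp: secYL)
    have "dg ?YL n i U t = t" unfolding c(1) prod_ssheaf_simps line_ssheaf_simps by simp
    then show "\<phi> (Suc n) U (dg ?YL n i U t) = dg ?F n i U (\<phi> n U t)"
      using \<phi>[OF U c(2)] c(1) by simp
  qed
  moreover have "bij_betw (\<lambda>h. Cmp ssheaf_cat ?YL h ?p) (ssheaf_hom ?Y ?F) (ssheaf_hom ?YL ?F)"
    using hyp Y unfolding hyperbolic_represented_iff by blast
  ultimately have "\<phi> \<in> (\<lambda>h. Cmp ssheaf_cat ?YL h ?p) ` ssheaf_hom ?Y ?F" by (simp add: bij_betw_def)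
  then obtain h where h: "\<phi> = Cmp ssheaf_cat ?YL h ?p" by blast
  have val: "Mor (compose (cpoints ?L) \<gamma> c) = h 0 ?L ?e" if c: "c \<in> hol_maps ?L ?L" for c
  proof -
    have t: "Pr ?e (Mor c) \<in> sec (level ?YL 0) ?L" using c by (auto simp: secYL)
    have "\<phi> 0 ?L (Pr ?e (Mor c)) = h 0 ?L (?p 0 ?L (Pr ?e (Mor c)))"
      unfolding h by (rule Cmp_ssheaf_cat[OF L t])
    also have "?p 0 ?L (Pr ?e (Mor c)) = ?e"
      by (rule proj_ssheaf_simps[OF L]) (use c in \<open>simp_all add: line_ssheaf_simps point_sheaf_def\<close>)
    finally show ?thesis unfolding \<phi>[OF L c] .
  qed
  have "compose (cpoints ?L) \<gamma> (\<lambda>x\<in>cpoints ?L. x) = compose (cpoints ?L) \<gamma> (\<lambda>x\<in>cpoints ?L. v)"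
    using val[OF hol_maps_ident[OF complex_spaceD(2)[OF L]]] val[OF hol_maps_const[OF L v]]
    by (metis elem.inject(1))
  from fun_cong[OF this, of u] show ?thesis using u by (simp add: compose_def)
qed

section \<open>Transfer of entire curves to the relabelled spaces, and the conclusion\<close>

lemma entire_const_relabel_iff:
  fixes X :: "'a cspace"
  assumes X: "function_sheaf X"
  shows "(\<forall>\<gamma> \<in> hol_maps (line_space :: (complex + 'a) cspace) (relabel Inr X :: (complex + 'a) cspace). \<forall>u \<in> cpoints line_space. \<forall>v \<in> cpoints line_space. \<gamma> u = \<gamma> v) \<longleftrightarrow>
    (\<forall>f \<in> hol_maps (planar_space UNIV) X. \<forall>z. f z = f 0)"
proof
  let ?L = "line_space :: (complex + 'a) cspace" and ?C = "planar_space UNIV"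
  have C: "function_sheaf ?C" by (rule function_sheaf_planar_space[OF open_UNIV])
  {
    assume *: "\<forall>\<gamma> \<in> hol_maps ?L (relabel Inr X :: (complex + 'a) cspace). \<forall>u \<in> cpoints ?L. \<forall>v \<in> cpoints ?L. \<gamma> u = \<gamma> v"
    show "\<forall>f \<in> hol_maps ?C X. \<forall>z. f z = f 0"
    proof (intro ballI allI)
      fix f z assume f: "f \<in> hol_maps ?C X"
      let ?\<gamma> = "compose (cpoints ?L) (restrict (Inr :: 'a \<Rightarrow> complex + 'a) (cpoints X))
         (compose (cpoints ?L) f (restrict (inv_into UNIV Inl) (Inl ` cpoints ?C)))"
      have \<gamma>: "?\<gamma> \<in> hol_maps ?L (relabel Inr X :: (complex + 'a) cspace)"
        by (rule hol_maps_compose[OF hol_maps_compose[OF relabel_hol_maps_inv[OF inj_Inl C] f] relabel_hol_maps[OF inj_Inr X]])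
      have "?\<gamma> (Inl z) = Inr (f z)" for z
        using hol_mapsD(4)[OF f, of z] by (simp add: compose_def)
      moreover have "?\<gamma> (Inl z) = ?\<gamma> (Inl 0)" by (rule *[rule_format, OF \<gamma>]) simp_all
      ultimately show "f z = f 0" by (metis sum.inject(2))
    qed
  next
    assume *: "\<forall>f \<in> hol_maps ?C X. \<forall>z. f z = f 0"
    show "\<forall>\<gamma> \<in> hol_maps ?L (relabel Inr X :: (complex + 'a) cspace). \<forall>u \<in> cpoints ?L. \<forall>v \<in> cpoints ?L. \<gamma> u = \<gamma> v"
    proof (intro ballI)
      fix \<gamma> u v assume \<gamma>: "\<gamma> \<in> hol_maps ?L (relabel Inr X :: (complex + 'a) cspace)" and uv: "u \<in> cpoints ?L" "v \<in> cpoints ?L"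
      obtain z w where zw: "u = Inl z" "v = Inl w" using uv by auto
      let ?f = "compose (cpoints ?C) (restrict (inv_into UNIV Inr) (Inr ` cpoints X))
         (compose (cpoints ?C) \<gamma> (restrict Inl (cpoints ?C)))"
      have f: "?f \<in> hol_maps ?C X"
        by (rule hol_maps_compose[OF hol_maps_compose[OF relabel_hol_maps[OF inj_Inl C] \<gamma>] relabel_hol_maps_inv[OF inj_Inr X]])
      have im: "\<gamma> (Inl z) \<in> Inr ` cpoints X" for z
        using hol_mapsD(4)[OF \<gamma>, of "Inl z"] by simp
      have "Inr (?f z) = \<gamma> (Inl z)" for z
      proof -
        obtain y where "y \<in> cpoints X" "\<gamma> (Inl z) = Inr y" using im[of z] by blast
        then show ?thesis by (simp add: compose_def)
      qed
      moreover have "?f z = ?f 0" "?f w = ?f 0" using * f by blast+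
      ultimately show "\<gamma> u = \<gamma> v" unfolding zw by metis
    qed
  }
qed

theorem corollary3p1:
  fixes X :: "'a cspace"
  assumes "complex_space X" and "compact_space (ctop X)"
  shows "kobayashi_hyperbolic X \<longleftrightarrow>
    hyperbolic (ssheaf_of X :: (complex + 'a, (complex + 'a, 'w) elem) ssheaf)"
proof -
  have "kobayashi_hyperbolic X \<longleftrightarrow> (\<forall>\<gamma> \<in> hol_maps (line_space :: (complex + 'a) cspace) (relabel Inr X :: (complex + 'a) cspace).
      \<forall>u \<in> cpoints line_space. \<forall>v \<in> cpoints line_space. \<gamma> u = \<gamma> v)"
    unfolding kobayashi_hyperbolic_iff_entire_const[OF assms]
      entire_const_relabel_iff[OF complex_spaceD(2)[OF assms(1)]] ..
  also have "\<dots> \<longleftrightarrow> hyperbolic (ssheaf_of X :: (complex + 'a, (complex + 'a, 'w) elem) ssheaf)"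
    unfolding ssheaf_of_def
  proof
    let ?h = "hyperbolic (const_ssheaf (represented (relabel Inr X)) :: (complex + 'a, (complex + 'a, 'w) elem) ssheaf)"
    {
      assume *: "\<forall>\<gamma> \<in> hol_maps (line_space :: (complex + 'a) cspace) (relabel Inr X :: (complex + 'a) cspace).
        \<forall>u \<in> cpoints line_space. \<forall>v \<in> cpoints line_space. \<gamma> u = \<gamma> v"
      show ?h by (rule hyperbolic_if_entire_const) (rule *[rule_format])
    next
      assume hyp: ?h
      show "\<forall>\<gamma> \<in> hol_maps (line_space :: (complex + 'a) cspace) (relabel Inr X :: (complex + 'a) cspace).
        \<forall>u \<in> cpoints line_space. \<forall>v \<in> cpoints line_space. \<gamma> u = \<gamma> v"
        by (intro ballI) (rule entire_const_if_hyperbolic[OF hyp])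
    }
  qed
  finally show ?thesis .
qed

end
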